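(* Let $q\ge 3$ and assume the Generalized Riemann Hypothesis for $L(s,\chi)$ for every non-principal Dirichlet character $\chi$ modulo $q$. Let $\varepsilon>0$ and let $a,b$ be distinct invertible residue classes modulo $q$. Then there exists a (unique) constant $C$ depending on $q,a,b$ such that the natural density of the set \[\left\{x\ge 2\, :\, \left| \pi_{1/2}(x;q,a)-\pi_{1/2}(x;q,b) +\mathrm{M}(q;a,b)\log \log x-C\right|\le \frac{(\log \log x)^{3+\varepsilon}}{\log x}\right\}\] exists and equals $1$. Furthermore, there exists $K=K(a,b)>1$ such that the logarithmic density of the set \[\left\{x\ge 2\, :\, \left| \pi_{1/2}(x;q,a)-\pi_{1/2}(x;q,b) +\mathrm{M}(q;a,b)\log \log x-C\right|\le \frac{K \log \log x}{\log x}\right\}\] exists and equals $1$.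
   Context: For $x\ge 2$, $\pi_{1/2}(x;q,a)=\sum_{p\le x,\ p\equiv a \bmod q} p^{-1/2}$, the sum over primes. For a non-principal Dirichlet character $\chi$ mod $q$, $m_\chi:=\mathrm{ord}_{s=1/2}L(s,\chi)$ is the order of vanishing of $L(s,\chi)$ at $s=1/2$. Let $r:(\mathbb Z/q\mathbb Z)^\times\to\mathbb Z_{\ge0}$, $r(a)=\#\{x\in(\mathbb Z/q\mathbb Z)^\times: x^2=a\}$, and $\mathrm{M}(q;a,b)=\frac{1}{2\varphi(q)}\Bigl(r(a)-r(b)+2\sum_{\chi\ne\chi_0}(\chi(a)-\chi(b))m_\chi\Bigr)$, the sum over non-principal characters mod $q$. The natural density of a Borel set $A\subset[2,\infty)$ is $\lim_{X\to\infty}\frac1X\mathrm{meas}\{2\le x\le X: x\in A\}$ (Lebesgue measure), and its logarithmic density is $\lim_{X\to\infty}\frac{1}{\log X}\int_2^X \mathbf 1_A(u)\frac{du}{u}$, when these limits exist. *)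

theory Defs
  imports "HOL-Complex_Analysis.Complex_Analysis" "HOL-Number_Theory.Number_Theory"
begin

definition dcharacter :: "nat \<Rightarrow> (nat \<Rightarrow> complex) \<Rightarrow> bool" where
  "dcharacter q \<psi> \<longleftrightarrow> q > 0 \<and> \<psi> 1 = 1 \<and>
     (\<forall>m n. \<psi> (m * n) = \<psi> m * \<psi> n) \<and>
     (\<forall>n. \<psi> (n + q) = \<psi> n) \<and>
     (\<forall>n. \<psi> n = 0 \<longleftrightarrow> \<not> coprime n q)"

definition principal_char :: "nat \<Rightarrow> nat \<Rightarrow> complex" where
  "principal_char q n = (if coprime n q then 1 else 0)"

definition nonprincipal_chars :: "nat \<Rightarrow> (nat \<Rightarrow> complex) set" where
  "nonprincipal_chars q = {\<psi>. dcharacter q \<psi> \<and> \<psi> \<noteq> principal_char q}"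

text \<open>The Dirichlet L-function of a non-principal character: the entire function
  agreeing with the Dirichlet series on Re s > 1 (unique by analytic continuation).\<close>
definition Lfun :: "(nat \<Rightarrow> complex) \<Rightarrow> complex \<Rightarrow> complex" where
  "Lfun \<psi> = (SOME L. L holomorphic_on UNIV \<and>
      (\<forall>s. Re s > 1 \<longrightarrow> (\<lambda>n. \<psi> (Suc n) / of_nat (Suc n) powr s) sums L s))"

definition GRH_L :: "(nat \<Rightarrow> complex) \<Rightarrow> bool" where
  "GRH_L \<psi> \<longleftrightarrow> (\<forall>s. 0 < Re s \<and> Re s < 1 \<and> Lfun \<psi> s = 0 \<longrightarrow> Re s = 1/2)"

definition m_chi :: "(nat \<Rightarrow> complex) \<Rightarrow> nat" where
  "m_chi \<psi> = nat (zorder (Lfun \<psi>) (1/2))"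

definition rsq :: "nat \<Rightarrow> nat \<Rightarrow> nat" where
  "rsq q a = card {x \<in> {0..<q}. coprime x q \<and> [x ^ 2 = a] (mod q)}"

definition pi_half :: "real \<Rightarrow> nat \<Rightarrow> nat \<Rightarrow> real" where
  "pi_half x q a = (\<Sum>p \<in> {p. prime p \<and> real p \<le> x \<and> [p = a] (mod q)}. real p powr (-1/2))"

text \<open>M(q;a,b); the bracket is real (conjugate characters have equal m_chi), we take
  its real part to view it as a real number.\<close>
definition Mqab :: "nat \<Rightarrow> nat \<Rightarrow> nat \<Rightarrow> real" where
  "Mqab q a b = Re ((of_nat (rsq q a) - of_nat (rsq q b)
       + 2 * (\<Sum>\<psi> \<in> nonprincipal_chars q. (\<psi> a - \<psi> b) * of_nat (m_chi \<psi>)))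
       / (2 * of_nat (totient q)))"

definition has_natural_density :: "real set \<Rightarrow> real \<Rightarrow> bool" where
  "has_natural_density A d \<longleftrightarrow> A \<in> sets borel \<and> A \<subseteq> {2..} \<and>
     ((\<lambda>X. measure lborel (A \<inter> {2..X}) / X) \<longlongrightarrow> d) at_top"

definition has_log_density :: "real set \<Rightarrow> real \<Rightarrow> bool" where
  "has_log_density A d \<longleftrightarrow> A \<in> sets borel \<and> A \<subseteq> {2..} \<and>
     ((\<lambda>X. (LBINT u : A \<inter> {2..X}. 1 / u) / ln X) \<longlongrightarrow> d) at_top"

end

theory Submission
  imports Defs "HOL-Probability.Probability" "HOL-Real_Asymp.Real_Asymp" "HOL-Computational_Algebra.Nth_Powers"
begin


subsection \<open>Periodic Dirichlet series of mean zero\<close>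

text \<open>For a non-principal \<psi> let f(y) be the sum of \<Lambda>(n) \<psi>(n) n^(-1/2) over n
  \<le> e^y plus m y, where m is the order of vanishing of L(s,\<psi>) at 1/2; this is
  \<open>ff\<close>. Formally f is a constant plus a sum of terms e^(i\<gamma>y)/(i\<gamma>), with
  signs and multiplicities, over the zeros 1/2 + i\<gamma> with \<gamma> different from 0. Such a
  sum need not be bounded pointwise, but it is bounded in mean square on windows of fixed length,
  uniformly in the position of the window. That bound, \<open>ff_stepanov\<close>, is the heart of
  the proof.

  Why it holds: under GRH the Laplace transform of f is \<open>FF\<close> w = -(L'/L(1/2+w) - m/w)/w
  on all of Re w > 0. Multiply f by e^(-\<delta>y), \<delta> = 1/Y, and by a Fejer weight centred at
  Y. The Fourier transform of the product at height t is a weighted integral of \<open>FF\<close>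
  over a segment of length 1/2 on the line Re w = \<delta>. Near that segment \<open>FF\<close> is a
  finite sum of simple poles on the imaginary axis plus a remainder, of total weight
  O(log(|t|+3)/(|t|+1)), because O(log(|t|+3)) zeros are close and each carries a factor
  1/|\<gamma>| (\<open>FF_decomposition\<close>). Smoothed by the Fejer weight, each pole
  contributes a bounded amount however small \<delta> is. The majorant \<open>lam\<close> is square
  integrable, so Plancherel (\<open>plancherel_le\<close>) bounds the window integral independently
  of Y. The Laplace identity is available up to the imaginary axis because f(y) = O(e^(\<epsilon>y))
  for every \<epsilon> > 0 (\<open>ff_subexp\<close>), which comes from Gaussian smoothing and a
  contour shift.

  Summation by parts then introduces the weight 1/ln n: the integral of f(v)/v^2 converges with tail
  O(1/y), again by the mean-square bound (\<open>lsum_asymp\<close>). Prime squares contribute half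
  of a Mertens sum for \<psi>^2, which is (ln y)/2 + O(1) exactly when \<psi>^2 is principal; higher
  powers converge. Hence the sum of \<psi>(p) p^(-1/2) over p \<le> e^y is -(m + e/2) ln y + c +
  O((|f(y)| + 1)/y) with e in {0,1} (\<open>prime_sum_asymp\<close>). Orthogonality of characters
  turns the coefficients m + e/2 into M(q;a,b), because r(a) counts the characters with principal
  square, weighted by the conjugate of \<psi>(a) (\<open>rsq_char_sum\<close>).

  Put y = ln x. The error exceeds (ln ln x)/(ln x) only where the sum of the |f| over all \<psi> is
  at least of order ln y. By Chebyshev's inequality this happens on a vanishing proportion of each
  block (X/e, X] (\<open>thin_from_mean_square\<close>), so the good set has natural and logarithmic
  density 1. Both claimed thresholds are eventually above this one, and both claims follow from the
  single lemma \<open>pi_half_thin\<close>.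

  The analytic input is built on the way: continuation of L by iterated summation by parts,
  non-vanishing on Re s = 1 (GRH speaks only of the open strip), local partial fractions of L'/L,
  Chebyshev and Mertens estimates, and orthogonality of characters.\<close>

fun bdiff :: "nat \<Rightarrow> complex \<Rightarrow> complex \<Rightarrow> complex" where
  "bdiff 0 s z = z powr (- s)"
| "bdiff (Suc k) s z = bdiff k s z - bdiff k s (z + 1)"

lemma bdiff_has_field_derivative:
  "Re z > 0 \<Longrightarrow> ((\<lambda>z. bdiff k s z) has_field_derivative (- s * bdiff k (s + 1) z)) (at z)"
proof (induction k arbitrary: z)
  case 0
  hence "z \<notin> \<real>\<^sub>\<le>\<^sub>0" by (auto simp: complex_nonpos_Reals_iff)
  thus ?case by (auto intro!: derivative_eq_intros)
next
  case (Suc k)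
  have "((\<lambda>z. bdiff k s (z + 1)) has_field_derivative (- s * bdiff k (s + 1) (z + 1)) * 1) (at z)"
    by (rule DERIV_chain2[of _ _ "\<lambda>z. z + 1"])
       (use Suc in \<open>auto intro!: derivative_eq_intros\<close>)
  with Suc show ?case
    by (auto intro!: derivative_eq_intros simp: algebra_simps)
qed

text \<open>Each difference gains one power of decay. By the mean value bound it costs one
  derivative, a factor s with s replaced by s + 1, and this turns the product with k factors for s +
  1 into the one with k + 1 factors for s. The condition on Re s + k makes the power of x
  non-increasing, so the left end of [x, x + 1] is the worst point.\<close>

lemma bdiff_bound:
  assumes "x > 0" "Re s + real k \<ge> 0"
  shows "norm (bdiff k s (of_real x)) \<le> (\<Prod>j<k. norm s + real j) * x powr (- (Re s + real k))"
  using assms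
proof (induction k arbitrary: s x)
  case 0
  thus ?case by (simp add: norm_powr_real_powr)
next
  case (Suc k)
  define B where "B = norm s * ((\<Prod>j<k. norm s + 1 + real j) * x powr (- (Re s + 1 + real k)))"
  have "norm (bdiff k s (of_real x) - bdiff k s (of_real x + 1)) \<le> B * norm (of_real x - (of_real x + 1 :: complex))"
  proof (rule field_differentiable_bound[where S = "closed_segment (of_real x) (of_real x + 1)"])
    fix z :: complex assume z: "z \<in> closed_segment (of_real x) (of_real x + 1)"
    then obtain u where u: "0 \<le> u" "u \<le> 1" "z = of_real (x + u)"
      by (auto simp: closed_segment_def algebra_simps scaleR_conv_of_real)
    show "((\<lambda>z. bdiff k s z) has_field_derivative (- s * bdiff k (s + 1) z))
        (at z within closed_segment (of_real x) (of_real x + 1))"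
      by (rule has_field_derivative_at_within, rule bdiff_has_field_derivative) (use u Suc.prems in auto)
    have "norm (bdiff k (s + 1) z) \<le> (\<Prod>j<k. norm (s + 1) + real j) * (x + u) powr (- (Re (s + 1) + real k))"
      unfolding u(3) by (rule Suc.IH) (use u Suc.prems in auto)
    also have "\<dots> \<le> (\<Prod>j<k. norm s + 1 + real j) * x powr (- (Re s + 1 + real k))"
    proof (intro mult_mono prod_mono prod_nonneg)
      show "(x + u) powr (- (Re (s + 1) + real k)) \<le> x powr (- (Re s + 1 + real k))"
        using u Suc.prems powr_mono2'[of "- (Re s + 1 + real k)" x "x + u"] by simp
    qed (auto intro: norm_triangle_ineq[of s 1, simplified] add_nonneg_nonneg)
    finally show "norm (- s * bdiff k (s + 1) z) \<le> B"
      by (simp add: norm_mult B_def mult_left_mono)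
  qed auto
  also have "B * norm (of_real x - (of_real x + 1 :: complex)) = B" by simp
  also have "B = (\<Prod>j<Suc k. norm s + real j) * x powr (- (Re s + real (Suc k)))"
    unfolding B_def by (subst prod.lessThan_Suc_shift) (simp add: add_ac)
  finally show ?case by simp
qed

lemma bdiff_holomorphic: "Re z > 0 \<Longrightarrow> (\<lambda>s. bdiff k s z) holomorphic_on A"
proof (induction k arbitrary: z)
  case 0
  hence "z \<noteq> 0" by auto
  thus ?case by (auto intro!: holomorphic_intros)
qed (auto intro!: holomorphic_intros)

definition mean0 :: "nat \<Rightarrow> (nat \<Rightarrow> complex) \<Rightarrow> bool" where
  "mean0 q g \<longleftrightarrow> q > 0 \<and> (\<forall>n. g (n + q) = g n) \<and> (\<Sum>n<q. g n) = 0"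

lemma periodic_mod:
  fixes g :: "nat \<Rightarrow> 'a"
  assumes "\<And>n. g (n + q) = g n"
  shows "g (n mod q) = g n"
proof -
  have "g (r + k * q) = g r" for r k
    by (induction k) (use assms in \<open>auto simp: add.assoc[symmetric] add.commute[of q]\<close>)
  from this[of "n mod q" "n div q"] show ?thesis by simp
qed

lemma periodic_bounded:
  fixes g :: "nat \<Rightarrow> complex"
  assumes "q > 0" "\<And>n. g (n + q) = g n"
  obtains M where "M > 0" "\<And>n. norm (g n) \<le> M"
proof
  show "(\<Sum>k<q. norm (g k)) + 1 > 0" by (simp add: add_nonneg_pos sum_nonneg)
  fix n
  have "norm (g n) = norm (g (n mod q))" using periodic_mod[of g q n] assms(2) by simp
  also have "\<dots> \<le> (\<Sum>k<q. norm (g k))"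
    by (rule member_le_sum) (use assms(1) in auto)
  finally show "norm (g n) \<le> (\<Sum>k<q. norm (g k)) + 1" by simp
qed

text \<open>Summation by parts in a form that can be iterated: the partial sums of g are again
  periodic, and subtracting their mean \<mu> restores mean zero at the cost of a telescoping term.
  The pair (g, v) is replaced by g' and the first difference of v.\<close>

lemma mean0_step:
  assumes "mean0 q g"
  obtains \<mu> g' where "mean0 q g'"
    "\<And>v N. (\<Sum>n<N. g n * v n) = (\<Sum>n<N. g n) * v N + \<mu> * (v 0 - v N) + (\<Sum>n<N. g' n * (v n - v (Suc n)))"
proof -
  from assms have q: "q > 0" and per: "\<And>n. g (n + q) = g n" and s0: "(\<Sum>n<q. g n) = 0"
    by (auto simp: mean0_def)
  define A where "A = (\<lambda>n. \<Sum>j<n. g j)"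
  have A_per: "A (n + q) = A n" for n
    by (induction n) (use s0 per in \<open>auto simp: A_def\<close>)
  define \<mu> where "\<mu> = (\<Sum>n<q. A (Suc n)) / of_nat q"
  define g' where "g' = (\<lambda>n. A (Suc n) - \<mu>)"
  have "mean0 q g'"
    unfolding mean0_def g'_def using q A_per[of "Suc _"] by (auto simp: sum_subtractf \<mu>_def)
  moreover have "(\<Sum>n<N. g n * v n) = A N * v N + \<mu> * (v 0 - v N) + (\<Sum>n<N. g' n * (v n - v (Suc n)))" for v N
    by (induction N) (auto simp: g'_def A_def algebra_simps)
  ultimately show ?thesis using that[of g' \<mu>] by (simp add: A_def)
qed

lemma mean0_partial_sums_bounded:
  assumes "mean0 q g"
  obtains M where "M > 0" "\<And>N. norm (\<Sum>n<N. g n) \<le> M"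
proof -
  from assms have q: "q > 0" and per: "\<And>n. g (n + q) = g n" and s0: "(\<Sum>n<q. g n) = 0"
    by (auto simp: mean0_def)
  have "(\<Sum>j<n+q. g j) = (\<Sum>j<n. g j)" for n
    by (induction n) (use s0 per in auto)
  from periodic_bounded[of q "\<lambda>n. \<Sum>j<n. g j", OF q this] that show ?thesis by blast
qed

text \<open>The boundary term of \<open>mean0_step\<close> disappears in the limit because partial
  sums of a mean-zero periodic sequence are bounded and v tends to 0.\<close>

lemma mean0_sums_step:
  assumes g: "mean0 q g" 
  obtains \<mu> g' where "mean0 q g'"
    "\<And>v S. v \<longlonglongrightarrow> 0 \<Longrightarrow> (\<lambda>n. g' n * (v n - v (Suc n))) sums S \<Longrightarrow> (\<lambda>n. g n * v n) sums (\<mu> * v 0 + S)"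
proof -
  obtain \<mu> g' where *: "mean0 q g'" "\<And>v N. (\<Sum>n<N. g n * v n) = 
       (\<Sum>n<N. g n) * v N + \<mu> * (v 0 - v N) + (\<Sum>n<N. g' n * (v n - v (Suc n)))"
    by (rule mean0_step[OF g]) blast
  obtain M where M: "M > 0" "\<And>N. norm (\<Sum>n<N. g n) \<le> M" by (rule mean0_partial_sums_bounded[OF g]) blast
  have "(\<lambda>n. g n * v n) sums (\<mu> * v 0 + S)" if v: "v \<longlonglongrightarrow> 0"
    and S: "(\<lambda>n. g' n * (v n - v (Suc n))) sums S" for v S
  proof -
    have "(\<lambda>N. (\<Sum>n<N. g n) * v N) \<longlonglongrightarrow> 0"
    proof (rule Lim_null_comparison)
      show "\<forall>\<^sub>F N in sequentially. norm ((\<Sum>n<N. g n) * v N) \<le> M * norm (v N)"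
        by (intro always_eventually allI) (auto simp: norm_mult intro!: mult_right_mono M)
      show "(\<lambda>N. M * norm (v N)) \<longlonglongrightarrow> 0"
        using tendsto_mult_left[OF tendsto_norm[OF v], of M] by simp
    qed
    from tendsto_add[OF tendsto_add[OF this tendsto_mult_left[OF tendsto_diff[OF tendsto_const v]]] S[unfolded sums_def]]
    show ?thesis unfolding sums_def *(2)[abs_def] by simp
  qed
  with *(1) show ?thesis by (rule that)
qed

lemma holomorphic_on_suminf:
  fixes f :: "nat \<Rightarrow> complex \<Rightarrow> complex"
  assumes S: "open S" and hol: "\<And>n. f n holomorphic_on S"
    and dom: "\<And>x. x \<in> S \<Longrightarrow> \<exists>d M. 0 < d \<and> summable M \<and> (\<forall>y\<in>cball x d. \<forall>n. norm (f n y) \<le> M n)"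
  shows "(\<lambda>x. \<Sum>n. f n x) holomorphic_on S"
proof (rule holomorphic_uniform_sequence[where f = "\<lambda>N x. \<Sum>n<N. f n x"])
  fix x assume x: "x \<in> S"
  obtain d M where dM: "0 < d" "summable M" "\<forall>y\<in>cball x d. \<forall>n. norm (f n y) \<le> M n"
    using dom[OF x] by blast
  obtain e where e: "e > 0" "cball x e \<subseteq> S" using S x open_contains_cball by blast
  have "uniform_limit (cball x (min d e)) (\<lambda>N x. \<Sum>n<N. f n x) (\<lambda>x. \<Sum>n. f n x) sequentially"
    by (rule Weierstrass_m_test[where M = M]) (use dM in auto)
  thus "\<exists>d>0. cball x d \<subseteq> S \<and> uniform_limit (cball x d) (\<lambda>N x. \<Sum>n<N. f n x) (\<lambda>x. \<Sum>n. f n x) sequentially"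
    using dM e by (intro exI[of _ "min d e"]) auto
qed (use assms in \<open>auto intro!: holomorphic_intros\<close>)

lemma summable_powr_Suc: "a > 1 \<Longrightarrow> summable (\<lambda>n. real (Suc n) powr (- a))"
  using summable_Suc_iff[of "\<lambda>n. real n powr (-a)"] summable_real_powr_iff[of "-a"] by simp

lemma bdiff_Suc_bound:
  assumes "Re s \<ge> \<sigma>" "norm s \<le> R" "\<sigma> + real k \<ge> 0"
  shows "norm (bdiff k s (of_nat (Suc n))) \<le> (\<Prod>j<k. R + real j) * real (Suc n) powr (- (\<sigma> + real k))"
proof -
  have "norm (bdiff k s (of_real (real (Suc n)))) 
      \<le> (\<Prod>j<k. norm s + real j) * real (Suc n) powr (- (Re s + real k))"
    by (rule bdiff_bound) (use assms in auto)
  also have "\<dots> \<le> (\<Prod>j<k. R + real j) * real (Suc n) powr (- (\<sigma> + real k))"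
  proof (rule mult_mono)
    show "(\<Prod>j<k. norm s + real j) \<le> (\<Prod>j<k. R + real j)"
      using assms by (intro prod_mono) auto
    show "real (Suc n) powr - (Re s + real k) \<le> real (Suc n) powr - (\<sigma> + real k)"
      using assms by (intro powr_mono) auto
    have "R \<ge> 0" using assms(2) norm_ge_zero[of s] by linarith
    thus "0 \<le> (\<Prod>j<k. R + real j)" by (intro prod_nonneg) auto
  qed auto
  finally show ?thesis by simp
qed

lemma bdiff_series_dominated:
  assumes "\<And>n. norm (g n) \<le> M" "M > 0" "Re x > 1 - real k"
  shows "\<exists>d h. 0 < d \<and> summable h \<and> 
            (\<forall>s\<in>cball x d. \<forall>n. norm (g n * bdiff k s (of_nat (Suc n))) \<le> h n)"
proof -
  define d where "d = (Re x - (1 - real k)) / 2"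
  define \<sigma> where "\<sigma> = Re x - d"
  have d: "d > 0" "\<sigma> + real k > 1" using assms by (auto simp: d_def \<sigma>_def field_simps)
  define h where "h = (\<lambda>n. M * ((\<Prod>j<k. (norm x + d) + real j) * real (Suc n) powr (- (\<sigma> + real k))))"
  have "summable h" unfolding h_def by (intro summable_mult summable_powr_Suc d)
  moreover have "norm (g n * bdiff k s (of_nat (Suc n))) \<le> h n" if "s \<in> cball x d" for s n
    unfolding norm_mult h_def
  proof (intro mult_mono assms bdiff_Suc_bound)
    have ds: "norm (x - s) \<le> d" using that by (simp add: dist_norm)
    show "\<sigma> \<le> Re s" using abs_Re_le_cmod[of "x - s"] ds by (auto simp: \<sigma>_def)
    show "norm s \<le> norm x + d" using ds norm_triangle_ineq2[of s x] by (simp add: norm_minus_commute)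
  qed (use d assms in \<open>simp_all\<close>)
  ultimately show ?thesis using d by blast
qed

lemma bdiff_series_holomorphic:
  assumes g: "\<And>n. norm (g n) \<le> M" "M > 0"
  shows "(\<lambda>s. \<Sum>n. g n * bdiff k s (of_nat (Suc n))) holomorphic_on {s. Re s > 1 - real k}"
proof (rule holomorphic_on_suminf)
  fix x assume "x \<in> {s. Re s > 1 - real k}"
  hence "Re x > 1 - real k" by simp
  from bdiff_series_dominated[where g = g, OF g this]
  show "\<exists>d M. 0 < d \<and> summable M \<and> (\<forall>y\<in>cball x d. \<forall>n. norm (g n * bdiff k y (of_nat (Suc n))) \<le> M n)" .
qed (auto intro!: holomorphic_intros bdiff_holomorphic simp: open_halfspace_Re_gt)

lemma bdiff_series_summable:
  assumes g: "\<And>n. norm (g n) \<le> M" "M > 0" and "Re s > 1 - real k"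
  shows "summable (\<lambda>n. g n * bdiff k s (of_nat (Suc n)))"
proof -
  obtain d h where h: "0 < d" "summable h" and
    *: "\<forall>y\<in>cball s d. \<forall>n. norm (g n * bdiff k y (of_nat (Suc n))) \<le> h n"
    using bdiff_series_dominated[where g = g, OF g assms(3)] by (elim exE conjE) (rule that)
  have "s \<in> cball s d" using h by simp
  hence "norm (g n * bdiff k s (of_nat (Suc n))) \<le> h n" for n
    by (rule *[rule_format])
  thus ?thesis using h(2) by (rule summable_comparison_test'[where g = h and N = 0, rotated])
qed

lemma bdiff_tendsto_0:
  assumes "Re s + real k > 0"
  shows "(\<lambda>n. bdiff k s (of_nat (Suc n))) \<longlonglongrightarrow> 0"
proof (rule Lim_null_comparison)
  show "\<forall>\<^sub>F n in sequentially. norm (bdiff k s (of_nat (Suc n))) \<le> 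
     (\<Prod>j<k. norm s + real j) * real (Suc n) powr (- (Re s + real k))"
    by (intro always_eventually allI bdiff_Suc_bound) (use assms in simp_all)
  have "(\<lambda>n. real n powr (- (Re s + real k))) \<longlonglongrightarrow> 0" using assms by real_asymp
  from tendsto_mult_left[OF LIMSEQ_Suc[OF this]] 
  show "(\<lambda>n. (\<Prod>j<k. norm s + real j) * real (Suc n) powr (- (Re s + real k))) \<longlonglongrightarrow> 0" by auto
qed

lemma mean0_bounded:
  assumes "mean0 q g" obtains M where "M > 0" "\<And>n. norm (g n) \<le> M"
  using assms unfolding mean0_def by (elim conjE) (rule periodic_bounded[of q g], auto)

text \<open>After k summations by parts the Dirichlet series equals entire boundary terms E plus a
  series in \<open>bdiff k\<close>, which converges for Re s > 1 - k. Every step moves the domain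
  one unit to the left.\<close>

lemma mean0_continuation_step:
  assumes g: "mean0 q g"
  shows "\<exists>E g'. E holomorphic_on UNIV \<and> mean0 q g' \<and> (\<forall>s. Re s > 1 \<longrightarrow>
    (\<lambda>n. g n * of_nat (Suc n) powr (- s)) sums (E s + (\<Sum>n. g' n * bdiff k s (of_nat (Suc n)))))"
proof (induction k)
  case 0
  obtain M where M: "M > 0" "\<And>n. norm (g n) \<le> M" by (rule mean0_bounded[OF g]) blast
  have "(\<lambda>n. g n * of_nat (Suc n) powr (- s)) sums (\<Sum>n. g n * bdiff 0 s (of_nat (Suc n)))" if "Re s > 1" for s
    using summable_sums[OF bdiff_series_summable[where g = g and k = 0 and s = s, OF M(2,1)]] that by simp
  thus ?case using g by (intro exI[of _ "\<lambda>_. 0"] exI[of _ g]) simp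
next
  case (Suc k)
  then obtain E g' where E: "E holomorphic_on UNIV" "mean0 q g'" and
    *: "\<And>s. Re s > 1 \<Longrightarrow> (\<lambda>n. g n * of_nat (Suc n) powr (- s)) sums (E s + (\<Sum>n. g' n * bdiff k s (of_nat (Suc n))))"
    by blast
  obtain \<mu> g'' where **: "mean0 q g''" "\<And>v S. v \<longlonglongrightarrow> 0 \<Longrightarrow> (\<lambda>n. g'' n * (v n - v (Suc n))) sums S \<Longrightarrow> (\<lambda>n. g' n * v n) sums (\<mu> * v 0 + S)"
    by (rule mean0_sums_step[OF E(2)]) blast
  obtain M where M: "M > 0" "\<And>n. norm (g'' n) \<le> M" by (rule mean0_bounded[OF **(1)]) blast
  show ?case
  proof (rule exI[of _ "\<lambda>s. E s + \<mu> * bdiff k s 1"], rule exI[of _ g''], intro conjI allI impI)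
    fix s assume s: "Re s > (1::real)"
    have "(\<lambda>n. g' n * bdiff k s (of_nat (Suc n))) sums 
       (\<mu> * bdiff k s (of_nat (Suc 0)) + (\<Sum>n. g'' n * bdiff (Suc k) s (of_nat (Suc n))))"
      using bdiff_series_summable[where g = g'' and k = "Suc k" and s = s, OF M(2,1)] s
      by (intro **(2) bdiff_tendsto_0) (auto simp: add_ac summable_sums)
    from sums_unique[OF this] *[OF s]
    show "(\<lambda>n. g n * of_nat (Suc n) powr (- s)) sums (E s + \<mu> * bdiff k s 1 + (\<Sum>n. g'' n * bdiff (Suc k) s (of_nat (Suc n))))"
      by (simp add: add_ac)
  qed (use E ** in \<open>auto intro!: holomorphic_intros bdiff_holomorphic\<close>)
qed


text \<open>One summation by parts already reaches Re s > 0: there the conditionally convergent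
  series itself represents the continuation, and dominating the first differences by |s| n^(-11/10)
  gives linear growth in s. That growth is what later limits the number of zeros near height
  t.\<close>

lemma mean0_half_plane:
  assumes g: "mean0 q g"
  shows "\<exists>G. G holomorphic_on {s. Re s > 0} \<and>
      (\<forall>s. Re s > 0 \<longrightarrow> (\<lambda>n. g n * of_nat (Suc n) powr (- s)) sums G s) \<and>
      (\<exists>C>0. \<forall>s. Re s \<ge> 1/10 \<longrightarrow> norm (G s) \<le> C * (1 + norm s))"
proof -
  obtain \<mu> g' where g': "mean0 q g'" and step: "\<And>v S. v \<longlonglongrightarrow> 0 \<Longrightarrow>
     (\<lambda>n. g' n * (v n - v (Suc n))) sums S \<Longrightarrow> (\<lambda>n. g n * v n) sums (\<mu> * v 0 + S)"
    by (rule mean0_sums_step[OF g]) blast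
  obtain M where M: "M > 0" "\<And>n. norm (g' n) \<le> M" by (rule mean0_bounded[OF g']) blast
  define G where "G = (\<lambda>s. \<mu> + (\<Sum>n. g' n * bdiff 1 s (of_nat (Suc n))))"
  have "G holomorphic_on {s. Re s > 0}"
    unfolding G_def using bdiff_series_holomorphic[where g = g' and k = 1, OF M(2,1)]
    by (intro holomorphic_intros) simp_all
  moreover have "(\<lambda>n. g n * of_nat (Suc n) powr (- s)) sums G s" if s: "Re s > 0" for s
  proof -
    have "(\<lambda>n. g' n * bdiff 1 s (of_nat (Suc n))) sums (\<Sum>n. g' n * bdiff 1 s (of_nat (Suc n)))"
      by (intro summable_sums bdiff_series_summable[where g = g' and k = 1, OF M(2,1)]) (use s in simp)
    hence *: "(\<lambda>n. g' n * (bdiff 0 s (of_nat (Suc n)) - bdiff 0 s (of_nat (Suc (Suc n))))) sums (\<Sum>n. g' n * bdiff 1 s (of_nat (Suc n)))"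
      by (simp add: add_ac)
    have "(\<lambda>n. bdiff 0 s (of_nat (Suc n))) \<longlonglongrightarrow> 0" by (rule bdiff_tendsto_0) (use s in simp)
    from step[OF this *] show ?thesis by (simp add: G_def)
  qed
  moreover have "\<exists>C>0. \<forall>s. Re s \<ge> 1/10 \<longrightarrow> norm (G s) \<le> C * (1 + norm s)"
  proof (intro exI[of _ "norm \<mu> + M * (\<Sum>n. real (Suc n) powr (-(11/10))) + 1"] conjI allI impI)
    have S0: "(\<Sum>n. real (Suc n) powr (-(11/10))) \<ge> 0"
      by (intro suminf_nonneg summable_powr_Suc) auto
    thus "norm \<mu> + M * (\<Sum>n. real (Suc n) powr (-(11/10))) + 1 > 0" using M 
      by (intro add_nonneg_pos add_nonneg_nonneg mult_nonneg_nonneg) auto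
    fix s :: complex assume s: "Re s \<ge> 1/10"
    have b: "norm (g' n * bdiff 1 s (of_nat (Suc n))) \<le> M * norm s * real (Suc n) powr (-(11/10))" for n
    proof -
      have "norm (bdiff 1 s (of_nat (Suc n))) \<le> (\<Prod>j<1. norm s + real j) * real (Suc n) powr (- (1/10 + real 1))"
        by (rule bdiff_Suc_bound) (use s in auto)
      hence "norm (g' n) * norm (bdiff 1 s (of_nat (Suc n))) \<le> M * ((\<Prod>j<1. norm s + real j) * real (Suc n) powr (- (1/10 + real 1)))"
        using M by (intro mult_mono) auto
      thus ?thesis by (simp add: norm_mult mult_ac)
    qed
    have "norm (\<Sum>n. g' n * bdiff 1 s (of_nat (Suc n))) \<le> (\<Sum>n. M * norm s * real (Suc n) powr (-(11/10)))"
      by (rule norm_suminf_le[OF b]) (intro summable_mult summable_powr_Suc, simp)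
    also have "\<dots> = M * norm s * (\<Sum>n. real (Suc n) powr (-(11/10)))"
      by (intro suminf_mult summable_powr_Suc) simp
    finally have "norm (G s) \<le> norm \<mu> + M * norm s * (\<Sum>n. real (Suc n) powr (-(11/10)))"
      unfolding G_def using norm_triangle_ineq order_trans add_left_mono by meson
    also have "\<dots> \<le> (norm \<mu> + M * (\<Sum>n. real (Suc n) powr (-(11/10))) + 1) * (1 + norm s)"
    proof -
      have "0 \<le> norm \<mu> * norm s" "0 \<le> M * (\<Sum>n. real (Suc n) powr (-(11/10)))" using M S0 by auto
      moreover have "norm s \<ge> 0" by simp
      ultimately show ?thesis by (simp add: algebra_simps)
    qed
    finally show "norm (G s) \<le> (norm \<mu> + M * (\<Sum>n. real (Suc n) powr (-(11/10))) + 1) * (1 + norm s)" .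
  qed
  ultimately show ?thesis by blast
qed

text \<open>The identity theorem for half-planes. It matches the different continuations of L here,
  and later carries the Laplace transform of \<open>ff\<close> from Re w > 1 to Re w > 0.\<close>

lemma half_plane_identity:
  assumes "f holomorphic_on {s. Re s > c}" "g holomorphic_on {s. Re s > c}"
    "\<And>s. Re s > d \<Longrightarrow> f s = g s" "Re z > c"
  shows "f z = g z"
proof (rule analytic_continuation_open[where s = "{s. Re s > max c d}" and s' = "{s. Re s > c}" and f = f and g = g])
  have "of_real (max c d + 1) \<in> {s. Re s > max c d}" by (simp add: max_def)
  thus "{s. Re s > max c d} \<noteq> {}" by blast
qed (use assms open_halfspace_Re_gt[of "max c d"] in
     \<open>auto simp: open_halfspace_Re_gt convex_connected convex_halfspace_Re_gt\<close>)

lemma mean0_entire: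
  assumes g: "mean0 q g"
  shows "\<exists>L. L holomorphic_on UNIV \<and>
      (\<forall>s. Re s > 1 \<longrightarrow> (\<lambda>n. g n * of_nat (Suc n) powr (- s)) sums L s)"
proof -
  have "\<exists>G. G holomorphic_on {s. Re s > 1 - real k} \<and>
      (\<forall>s. Re s > 1 \<longrightarrow> (\<lambda>n. g n * of_nat (Suc n) powr (- s)) sums G s)" for k
  proof -
    obtain E g' where E: "E holomorphic_on UNIV" "mean0 q g'" and
      S: "\<And>s. Re s > 1 \<Longrightarrow> (\<lambda>n. g n * of_nat (Suc n) powr (- s)) sums (E s + (\<Sum>n. g' n * bdiff k s (of_nat (Suc n))))"
      using mean0_continuation_step[OF g, of k] by blast
    obtain M where M: "M > 0" "\<And>n. norm (g' n) \<le> M" by (rule mean0_bounded[OF E(2)]) blast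
    have "(\<lambda>s. E s + (\<Sum>n. g' n * bdiff k s (of_nat (Suc n)))) holomorphic_on {s. Re s > 1 - real k}"
      by (intro holomorphic_intros bdiff_series_holomorphic[where g = g', OF M(2,1)]
            holomorphic_on_subset[OF E(1)]) auto
    with S show ?thesis by blast
  qed
  then obtain G where G: "\<And>k. G k holomorphic_on {s. Re s > 1 - real k}"
    and GS: "\<And>k s. Re s > 1 \<Longrightarrow> (\<lambda>n. g n * of_nat (Suc n) powr (- s)) sums G k s" by metis
  \<comment> \<open>The index is chosen large enough for s to lie in the half-plane of that
    \<open>G\<close>; \<open>L_eq\<close> shows that any admissible index gives the same
    value.\<close>
  define L where "L = (\<lambda>s. G (nat \<lceil>2 - Re s\<rceil>) s)"
  have L_eq: "L s = G k s" if s: "Re s > 1 - real k" for s k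
  proof -
    define j where "j = nat \<lceil>2 - Re s\<rceil>"
    have j: "Re s > 1 - real j" unfolding j_def by linarith
    have "G j s = G k s"
    proof (rule half_plane_identity[where f = "G j" and g = "G k" and c = "1 - real (min j k)" and d = 1])
      show "G j z = G k z" if "Re z > 1" for z
        using sums_unique2[OF GS GS] that by blast
    qed (use j s in \<open>auto intro!: holomorphic_on_subset[OF G] simp: min_def split: if_splits\<close>)
    thus ?thesis by (simp add: L_def j_def)
  qed
  have "L holomorphic_on (\<Union>k. {s. Re s > 1 - real k})"
    by (rule holomorphic_on_UN_open)
       (auto simp: open_halfspace_Re_gt L_eq intro!: holomorphic_transform[OF G])
  also have "(\<Union>k. {s. Re s > 1 - real k}) = UNIV"
  proof -
    have "\<exists>k. Re s > 1 - real k" for s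
      by (rule exI[of _ "nat \<lceil>2 - Re s\<rceil>"]) linarith
    thus ?thesis by auto
  qed
  finally have "L holomorphic_on UNIV" .
  moreover have "(\<lambda>n. g n * of_nat (Suc n) powr (- s)) sums L s" if "Re s > 1" for s
    using GS[OF that, of 1] L_eq[of 1 s] that by simp
  ultimately show ?thesis by blast
qed

subsection \<open>Dirichlet characters and their L-functions\<close>

lemma dcharacterD:
  assumes "dcharacter q \<psi>"
  shows "q > 0" "\<psi> 1 = 1" "\<psi> (m * n) = \<psi> m * \<psi> n" "\<psi> (n + q) = \<psi> n" "\<psi> n = 0 \<longleftrightarrow> \<not> coprime n q"
    "\<psi> (n mod q) = \<psi> n"
  using assms periodic_mod[of \<psi> q] by (auto simp: dcharacter_def)

lemma dcharacter_power: "dcharacter q \<psi> \<Longrightarrow> \<psi> (n ^ k) = \<psi> n ^ k"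
  by (induction k) (auto simp: dcharacter_def simp del: One_nat_def)

lemma dcharacter_cong: "dcharacter q \<psi> \<Longrightarrow> [m = n] (mod q) \<Longrightarrow> \<psi> m = \<psi> n"
  using dcharacterD(6)[of q \<psi> m] dcharacterD(6)[of q \<psi> n] by (simp add: cong_def)

lemma dcharacter_totient:
  assumes "dcharacter q \<psi>" "coprime n q"
  shows "\<psi> n ^ totient q = 1"
proof -
  have "\<psi> (n ^ totient q) = \<psi> 1"
    by (rule dcharacter_cong[OF assms(1)]) (use euler_theorem assms in auto)
  thus ?thesis using dcharacterD(2)[OF assms(1)] dcharacter_power[OF assms(1)] by simp
qed

lemma norm_dcharacter:
  assumes "dcharacter q \<psi>"
  shows "norm (\<psi> n) = (if coprime n q then 1 else 0)"
proof (cases "coprime n q")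
  case True
  have "norm (\<psi> n) ^ totient q = 1"
    using dcharacter_totient[OF assms True] by (simp flip: norm_power)
  moreover have "totient q > 0" using dcharacterD(1)[OF assms] by simp
  ultimately have "norm (\<psi> n) = 1" using power_eq_1_iff[of "norm (\<psi> n)" "totient q"] by simp
  thus ?thesis using True by simp
qed (use dcharacterD(5)[OF assms] in auto)

lemma norm_dcharacter_le: "dcharacter q \<psi> \<Longrightarrow> norm (\<psi> n) \<le> 1"
  by (simp add: norm_dcharacter)

lemma nonprincipal_charsD: 
  assumes "\<psi> \<in> nonprincipal_chars q" 
  shows "dcharacter q \<psi>" "\<exists>c. coprime c q \<and> \<psi> c \<noteq> 1"
proof -
  show chi: "dcharacter q \<psi>" using assms by (simp add: nonprincipal_chars_def)
  show "\<exists>c. coprime c q \<and> \<psi> c \<noteq> 1"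
  proof (rule ccontr)
    assume "\<not> ?thesis"
    hence "\<psi> = principal_char q"
      using dcharacterD(5)[OF chi] by (auto simp: principal_char_def fun_eq_iff)
    with assms show False by (simp add: nonprincipal_chars_def)
  qed
qed

lemma bij_betw_mult_mod:
  fixes c q :: nat
  assumes "q > 0" "coprime c q"
  shows "bij_betw (\<lambda>n. c * n mod q) {..<q} {..<q}"
proof -
  have "inj_on (\<lambda>n. c * n mod q) {..<q}"
  proof (rule inj_onI)
    fix x y assume xy: "x \<in> {..<q}" "y \<in> {..<q}" "c * x mod q = c * y mod q"
    hence "[c * x = c * y] (mod q)" by (simp add: cong_def)
    hence "[x = y] (mod q)" using assms(2) cong_mult_lcancel_nat by blast
    with xy show "x = y" by (simp add: cong_def)
  qed
  moreover have "(\<lambda>n. c * n mod q) ` {..<q} \<subseteq> {..<q}" using assms by auto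
  ultimately show ?thesis
    by (simp add: bij_betw_def endo_inj_surj)
qed

lemma sum_dcharacter_eq_0:
  assumes "\<psi> \<in> nonprincipal_chars q"
  shows "(\<Sum>n<q. \<psi> n) = 0"
proof -
  note chi = nonprincipal_charsD(1)[OF assms]
  obtain c where c: "coprime c q" "\<psi> c \<noteq> 1" using nonprincipal_charsD(2)[OF assms] by blast
  have "(\<Sum>n<q. \<psi> n) = (\<Sum>n<q. \<psi> (c * n mod q))"
    by (rule sum.reindex_bij_betw[OF bij_betw_mult_mod, symmetric]) (use c dcharacterD(1)[OF chi] in auto)
  also have "\<dots> = \<psi> c * (\<Sum>n<q. \<psi> n)"
    by (simp add: dcharacterD[OF chi] sum_distrib_left)
  finally show ?thesis using c by (simp add: algebra_simps)
qed

lemma mean0_dcharacter: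
  assumes "\<psi> \<in> nonprincipal_chars q"
  shows "mean0 q (\<lambda>n. \<psi> (Suc n))"
proof -
  note chi = nonprincipal_charsD(1)[OF assms]
  have "(\<Sum>n<q. \<psi> (Suc n)) = (\<Sum>n<q. \<psi> n) + \<psi> q - \<psi> 0"
    by (induction q) auto
  also have "\<psi> q = \<psi> 0" using dcharacterD(4)[OF chi, of 0] by simp
  finally show ?thesis
    using sum_dcharacter_eq_0[OF assms] dcharacterD(1)[OF chi] dcharacterD(4)[OF chi, of "Suc _"]
    by (simp add: mean0_def)
qed

text \<open>\<open>mean0_entire\<close> provides a witness for the choice in the definition of
  \<open>Lfun\<close>. Convergence of the series on Re s > 0 and the growth bound are then
  transported from the function of \<open>mean0_half_plane\<close> by the identity theorem.\<close>

lemma Lfun_props: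
  assumes "\<psi> \<in> nonprincipal_chars q"
  shows "Lfun \<psi> holomorphic_on A"
    and "Re s > 0 \<Longrightarrow> (\<lambda>n. \<psi> n * of_nat n powr (- s)) sums Lfun \<psi> s"
    and "\<exists>C>0. \<forall>s. Re s \<ge> 1/10 \<longrightarrow> norm (Lfun \<psi> s) \<le> C * (1 + norm s)"
proof -
  have "\<exists>L. L holomorphic_on UNIV \<and> (\<forall>s. Re s > 1 \<longrightarrow> (\<lambda>n. \<psi> (Suc n) / of_nat (Suc n) powr s) sums L s)"
    using mean0_entire[OF mean0_dcharacter[OF assms]] by (simp add: powr_minus_divide del: of_nat_Suc)
  from someI_ex[OF this] have L: "Lfun \<psi> holomorphic_on UNIV"
    "\<And>s. Re s > 1 \<Longrightarrow> (\<lambda>n. \<psi> (Suc n) * of_nat (Suc n) powr (- s)) sums Lfun \<psi> s"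
    unfolding Lfun_def[symmetric] by (auto simp: powr_minus_divide simp del: of_nat_Suc)
  show "Lfun \<psi> holomorphic_on A" using L(1) by (rule holomorphic_on_subset) auto
  obtain G where G: "G holomorphic_on {s. Re s > 0}" 
    "\<And>s. Re s > 0 \<Longrightarrow> (\<lambda>n. \<psi> (Suc n) * of_nat (Suc n) powr (- s)) sums G s"
    "\<exists>C>0. \<forall>s. Re s \<ge> 1/10 \<longrightarrow> norm (G s) \<le> C * (1 + norm s)"
    using mean0_half_plane[OF mean0_dcharacter[OF assms]] by blast
  have eq: "Lfun \<psi> s = G s" if "Re s > 0" for s
  proof (rule half_plane_identity[where f = "Lfun \<psi>" and g = G and c = 0 and d = 1])
    show "Lfun \<psi> z = G z" if "Re z > 1" for z
      using sums_unique2[OF L(2) G(2)] that by simp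
  qed (use that G(1) L(1) holomorphic_on_subset in auto)
  show "(\<lambda>n. \<psi> n * of_nat n powr (- s)) sums Lfun \<psi> s" if "Re s > 0"
    using G(2)[OF that] sums_Suc_iff[of "\<lambda>n. \<psi> n * of_nat n powr (- s)" "Lfun \<psi> s"] eq[OF that] by simp
  show "\<exists>C>0. \<forall>s. Re s \<ge> 1/10 \<longrightarrow> norm (Lfun \<psi> s) \<le> C * (1 + norm s)"
    using G(3) eq by force
qed


subsection \<open>Absolutely convergent Dirichlet series\<close>

text \<open>The sum starts at n = 0, where the term vanishes because 0 \<open>powr\<close> anything
  is 0.\<close>

definition dirs :: "(nat \<Rightarrow> complex) \<Rightarrow> complex \<Rightarrow> complex" where
  "dirs a s = (\<Sum>n. a n * of_nat n powr (- s))"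

lemma norm_of_nat_powr: "n > 0 \<Longrightarrow> norm (of_nat n powr (s :: complex)) = real n powr Re s"
  using norm_powr_real_powr[of "of_nat n" s] by simp

lemma of_nat_powr_mult:
  "of_nat (m * n) powr (s :: complex) = of_nat m powr s * of_nat n powr s"
  using powr_times_real[of "of_nat m" "of_nat n" s] by simp

lemma summable_ln_powr:
  assumes "\<sigma> > 1"
  shows "summable (\<lambda>n. (ln (real n) + 1) * real n powr (- \<sigma>))"
proof (rule summable_comparison_test_bigo)
  show "summable (\<lambda>n. norm (real n powr (- ((1 + \<sigma>) / 2))))"
    using assms by (simp add: summable_real_powr_iff)
  show "(\<lambda>n. (ln (real n) + 1) * real n powr (- \<sigma>)) \<in> O(\<lambda>n. real n powr (- ((1 + \<sigma>) / 2)))"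
    using assms by real_asymp
qed

lemma dirs_summable_norm:
  assumes a: "\<And>n. n > 0 \<Longrightarrow> norm (a n) \<le> ln (real n) + 1" and s: "Re s > 1"
  shows "summable (\<lambda>n. norm (a n * of_nat n powr (- s)))"
proof (rule summable_comparison_test'[where N = 1])
  show "summable (\<lambda>n. (ln (real n) + 1) * real n powr (- Re s))"
    by (rule summable_ln_powr[OF s])
  fix n :: nat assume "n \<ge> 1"
  thus "norm (norm (a n * of_nat n powr (- s))) \<le> (ln (real n) + 1) * real n powr (- Re s)"
    using a[of n] by (simp add: norm_mult norm_of_nat_powr mult_right_mono)
qed

lemma dirs_sums:
  assumes "\<And>n. n > 0 \<Longrightarrow> norm (a n) \<le> ln (real n) + 1" "Re s > 1"
  shows "(\<lambda>n. a n * of_nat n powr (- s)) sums dirs a s"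
  unfolding dirs_def by (rule summable_sums, rule summable_norm_cancel, rule dirs_summable_norm) (use assms in auto)

lemma dirs_has_field_derivative:
  assumes a: "\<And>n. n > 0 \<Longrightarrow> norm (a n) \<le> ln (real n) + 1" and s: "Re s > 1"
  shows "(dirs a has_field_derivative - dirs (\<lambda>n. a n * ln (real n)) s) (at s)"
proof -
  have "\<exists>g g'. \<forall>x\<in>{s. Re s > 1}. (\<lambda>n. a n * of_nat n powr (- x)) sums g x \<and>
     (\<lambda>n. - (a n * ln (real n) * of_nat n powr (- x))) sums g' x \<and> (g has_field_derivative g' x) (at x)"
  proof (rule series_and_derivative_comparison_complex)
    fix n :: nat and x :: complex
    show "((\<lambda>x. a n * of_nat n powr (- x)) has_field_derivative - (a n * ln (real n) * of_nat n powr (- x))) (at x)"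
    proof (cases "n = 0")
      case False
      have "ln (of_nat n :: complex) = of_real (ln (real n))"
        using Ln_of_real[of "real n"] False by simp
      thus ?thesis using False unfolding powr_def by (auto intro!: derivative_eq_intros)
    qed auto
  next
    fix x assume x: "x \<in> {s. Re s > (1::real)}"
    define d where "d = (Re x - 1) / 2"
    define h where "h = (\<lambda>n. complex_of_real ((ln (real n) + 1) * real n powr (- (1 + d))))"
    have d: "d > 0" using x by (simp add: d_def)
    have "summable h" unfolding h_def by (intro summable_of_real summable_ln_powr) (use d in simp)
    moreover have "h n \<in> \<real>\<^sub>\<ge>\<^sub>0" for n
      unfolding h_def by (cases "n = 0") (auto intro!: mult_nonneg_nonneg add_nonneg_nonneg)
    hence "range h \<subseteq> \<real>\<^sub>\<ge>\<^sub>0" by auto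
    moreover have "norm (a n * of_nat n powr (- y)) \<le> norm (h n)" if "y \<in> ball x d \<inter> {s. Re s > 1}" "n \<ge> 1" for y n
    proof -
      have "\<bar>Re (x - y)\<bar> < d" using abs_Re_le_cmod[of "x - y"] that by (simp add: dist_norm)
      hence "Re y > 1 + d" unfolding d_def by (simp add: field_simps abs_if split: if_splits)
      hence "norm (a n) * real n powr (- Re y) \<le> (ln (real n) + 1) * real n powr (- (1 + d))"
        using that a[of n] by (intro mult_mono powr_mono) auto
      thus ?thesis using that by (simp add: norm_mult norm_of_nat_powr h_def)
    qed
    hence "\<forall>\<^sub>F n in sequentially. \<forall>y\<in>ball x d \<inter> {s. Re s > 1}. norm (a n * of_nat n powr (- y)) \<le> norm (h n)"
      by (intro eventually_mono[OF eventually_ge_at_top[of 1]]) blast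
    ultimately show "\<exists>d h. 0 < d \<and> summable h \<and> range h \<subseteq> \<real>\<^sub>\<ge>\<^sub>0 \<and> 
        (\<forall>\<^sub>F n in sequentially. \<forall>y\<in>ball x d \<inter> {s. Re s > 1}. norm (a n * of_nat n powr (- y)) \<le> cmod (h n))"
      using d by (intro exI[of _ d] exI[of _ h] conjI)
  qed (simp add: open_halfspace_Re_gt)
  then obtain g g' where g0: "\<forall>x\<in>{s. Re s > 1}. (\<lambda>n. a n * of_nat n powr (- x)) sums g x \<and>
     (\<lambda>n. - (a n * ln (real n) * of_nat n powr (- x))) sums g' x \<and> (g has_field_derivative g' x) (at x)"
    by (elim exE)
  have g: "(\<lambda>n. a n * of_nat n powr (- x)) sums g x"
    "(\<lambda>n. - (a n * ln (real n) * of_nat n powr (- x))) sums g' x"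
    "(g has_field_derivative g' x) (at x)" if "Re x > 1" for x using g0 that by simp_all
  have eq: "dirs a x = g x" if "Re x > 1" for x using g(1)[OF that] by (simp add: dirs_def sums_iff)
  have "g' s = - dirs (\<lambda>n. a n * ln (real n)) s"
    using sums_minus[OF g(2)[OF s]] by (simp add: dirs_def sums_iff minus_equation_iff)
  moreover have "(dirs a has_field_derivative g' s) (at s)"
    by (rule has_field_derivative_transform_within_open[OF g(3)[OF s], of "{s. Re s > 1}"])
       (use s eq in \<open>auto simp: open_halfspace_Re_gt\<close>)
  ultimately show ?thesis by simp
qed

text \<open>Dirichlet convolution: a double sum over (n, m) is regrouped by the product k = n
  m.\<close>

lemma has_sum_divisors:
  fixes F :: "nat \<Rightarrow> nat \<Rightarrow> complex"
  assumes "((\<lambda>(n, m). F n m) has_sum S) ({1..} \<times> {1..})"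
  shows "((\<lambda>k. \<Sum>d | d dvd k. F (k div d) d) has_sum S) {1..}"
proof -
  have "bij_betw (\<lambda>(k, d). (k div d, d)) (Sigma {1..} (\<lambda>k. {d. d dvd k})) ({1..} \<times> {1..} :: (nat \<times> nat) set)"
    by (rule bij_betwI[where g = "\<lambda>(n, m). (n * m, m)"]) (auto simp: Suc_le_eq dvd_div_eq_0_iff intro!: Nat.gr0I)
  from has_sum_reindex_bij_betw[OF this, of "\<lambda>(n, m). F n m" S] assms
  have "((\<lambda>(k, d). F (k div d) d) has_sum S) (Sigma {1..} (\<lambda>k. {d. d dvd k}))"
    by (simp add: case_prod_unfold)
  thus ?thesis
  proof (rule has_sum_SigmaD)
    fix k :: nat assume "k \<in> {1..}"
    thus "((\<lambda>y. case (k, y) of (k, d) \<Rightarrow> F (k div d) d) has_sum (\<Sum>d | d dvd k. F (k div d) d)) {d. d dvd k}"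
      by (auto intro!: has_sum_finiteI)
  qed
qed

lemma has_sum_times:
  fixes A B :: "nat \<Rightarrow> complex"
  assumes A: "summable (\<lambda>n. norm (A n))" "A sums a" "A 0 = 0" and B: "summable (\<lambda>n. norm (B n))" "B sums b" "B 0 = 0"
  shows "((\<lambda>(n, m). A n * B m) has_sum (a * b)) ({1..} \<times> {1..})"
proof -
  have hA: "(A has_sum a) UNIV" and hB: "(B has_sum b) UNIV"
    using norm_summable_imp_has_sum A B by blast+
  have "(A has_sum a) {1..}" "(B has_sum b) {1..}"
    using hA hB A(3) B(3) has_sum_cong_neutral[of "{1..}" UNIV A A a] has_sum_cong_neutral[of "{1..}" UNIV B B b]
    by (auto simp: not_less_eq_eq)
  moreover have "(\<lambda>(n, m). A n * B m) summable_on ({1..} \<times> {1..})"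
  proof (rule abs_summable_summable)
    have "(\<lambda>n. norm (A n)) summable_on {1..}" "(\<lambda>n. norm (B n)) summable_on {1..}"
      using norm_summable_imp_summable_on[of "\<lambda>n. norm (A n)"] norm_summable_imp_summable_on[of "\<lambda>n. norm (B n)"] A B
      by (auto intro: summable_on_subset_banach)
    thus "(\<lambda>x. norm (case x of (n, m) \<Rightarrow> A n * B m)) summable_on ({1..} \<times> {1..})"
      by (intro summable_on_SigmaI[where g = "\<lambda>n. norm (A n) * infsum (\<lambda>m. norm (B m)) {1..}"])
         (auto simp: norm_mult intro!: has_sum_cmult_right summable_on_cmult_left)
  qed
  ultimately show ?thesis
    by (intro has_sum_SigmaI[where g = "\<lambda>n. A n * b"]) (auto intro: has_sum_cmult_right has_sum_cmult_left)
qed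

text \<open>A class containing the characters, their pointwise squares and the constant 1, so that
  L-functions and the zeta function obey the same lemmas.\<close>

definition unitmult :: "(nat \<Rightarrow> complex) \<Rightarrow> bool" where
  "unitmult f \<longleftrightarrow> f 1 = 1 \<and> (\<forall>m n. f (m * n) = f m * f n) \<and> (\<forall>n. norm (f n) \<le> 1)"

lemma ln_plus1_ge: "n > 0 \<Longrightarrow> ln (real n) + 1 \<ge> (1::real)" by simp

context
  fixes f :: "nat \<Rightarrow> complex"
  assumes f: "unitmult f"
begin

lemma unitmult_norm: "norm (f n) \<le> 1"
  using f by (simp add: unitmult_def)

lemma unitmult_bounds:
  "n > 0 \<Longrightarrow> norm (f n) \<le> ln (real n) + 1"
  "n > 0 \<Longrightarrow> norm (mangoldt n * f n) \<le> ln (real n) + 1"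
  "n > 0 \<Longrightarrow> norm (mangoldt n / ln (real n) * f n) \<le> ln (real n) + 1"
proof -
  assume n: "n > 0"
  show "norm (f n) \<le> ln (real n) + 1" using unitmult_norm[of n] ln_plus1_ge[OF n] by linarith
  have "norm (mangoldt n * f n) \<le> ln (real n) * 1"
    unfolding norm_mult norm_mangoldt by (intro mult_mono unitmult_norm mangoldt_le) (use n in auto)
  thus "norm (mangoldt n * f n) \<le> ln (real n) + 1" by simp
  have "mangoldt n / ln (real n) \<le> 1"
    using mangoldt_le[OF n] n by (cases "n = 1") (auto simp: divide_le_eq)
  hence "norm (mangoldt n / ln (real n) * f n) \<le> 1 * 1"
    unfolding norm_mult using n mangoldt_nonneg[of n]
    by (intro mult_mono unitmult_norm) (auto simp: norm_divide)
  thus "norm (mangoldt n / ln (real n) * f n) \<le> ln (real n) + 1" using ln_plus1_ge[OF n] by linarith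
qed

text \<open>The convolution identity that the von Mangoldt function summed over divisors gives the
  logarithm, twisted by the completely multiplicative f.\<close>

lemma dirs_logderiv:
  assumes s: "Re s > 1"
  shows "(dirs f has_field_derivative - (dirs f s * dirs (\<lambda>n. mangoldt n * f n) s)) (at s)"
proof -
  let ?A = "\<lambda>n. f n * of_nat n powr (- s)" and ?B = "\<lambda>n. (mangoldt n * f n) * of_nat n powr (- s)"
  have "((\<lambda>(n, m). ?A n * ?B m) has_sum (dirs f s * dirs (\<lambda>n. mangoldt n * f n) s)) ({1..} \<times> {1..})"
    by (intro has_sum_times dirs_summable_norm dirs_sums unitmult_bounds) (use s in auto)
  from has_sum_divisors[OF this]
  have "((\<lambda>k. \<Sum>d | d dvd k. ?A (k div d) * ?B d) has_sum (dirs f s * dirs (\<lambda>n. mangoldt n * f n) s)) {1..}" .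
  also have "?this \<longleftrightarrow> ((\<lambda>k. f k * ln (real k) * of_nat k powr (- s)) has_sum (dirs f s * dirs (\<lambda>n. mangoldt n * f n) s)) UNIV"
  proof (rule has_sum_cong_neutral)
    fix k :: nat assume k: "k \<in> {1..} \<inter> UNIV"
    have "(\<Sum>d | d dvd k. ?A (k div d) * ?B d) = (\<Sum>d | d dvd k. mangoldt d * (f k * of_nat k powr (- s)))"
    proof (rule sum.cong)
      fix d assume "d \<in> {d. d dvd k}"
      then obtain e where e: "k = e * d" by (auto simp: dvd_def mult.commute)
      have "k \<noteq> 0" using k by auto
      with e have "d > 0" by auto
      thus "?A (k div d) * ?B d = mangoldt d * (f k * of_nat k powr (- s))"
        using f unfolding e of_nat_powr_mult unitmult_def by (simp add: mult_ac)
    qed simp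
    also have "\<dots> = f k * ln (real k) * of_nat k powr (- s)"
      using k by (subst sum_distrib_right[symmetric], subst mangoldt_sum) (auto simp: mult_ac)
    finally show "(\<Sum>d | d dvd k. ?A (k div d) * ?B d) = f k * ln (real k) * of_nat k powr (- s)" .
  qed (auto simp: not_less_eq_eq)
  finally have "dirs (\<lambda>n. f n * ln (real n)) s = dirs f s * dirs (\<lambda>n. mangoldt n * f n) s"
    unfolding dirs_def[of "\<lambda>n. f n * ln (real n)"] by (intro sums_unique[symmetric] has_sum_imp_sums)
  thus ?thesis using dirs_has_field_derivative[of f s] unitmult_bounds(1) s by simp
qed

text \<open>The terms with n \<ge> 2 contribute at most the sum of 1/n^2, and 1/n^2 \<le> 1/(n -
  1/2) - 1/(n + 1/2) telescopes to 2/3.\<close>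

lemma dirs_lower_bound:
  assumes s: "Re s = 2"
  shows "norm (dirs f s) \<ge> 1 / 3"
proof -
  have "(\<lambda>n. f n * of_nat n powr (- s)) sums dirs f s" by (intro dirs_sums unitmult_bounds) (use s in auto)
  hence "(\<lambda>n. f (n + 2) * of_nat (n + 2) powr (- s)) sums (dirs f s - 1)"
    using sums_iff_shift[of "\<lambda>n. f n * of_nat n powr (- s)" 2] f by (simp add: unitmult_def numeral_2_eq_2)
  moreover have "(\<lambda>n. 1 / (real n + 3/2) - 1 / (real (Suc n) + 3/2)) sums (1 / (real 0 + 3/2) - 0)"
    by (rule telescope_sums') real_asymp
  moreover have "norm (f (n + 2) * of_nat (n + 2) powr (- s)) \<le> 1 / (real n + 3/2) - 1 / (real (Suc n) + 3/2)" for n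
  proof -
    have "norm (f (n + 2) * of_nat (n + 2) powr (- s)) \<le> 1 * real (n + 2) powr (-2)"
      unfolding norm_mult by (intro mult_mono unitmult_norm) (use s norm_of_nat_powr[of "n + 2" "- s"] in simp_all)
    also have "real (n + 2) powr (-2) = 1 / (real n + 2)\<^sup>2"
      by (simp add: powr_minus_divide)
    also have "1 * (1 / (real n + 2)\<^sup>2) \<le> 1 / (real n + 3/2) - 1 / (real (Suc n) + 3/2)"
    proof -
      have "1 / (real n + 3/2) - 1 / (real (Suc n) + 3/2) = 1 / ((real n + 3/2) * (real n + 5/2))"
        by (simp add: field_simps)
      moreover have "(real n + 3/2) * (real n + 5/2) \<le> (real n + 2)\<^sup>2" by (simp add: power2_eq_square algebra_simps)
      ultimately show ?thesis by (auto intro!: divide_left_mono mult_pos_pos add_nonneg_pos)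
    qed
    finally show ?thesis .
  qed
  ultimately have "norm (dirs f s - 1) \<le> 1 / (real 0 + 3/2) - 0" by (rule norm_sums_le)
  moreover have "1 - norm (dirs f s) \<le> norm (dirs f s - 1)"
    using norm_triangle_ineq2[of 1 "dirs f s"] by (simp add: norm_minus_commute)
  ultimately show ?thesis by simp
qed

text \<open>A substitute for the Euler product: with P the series of \<Lambda>(n) f(n)/ln n, the
  quotient of \<open>dirs f\<close> by exp P has zero derivative and is constant. The lower bound at
  s = 2 shows that the constant is not 0.\<close>

lemma dirs_exp:
  obtains c where "c \<noteq> 0" "\<And>s. Re s > 1 \<Longrightarrow> dirs f s = c * exp (dirs (\<lambda>n. mangoldt n / ln (real n) * f n) s)"
proof -
  define P where "P = dirs (\<lambda>n. mangoldt n / ln (real n) * f n)"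
  have P': "(P has_field_derivative - dirs (\<lambda>n. mangoldt n * f n) s) (at s)" if "Re s > 1" for s
  proof -
    have eq: "mangoldt n / ln (real n) * f n * ln (real n) = mangoldt n * f n" for n
      by (cases "n \<le> 1") (auto simp: le_Suc_eq)
    from dirs_has_field_derivative[OF unitmult_bounds(3) that] show ?thesis
      unfolding P_def eq .
  qed
  have "\<exists>c. \<forall>s\<in>{s. Re s > 1}. dirs f s * exp (- P s) = c"
  proof (rule has_field_derivative_zero_constant)
    fix s assume "s \<in> {s. Re s > (1::real)}"
    hence s: "Re s > 1" by simp
    show "((\<lambda>s. dirs f s * exp (- P s)) has_field_derivative 0) (at s within {s. Re s > 1})"
      by (rule has_field_derivative_at_within)
         (auto intro!: derivative_eq_intros dirs_logderiv[OF s] P'[OF s] simp: algebra_simps)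
  qed (simp add: convex_halfspace_Re_gt)
  then obtain c where c: "\<And>s. Re s > 1 \<Longrightarrow> dirs f s * exp (- P s) = c" by auto
  have eq: "dirs f s = c * exp (P s)" if "Re s > 1" for s
    using c[OF that] by (auto simp: exp_minus field_simps)
  have "c \<noteq> 0" using eq[of 2] dirs_lower_bound[of 2] by auto
  with eq that show ?thesis unfolding P_def by blast
qed

lemma dirs_nonzero:
  assumes "Re s > 1"
  shows "dirs f s \<noteq> 0"
proof -
  obtain c where "c \<noteq> 0" "\<And>s. Re s > 1 \<Longrightarrow> dirs f s = c * exp (dirs (\<lambda>n. mangoldt n / ln (real n) * f n) s)"
    by (rule dirs_exp) blast
  thus ?thesis using assms by simp
qed

end


subsection \<open>Non-vanishing on the line $\mathrm{Re}\, s = 1$\<close>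

lemma unitmult_dcharacter: "dcharacter q \<psi> \<Longrightarrow> unitmult \<psi>"
  by (simp add: unitmult_def dcharacterD norm_dcharacter_le del: One_nat_def)

lemma Lfun_eq_dirs:
  assumes "\<psi> \<in> nonprincipal_chars q" "Re s > 0"
  shows "Lfun \<psi> s = dirs \<psi> s"
  using Lfun_props(2)[OF assms] by (simp add: dirs_def sums_iff)

text \<open>The term \<open>bdiff 1 (s - 1) n / (s - 1)\<close> is the integral of x^(-s) over
  [n, n + 1], so a term of the zeta series is compared with the corresponding piece of the
  integral.\<close>

lemma one_of_nat_powr_diff_bound:
  assumes n: "n > 0" and s: "Re s > 0" "s \<noteq> 1"
  shows "norm (of_nat n powr (- s) - bdiff 1 (s - 1) (of_nat n) / (s - 1)) \<le> norm s * real n powr (- Re s - 1)"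
proof -
  define h where "h = (\<lambda>z. z powr (1 - s) / (1 - s) - z * of_nat n powr (- s))"
  define S where "S = closed_segment (of_nat n) (of_nat n + 1 :: complex)"
  define B where "B = norm s * real n powr (- Re s - 1)"
  have S: "\<exists>u. 0 \<le> u \<and> u \<le> 1 \<and> z = of_real (real n + u)" if "z \<in> S" for z
    using that by (auto simp: S_def closed_segment_def algebra_simps scaleR_conv_of_real)
  have nS: "z \<notin> \<real>\<^sub>\<le>\<^sub>0" if z: "z \<in> S" for z
  proof -
    obtain u where u: "0 \<le> u" "z = of_real (real n + u)" using S[OF z] by blast
    hence "Re z > 0" using n by simp
    thus ?thesis by (auto simp: complex_nonpos_Reals_iff)
  qed
  have pw: "norm (z powr (- s) - of_nat n powr (- s)) \<le> B" if z: "z \<in> S" for z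
  proof -
    have "norm (z powr (- s) - of_nat n powr (- s)) \<le> B * norm (z - of_nat n)"
    proof (rule field_differentiable_bound[where S = S])
      fix y assume y: "y \<in> S"
      show "((\<lambda>z. z powr (- s)) has_field_derivative - s * y powr (- s - 1)) (at y within S)"
        by (rule has_field_derivative_at_within) (use nS[OF y] in \<open>auto intro!: derivative_eq_intros\<close>)
      obtain u where u: "0 \<le> u" "y = of_real (real n + u)" using S[OF y] by blast
      have "norm (y powr (- s - 1)) = (real n + u) powr (- Re s - 1)"
        using u n norm_powr_real_powr[of y "- s - 1"] by simp
      also have "\<dots> \<le> real n powr (- Re s - 1)" using u n s by (intro powr_mono2') auto
      finally show "norm (- s * y powr (- s - 1)) \<le> B"
        by (simp add: norm_mult B_def mult_left_mono)
    qed (use z in \<open>auto simp: S_def\<close>)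
    also obtain u where u: "0 \<le> u" "u \<le> 1" "z = of_real (real n + u)" using S[OF z] by blast
    have "z - of_nat n = of_real u" using u by simp
    hence "norm (z - of_nat n) \<le> 1" using u by simp
    hence "B * norm (z - of_nat n) \<le> B" unfolding B_def by (intro mult_left_le) auto
    finally show ?thesis .
  qed
  have "norm (h (of_nat n + 1) - h (of_nat n)) \<le> B * norm (of_nat n + 1 - of_nat n :: complex)"
  proof (rule field_differentiable_bound[where S = S])
    fix z assume z: "z \<in> S"
    show "(h has_field_derivative (z powr (- s) - of_nat n powr (- s))) (at z within S)"
      unfolding h_def
      by (rule has_field_derivative_at_within) (use nS[OF z] s in \<open>auto intro!: derivative_eq_intros\<close>)
  qed (use pw in \<open>auto simp: S_def\<close>)
  moreover have "h (of_nat n + 1) - h (of_nat n) = - (of_nat n powr (- s) - bdiff 1 (s - 1) (of_nat n) / (s - 1))"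
  proof -
    have "x / (1 - s) = - (x / (s - 1))" for x by (metis minus_diff_eq minus_divide_right)
    thus ?thesis by (simp add: h_def algebra_simps diff_divide_distrib)
  qed
  ultimately show ?thesis unfolding B_def by (simp add: norm_minus_commute)
qed

text \<open>The integrals over [n, n + 1] add up to 1/(s - 1), which carries the pole; the
  differences are summed with the previous lemma and a telescoping majorant of 1/n^2 with total
  2.\<close>

lemma zeta_bound:
  assumes s: "Re s > 1"
  shows "norm (dirs (\<lambda>_. 1) s) \<le> 1 / norm (s - 1) + 2 * norm s"
proof -
  have s1: "s \<noteq> 1" using s by auto
  have "(\<lambda>n. 1 * of_nat n powr (- s)) sums dirs (\<lambda>_. 1) s"
    by (rule dirs_sums) (use s in auto)
  hence A: "(\<lambda>n. of_nat (Suc n) powr (- s)) sums dirs (\<lambda>_. 1) s"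
    using sums_Suc_iff[of "\<lambda>n. of_nat n powr (- s)"] by simp
  have "(\<lambda>n. of_nat (Suc n) powr (- (s - 1))) \<longlonglongrightarrow> 0"
    using bdiff_tendsto_0[of "s - 1" 0] s by simp
  from telescope_sums'[OF this]
  have "(\<lambda>n. bdiff 1 (s - 1) (of_nat (Suc n))) sums 1" by (simp add: add_ac)
  from sums_diff[OF A sums_divide[OF this, of "s - 1"]]
  have B: "(\<lambda>n. of_nat (Suc n) powr (- s) - bdiff 1 (s - 1) (of_nat (Suc n)) / (s - 1)) sums (dirs (\<lambda>_. 1) s - 1 / (s - 1))" .
  have "(\<lambda>n. 1 / (real n + 1/2) - 1 / (real (Suc n) + 1/2)) sums (1 / (real 0 + 1/2) - 0)"
    by (rule telescope_sums') real_asymp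
  from sums_mult[OF this, of "norm s"]
  have C: "(\<lambda>n. norm s * (1 / (real n + 1/2) - 1 / (real (Suc n) + 1/2))) sums (norm s * 2)" by simp
  have "norm (of_nat (Suc n) powr (- s) - bdiff 1 (s - 1) (of_nat (Suc n)) / (s - 1)) \<le> 
      norm s * (1 / (real n + 1/2) - 1 / (real (Suc n) + 1/2))" for n
  proof -
    have "norm (of_nat (Suc n) powr (- s) - bdiff 1 (s - 1) (of_nat (Suc n)) / (s - 1)) \<le> norm s * real (Suc n) powr (- Re s - 1)"
      by (rule one_of_nat_powr_diff_bound) (use s s1 in auto)
    also have "real (Suc n) powr (- Re s - 1) \<le> real (Suc n) powr (-2)"
      by (intro powr_mono) (use s in auto)
    also have "\<dots> = 1 / (real n + 1)\<^sup>2" by (simp add: powr_minus_divide add_ac)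
    also have "\<dots> \<le> 1 / (real n + 1/2) - 1 / (real (Suc n) + 1/2)"
    proof -
      have "1 / (real n + 1/2) - 1 / (real (Suc n) + 1/2) = 1 / ((real n + 1/2) * (real n + 3/2))"
        by (simp add: field_simps)
      moreover have "(real n + 1/2) * (real n + 3/2) \<le> (real n + 1)\<^sup>2" by (simp add: power2_eq_square algebra_simps)
      ultimately show ?thesis by (auto intro!: divide_left_mono mult_pos_pos add_nonneg_pos)
    qed
    finally show ?thesis by (simp add: mult_left_mono)
  qed
  from norm_sums_le[OF B C this] have "norm (dirs (\<lambda>_. 1) s - 1 / (s - 1)) \<le> norm s * 2" .
  moreover have "norm (dirs (\<lambda>_. 1) s) \<le> norm (1 / (s - 1)) + norm (dirs (\<lambda>_. 1) s - 1 / (s - 1))"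
    by (rule norm_triangle_sub)
  ultimately show ?thesis by (simp add: norm_divide)
qed

text \<open>The classical inequality $3 + 4 \cos\theta + \cos 2\theta \ge 0$, with $h$ playing the role of the
  square of $f$; away from the conductor $h = 1$ is also allowed.\<close>

lemma three_four_one:
  fixes t :: real
  assumes f: "unitmult f" and h: "unitmult h"
    and pos: "\<And>n. n > 0 \<Longrightarrow> 3 + 4 * Re (f n * of_nat n powr (- (\<i> * t))) + Re (h n * of_nat n powr (- (2 * \<i> * t))) \<ge> 0"
  shows "\<exists>c>0. \<forall>\<sigma>>1. c \<le> norm (dirs (\<lambda>_. 1) (of_real \<sigma>)) ^ 3 * norm (dirs f (\<sigma> + \<i> * t)) ^ 4 * norm (dirs h (\<sigma> + 2 * \<i> * t))"
proof -
  have u1: "unitmult (\<lambda>_. 1)" by (simp add: unitmult_def)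
  define P where "P = (\<lambda>f :: nat \<Rightarrow> complex. dirs (\<lambda>n. mangoldt n / ln (real n) * f n))"
  obtain c1 where c1: "c1 \<noteq> 0" "\<And>s. Re s > 1 \<Longrightarrow> dirs (\<lambda>_. 1) s = c1 * exp (P (\<lambda>_. 1) s)" 
    by (rule dirs_exp[OF u1]) (rule that, assumption, unfold P_def, blast)
  obtain cf where cf: "cf \<noteq> 0" "\<And>s. Re s > 1 \<Longrightarrow> dirs f s = cf * exp (P f s)" 
    by (rule dirs_exp[OF f]) (rule that, assumption, unfold P_def, blast)
  obtain ch where ch: "ch \<noteq> 0" "\<And>s. Re s > 1 \<Longrightarrow> dirs h s = ch * exp (P h s)" 
    by (rule dirs_exp[OF h]) (rule that, assumption, unfold P_def, blast)
  define c where "c = norm c1 ^ 3 * norm cf ^ 4 * norm ch"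
  have "c \<le> norm (dirs (\<lambda>_. 1) (of_real \<sigma>)) ^ 3 * norm (dirs f (\<sigma> + \<i> * t)) ^ 4 * norm (dirs h (\<sigma> + 2 * \<i> * t))"
    if \<sigma>: "\<sigma> > 1" for \<sigma>
  proof -
    define b where "b = (\<lambda>n. mangoldt n / ln (real n) * real n powr (- \<sigma>))"
    have eq: "of_real (mangoldt n / ln (real n)) * f' n * of_nat n powr (- (\<sigma> + z)) = 
        of_real (b n) * (f' n * of_nat n powr (- z))" for f' :: "nat \<Rightarrow> complex" and n and z :: complex
    proof (cases "n = 0")
      case False
      have "(of_nat n :: complex) powr (- (\<sigma> + z)) = of_nat n powr (- of_real \<sigma>) * of_nat n powr (- z)"
        using powr_add[of "of_nat n" "- of_real \<sigma>" "- z"] by simp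
      also have "(of_nat n :: complex) powr (- of_real \<sigma>) = of_real (real n powr (- \<sigma>))"
        using powr_of_real[of "real n" "- \<sigma>"] by simp
      finally show ?thesis by (simp add: b_def)
    qed (simp add: b_def)
    have S: "(\<lambda>n. Re (of_real (b n) * (f' n * of_nat n powr (- z)))) sums Re (P f' (\<sigma> + z))" 
      if "unitmult f'" "Re z = 0" for f' and z :: complex
      unfolding P_def eq[symmetric] 
      by (rule sums_Re, rule dirs_sums, rule unitmult_bounds(3)) (use that \<sigma> in auto)
    have "(\<lambda>n. 3 * Re (of_real (b n) * (1 * of_nat n powr (- 0))) + 4 * Re (of_real (b n) * (f n * of_nat n powr (- (\<i> * t))))
        + Re (of_real (b n) * (h n * of_nat n powr (- (2 * \<i> * t))))) sums
      (3 * Re (P (\<lambda>_. 1) (of_real \<sigma> + 0)) + 4 * Re (P f (\<sigma> + \<i> * t)) + Re (P h (\<sigma> + 2 * \<i> * t)))"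
      by (intro sums_add sums_mult S[OF u1, of 0] S[OF f] S[OF h]) simp_all
    hence "0 \<le> 3 * Re (P (\<lambda>_. 1) (of_real \<sigma> + 0)) + 4 * Re (P f (\<sigma> + \<i> * t)) + Re (P h (\<sigma> + 2 * \<i> * t))"
    proof (rule sums_le[OF _ sums_zero, rotated])
      fix n
      show "0 \<le> 3 * Re (of_real (b n) * (1 * of_nat n powr (- 0))) + 4 * Re (of_real (b n) * (f n * of_nat n powr (- (\<i> * t))))
        + Re (of_real (b n) * (h n * of_nat n powr (- (2 * \<i> * t))))"
      proof (cases "n = 0")
        case False
        have "b n \<ge> 0" unfolding b_def using False
          by (intro mult_nonneg_nonneg divide_nonneg_nonneg mangoldt_nonneg) auto
        with pos[of n] False have "0 \<le> b n * (3 + 4 * Re (f n * of_nat n powr (- (\<i> * t))) + Re (h n * of_nat n powr (- (2 * \<i> * t))))"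
          by (intro mult_nonneg_nonneg) auto
        thus ?thesis using False by (simp add: algebra_simps)
      qed simp
    qed
    hence "1 \<le> exp (3 * Re (P (\<lambda>_. 1) \<sigma>) + 4 * Re (P f (\<sigma> + \<i> * t)) + Re (P h (\<sigma> + 2 * \<i> * t)))" by simp
    also have "\<dots> = exp (Re (P (\<lambda>_. 1) \<sigma>)) ^ 3 * exp (Re (P f (\<sigma> + \<i> * t))) ^ 4 * exp (Re (P h (\<sigma> + 2 * \<i> * t)))"
      by (simp add: exp_add flip: exp_of_nat_mult)
    finally have "c * 1 \<le> c * \<dots>" by (intro mult_left_mono) (auto simp: c_def)
    thus ?thesis using \<sigma> by (simp add: c_def c1(2) cf(2) ch(2) norm_mult power_mult_distrib mult_ac)
  qed
  moreover have "c > 0" using c1 cf ch by (simp add: c_def)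
  ultimately show ?thesis by blast
qed


text \<open>The double sum runs over n(n + 1) pairs (i, j). Pair (i, j) with its reflection, so that
  the exponents are e and 2n - 1 - e; each such pair of powers has sum at least 2 x^n.\<close>

lemma prod_lower_bound_pow:
  fixes x :: real
  assumes "0 < x" "x < 1"
  shows "real n * real (n + 1) * x ^ n \<le> (\<Sum>i<n. x ^ i) * (\<Sum>j<Suc n. x ^ j)"
proof -
  have key: "2 * x ^ n \<le> x ^ e + x ^ (2 * n - 1 - e)" if "e \<le> 2 * n - 1" "n > 0" for e
  proof -
    \<comment> \<open>Expanding x^d (1 - x^(n-1-d)) (1 - x^(n-d)) \<ge> 0 gives x^d + x^(2n-1-d)
      \<ge> x^(n-1) + x^n.\<close>
    have main: "2 * x ^ n \<le> x ^ d + x ^ (2 * n - 1 - d)" if d: "d \<le> n - 1" for d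
    proof -
      have eqs: "d + (n - 1 - d) = n - 1" "d + (n - d) = n" "n - 1 + (n - d) = 2 * n - 1 - d"
        using d \<open>n > 0\<close> by auto
      have "0 \<le> x ^ d * (1 - x ^ (n - 1 - d)) * (1 - x ^ (n - d))"
        using assms by (intro mult_nonneg_nonneg) (auto simp: power_le_one)
      also have "\<dots> = x ^ d - x ^ (d + (n - 1 - d)) - x ^ (d + (n - d)) + x ^ (d + (n - 1 - d) + (n - d))"
        by (simp only: power_add) (simp add: algebra_simps)
      also have "\<dots> = x ^ d - x ^ (n - 1) - x ^ n + x ^ (2 * n - 1 - d)" unfolding eqs ..
      finally have "0 \<le> x ^ d - x ^ (n - 1) - x ^ n + x ^ (2 * n - 1 - d)" .
      moreover have "x ^ n \<le> x ^ (n - 1)" by (rule power_decreasing) (use assms in auto)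
      ultimately show ?thesis by linarith
    qed
    show ?thesis
    proof (cases "e \<le> n - 1")
      case False
      have "2 * x ^ n \<le> x ^ (2 * n - 1 - e) + x ^ (2 * n - 1 - (2 * n - 1 - e))"
        by (rule main) (use False in auto)
      also have "2 * n - 1 - (2 * n - 1 - e) = e" using that by simp
      finally show ?thesis by simp
    qed (use main in auto)
  qed
  define S where "S = (\<Sum>i<n. \<Sum>j<Suc n. x ^ (i + j))"
  have "S = (\<Sum>i<n. \<Sum>j<Suc n. x ^ ((n - Suc i) + (Suc n - Suc j)))"
    unfolding S_def by (subst sum.nat_diff_reindex[symmetric], subst (2) sum.nat_diff_reindex[symmetric]) simp
  also have "\<dots> = (\<Sum>i<n. \<Sum>j<Suc n. x ^ (2 * n - 1 - (i + j)))"
    by (intro sum.cong refl arg_cong2[where f = "(^)"]) auto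
  finally have "S + S = (\<Sum>i<n. \<Sum>j<Suc n. x ^ (i + j) + x ^ (2 * n - 1 - (i + j)))"
    unfolding S_def by (simp add: sum.distrib)
  also have "\<dots> \<ge> (\<Sum>i<n. \<Sum>j<Suc n. 2 * x ^ n)"
    by (intro sum_mono key) auto
  also have "(\<Sum>i<n. \<Sum>j<Suc n. 2 * x ^ n) = 2 * (real n * real (n + 1) * x ^ n)" by simp
  also have "S = (\<Sum>i<n. x ^ i) * (\<Sum>j<Suc n. x ^ j)"
    unfolding S_def by (simp only: sum_product power_add)
  finally show ?thesis by simp
qed

text \<open>With A(n) = 1 + x + ... + x^(n-1), the difference b(n) - b(n+1) equals 1/(1-x) times
  1/(n(n+1)) - x^n/(A(n) A(n+1)), so monotonicity is exactly
  \<open>prod_lower_bound_pow\<close>.\<close>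

lemma lambert_weight_antimono:
  fixes x :: real
  assumes x: "0 < x" "x < 1" and n: "n > 0"
  defines "b \<equiv> (\<lambda>n. 1 / (real n * (1 - x)) - x ^ n / (1 - x ^ n))"
  shows "b (Suc n) \<le> b n" "b n \<ge> 0"
proof -
  define A where "A = (\<lambda>n. \<Sum>i<n. x ^ i)"
  have A: "1 - x ^ m = (1 - x) * A m" for m
    by (simp add: A_def one_diff_power_eq)
  have Apos: "A m > 0" if "m > 0" for m
    unfolding A_def using x that by (intro sum_pos) auto
  have pos: "1 - x ^ m > 0" if "m > 0" for m using Apos[OF that] x A by simp
  have "real n * x ^ n \<le> A n"
  proof -
    have "(\<Sum>i<n. x ^ n) \<le> A n" unfolding A_def by (intro sum_mono power_decreasing) (use x in auto)
    thus ?thesis by simp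
  qed
  hence "x ^ n * (real n * (1 - x)) \<le> 1 * (1 - x ^ n)"
    using x A[of n] by (simp add: mult_left_mono mult_ac)
  hence "x ^ n / (1 - x ^ n) \<le> 1 / (real n * (1 - x))"
    using x n pos[of n] by (subst frac_le_eq) (auto simp: divide_le_0_iff mult_ac)
  thus "b n \<ge> 0" by (simp add: b_def)
  have "b n - b (Suc n) = (1 / (1 - x)) * (1 / (real n * real (n + 1)) - x ^ n / (A n * A (Suc n)))"
  proof -
    have "1 / (real n * (1 - x)) - 1 / (real (Suc n) * (1 - x)) = (1 / (1 - x)) * (1 / (real n * real (n + 1)))"
      using n x by (simp add: divide_simps)
    moreover have "x ^ n / (1 - x ^ n) - x ^ Suc n / (1 - x ^ Suc n) = (x ^ n * (1 - x)) / ((1 - x ^ n) * (1 - x ^ Suc n))"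
      using pos[of n] pos[of "Suc n"] n by (simp add: divide_simps del: power_Suc) (simp add: algebra_simps)
    moreover have "\<dots> = (1 / (1 - x)) * (x ^ n / (A n * A (Suc n)))"
      unfolding A using x by (simp add: divide_simps)
    ultimately show ?thesis unfolding b_def by (simp only: right_diff_distrib)
  qed
  also have "\<dots> \<ge> 0"
  proof -
    have "real n * real (n + 1) * x ^ n \<le> A n * A (Suc n)"
      unfolding A_def by (rule prod_lower_bound_pow) (use x in auto)
    hence "x ^ n / (A n * A (Suc n)) \<le> 1 / (real n * real (n + 1))"
      using n Apos[of n] Apos[of "Suc n"] by (simp add: divide_simps mult_ac)
    thus ?thesis using x by simp
  qed
  finally show "b (Suc n) \<le> b n" by simp
qed

text \<open>The divisor sum is multiplicative, and on p^k it is a sum of powers of f(p) in {-1, 0,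
  1}: it is never negative, and at least 1 when k is even. The induction strips off one full prime
  power.\<close>

lemma divisor_sum_nonneg:
  fixes f :: "nat \<Rightarrow> real"
  assumes f1: "f 1 = 1" and fm: "\<And>m n. f (m * n) = f m * f n" and fv: "\<And>n. f n \<in> {-1, 0, 1}"
  shows "n > 0 \<Longrightarrow> (\<Sum>d | d dvd n. f d) \<ge> (if \<exists>m. n = m\<^sup>2 then 1 else 0)"
proof (induction n rule: less_induct)
  case (less n)
  show ?case
  proof (cases "n = 1")
    case True
    have "{d :: nat. d dvd 1} = {1}" by auto
    thus ?thesis using True f1 by simp
  next
    case False
    then obtain p where p: "prime p" "p dvd n" using prime_factor_nat by blast
    define k where "k = multiplicity p n"
    obtain m where m: "n = p ^ k * m" "\<not> p dvd m"
      unfolding k_def using multiplicity_decompose'[of n p] not_prime_unit p(1) less.prems by blast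
    have k: "k > 0" using p less.prems unfolding k_def by (simp add: prime_multiplicity_gt_zero_iff)
    have m0: "m > 0" using m less.prems by (cases m) auto
    have "m < n" using m m0 k prime_gt_1_nat[OF p(1)] one_less_power[of p k] by simp
    note IH = less.IH[OF this m0]
    have cop: "coprime (p ^ k) m" using m p prime_imp_coprime by auto
    have "bij_betw (\<lambda>(i, d). p ^ i * d) ({..k} \<times> {d. d dvd m}) {d. d dvd n}"
      unfolding bij_betw_def
    proof
      show "inj_on (\<lambda>(i, d). p ^ i * d) ({..k} \<times> {d. d dvd m})"
      proof (rule inj_onI, clarsimp)
        fix i d j e assume *: "d dvd m" "e dvd m" "p ^ i * d = p ^ j * e"
        hence nd: "\<not> p dvd d" "\<not> p dvd e" using m dvd_trans by blast+
        have "multiplicity p (p ^ i * d) = i" "multiplicity p (p ^ j * e) = j"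
          using nd p(1) by (auto intro!: multiplicity_eqI simp: power_Suc2 mult.assoc dest: prime_gt_0_nat)
        with * have "i = j" by simp
        with * p(1) show "i = j \<and> d = e" by (auto dest: prime_gt_0_nat)
      qed
      show "(\<lambda>(i, d). p ^ i * d) ` ({..k} \<times> {d. d dvd m}) = {d. d dvd n}"
      proof (intro equalityI subsetI)
        fix e assume "e \<in> {d. d dvd n}"
        hence "e dvd p ^ k * m" using m by simp
        then obtain a c where "e = a * c" "a dvd p ^ k" "c dvd m"
          using division_decomp by blast
        moreover from this(2) obtain i where "i \<le> k" "a = p ^ i"
          using p(1) divides_primepow_nat by blast
        ultimately show "e \<in> (\<lambda>(i, d). p ^ i * d) ` ({..k} \<times> {d. d dvd m})" by auto
      qed (auto simp: m intro!: mult_dvd_mono le_imp_power_dvd)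
    qed
    from sum.reindex_bij_betw[OF this, of f, symmetric]
    have "(\<Sum>d | d dvd n. f d) = (\<Sum>i\<le>k. f (p ^ i)) * (\<Sum>d | d dvd m. f d)"
      by (simp add: sum_product sum.cartesian_product case_prod_unfold fm)
    moreover have fp: "f (p ^ i) = f p ^ i" for i by (induction i) (use f1 fm in auto)
    have "(\<Sum>i\<le>k. f (p ^ i)) \<ge> (if even k then 1 else 0)"
    proof -
      consider "f p = 1" | "f p = 0" | "f p = -1" using fv[of p] by auto
      thus ?thesis
      proof cases
        case 3
        have "(\<Sum>i\<le>k. (-1 :: real) ^ i) = (if even k then 1 else 0)" by (induction k) auto
        thus ?thesis by (simp add: fp 3)
      qed (auto simp: fp power_0_left)
    qed
    moreover have "even k \<and> (\<exists>l. m = l\<^sup>2)" if "\<exists>l. n = l\<^sup>2"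
    proof -
      from that obtain l where l: "n = l\<^sup>2" by blast
      have "k = 2 * multiplicity p l" unfolding k_def l
        using p(1) l less.prems by (simp add: prime_elem_multiplicity_power_distrib)
      moreover have "is_nth_power 2 (p ^ k * m)"
        unfolding is_nth_power_def m(1)[symmetric] l by blast
      hence "is_nth_power 2 m" using is_nth_power_mult_coprime_nat_iff[OF cop] by blast
      ultimately show ?thesis by (auto simp: is_nth_power_def)
    qed
    ultimately show ?thesis
      using IH mult_mono[of 1 "\<Sum>i\<le>k. f (p ^ i)" 1 "\<Sum>d | d dvd m. f d"]
        mult_nonneg_nonneg[of "\<Sum>i\<le>k. f (p ^ i)" "\<Sum>d | d dvd m. f d"]
      by (auto split: if_splits)
  qed
qed


lemma dcharacter_unimodular_sq:
  assumes psi: "dcharacter q \<psi>" and sq: "\<And>n. coprime n q \<Longrightarrow> \<psi> n ^ 2 = 1"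
  shows "\<psi> n = of_real (Re (\<psi> n))" "Re (\<psi> n) \<in> {-1, 0, 1}"
proof -
  have "\<psi> n = 1 \<or> \<psi> n = -1 \<or> \<psi> n = 0"
    using sq[of n] dcharacterD(5)[OF psi, of n] by (auto simp: power2_eq_1_iff)
  thus "\<psi> n = of_real (Re (\<psi> n))" "Re (\<psi> n) \<in> {-1, 0, 1}" by auto
qed

lemma abel_bound:
  fixes g :: "nat \<Rightarrow> complex" and v :: "nat \<Rightarrow> real"
  assumes M: "\<And>N. norm (\<Sum>n<N. g n) \<le> M" and v: "\<And>n. v (Suc n) \<le> v n" "\<And>n. v n \<ge> 0"
  shows "norm (\<Sum>n<N. g n * of_real (v n)) \<le> M * v 0"
proof -
  define A where "A = (\<lambda>N. \<Sum>n<N. g n)"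
  have eq: "(\<Sum>n<N. g n * of_real (v n)) = A N * of_real (v N) + (\<Sum>n<N. A (Suc n) * of_real (v n - v (Suc n)))"
    by (induction N) (auto simp: A_def algebra_simps)
  have "norm (A N * of_real (v N)) \<le> M * v N"
    using M[of N] v(2)[of N] by (simp add: norm_mult A_def mult_right_mono)
  moreover have "norm (\<Sum>n<N. A (Suc n) * of_real (v n - v (Suc n))) \<le> (\<Sum>n<N. M * (v n - v (Suc n)))"
  proof (rule sum_norm_le)
    fix n
    have "norm (A (Suc n) * of_real (v n - v (Suc n))) = norm (A (Suc n)) * (v n - v (Suc n))"
      using v(1)[of n] by (simp only: norm_mult norm_of_real)
    also have "\<dots> \<le> M * (v n - v (Suc n))"
      using v(1)[of n] M[of "Suc n"] unfolding A_def by (intro mult_right_mono) simp_all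
    finally show "norm (A (Suc n) * of_real (v n - v (Suc n))) \<le> M * (v n - v (Suc n))" .
  qed
  moreover have "(\<Sum>n<N. M * (v n - v (Suc n))) = M * (v 0 - v N)"
    by (induction N) (auto simp: algebra_simps)
  ultimately have "norm (\<Sum>n<N. g n * of_real (v n)) \<le> M * v N + M * (v 0 - v N)"
    unfolding eq by (intro norm_triangle_le) linarith
  thus ?thesis by (simp add: algebra_simps)
qed

text \<open>If $L(1,\psi) = 0$, the Lambert series $\sum \psi(n) x^n/(1-x^n)$ stays bounded as $x \to 1$,
  by partial summation against the decreasing weights $1/(n(1-x)) - x^n/(1-x^n)$; but its power
  series coefficients are nonnegative and at least 1 at squares.\<close>

lemma Lfun_real_1_nonzero:
  assumes NP: "\<psi> \<in> nonprincipal_chars q" and sq: "\<And>n. coprime n q \<Longrightarrow> \<psi> n ^ 2 = 1"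
  shows "Lfun \<psi> 1 \<noteq> 0"
proof
  assume L0: "Lfun \<psi> 1 = 0"
  note psi = nonprincipal_charsD(1)[OF NP]
  obtain M where M: "M > 0" "\<And>N. norm (\<Sum>n<N. \<psi> (Suc n)) \<le> M"
    by (rule mean0_partial_sums_bounded[OF mean0_dcharacter[OF NP]]) blast
  have S1: "(\<lambda>n. \<psi> n / of_nat n) sums 0"
    using Lfun_props(2)[OF NP, of 1] L0 by (simp add: powr_minus_divide)
  \<comment> \<open>At x = 1 the first J squares alone contribute J > M, so some x < 1 already lifts
    their contribution above the bound M for the partial sums of \<psi>.\<close>
  obtain J :: nat where J: "real J > M + 1" using reals_Archimedean2 by blast
  have "((\<lambda>x::real. \<Sum>j<J. x ^ ((Suc j)\<^sup>2)) \<longlongrightarrow> (\<Sum>j<J. 1 ^ ((Suc j)\<^sup>2))) (at_left 1)"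
    by (intro tendsto_intros)
  hence "eventually (\<lambda>x. (\<Sum>j<J. x ^ ((Suc j)\<^sup>2)) > M) (at_left (1::real))"
    using J by (intro order_tendstoD) auto
  moreover have "eventually (\<lambda>x. x \<in> {0<..<1}) (at_left (1::real))"
    by (rule eventually_at_left_real) simp
  ultimately have "eventually (\<lambda>x. (\<Sum>j<J. x ^ ((Suc j)\<^sup>2)) > M \<and> x \<in> {0<..<1}) (at_left (1::real))"
    by (rule eventually_conj)
  then obtain x :: real where x: "(\<Sum>j<J. x ^ ((Suc j)\<^sup>2)) > M" "0 < x" "x < 1"
    by (auto dest!: eventually_happens simp: trivial_limit_at_left_real)
  define b where "b = (\<lambda>n. 1 / (real n * (1 - x)) - x ^ n / (1 - x ^ n))"
  have b: "b (Suc n) \<le> b n" "b n \<ge> 0" if "n > 0" for n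
    using lambert_weight_antimono[OF x(2,3) that] unfolding b_def by auto
  have xn: "x ^ n < 1" if "n > 0" for n using x that by (simp add: power_less_one_iff)
  define g where "g = (\<lambda>n. \<psi> n * of_real (x ^ n / (1 - x ^ n)))"
  have gn: "norm (g n) \<le> (1 / (1 - x)) * x ^ n" if "n \<ge> 1" for n
  proof -
    have "x ^ n \<le> x ^ 1" by (intro power_decreasing) (use that x in auto)
    hence "x ^ n / (1 - x ^ n) \<le> x ^ n / (1 - x)"
      using x xn[of n] that by (intro divide_left_mono) auto
    moreover have "norm (g n) \<le> 1 * (x ^ n / (1 - x ^ n))"
      unfolding g_def norm_mult using xn[of n] that x
      by (intro mult_mono norm_dcharacter_le[OF psi]) (auto simp del: of_real_divide)
    ultimately show ?thesis by simp
  qed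
  have sg: "summable (\<lambda>n. norm (g n))"
  proof (rule summable_comparison_test'[where N = 1])
    show "summable (\<lambda>n. (1 / (1 - x)) * x ^ n)" using x by (intro summable_mult summable_geometric) auto
  qed (use gn in auto)
  obtain S where S: "g sums S" using summable_norm_cancel[OF sg] by (auto simp: summable_def)
  have "(g has_sum S) UNIV" by (rule norm_summable_imp_has_sum[OF sg S])
  hence gS: "(g has_sum S) {1..}"
    using has_sum_cong_neutral[of "{1..}" UNIV g g S] by (auto simp: not_less_eq_eq g_def)
  have "(\<lambda>n. norm (g n)) summable_on UNIV"
    by (rule norm_summable_imp_summable_on) (use sg in simp)
  hence sg': "(\<lambda>n. norm (g n)) summable_on {1..}"
    by (rule summable_on_subset_banach) simp
  have "norm S \<le> M"
  proof -
    \<comment> \<open>Here L(1,\<psi>) = 0 enters: subtracting the Lambert terms from the series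
      \<psi>(n)/(n(1 - x)), whose sum is 0, leaves \<psi>(n) times the decreasing weight
      b(n).\<close>
    have "(\<lambda>n. \<psi> n / of_nat n / of_real (1 - x) - g n) sums (0 / of_real (1 - x) - S)"
      by (intro sums_diff sums_divide S1 S)
    also have "(\<lambda>n. \<psi> n / of_nat n / of_real (1 - x) - g n) = (\<lambda>n. \<psi> n * of_real (b n))"
      by (simp add: g_def b_def fun_eq_iff algebra_simps)
    finally have "(\<lambda>n. \<psi> n * of_real (b n)) sums (- S)" by simp
    hence "(\<lambda>n. \<psi> (Suc n) * of_real (b (Suc n))) sums (- S)"
      using sums_Suc_iff[of "\<lambda>n. \<psi> n * of_real (b n)"] by (simp add: b_def)
    hence "(\<lambda>N. norm (\<Sum>n<N. \<psi> (Suc n) * of_real (b (Suc n)))) \<longlonglongrightarrow> norm (- S)"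
      unfolding sums_def by (rule tendsto_norm)
    moreover have "norm (\<Sum>n<N. \<psi> (Suc n) * of_real (b (Suc n))) \<le> M * b (Suc 0)" for N
      by (rule abel_bound) (use M b in auto)
    moreover have "b (Suc 0) = 1" using x by (simp add: b_def field_simps)
    ultimately show ?thesis by (auto intro: LIMSEQ_le_const2)
  qed
  have geo: "((\<lambda>m. w ^ m) has_sum (w / (1 - w))) {1..}" if "norm w < 1" for w :: complex
    using has_sum_geometric_from_1[OF that] .
  have geo': "((\<lambda>m. w ^ m) has_sum (w / (1 - w))) {1..}" if "norm w < 1" for w :: real
    using has_sum_geometric_from_1[OF that] .
  have inner: "((\<lambda>m. \<psi> n * of_real x ^ (n * m)) has_sum g n) {1..}" if "n \<ge> 1" for n
  proof -
    have "norm (of_real (x ^ n) :: complex) < 1" using x xn[of n] that by (simp add: norm_power)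
    from has_sum_cmult_right[OF geo[OF this], of "\<psi> n"] show ?thesis
      by (simp add: g_def power_mult)
  qed
  have "((\<lambda>(n, m). \<psi> n * of_real x ^ (n * m)) has_sum S) ({1..} \<times> {1..})"
  proof (rule has_sum_SigmaI[where g = g])
    show "(\<lambda>(n, m). \<psi> n * of_real x ^ (n * m)) summable_on ({1..} \<times> {1..})"
    proof (rule abs_summable_summable, rule summable_on_SigmaI[where g = "\<lambda>n. norm (g n)"])
      fix n :: nat assume n: "n \<in> {1..}"
      have "norm (x ^ n) < 1" using x xn[of n] n by simp
      moreover have "norm (g n) = norm (\<psi> n) * (x ^ n / (1 - x ^ n))"
        unfolding g_def norm_mult norm_of_real using x xn[of n] n by simp
      moreover have "norm (\<psi> n * of_real x ^ (n * m)) = norm (\<psi> n) * (x ^ n) ^ m" for m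
        unfolding norm_mult norm_power norm_of_real using x by (simp add: power_mult)
      ultimately
      show "((\<lambda>m. norm (case (n, m) of (n, m) \<Rightarrow> \<psi> n * of_real x ^ (n * m))) has_sum norm (g n)) {1..}"
        using has_sum_cmult_right[OF geo'[of "x ^ n"], of "norm (\<psi> n)"] by simp
    next
      show "(\<lambda>n. norm (g n)) summable_on {1..}" by (rule sg')
    qed auto
  qed (use inner gS in auto)
  \<comment> \<open>Expanding each Lambert term as a geometric series and collecting powers, the
    coefficient of x^k becomes the divisor sum of \<psi>.\<close>
  from has_sum_divisors[OF this]
  have "((\<lambda>k. \<Sum>d | d dvd k. \<psi> (k div d) * of_real x ^ (k div d * d)) has_sum S) {1..}" .
  hence ReS: "((\<lambda>k. Re (\<Sum>d | d dvd k. \<psi> (k div d) * of_real x ^ (k div d * d))) has_sum Re S) {1..}"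
    by (rule has_sum_Re)
  define r where "r = (\<lambda>k. \<Sum>d | d dvd k. Re (\<psi> d))"
  have r: "r k \<ge> (if \<exists>m. k = m\<^sup>2 then 1 else 0)" if "k > 0" for k
    unfolding r_def
  proof (rule divisor_sum_nonneg)
    show "Re (\<psi> (m * n)) = Re (\<psi> m) * Re (\<psi> n)" for m n
    proof -
      have "Im (\<psi> m) = 0"
        using dcharacter_unimodular_sq(1)[OF psi sq, of m] by (metis Im_complex_of_real)
      thus ?thesis using dcharacterD(3)[OF psi, of m n] by simp
    qed
  qed (use dcharacter_unimodular_sq(2)[OF psi sq] dcharacterD(2)[OF psi] that in auto)
  have "Re (\<Sum>d | d dvd k. \<psi> (k div d) * of_real x ^ (k div d * d)) = r k * x ^ k" if "k \<in> {1..}" for k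
  proof -
    have "(\<Sum>d | d dvd k. \<psi> (k div d) * of_real x ^ (k div d * d)) = (\<Sum>d | d dvd k. \<psi> d * of_real (x ^ k))"
      by (rule sum.reindex_bij_witness[of _ "\<lambda>d. k div d" "\<lambda>d. k div d"]) (use that in \<open>auto simp: div_div_eq_right\<close>)
    thus ?thesis by (simp add: r_def sum_distrib_right del: of_real_power)
  qed
  hence "((\<lambda>k. Re (\<Sum>d | d dvd k. \<psi> (k div d) * of_real x ^ (k div d * d))) has_sum Re S) {1..} =
      ((\<lambda>k. r k * x ^ k) has_sum Re S) {1..}"
    by (rule has_sum_cong)
  with ReS have rS: "((\<lambda>k. r k * x ^ k) has_sum Re S) {1..}" by (rule iffD1[rotated])
  have "(\<Sum>k\<in>(\<lambda>j. (Suc j)\<^sup>2) ` {..<J}. r k * x ^ k) \<le> Re S"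
  proof (rule has_sum_mono_neutral[OF has_sum_finite rS])
    fix k :: nat assume "k \<in> {1..} - (\<lambda>j. (Suc j)\<^sup>2) ` {..<J}"
    thus "0 \<le> r k * x ^ k" using r[of k] x by (intro mult_nonneg_nonneg) (auto split: if_splits)
  qed auto
  also have "(\<Sum>k\<in>(\<lambda>j. (Suc j)\<^sup>2) ` {..<J}. r k * x ^ k) = (\<Sum>j<J. r ((Suc j)\<^sup>2) * x ^ ((Suc j)\<^sup>2))"
    by (subst sum.reindex) (auto simp: inj_on_def o_def power2_eq_iff_nonneg)
  also have "\<dots> \<ge> (\<Sum>j<J. 1 * x ^ ((Suc j)\<^sup>2))"
  proof (intro sum_mono mult_right_mono)
    fix j
    have "\<exists>m. (Suc j)\<^sup>2 = m\<^sup>2" by blast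
    thus "1 \<le> r ((Suc j)\<^sup>2)" using r[of "(Suc j)\<^sup>2"] by simp
  qed (use x in auto)
  finally have "Re S > M" using x by simp
  with \<open>norm S \<le> M\<close> show False using complex_Re_le_cmod[of S] by linarith
qed

text \<open>A zero at 1 + it would make |L|^4 of order (\<sigma> - 1)^4 near \<sigma> = 1, against a
  zeta factor of order (\<sigma> - 1)^(-3) and a bounded third factor, so the product in
  \<open>three_four_one\<close> would tend to 0.\<close>

lemma Lfun_nonzero_line_1:
  assumes NP: "\<psi> \<in> nonprincipal_chars q"
  shows "Lfun \<psi> (1 + \<i> * of_real t) \<noteq> 0"
proof
  assume L0: "Lfun \<psi> (1 + \<i> * of_real t) = 0"
  note psi = nonprincipal_charsD(1)[OF NP]
  define sq where "sq \<longleftrightarrow> (\<forall>n. coprime n q \<longrightarrow> \<psi> n ^ 2 = 1)"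
  \<comment> \<open>If \<psi>^2 is principal, it is replaced by the constant 1, so the third factor
    is zeta at \<sigma> + 2it; this stays bounded because t = 0 was excluded by the real case.
    Otherwise \<psi>^2 is non-principal and its L-function is continuous there.\<close>
  define h where "h = (if sq then (\<lambda>_. 1) else (\<lambda>n. \<psi> n ^ 2))"
  have h: "unitmult h"
    using unitmult_dcharacter[OF psi] by (auto simp: h_def unitmult_def power_mult_distrib norm_power power_le_one simp del: One_nat_def)
  have t0: "t \<noteq> 0" if sq
    using Lfun_real_1_nonzero[OF NP] that L0 unfolding sq_def by auto
  have pos: "3 + 4 * Re (\<psi> n * of_nat n powr (- (\<i> * t))) + Re (h n * of_nat n powr (- (2 * \<i> * t))) \<ge> 0" if n: "n > 0" for n
  proof -
    define u where "u = of_nat n powr (- (\<i> * t))"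
    have u: "norm u = 1" unfolding u_def using n by (simp add: norm_of_nat_powr)
    have u2: "of_nat n powr (- (2 * \<i> * t)) = u ^ 2"
      unfolding u_def power2_eq_square by (simp add: mult.assoc flip: powr_add)
    show ?thesis
    proof (cases "coprime n q")
      case True
      define z where "z = \<psi> n * u"
      have "norm z = 1" using True u norm_dcharacter[OF psi, of n] by (simp add: z_def norm_mult)
      hence "(Re z)\<^sup>2 + (Im z)\<^sup>2 = 1" by (metis cmod_power2 one_power2)
      hence "3 + 4 * Re z + Re (z ^ 2) = 2 * (1 + Re z)\<^sup>2"
        by (simp add: power2_eq_square algebra_simps)
      moreover have "h n * u ^ 2 = z ^ 2" using True by (auto simp: h_def z_def power_mult_distrib sq_def)
      ultimately show ?thesis unfolding u2 u_def[symmetric] by (simp add: z_def)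
    next
      case False
      hence "\<psi> n = 0" using dcharacterD(5)[OF psi] by simp
      moreover have "\<bar>Re (h n * u ^ 2)\<bar> \<le> 1"
      proof -
        have "norm (h n * u ^ 2) = norm (h n)" using u by (simp add: norm_mult norm_power)
        also have "\<dots> \<le> 1" using h by (simp add: unitmult_def)
        finally show ?thesis using abs_Re_le_cmod[of "h n * u ^ 2"] by linarith
      qed
      ultimately show ?thesis unfolding u2 u_def[symmetric] by simp
    qed
  qed
  have "\<exists>c>0. \<forall>\<sigma>>1. c \<le> norm (dirs (\<lambda>_. 1) (of_real \<sigma>)) ^ 3 *
      norm (dirs \<psi> (\<sigma> + \<i> * t)) ^ 4 * norm (dirs h (\<sigma> + 2 * \<i> * t))"
    by (rule three_four_one[OF unitmult_dcharacter[OF psi] h]) (rule pos)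
  then obtain c where c: "c > 0" "\<forall>\<sigma>>1. c \<le> norm (dirs (\<lambda>_. 1) (of_real \<sigma>)) ^ 3 *
      norm (dirs \<psi> (\<sigma> + \<i> * t)) ^ 4 * norm (dirs h (\<sigma> + 2 * \<i> * t))"
    by (elim exE conjE)
  have "\<exists>B>0. \<forall>\<sigma>. (1::real) < \<sigma> \<and> \<sigma> \<le> 2 \<longrightarrow> norm (dirs h (of_real \<sigma> + 2 * \<i> * t)) \<le> B"
  proof (cases sq)
    case True
    have h1: "h = (\<lambda>_. 1)" using True by (simp add: h_def)
    have "norm (dirs h (\<sigma> + 2 * \<i> * t)) \<le> 1 / (2 * \<bar>t\<bar>) + 2 * (2 + 2 * \<bar>t\<bar>)" if "1 < \<sigma>" "\<sigma> \<le> 2" for \<sigma> :: real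
    proof -
      have "norm (dirs h (\<sigma> + 2 * \<i> * t)) \<le> 1 / norm (\<sigma> + 2 * \<i> * t - 1) + 2 * norm (\<sigma> + 2 * \<i> * t)"
        unfolding h1 by (rule zeta_bound) (use that in simp)
      also have "norm (\<sigma> + 2 * \<i> * t) \<le> 2 + 2 * \<bar>t\<bar>"
        by (rule norm_triangle_le) (use that in \<open>simp add: norm_mult\<close>)
      also have "2 * \<bar>t\<bar> \<le> norm (\<sigma> + 2 * \<i> * t - 1)"
        using abs_Im_le_cmod[of "\<sigma> + 2 * \<i> * t - 1"] by simp
      hence "1 / norm (\<sigma> + 2 * \<i> * t - 1) \<le> 1 / (2 * \<bar>t\<bar>)" using t0[OF True] by (intro divide_left_mono mult_pos_pos) auto
      finally show ?thesis by simp
    qed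
    moreover have "1 / (2 * \<bar>t\<bar>) + 2 * (2 + 2 * \<bar>t\<bar>) > 0" by (intro add_nonneg_pos) auto
    ultimately show ?thesis by (intro exI[of _ "1 / (2 * \<bar>t\<bar>) + 2 * (2 + 2 * \<bar>t\<bar>)"] conjI allI impI) simp_all
  next
    case False
    hence hsq: "h = (\<lambda>n. \<psi> n ^ 2)" by (auto simp: h_def)
    have "dcharacter q h"
      unfolding hsq dcharacter_def using psi by (auto simp: dcharacter_def power_mult_distrib simp del: One_nat_def)
    moreover have "h \<noteq> principal_char q"
      using False by (auto simp: sq_def hsq principal_char_def fun_eq_iff)
    ultimately have hNP: "h \<in> nonprincipal_chars q" by (simp add: nonprincipal_chars_def)
    obtain C where C: "C > 0" "\<forall>s. Re s \<ge> 1/10 \<longrightarrow> norm (Lfun h s) \<le> C * (1 + norm s)"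
      using Lfun_props(3)[OF hNP] by (elim exE conjE)
    have "norm (dirs h (\<sigma> + 2 * \<i> * t)) \<le> C * (1 + (2 + 2 * \<bar>t\<bar>))" if "1 < \<sigma>" "\<sigma> \<le> 2" for \<sigma> :: real
    proof -
      have "norm (dirs h (\<sigma> + 2 * \<i> * t)) \<le> C * (1 + norm (\<sigma> + 2 * \<i> * t))"
      proof (subst Lfun_eq_dirs[OF hNP, symmetric])
        show "norm (Lfun h (\<sigma> + 2 * \<i> * t)) \<le> C * (1 + norm (\<sigma> + 2 * \<i> * t))"
          by (rule C(2)[rule_format]) (use that in simp)
      qed (use that in simp)
      also have "norm (\<sigma> + 2 * \<i> * t) \<le> 2 + 2 * \<bar>t\<bar>"
        by (rule norm_triangle_le) (use that in \<open>simp add: norm_mult\<close>)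
      finally show ?thesis using C by simp
    qed
    moreover have "C * (1 + (2 + 2 * \<bar>t\<bar>)) > 0" using C by (intro mult_pos_pos) auto
    ultimately show ?thesis by (intro exI[of _ "C * (1 + (2 + 2 * \<bar>t\<bar>))"] conjI allI impI) simp_all
  qed
  then obtain B where B: "B > 0" "\<forall>\<sigma>. (1::real) < \<sigma> \<and> \<sigma> \<le> 2 \<longrightarrow> norm (dirs h (of_real \<sigma> + 2 * \<i> * t)) \<le> B"
    by (elim exE conjE)
  define z0 where "z0 = 1 + \<i> * complex_of_real t"
  have "bounded (deriv (Lfun \<psi>) ` cball z0 1)"
    by (intro compact_imp_bounded compact_continuous_image holomorphic_on_imp_continuous_on
        holomorphic_on_subset[OF holomorphic_deriv[OF Lfun_props(1)[OF NP, of UNIV]]]) auto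
  then obtain D where D: "D > 0" "\<And>z. z \<in> cball z0 1 \<Longrightarrow> norm (deriv (Lfun \<psi>) z) \<le> D"
    unfolding bounded_pos by auto
  have LD: "norm (dirs \<psi> (of_real (1 + e) + \<i> * t)) \<le> D * e" if e: "0 < e" "e \<le> 1" for e
  proof -
    have "norm (Lfun \<psi> (z0 + of_real e) - Lfun \<psi> z0) \<le> D * norm (z0 + of_real e - z0)"
      by (rule field_differentiable_bound[where S = "cball z0 1" and f' = "deriv (Lfun \<psi>)"])
         (use e D holomorphic_derivI[OF Lfun_props(1)[OF NP, of UNIV]] in
           \<open>auto intro: has_field_derivative_at_within simp: dist_norm\<close>)
    moreover have "Lfun \<psi> (z0 + of_real e) = dirs \<psi> (of_real (1 + e) + \<i> * t)"
      by (subst Lfun_eq_dirs[OF NP]) (use e in \<open>auto simp: z0_def algebra_simps\<close>)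
    ultimately show ?thesis using L0 e by (simp add: z0_def)
  qed
  \<comment> \<open>With \<sigma> = 1 + e the three factors are at most (5/e)^3, (D e)^4 and B,
    leaving one positive power of e.\<close>
  have key: "c \<le> 125 * D ^ 4 * B * e" if e: "0 < e" "e \<le> 1" for e :: real
  proof -
    have "norm (dirs (\<lambda>_. 1) (of_real (1 + e))) \<le> 1 / norm (of_real (1 + e) - 1 :: complex) + 2 * norm (of_real (1 + e) :: complex)"
      by (rule zeta_bound) (use e in simp)
    also have "of_real (1 + e) - 1 = (of_real e :: complex)" by simp
    also have "1 / norm (of_real e :: complex) + 2 * norm (of_real (1 + e) :: complex) = 1 / e + 2 * (1 + e)"
      unfolding norm_of_real using e by simp
    also have "\<dots> \<le> 5 / e"
    proof -
      have "2 * (1 + e) * e \<le> 4 * 1" using e by (intro mult_mono) auto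
      hence "2 * (1 + e) \<le> 4 / e" using e by (simp only: le_divide_eq) simp
      moreover have "1 / e + 4 / e = 5 / e" by (simp add: add_divide_distrib[symmetric])
      ultimately show ?thesis by linarith
    qed
    finally have Z: "norm (dirs (\<lambda>_. 1) (of_real (1 + e))) \<le> 5 / e" .
    have "c \<le> norm (dirs (\<lambda>_. 1) (of_real (1 + e))) ^ 3 * norm (dirs \<psi> (of_real (1 + e) + \<i> * t)) ^ 4 * norm (dirs h (of_real (1 + e) + 2 * \<i> * t))"
      by (rule c(2)[rule_format]) (use e in auto)
    also have "\<dots> \<le> (5 / e) ^ 3 * (D * e) ^ 4 * B"
      by (intro mult_mono power_mono Z LD B(2)[rule_format]) (use e D in auto)
    also have "\<dots> = 125 * D ^ 4 * B * e"
      using e by (simp add: power_mult_distrib power_divide field_simps power_numeral_reduce)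
    finally show ?thesis .
  qed
  define e where "e = min 1 (c / (2 * (125 * D ^ 4 * B)))"
  have K: "125 * D ^ 4 * B > 0" using D B by simp
  have e: "0 < e" "e \<le> 1" "e \<le> c / (2 * (125 * D ^ 4 * B))" using c K by (auto simp: e_def)
  have "125 * D ^ 4 * B * e \<le> 125 * D ^ 4 * B * (c / (2 * (125 * D ^ 4 * B)))" using e K by (intro mult_left_mono) auto
  also have "\<dots> = c / 2" using K D B by (simp add: field_simps)
  finally show False using key[OF e(1,2)] c by simp
qed


subsection \<open>Local partial fractions of the logarithmic derivative\<close>

lemma factor_zero_single:
  assumes f: "f holomorphic_on S" and S: "open S" "connected S" and z0: "z0 \<in> S" and w: "w \<in> S" "f w \<noteq> 0"
  shows "\<exists>(k :: nat) h. h holomorphic_on S \<and> h z0 \<noteq> 0 \<and> (\<forall>z\<in>S. f z = (z - z0) ^ k * h z)"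
proof (cases "f z0 = 0")
  case False
  with f show ?thesis by (intro exI[of _ 0] exI[of _ f]) auto
next
  case True
  have "\<not> f constant_on S" using True w z0 by (force simp: constant_on_def)
  then obtain g r n where gr: "0 < n" "0 < r" "ball z0 r \<subseteq> S" "g holomorphic_on ball z0 r"
      "\<And>w. w \<in> ball z0 r \<Longrightarrow> f w = (w - z0) ^ n * g w" "\<And>w. w \<in> ball z0 r \<Longrightarrow> g w \<noteq> 0"
    using holomorphic_factor_zero_nonconstant[OF f S z0 True] by metis
  define h where "h = (\<lambda>z. if z = z0 then g z0 else f z / (z - z0) ^ n)"
  have hg: "h z = g z" if "z \<in> ball z0 r" for z using gr(5)[OF that] by (auto simp: h_def)
  have "h holomorphic_on (S - {z0}) \<union> ball z0 r"
  proof (rule holomorphic_on_Un)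
    show "h holomorphic_on S - {z0}"
      by (rule holomorphic_transform[of "\<lambda>z. f z / (z - z0) ^ n"])
         (auto intro!: holomorphic_intros holomorphic_on_subset[OF f] simp: h_def)
    show "h holomorphic_on ball z0 r"
      by (rule holomorphic_transform[OF gr(4)]) (use hg in simp)
  qed (use S in auto)
  also have "(S - {z0}) \<union> ball z0 r = S" using gr z0 by auto
  finally show ?thesis
    by (intro exI[of _ n] exI[of _ h]) (use gr hg[of z0] gr(6)[of z0] True in \<open>auto simp: h_def\<close>)
qed

lemma factor_zeros_finite:
  assumes "finite Z" "Z \<subseteq> S" and f: "f holomorphic_on S" and S: "open S" "connected S" and w: "w \<in> S" "f w \<noteq> 0"
  shows "\<exists>n h. h holomorphic_on S \<and> (\<forall>\<rho>\<in>Z. h \<rho> \<noteq> 0) \<and> (\<forall>z\<in>S. f z = (\<Prod>\<rho>\<in>Z. (z - \<rho>) ^ n \<rho>) * h z)"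
  using assms(1,2)
proof (induction Z rule: finite_induct)
  case empty
  thus ?case using f by auto
next
  case (insert \<rho> Z)
  then obtain n h where h: "h holomorphic_on S" "\<forall>\<rho>\<in>Z. h \<rho> \<noteq> 0"
    "\<forall>z\<in>S. f z = (\<Prod>\<rho>\<in>Z. (z - \<rho>) ^ n \<rho>) * h z" by auto
  have "h w \<noteq> 0" using h(3) w by auto
  hence "\<exists>(k :: nat) h2. h2 holomorphic_on S \<and> h2 \<rho> \<noteq> 0 \<and> (\<forall>z\<in>S. h z = (z - \<rho>) ^ k * h2 z)"
    using insert.prems by (intro factor_zero_single[OF h(1) S _ w(1)]) auto
  then obtain k h2 where h2: "h2 holomorphic_on S" "h2 \<rho> \<noteq> 0" "\<forall>z\<in>S. h z = (z - \<rho>) ^ k * h2 z"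
    by (elim exE conjE)
  define n' where "n' = n(\<rho> := k)"
  have "(\<Prod>\<rho>\<in>Z. (z - \<rho>) ^ n' \<rho>) = (\<Prod>\<rho>\<in>Z. (z - \<rho>) ^ n \<rho>)" for z
    using insert.hyps by (intro prod.cong) (auto simp: n'_def)
  hence "f z = (\<Prod>\<rho>\<in>insert \<rho> Z. (z - \<rho>) ^ n' \<rho>) * h2 z" if "z \<in> S" for z
    using insert.hyps h(3) h2(3) that by (simp add: n'_def mult_ac)
  moreover have "h2 \<rho>' \<noteq> 0" if "\<rho>' \<in> Z" for \<rho>'
    using h(2)[rule_format, OF that] h2(3)[rule_format, of \<rho>'] that insert.prems by auto
  ultimately show ?case using h2 by (intro exI[of _ n'] exI[of _ h2]) auto
qed

lemma has_field_derivative_prod_power: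
  fixes u :: "'b \<Rightarrow> complex \<Rightarrow> complex"
  assumes "finite Z" "\<And>\<rho>. \<rho> \<in> Z \<Longrightarrow> (u \<rho> has_field_derivative u' \<rho>) (at z)" "\<And>\<rho>. \<rho> \<in> Z \<Longrightarrow> u \<rho> z \<noteq> 0"
  shows "((\<lambda>z. \<Prod>\<rho>\<in>Z. u \<rho> z ^ n \<rho>) has_field_derivative
            (\<Prod>\<rho>\<in>Z. u \<rho> z ^ n \<rho>) * (\<Sum>\<rho>\<in>Z. of_nat (n \<rho>) * u' \<rho> / u \<rho> z)) (at z)"
  using assms
proof (induction Z rule: finite_induct)
  case (insert \<rho> Z)
  have *: "((\<lambda>z. u \<rho> z ^ n \<rho>) has_field_derivative u \<rho> z ^ n \<rho> * (of_nat (n \<rho>) * u' \<rho> / u \<rho> z)) (at z)"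
  proof -
    have "u \<rho> z ^ n \<rho> * (of_nat (n \<rho>) * u' \<rho> / u \<rho> z) = of_nat (n \<rho>) * (u' \<rho> * u \<rho> z ^ (n \<rho> - Suc 0))"
      using insert.prems(2)[of \<rho>] by (cases "n \<rho>") simp_all
    thus ?thesis using DERIV_power[OF insert.prems(1)[of \<rho>], of "n \<rho>"] by simp
  qed
  show ?case using DERIV_mult[OF * insert.IH] insert by (simp add: algebra_simps)
qed auto

lemma cauchy_deriv_bound:
  assumes f: "f holomorphic_on ball 0 r" and "0 < r3" "r3 < r2" "r2 < r" 
    and K: "\<And>z. z \<in> cball 0 r2 \<Longrightarrow> norm (f z) \<le> K" and z: "z \<in> cball 0 r3"
  shows "norm (deriv f z) \<le> K / (r2 - r3)"
proof -
  have sub: "cball z (r2 - r3) \<subseteq> cball 0 r2" 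
    using z by (simp add: cball_subset_cball_iff)
  have "norm ((deriv ^^ 1) f z) \<le> fact 1 * K / (r2 - r3) ^ 1"
  proof (rule Cauchy_inequality)
    have "cball z (r2 - r3) \<subseteq> ball 0 r" using sub assms by auto
    hence hol: "f holomorphic_on cball z (r2 - r3)" by (rule holomorphic_on_subset[OF f])
    show "f holomorphic_on ball z (r2 - r3)" by (rule holomorphic_on_subset[OF hol]) auto
    show "continuous_on (cball z (r2 - r3)) f" by (rule holomorphic_on_imp_continuous_on[OF hol])
    show "norm (f x) \<le> K" if "norm (z - x) = r2 - r3" for x
      by (rule K, rule subsetD[OF sub]) (use that in \<open>simp add: dist_norm\<close>)
  qed (use assms in auto)
  thus ?thesis by simp
qed

lemma cauchy_lipschitz:
  assumes f: "f holomorphic_on ball 0 r" and "0 < r3" "r3 < r2" "r2 < r" 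
    and K: "\<And>z. z \<in> cball 0 r2 \<Longrightarrow> norm (f z) \<le> K" and zw: "z \<in> cball 0 r3" "w \<in> cball 0 r3"
  shows "norm (f z - f w) \<le> K / (r2 - r3) * norm (z - w)"
proof (rule field_differentiable_bound[where S = "cball 0 r3" and f' = "deriv f"])
  fix z :: complex assume z: "z \<in> cball 0 r3"
  show "(f has_field_derivative deriv f z) (at z within cball 0 r3)"
    by (rule has_field_derivative_at_within, rule holomorphic_derivI[OF f]) (use z assms in auto)
  show "norm (deriv f z) \<le> K / (r2 - r3)"
    by (rule cauchy_deriv_bound[OF f assms(2-4) K z])
qed (use zw in auto)

text \<open>Schwarz's lemma for G/(2A - G), which maps the disc into the unit disc because Re G < A.
  The inequality is kept multiplied out by r - |z|.\<close>

lemma borel_caratheodory: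
  assumes G: "G holomorphic_on ball 0 r" and G0: "G 0 = 0" and A: "A > 0"
    and ReG: "\<And>z. norm z < r \<Longrightarrow> Re (G z) < A" and z: "norm z < r"
  shows "norm (G z) * (r - norm z) \<le> 2 * A * norm z"
proof -
  have r: "r > 0" using z norm_ge_zero[of z] by linarith
  have nz: "2 * A - G z \<noteq> 0" if "norm z < r" for z
    using ReG[OF that] A by (auto simp: complex_eq_iff)
  define w where "w = (\<lambda>\<zeta> :: complex. G (r * \<zeta>) / (2 * A - G (r * \<zeta>)))"
  have "norm (w (z / r)) \<le> norm (z / of_real r)"
  proof (rule Schwarz_Lemma)
    have "(\<lambda>\<zeta>. G (r * \<zeta>)) holomorphic_on ball 0 1"
      by (rule holomorphic_on_compose_gen[OF _ G, unfolded o_def])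
         (use r in \<open>auto intro!: holomorphic_intros simp: norm_mult\<close>)
    thus "w holomorphic_on ball 0 1"
      unfolding w_def using r by (intro holomorphic_intros nz) (auto simp: norm_mult)
    show "w 0 = 0" by (simp add: w_def G0)
    fix \<zeta> :: complex assume "norm \<zeta> < 1"
    hence n: "norm (r * \<zeta>) < r" using r by (simp add: norm_mult)
    have "(norm (G (r * \<zeta>)))\<^sup>2 < (norm (2 * A - G (r * \<zeta>)))\<^sup>2"
    proof -
      have "0 < 4 * A * (A - Re (G (r * \<zeta>)))" using ReG[OF n] A by simp
      thus ?thesis unfolding cmod_power2 by (simp add: power2_eq_square algebra_simps)
    qed
    hence "norm (G (r * \<zeta>)) < norm (2 * A - G (r * \<zeta>))" by (rule power2_less_imp_less) simp
    thus "norm (w \<zeta>) < 1" unfolding w_def norm_divide by (subst divide_less_eq_1) auto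
  qed (use z r in \<open>auto simp: norm_divide\<close>)
  hence "norm (G z) / norm (2 * A - G z) \<le> norm z / r" using r by (simp add: w_def norm_divide)
  hence "norm (G z) * r \<le> norm z * norm (2 * A - G z)" using r nz[OF z] by (simp add: field_simps)
  also have "\<dots> \<le> norm z * (2 * A + norm (G z))"
    by (intro mult_left_mono order_trans[OF norm_triangle_ineq4]) (use A in auto)
  finally show ?thesis by (simp add: algebra_simps)
qed

text \<open>Dividing $f$ by Blaschke factors of the disc of radius $R$ keeps it bounded by $M$ and removes the
  zeros in the smaller disc, so that its logarithm is controlled by Borel--Carath\'eodory.\<close>

lemma local_partial_fractions:
  fixes r2 r R :: real
  assumes r: "0 < r2" "r2 < r" "r < R" "R < R'"
  shows "\<exists>C>0. \<forall>f M. f holomorphic_on ball 0 R' \<and> f 0 \<noteq> 0 \<and> (\<forall>z\<in>cball 0 R. norm (f z) \<le> M) \<longrightarrow>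
     (\<exists>n E. finite {\<rho>\<in>cball 0 r. f \<rho> = 0} \<and>
       (\<forall>\<rho>\<in>cball 0 r. f \<rho> = 0 \<longrightarrow> int (n \<rho>) = zorder f \<rho>) \<and>
       real (\<Sum>\<rho> | \<rho> \<in> cball 0 r \<and> f \<rho> = 0. n \<rho>) \<le> C * (ln (M / norm (f 0)) + 1) \<and>
       E holomorphic_on ball 0 r \<and> (\<forall>z\<in>cball 0 r2. norm (E z) \<le> C * (ln (M / norm (f 0)) + 1)) \<and>
       (\<forall>z\<in>ball 0 r. f z \<noteq> 0 \<longrightarrow>
          deriv f z / f z = (\<Sum>\<rho> | \<rho> \<in> cball 0 r \<and> f \<rho> = 0. of_nat (n \<rho>) / (z - \<rho>)) + E z))"
proof -
  \<comment> \<open>An intermediate radius: the logarithm is bounded on the disc of radius r1, and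
    Cauchy's estimate then bounds its derivative on the disc of radius r2.\<close>
  define r1 where "r1 = (r2 + r) / 2"
  have r1: "r2 < r1" "r1 < r" using r by (auto simp: r1_def)
  have R: "R > 0" "R\<^sup>2 - r\<^sup>2 > 0" using r by (auto simp: power_strict_mono)
  have lnR: "ln (R / r) > 0" using r by simp
  \<comment> \<open>The three summands account for the number of zeros, the derivative of the
    logarithm and the terms from the Blaschke factors.\<close>
  define C where "C = 1 / ln (R / r) + (2 * r1 / (r - r1)) / (r1 - r2) + (1 / ln (R / r)) * (r / (R\<^sup>2 - r\<^sup>2))"
  have Cpos: "1 / ln (R / r) > 0" "(2 * r1 / (r - r1)) / (r1 - r2) > 0" "(1 / ln (R / r)) * (r / (R\<^sup>2 - r\<^sup>2)) > 0"
    using r r1 R lnR by auto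
  hence "C > 0" unfolding C_def by (intro add_pos_pos)
  moreover have "\<exists>n E. finite {\<rho>\<in>cball 0 r. f \<rho> = 0} \<and>
       (\<forall>\<rho>\<in>cball 0 r. f \<rho> = 0 \<longrightarrow> int (n \<rho>) = zorder f \<rho>) \<and>
       real (\<Sum>\<rho> | \<rho> \<in> cball 0 r \<and> f \<rho> = 0. n \<rho>) \<le> C * (ln (M / norm (f 0)) + 1) \<and>
       E holomorphic_on ball 0 r \<and> (\<forall>z\<in>cball 0 r2. norm (E z) \<le> C * (ln (M / norm (f 0)) + 1)) \<and>
       (\<forall>z\<in>ball 0 r. f z \<noteq> 0 \<longrightarrow>
          deriv f z / f z = (\<Sum>\<rho> | \<rho> \<in> cball 0 r \<and> f \<rho> = 0. of_nat (n \<rho>) / (z - \<rho>)) + E z)"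
    if f: "f holomorphic_on ball 0 R'" and f0: "f 0 \<noteq> 0" and M: "\<And>z. z \<in> cball 0 R \<Longrightarrow> norm (f z) \<le> M" for f M
  proof -
    define A where "A = ln (M / norm (f 0))"
    define Z where "Z = {\<rho>\<in>cball 0 r. f \<rho> = 0}"
    have Mf: "norm (f 0) \<le> M" using M[of 0] R by simp
    have f0': "norm (f 0) > 0" using f0 by simp
    have A0: "A \<ge> 0" using Mf f0' by (simp add: A_def)
    have finZ: "finite Z" unfolding Z_def
    proof (cases "f constant_on ball 0 R'")
      case True
      hence "{\<rho>\<in>cball 0 r. f \<rho> = 0} = {}" using f0 r by (force simp: constant_on_def)
      thus "finite {\<rho>\<in>cball 0 r. f \<rho> = 0}" by (simp only: finite.emptyI)
    next
      case False
      show "finite {\<rho>\<in>cball 0 r. f \<rho> = 0}"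
        by (rule holomorphic_compact_finite_zeros[OF f _ _ _ _ False]) (use r in auto)
    qed
    have "Z \<subseteq> ball 0 R'" using r unfolding Z_def by auto
    have "0 \<in> ball (0 :: complex) R'" using r by simp
    from factor_zeros_finite[OF finZ \<open>Z \<subseteq> ball 0 R'\<close> f open_ball connected_ball this f0]
    obtain n h where h: "h holomorphic_on ball 0 R'" "\<forall>\<rho>\<in>Z. h \<rho> \<noteq> 0" 
      "\<forall>z\<in>ball 0 R'. f z = (\<Prod>\<rho>\<in>Z. (z - \<rho>) ^ n \<rho>) * h z"
      by (elim exE conjE)
    have Zr: "norm \<rho> \<le> r" if "\<rho> \<in> Z" for \<rho> using that by (simp add: Z_def)
    have h0: "h z \<noteq> 0" if "z \<in> cball 0 r" for z
    proof (cases "z \<in> Z")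
      case False
      hence "f z \<noteq> 0" using that by (auto simp: Z_def)
      thus ?thesis using h(3) that r by auto
    qed (use h in auto)
    define N where "N = (\<Sum>\<rho>\<in>Z. n \<rho>)"
    \<comment> \<open>On |z| = R one has |u \<rho> z| = |z - \<rho>|, so replacing each factor z -
      \<rho> by this one keeps the modulus on the circle; and u has no zero in the disc of radius
      r.\<close>
    define u where "u = (\<lambda>\<rho> z. (of_real (R\<^sup>2) - cnj \<rho> * z) / of_real R)"
    define Q where "Q = (\<lambda>z. \<Prod>\<rho>\<in>Z. u \<rho> z ^ n \<rho>)"
    define B where "B = (\<lambda>z. h z * Q z)"
    have Bhol: "B holomorphic_on ball 0 R'"
      unfolding B_def Q_def u_def using R by (intro holomorphic_intros h) auto
    have Bbd: "norm (B z) \<le> M" if z: "z \<in> cball 0 R" for z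
    proof (rule maximum_modulus_frontier[where f = B and S = "cball 0 R"])
      show "B holomorphic_on interior (cball 0 R)" using r by (intro holomorphic_on_subset[OF Bhol]) auto
      show "continuous_on (closure (cball 0 R)) B"
        using r by (intro holomorphic_on_imp_continuous_on holomorphic_on_subset[OF Bhol]) auto
      fix z :: complex assume "z \<in> frontier (cball 0 R)"
      hence z: "norm z = R" using R by (simp add: frontier_cball sphere_def)
      have "norm (u \<rho> z) = norm (z - \<rho>)" for \<rho>
      proof -
        have "of_real (R\<^sup>2) = z * cnj z" using z complex_norm_square[of z] by simp
        hence "of_real (R\<^sup>2) - cnj \<rho> * z = z * cnj (z - \<rho>)" by (simp add: algebra_simps)
        thus ?thesis using z R by (simp add: u_def norm_divide norm_mult del: complex_cnj_diff)
      qed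
      hence "norm (Q z) = norm (\<Prod>\<rho>\<in>Z. (z - \<rho>) ^ n \<rho>)" by (simp add: Q_def prod_norm[symmetric] norm_power)
      hence "norm (B z) = norm (f z)" using h(3) z r by (simp add: B_def norm_mult)
      thus "norm (B z) \<le> M" using M[of z] z by simp
    qed (use z in auto)
    \<comment> \<open>A Jensen-type inequality: at the origin each replaced factor grows from at
      most r to R, so every zero in the disc costs a factor R/r between |f 0| and M. Taking
      logarithms bounds the number of zeros.\<close>
    have "norm (f 0) * (R / r) ^ N \<le> norm (B 0)"
    proof -
      have "(R / r) ^ N * norm (\<Prod>\<rho>\<in>Z. (0 - \<rho>) ^ n \<rho>) \<le> (R / r) ^ N * (\<Prod>\<rho>\<in>Z. r ^ n \<rho>)"
        unfolding prod_norm[symmetric] norm_power using Zr r R by (intro mult_left_mono prod_mono) (auto intro!: power_mono)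
      also have "(\<Prod>\<rho>\<in>Z. r ^ n \<rho>) = r ^ N" by (simp add: N_def power_sum)
      also have "(R / r) ^ N * r ^ N = R ^ N" using r by (simp add: power_divide)
      also have "\<dots> = norm (Q 0)" using R by (simp add: Q_def u_def prod_norm[symmetric] norm_power N_def power_sum norm_divide power2_eq_square norm_mult)
      finally have "norm (h 0) * ((R / r) ^ N * norm (\<Prod>\<rho>\<in>Z. (0 - \<rho>) ^ n \<rho>)) \<le> norm (h 0) * norm (Q 0)"
        by (rule mult_left_mono) simp
      thus ?thesis using h(3) R r by (simp add: B_def norm_mult mult_ac)
    qed
    moreover have "norm (B 0) \<le> M" using Bbd[of 0] R by simp
    ultimately have RN: "(R / r) ^ N \<le> M / norm (f 0)" using f0' by (simp add: pos_le_divide_eq mult.commute)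
    have NA: "real N \<le> A / ln (R / r)"
    proof -
      have "ln ((R / r) ^ N) \<le> A" unfolding A_def using RN r R by (subst ln_le_cancel_iff) (auto intro: less_le_trans[OF _ RN])
      thus ?thesis using lnR r R by (simp add: ln_realpow pos_le_divide_eq)
    qed
    have B0: "norm (B 0) \<ge> norm (f 0)"
    proof -
      have "norm (f 0) * 1 \<le> norm (f 0) * (R / r) ^ N" using r by (intro mult_left_mono one_le_power) auto
      thus ?thesis using \<open>norm (f 0) * (R / r) ^ N \<le> norm (B 0)\<close> by simp
    qed
    have u0: "u \<rho> z \<noteq> 0" and ulow: "norm (of_real (R\<^sup>2) - cnj \<rho> * z) \<ge> R\<^sup>2 - r\<^sup>2" if "\<rho> \<in> Z" "z \<in> cball 0 r" for \<rho> z
    proof -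
      have "norm (cnj \<rho> * z) \<le> r * r" unfolding norm_mult using that Zr r by (intro mult_mono) auto
      hence "R\<^sup>2 - r\<^sup>2 \<le> norm (of_real (R\<^sup>2) :: complex) - norm (cnj \<rho> * z)" by (simp add: power2_eq_square norm_mult)
      also have "\<dots> \<le> norm (of_real (R\<^sup>2) - cnj \<rho> * z)" by (rule norm_triangle_ineq2)
      finally show *: "norm (of_real (R\<^sup>2) - cnj \<rho> * z) \<ge> R\<^sup>2 - r\<^sup>2" .
      show "u \<rho> z \<noteq> 0" using * R by (auto simp: u_def)
    qed
    have Bnz: "B z \<noteq> 0" if "z \<in> ball 0 r" for z
      using h0[of z] u0[of _ z] that finZ by (auto simp: B_def Q_def)
    have Bhol': "B holomorphic_on ball 0 r" using r by (intro holomorphic_on_subset[OF Bhol]) auto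
    obtain g where g: "g holomorphic_on ball 0 r" "\<And>z. z \<in> ball 0 r \<Longrightarrow> exp (g z) = B z"
      by (rule holomorphic_logarithm_exists[OF convex_ball open_ball Bhol', of 0]) (use Bnz r in auto)
    define G where "G = (\<lambda>z. g z - g 0)"
    have Ghol: "G holomorphic_on ball 0 r" unfolding G_def by (intro holomorphic_intros g)
    \<comment> \<open>The bound A + 1 in place of A makes the inequality strict and the constant
      positive, as \<open>borel_caratheodory\<close> requires.\<close>
    have ReG: "Re (G z) < A + 1" if z: "norm z < r" for z
    proof -
      have "exp (Re (G z)) = norm (B z) / norm (B 0)"
        using g(2)[of z] g(2)[of 0] z r by (simp add: G_def exp_diff norm_divide flip: norm_exp_eq_Re)
      also have "\<dots> \<le> M / norm (f 0)"
        using Bbd[of z] B0 f0' z r order_trans[OF norm_ge_zero Mf] by (intro frac_le) auto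
      also have "M / norm (f 0) > 0" using f0' less_le_trans[OF f0' Mf] by (intro divide_pos_pos)
      hence "M / norm (f 0) = exp A" by (simp add: A_def)
      finally show ?thesis by simp
    qed
    have Gbd: "norm (G z) \<le> (2 * r1 / (r - r1)) * (A + 1)" if z: "z \<in> cball 0 r1" for z
    proof -
      have "norm (G z) * (r - r1) \<le> norm (G z) * (r - norm z)" using z by (intro mult_left_mono) auto
      also have "\<dots> \<le> 2 * (A + 1) * norm z"
        by (rule borel_caratheodory[OF Ghol]) (use A0 ReG z r1 in \<open>simp_all add: G_def\<close>)
      also have "\<dots> \<le> 2 * (A + 1) * r1" using z A0 by (intro mult_left_mono) auto
      finally show ?thesis using r1 by (simp add: field_simps)
    qed
    \<comment> \<open>The logarithmic derivative of f is the sum over the zeros plus the derivative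
      of G minus the logarithmic derivative of the Blaschke product Q; the second sum is this last
      contribution.\<close>
    define E where "E = (\<lambda>z. deriv G z + (\<Sum>\<rho>\<in>Z. of_nat (n \<rho>) * cnj \<rho> / (of_real (R\<^sup>2) - cnj \<rho> * z)))"
    have "E holomorphic_on ball 0 r"
    proof -
      have "of_real (R\<^sup>2) - cnj \<rho> * z \<noteq> 0" if "\<rho> \<in> Z" "z \<in> ball 0 r" for \<rho> z
        using ulow[of \<rho> z] that R by auto
      thus ?thesis unfolding E_def by (intro holomorphic_intros holomorphic_deriv[OF Ghol]) auto
    qed
    moreover have "norm (E z) \<le> C * (A + 1)" if z: "z \<in> cball 0 r2" for z
    proof -
      have "norm (deriv G z) \<le> (2 * r1 / (r - r1)) * (A + 1) / (r1 - r2)"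
        by (rule cauchy_deriv_bound[OF Ghol _ _ _ Gbd z]) (use r r1 in auto)
      moreover have "norm (\<Sum>\<rho>\<in>Z. of_nat (n \<rho>) * cnj \<rho> / (of_real (R\<^sup>2) - cnj \<rho> * z)) \<le> (\<Sum>\<rho>\<in>Z. real (n \<rho>) * (r / (R\<^sup>2 - r\<^sup>2)))"
      proof (rule sum_norm_le)
        fix \<rho> assume \<rho>: "\<rho> \<in> Z"
        have "norm \<rho> / norm (of_real (R\<^sup>2) - cnj \<rho> * z) \<le> r / (R\<^sup>2 - r\<^sup>2)"
          using ulow[OF \<rho>, of z] Zr[OF \<rho>] z r R by (intro frac_le) auto
        hence "real (n \<rho>) * (norm \<rho> / norm (of_real (R\<^sup>2) - cnj \<rho> * z)) \<le> real (n \<rho>) * (r / (R\<^sup>2 - r\<^sup>2))"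
          by (rule mult_left_mono) simp
        thus "norm (of_nat (n \<rho>) * cnj \<rho> / (of_real (R\<^sup>2) - cnj \<rho> * z)) \<le> real (n \<rho>) * (r / (R\<^sup>2 - r\<^sup>2))"
          by (simp add: norm_mult norm_divide)
      qed
      moreover have "(\<Sum>\<rho>\<in>Z. real (n \<rho>) * (r / (R\<^sup>2 - r\<^sup>2))) = real N * (r / (R\<^sup>2 - r\<^sup>2))"
        unfolding N_def of_nat_sum by (rule sum_distrib_right[symmetric])
      moreover have "real N * (r / (R\<^sup>2 - r\<^sup>2)) \<le> ((A + 1) / ln (R / r)) * (r / (R\<^sup>2 - r\<^sup>2))"
        using lnR R r by (intro mult_right_mono order_trans[OF NA] divide_right_mono) auto
      ultimately have "norm (E z) \<le> (2 * r1 / (r - r1)) * (A + 1) / (r1 - r2) + ((A + 1) / ln (R / r)) * (r / (R\<^sup>2 - r\<^sup>2))"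
        unfolding E_def by (intro norm_triangle_le) linarith
      also have "\<dots> \<le> (2 * r1 / (r - r1)) * (A + 1) / (r1 - r2) + ((A + 1) / ln (R / r)) * (r / (R\<^sup>2 - r\<^sup>2)) + 1 / ln (R / r) * (A + 1)"
        using Cpos A0 by simp
      also have "\<dots> = C * (A + 1)" by (simp add: C_def algebra_simps add_divide_distrib)
      finally show ?thesis .
    qed
    moreover have "real N \<le> C * (A + 1)"
    proof -
      have "real N \<le> 1 / ln (R / r) * (A + 1)" using NA lnR by (simp add: divide_simps)
      also have "\<dots> \<le> C * (A + 1)" using Cpos A0 by (intro mult_right_mono) (auto simp: C_def)
      finally show ?thesis .
    qed
    moreover have "deriv f z / f z = (\<Sum>\<rho>\<in>Z. of_nat (n \<rho>) / (z - \<rho>)) + E z" if z: "z \<in> ball 0 r" "f z \<noteq> 0" for z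
    proof -
      have zZ: "z - \<rho> \<noteq> 0" if "\<rho> \<in> Z" for \<rho> using that z by (auto simp: Z_def)
      have zR: "z \<in> ball 0 R'" using z r by auto
      define P where "P = (\<lambda>z. \<Prod>\<rho>\<in>Z. (z - \<rho>) ^ n \<rho>)"
      have P': "(P has_field_derivative P z * (\<Sum>\<rho>\<in>Z. of_nat (n \<rho>) * 1 / (z - \<rho>))) (at z)"
        unfolding P_def by (rule has_field_derivative_prod_power[OF finZ]) (use zZ in \<open>auto intro!: derivative_eq_intros\<close>)
      have Q': "(Q has_field_derivative Q z * (\<Sum>\<rho>\<in>Z. of_nat (n \<rho>) * (- cnj \<rho> / of_real R) / u \<rho> z)) (at z)"
        unfolding Q_def by (rule has_field_derivative_prod_power[OF finZ]) 
          (use u0[of _ z] z R in \<open>auto intro!: derivative_eq_intros simp: u_def divide_simps\<close>)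
      have "(\<Sum>\<rho>\<in>Z. of_nat (n \<rho>) * (- cnj \<rho> / of_real R) / u \<rho> z) = - (\<Sum>\<rho>\<in>Z. of_nat (n \<rho>) * cnj \<rho> / (of_real (R\<^sup>2) - cnj \<rho> * z))"
        unfolding sum_negf[symmetric] using R by (intro sum.cong) (auto simp: u_def)
      hence EQ: "(\<Sum>\<rho>\<in>Z. of_nat (n \<rho>) * (- cnj \<rho> / of_real R) / u \<rho> z) = deriv G z - E z" by (simp add: E_def)
      have h': "(h has_field_derivative deriv h z) (at z)" by (rule holomorphic_derivI[OF h(1) _ zR]) simp
      have g': "(g has_field_derivative deriv g z) (at z)" by (rule holomorphic_derivI[OF g(1) open_ball z(1)])
      have "(G has_field_derivative deriv g z - 0) (at z)" unfolding G_def by (intro DERIV_diff g' DERIV_const)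
      hence "deriv G z = deriv g z" using DERIV_imp_deriv by fastforce
      hence "((\<lambda>z. exp (g z)) has_field_derivative exp (g z) * deriv G z) (at z)"
        using DERIV_chain2[OF DERIV_exp g'] by simp
      hence "(B has_field_derivative exp (g z) * deriv G z) (at z)"
        by (rule has_field_derivative_transform_within_open[where S = "ball 0 r"]) (use g z in auto)
      hence "(B has_field_derivative B z * deriv G z) (at z)" using g(2)[OF z(1)] by simp
      moreover have "(B has_field_derivative deriv h z * Q z + Q z * (deriv G z - E z) * h z) (at z)"
        unfolding B_def using DERIV_mult[OF h' Q'] unfolding EQ by simp
      ultimately have "B z * deriv G z = deriv h z * Q z + Q z * (deriv G z - E z) * h z" by (rule DERIV_unique)
      moreover have Qz: "Q z \<noteq> 0" using u0[of _ z] z finZ by (auto simp: Q_def)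
      ultimately have "Q z * (h z * E z - deriv h z) = 0" "Q z \<noteq> 0" by (simp_all add: B_def algebra_simps)
      hence hE: "deriv h z = h z * E z" by simp
      have "((\<lambda>z. P z * h z) has_field_derivative P z * (\<Sum>\<rho>\<in>Z. of_nat (n \<rho>) * 1 / (z - \<rho>)) * h z + deriv h z * P z) (at z)"
        by (rule DERIV_mult[OF P' h'])
      hence "(f has_field_derivative P z * (\<Sum>\<rho>\<in>Z. of_nat (n \<rho>) * 1 / (z - \<rho>)) * h z + deriv h z * P z) (at z)"
        by (rule has_field_derivative_transform_within_open[where S = "ball 0 R'"]) (use zR h(3) in \<open>auto simp: P_def\<close>)
      hence "deriv f z = P z * (\<Sum>\<rho>\<in>Z. of_nat (n \<rho>) * 1 / (z - \<rho>)) * h z + deriv h z * P z" by (rule DERIV_imp_deriv)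
      also have "\<dots> = (P z * h z) * ((\<Sum>\<rho>\<in>Z. of_nat (n \<rho>) / (z - \<rho>)) + E z)" by (simp add: hE algebra_simps)
      also have "P z * h z = f z" using h(3) zR by (simp add: P_def)
      finally show ?thesis using z by simp
    qed
    moreover have "int (n \<rho>) = zorder f \<rho>" if \<rho>: "\<rho> \<in> Z" for \<rho>
    proof (rule zorder_eqI[symmetric])
      define k where "k = (\<lambda>z. (\<Prod>\<rho>'\<in>Z-{\<rho>}. (z - \<rho>') ^ n \<rho>') * h z)"
      show "k holomorphic_on ball 0 R'" unfolding k_def by (intro holomorphic_intros h)
      show "k \<rho> \<noteq> 0" using h(2) \<rho> finZ by (auto simp: k_def)
      show "\<rho> \<in> ball 0 R'" using Zr[OF \<rho>] r by simp
      show "f w = k w * (w - \<rho>) powi int (n \<rho>)" if "w \<in> ball 0 R'" for w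
        using h(3) that finZ \<rho> by (simp add: k_def prod.remove[of Z \<rho>])
    qed simp
    ultimately show ?thesis
      using finZ unfolding N_def A_def[symmetric] Z_def
      by (intro exI[of _ n] exI[of _ E]) simp
  qed
  ultimately show ?thesis by (intro exI[of _ C]) blast
qed


section \<open>The L-function under GRH near a point of height t\<close>

locale grh_char =
  fixes q :: nat and \<psi> :: "nat \<Rightarrow> complex"
  assumes NP: "\<psi> \<in> nonprincipal_chars q" and GRH: "GRH_L \<psi>"
begin

lemma char: "dcharacter q \<psi>"
  using NP by (rule nonprincipal_charsD)

lemma Lfun_holo: "Lfun \<psi> holomorphic_on A"
  by (rule Lfun_props(1)[OF NP])

text \<open>GRH covers 0 < Re s < 1; Re s > 1 is \<open>dirs_nonzero\<close> and the boundary line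
  is \<open>Lfun_nonzero_line_1\<close>.\<close>

lemma Lfun_zero_Re:
  assumes "Re s > 0" "Lfun \<psi> s = 0"
  shows "Re s = 1 / 2"
proof -
  consider "Re s > 1" | "Re s = 1" | "Re s < 1" by linarith
  thus ?thesis
  proof cases
    case 1
    thus ?thesis using Lfun_eq_dirs[OF NP, of s] dirs_nonzero[OF unitmult_dcharacter[OF char] 1] assms by simp
  next
    case 2
    have "s = 1 + \<i> * of_real (Im s)" using 2 by (simp add: complex_eq_iff)
    thus ?thesis using Lfun_nonzero_line_1[OF NP, of "Im s"] assms by metis
  next
    case 3
    thus ?thesis using GRH assms by (auto simp: GRH_L_def)
  qed
qed

lemma Lfun_2: "norm (Lfun \<psi> (2 + \<i> * of_real t)) \<ge> 1 / 3"
  using Lfun_eq_dirs[OF NP, of "2 + \<i> * of_real t"] dirs_lower_bound[OF unitmult_dcharacter[OF char], of "2 + \<i> * of_real t"]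
  by simp

definition crit :: "real \<Rightarrow> complex" where "crit \<gamma> = 1 / 2 + \<i> * of_real \<gamma>"

text \<open>Zeros are discrete. The gap is used to bound 1/|\<gamma>| by a constant times 1/(|t| +
  1) for zeros near height t, also when t is small.\<close>

lemma crit_zeros_away:
  "\<exists>\<gamma>0>0. \<forall>\<gamma>. Lfun \<psi> (crit \<gamma>) = 0 \<and> \<gamma> \<noteq> 0 \<longrightarrow> \<gamma>0 \<le> \<bar>\<gamma>\<bar>"
proof -
  have fin: "finite {z \<in> cball (1 / 2) 1. Lfun \<psi> z = 0}"
  proof (cases "Lfun \<psi> constant_on UNIV")
    case True
    hence "Lfun \<psi> z = Lfun \<psi> (2 + \<i> * of_real 0)" for z by (force simp: constant_on_def)
    hence "norm (Lfun \<psi> z) \<ge> 1 / 3" for z using Lfun_2[of 0] by metis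
    hence "Lfun \<psi> z \<noteq> 0" for z by (metis norm_zero zero_less_divide_1_iff zero_less_numeral not_le)
    hence "{z \<in> cball (1 / 2) 1. Lfun \<psi> z = 0} = {}" by auto
    thus ?thesis by (simp only: finite.emptyI)
  next
    case False
    show ?thesis
      by (rule holomorphic_compact_finite_zeros[OF Lfun_holo open_UNIV connected_UNIV _ _ False]) auto
  qed
  define N where "N = insert 1 ((\<lambda>z. norm (z - 1 / 2)) ` {z \<in> cball (1 / 2) 1. Lfun \<psi> z = 0} - {0})"
  have N: "finite N" "N \<noteq> {}" using fin by (auto simp: N_def)
  have "Min N > 0" using N by (subst Min_gr_iff) (auto simp: N_def)
  moreover have "Min N \<le> \<bar>\<gamma>\<bar>" if "Lfun \<psi> (crit \<gamma>) = 0" "\<gamma> \<noteq> 0" for \<gamma>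
  proof (cases "\<bar>\<gamma>\<bar> \<le> 1")
    case True
    have n: "norm (crit \<gamma> - 1 / 2) = \<bar>\<gamma>\<bar>" by (simp add: crit_def norm_mult)
    hence "crit \<gamma> \<in> {z \<in> cball (1 / 2) 1. Lfun \<psi> z = 0}" using that True by (simp add: dist_norm norm_minus_commute)
    from imageI[OF this, of "\<lambda>z. norm (z - 1 / 2)"]
    have "\<bar>\<gamma>\<bar> \<in> (\<lambda>z. norm (z - 1 / 2)) ` {z \<in> cball (1 / 2) 1. Lfun \<psi> z = 0}" unfolding n .
    moreover have "\<bar>\<gamma>\<bar> \<notin> {0}" using that by simp
    ultimately have "\<bar>\<gamma>\<bar> \<in> N" unfolding N_def by (intro insertI2 DiffI)
    thus ?thesis using N by simp
  next
    case False
    have "Min N \<le> 1" using N by (intro Min_le) (auto simp: N_def)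
    thus ?thesis using False by simp
  qed
  ultimately show ?thesis by blast
qed

text \<open>The radius 189/100 keeps the disc around 2 + it inside Re s \<ge> 1/10, where L grows
  linearly.\<close>

lemma local_log_bound:
  "\<exists>C>0. \<forall>t z. norm z \<le> 189/100 \<longrightarrow> norm (Lfun \<psi> (2 + \<i> * of_real t + z)) \<le> C * (\<bar>t\<bar> + 5)"
proof -
  obtain C where C: "C > 0" "\<forall>s. Re s \<ge> 1/10 \<longrightarrow> norm (Lfun \<psi> s) \<le> C * (1 + norm s)"
    using Lfun_props(3)[OF NP] by (elim exE conjE)
  have "norm (Lfun \<psi> (2 + \<i> * of_real t + z)) \<le> C * (\<bar>t\<bar> + 5)" if z: "norm z \<le> 189/100" for t :: real and z
  proof -
    have "norm (Lfun \<psi> (2 + \<i> * of_real t + z)) \<le> C * (1 + norm (2 + \<i> * of_real t + z))"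
      by (rule C(2)[rule_format]) (use z abs_Re_le_cmod[of z] in simp)
    also have "norm (2 + \<i> * of_real t + z) \<le> norm (2 :: complex) + norm (\<i> * of_real t) + norm z"
      by (intro norm_triangle_mono norm_triangle_ineq order_refl)
    hence "1 + norm (2 + \<i> * of_real t + z) \<le> \<bar>t\<bar> + 5" using z by (simp add: norm_mult)
    finally show ?thesis using C(1) by (simp add: mult_left_mono)
  qed
  thus ?thesis using C(1) by (intro exI[of _ C]) simp
qed

text \<open>\<open>local_partial_fractions\<close> around 2 + it with radii 17/10 < 18/10 < 189/100
  < 19/10, rewritten in the variable w = s - 1/2; by GRH the zeros involved are the points
  i\<gamma>. The disc of radius 16/10 reaches past the imaginary axis (the centre has Re w = 3/2).
  The Lipschitz bound for E serves heights near 0, where E will be divided by w.\<close>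

lemma local_logderiv:
  "\<exists>C>0. \<forall>t. \<exists>\<Gamma> n E. finite \<Gamma> \<and> (\<forall>\<gamma>\<in>\<Gamma>. Lfun \<psi> (crit \<gamma>) = 0 \<and> \<bar>\<gamma> - t\<bar> \<le> 2 \<and> int (n \<gamma>) = zorder (Lfun \<psi>) (crit \<gamma>)) \<and>
     (\<forall>\<gamma>. Lfun \<psi> (crit \<gamma>) = 0 \<and> \<bar>\<gamma> - t\<bar> < 1/2 \<longrightarrow> \<gamma> \<in> \<Gamma>) \<and>
     real (\<Sum>\<gamma>\<in>\<Gamma>. n \<gamma>) \<le> C * ln (\<bar>t\<bar> + 3) \<and>
     (\<forall>w. norm (w - 3/2 - \<i> * of_real t) \<le> 16/10 \<longrightarrow> norm (E w) \<le> C * ln (\<bar>t\<bar> + 3)) \<and>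
     (\<forall>w w'. norm (w - 3/2 - \<i> * of_real t) \<le> 16/10 \<and> norm (w' - 3/2 - \<i> * of_real t) \<le> 16/10 \<longrightarrow>
        norm (E w - E w') \<le> C * ln (\<bar>t\<bar> + 3) * norm (w - w')) \<and>
     (\<forall>w. norm (w - 3/2 - \<i> * of_real t) \<le> 16/10 \<and> Re w > 0 \<longrightarrow>
        deriv (Lfun \<psi>) (1/2 + w) / Lfun \<psi> (1/2 + w) = (\<Sum>\<gamma>\<in>\<Gamma>. of_nat (n \<gamma>) / (w - \<i> * of_real \<gamma>)) + E w)"
proof -
  obtain C1 where C1: "C1 > 0" "\<forall>t z. norm z \<le> 189/100 \<longrightarrow> norm (Lfun \<psi> (2 + \<i> * of_real t + z)) \<le> C1 * (\<bar>t\<bar> + 5)"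
    using local_log_bound by (elim exE conjE)
  have "\<exists>C>0. \<forall>f M. f holomorphic_on ball 0 (19/10) \<and> f 0 \<noteq> 0 \<and> (\<forall>z\<in>cball 0 (189/100). norm (f z) \<le> M) \<longrightarrow>
     (\<exists>n E. finite {\<rho>\<in>cball 0 (18/10). f \<rho> = 0} \<and>
       (\<forall>\<rho>\<in>cball 0 (18/10). f \<rho> = 0 \<longrightarrow> int (n \<rho>) = zorder f \<rho>) \<and>
       real (\<Sum>\<rho> | \<rho> \<in> cball 0 (18/10) \<and> f \<rho> = 0. n \<rho>) \<le> C * (ln (M / norm (f 0)) + 1) \<and>
       E holomorphic_on ball 0 (18/10) \<and> (\<forall>z\<in>cball 0 (17/10). norm (E z) \<le> C * (ln (M / norm (f 0)) + 1)) \<and>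
       (\<forall>z\<in>ball 0 (18/10). f z \<noteq> 0 \<longrightarrow>
          deriv f z / f z = (\<Sum>\<rho> | \<rho> \<in> cball 0 (18/10) \<and> f \<rho> = 0. of_nat (n \<rho>) / (z - \<rho>)) + E z))"
    by (rule local_partial_fractions) auto
  then obtain C2 where C2: "C2 > 0" "\<forall>f M. f holomorphic_on ball 0 (19/10) \<and> f 0 \<noteq> 0 \<and> (\<forall>z\<in>cball 0 (189/100). norm (f z) \<le> M) \<longrightarrow>
     (\<exists>n E. finite {\<rho>\<in>cball 0 (18/10). f \<rho> = 0} \<and>
       (\<forall>\<rho>\<in>cball 0 (18/10). f \<rho> = 0 \<longrightarrow> int (n \<rho>) = zorder f \<rho>) \<and>
       real (\<Sum>\<rho> | \<rho> \<in> cball 0 (18/10) \<and> f \<rho> = 0. n \<rho>) \<le> C2 * (ln (M / norm (f 0)) + 1) \<and>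
       E holomorphic_on ball 0 (18/10) \<and> (\<forall>z\<in>cball 0 (17/10). norm (E z) \<le> C2 * (ln (M / norm (f 0)) + 1)) \<and>
       (\<forall>z\<in>ball 0 (18/10). f z \<noteq> 0 \<longrightarrow>
          deriv f z / f z = (\<Sum>\<rho> | \<rho> \<in> cball 0 (18/10) \<and> f \<rho> = 0. of_nat (n \<rho>) / (z - \<rho>)) + E z))"
    by (elim exE conjE)
  \<comment> \<open>The factor 10 is 1/(17/10 - 16/10), lost in Cauchy's estimate for the Lipschitz
    bound.\<close>
  define D where "D = C2 * (\<bar>ln (6 * C1)\<bar> + 2) * 10"
  have D: "D > 0" "C2 * (\<bar>ln (6 * C1)\<bar> + 2) \<le> D" using C2(1) by (auto simp: D_def intro!: mult_pos_pos add_nonneg_pos)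
  have "\<exists>\<Gamma> n E. finite \<Gamma> \<and> (\<forall>\<gamma>\<in>\<Gamma>. Lfun \<psi> (crit \<gamma>) = 0 \<and> \<bar>\<gamma> - t\<bar> \<le> 2 \<and> int (n \<gamma>) = zorder (Lfun \<psi>) (crit \<gamma>)) \<and>
     (\<forall>\<gamma>. Lfun \<psi> (crit \<gamma>) = 0 \<and> \<bar>\<gamma> - t\<bar> < 1/2 \<longrightarrow> \<gamma> \<in> \<Gamma>) \<and>
     real (\<Sum>\<gamma>\<in>\<Gamma>. n \<gamma>) \<le> D * ln (\<bar>t\<bar> + 3) \<and>
     (\<forall>w. norm (w - 3/2 - \<i> * of_real t) \<le> 16/10 \<longrightarrow> norm (E w) \<le> D * ln (\<bar>t\<bar> + 3)) \<and>
     (\<forall>w w'. norm (w - 3/2 - \<i> * of_real t) \<le> 16/10 \<and> norm (w' - 3/2 - \<i> * of_real t) \<le> 16/10 \<longrightarrow>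
        norm (E w - E w') \<le> D * ln (\<bar>t\<bar> + 3) * norm (w - w')) \<and>
     (\<forall>w. norm (w - 3/2 - \<i> * of_real t) \<le> 16/10 \<and> Re w > 0 \<longrightarrow>
        deriv (Lfun \<psi>) (1/2 + w) / Lfun \<psi> (1/2 + w) = (\<Sum>\<gamma>\<in>\<Gamma>. of_nat (n \<gamma>) / (w - \<i> * of_real \<gamma>)) + E w)" for t :: real
  proof -
    define f where "f = (\<lambda>z. Lfun \<psi> (2 + \<i> * of_real t + z))"
    define M where "M = C1 * (\<bar>t\<bar> + 5)"
    have f: "f holomorphic_on A" for A unfolding f_def
      by (rule holomorphic_on_compose[OF _ Lfun_holo, unfolded o_def]) (auto intro!: holomorphic_intros)
    have f0: "norm (f 0) \<ge> 1/3" using Lfun_2[of t] by (simp add: f_def)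
    hence f0': "f 0 \<noteq> 0" by auto
    have fM: "\<forall>z\<in>cball 0 (189/100). norm (f z) \<le> M" using C1(2) by (simp add: f_def M_def)
    have A: "C2 * (ln (M / norm (f 0)) + 1) \<le> C2 * (\<bar>ln (6 * C1)\<bar> + 2) * ln (\<bar>t\<bar> + 3)"
    proof -
      have Mp: "M > 0" using C1(1) by (simp add: M_def)
      have "exp 1 < \<bar>t\<bar> + 3" using e_less_272 by linarith
      hence l: "ln (\<bar>t\<bar> + 3) \<ge> 1" by (metis exp_le_cancel_iff exp_ln less_eq_real_def exp_gt_zero less_trans)
      have "M / norm (f 0) \<le> (6 * C1) * (\<bar>t\<bar> + 3)"
      proof -
        have "M / norm (f 0) \<le> M / (1/3)" using f0 f0' Mp by (intro divide_left_mono) auto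
        also have "\<dots> \<le> (6 * C1) * (\<bar>t\<bar> + 3)" using C1(1) by (simp add: M_def algebra_simps)
        finally show ?thesis .
      qed
      hence "ln (M / norm (f 0)) \<le> ln ((6 * C1) * (\<bar>t\<bar> + 3))" using Mp f0' C1(1) by (subst ln_le_cancel_iff) auto
      also have "\<dots> = ln (6 * C1) + ln (\<bar>t\<bar> + 3)" using C1(1) by (subst ln_mult) auto
      finally have "ln (M / norm (f 0)) + 1 \<le> \<bar>ln (6 * C1)\<bar> * 1 + ln (\<bar>t\<bar> + 3) + 1" by linarith
      also have "\<dots> \<le> \<bar>ln (6 * C1)\<bar> * ln (\<bar>t\<bar> + 3) + ln (\<bar>t\<bar> + 3) + ln (\<bar>t\<bar> + 3)"
        using l by (intro add_mono mult_left_mono) auto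
      finally have "ln (M / norm (f 0)) + 1 \<le> (\<bar>ln (6 * C1)\<bar> + 2) * ln (\<bar>t\<bar> + 3)" by (simp add: algebra_simps)
      from mult_left_mono[OF this, of C2] C2(1) show ?thesis by (simp add: mult.assoc)
    qed
    define K where "K = C2 * (\<bar>ln (6 * C1)\<bar> + 2) * ln (\<bar>t\<bar> + 3)"
    define Z where "Z = {\<rho>. \<rho> \<in> cball 0 (18/10) \<and> f \<rho> = 0}"
    from C2(2)[rule_format, of f M] f f0' fM
    have "\<exists>n E. finite Z \<and>
       (\<forall>\<rho>\<in>cball 0 (18/10). f \<rho> = 0 \<longrightarrow> int (n \<rho>) = zorder f \<rho>) \<and>
       real (\<Sum>\<rho>\<in>Z. n \<rho>) \<le> C2 * (ln (M / norm (f 0)) + 1) \<and>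
       E holomorphic_on ball 0 (18/10) \<and> (\<forall>z\<in>cball 0 (17/10). norm (E z) \<le> C2 * (ln (M / norm (f 0)) + 1)) \<and>
       (\<forall>z\<in>ball 0 (18/10). f z \<noteq> 0 \<longrightarrow>
          deriv f z / f z = (\<Sum>\<rho>\<in>Z. of_nat (n \<rho>) / (z - \<rho>)) + E z)"
      unfolding Z_def by simp
    then obtain n E where nE: "finite Z" "\<forall>\<rho>\<in>cball 0 (18/10). f \<rho> = 0 \<longrightarrow> int (n \<rho>) = zorder f \<rho>"
      "real (\<Sum>\<rho>\<in>Z. n \<rho>) \<le> C2 * (ln (M / norm (f 0)) + 1)" "E holomorphic_on ball 0 (18/10)"
      "\<forall>z\<in>cball 0 (17/10). norm (E z) \<le> C2 * (ln (M / norm (f 0)) + 1)"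
      "\<forall>z\<in>ball 0 (18/10). f z \<noteq> 0 \<longrightarrow> deriv f z / f z = (\<Sum>\<rho>\<in>Z. of_nat (n \<rho>) / (z - \<rho>)) + E z"
      by (elim exE conjE)
    have EK: "norm (E z) \<le> K" if "z \<in> cball 0 (17/10)" for z
      using nE(5) that A unfolding K_def by force
    \<comment> \<open>The displacement from 2 + it to the critical point of ordinate \<gamma>. GRH
      makes g a bijection from ordinates onto the zeros in the disc.\<close>
    define g where "g = (\<lambda>\<gamma>. Complex (-3/2) (\<gamma> - t))"
    have gcrit: "2 + \<i> * of_real t + g \<gamma> = crit \<gamma>" for \<gamma> by (simp add: g_def crit_def complex_eq_iff)
    define \<Gamma> where "\<Gamma> = {\<gamma>. g \<gamma> \<in> Z}"
    have bij: "bij_betw g \<Gamma> Z"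
      unfolding bij_betw_def
    proof
      show "inj_on g \<Gamma>" by (auto simp: inj_on_def g_def)
      show "g ` \<Gamma> = Z"
      proof (intro equalityI subsetI)
        fix \<rho> assume \<rho>: "\<rho> \<in> Z"
        hence "norm \<rho> \<le> 18/10" "Lfun \<psi> (2 + \<i> * of_real t + \<rho>) = 0" by (auto simp: Z_def f_def)
        hence "Re (2 + \<i> * of_real t + \<rho>) = 1/2" using abs_Re_le_cmod[of \<rho>] by (intro Lfun_zero_Re) auto
        hence "\<rho> = g (Im \<rho> + t)" by (simp add: g_def complex_eq_iff)
        thus "\<rho> \<in> g ` \<Gamma>" using \<rho> unfolding \<Gamma>_def by (metis image_eqI mem_Collect_eq)
      qed (auto simp: \<Gamma>_def)
    qed
    have r1: "finite \<Gamma>" using bij_betw_finite[OF bij] nE(1) by simp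
    have r2: "Lfun \<psi> (crit \<gamma>) = 0 \<and> \<bar>\<gamma> - t\<bar> \<le> 2 \<and> int ((n \<circ> g) \<gamma>) = zorder (Lfun \<psi>) (crit \<gamma>)" if "\<gamma> \<in> \<Gamma>" for \<gamma>
    proof -
      have gZ: "g \<gamma> \<in> cball 0 (18/10)" "f (g \<gamma>) = 0" using that by (auto simp: \<Gamma>_def Z_def)
      have "\<bar>\<gamma> - t\<bar> \<le> 2" using gZ(1) abs_Im_le_cmod[of "g \<gamma>"] by (simp add: g_def)
      moreover have "zorder f (g \<gamma>) = zorder (Lfun \<psi>) (crit \<gamma>)"
        using zorder_shift[of f "g \<gamma>"] zorder_shift[of "Lfun \<psi>" "crit \<gamma>"]
        by (simp add: f_def gcrit[symmetric] add_ac)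
      ultimately show ?thesis using nE(2) gZ gcrit[of \<gamma>] by (simp add: f_def)
    qed
    have r3: "\<gamma> \<in> \<Gamma>" if "Lfun \<psi> (crit \<gamma>) = 0" "\<bar>\<gamma> - t\<bar> < 1/2" for \<gamma>
    proof -
      have "(\<gamma> - t)\<^sup>2 < (1/2)\<^sup>2" using that(2) power_strict_mono[of "\<bar>\<gamma> - t\<bar>" "1/2" 2] by simp
      hence "norm (g \<gamma>) \<le> 18/10" unfolding cmod_def g_def by (intro real_le_lsqrt) (auto simp: power2_eq_square)
      thus ?thesis using that by (simp add: \<Gamma>_def Z_def f_def gcrit)
    qed
    have "(\<Sum>\<gamma>\<in>\<Gamma>. (n \<circ> g) \<gamma>) = (\<Sum>\<rho>\<in>Z. n \<rho>)"
      using sum.reindex_bij_betw[OF bij, of n] by simp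
    hence r4: "real (\<Sum>\<gamma>\<in>\<Gamma>. (n \<circ> g) \<gamma>) \<le> K" using nE(3) A unfolding K_def by simp
    define E2 where "E2 = (\<lambda>w. E (w - 3/2 - \<i> * of_real t))"
    have r5: "norm (E2 w) \<le> K" if "norm (w - 3/2 - \<i> * of_real t) \<le> 16/10" for w
      unfolding E2_def by (rule EK) (use that in simp)
    have r6: "norm (E2 w - E2 w') \<le> K * 10 * norm (w - w')"
      if "norm (w - 3/2 - \<i> * of_real t) \<le> 16/10" "norm (w' - 3/2 - \<i> * of_real t) \<le> 16/10" for w w'
    proof -
      have "norm (E2 w - E2 w') \<le> K / (17/10 - 16/10) * norm ((w - 3/2 - \<i> * of_real t) - (w' - 3/2 - \<i> * of_real t))"
        unfolding E2_def by (rule cauchy_lipschitz[OF nE(4) _ _ _ EK]) (use that in auto)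
      thus ?thesis by (simp add: mult.commute)
    qed
    have r7: "deriv (Lfun \<psi>) (1/2 + w) / Lfun \<psi> (1/2 + w) = (\<Sum>\<gamma>\<in>\<Gamma>. of_nat ((n \<circ> g) \<gamma>) / (w - \<i> * of_real \<gamma>)) + E2 w"
      if w: "norm (w - 3/2 - \<i> * of_real t) \<le> 16/10" "Re w > 0" for w
    proof -
      define z where "z = w - 3/2 - \<i> * of_real t"
      have z2: "2 + \<i> * of_real t + z = 1/2 + w" by (simp add: z_def)
      have "Lfun \<psi> (1/2 + w) \<noteq> 0" using Lfun_zero_Re[of "1/2 + w"] w by auto
      hence "f z \<noteq> 0" by (simp add: f_def z2)
      moreover have "z \<in> ball 0 (18/10)" using w by (simp add: z_def)
      ultimately have "deriv f z / f z = (\<Sum>\<rho>\<in>Z. of_nat (n \<rho>) / (z - \<rho>)) + E z" using nE(6) by blast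
      moreover have "deriv f z = deriv (Lfun \<psi>) (1/2 + w)"
      proof (rule DERIV_imp_deriv)
        have "(f has_field_derivative deriv (Lfun \<psi>) (2 + \<i> * of_real t + z) * 1) (at z)"
          unfolding f_def by (rule DERIV_chain2[OF holomorphic_derivI[OF Lfun_holo open_UNIV UNIV_I]])
            (auto intro!: derivative_eq_intros)
        thus "(f has_field_derivative deriv (Lfun \<psi>) (1/2 + w)) (at z)" by (simp add: z2)
      qed
      moreover have "(\<Sum>\<rho>\<in>Z. of_nat (n \<rho>) / (z - \<rho>)) = (\<Sum>\<gamma>\<in>\<Gamma>. of_nat ((n \<circ> g) \<gamma>) / (z - g \<gamma>))"
        using sum.reindex_bij_betw[OF bij, of "\<lambda>\<rho>. of_nat (n \<rho>) / (z - \<rho>)"] by simp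
      moreover have "z - g \<gamma> = w - \<i> * of_real \<gamma>" for \<gamma> by (simp add: z_def g_def complex_eq_iff)
      ultimately show ?thesis by (simp add: f_def z2 E2_def z_def[symmetric])
    qed
    have l0: "ln (\<bar>t\<bar> + 3) \<ge> 0" by simp
    hence "0 \<le> K" using C2(1) by (auto simp: K_def intro!: mult_nonneg_nonneg)
    moreover have "D * ln (\<bar>t\<bar> + 3) = K * 10" by (simp add: D_def K_def mult_ac)
    ultimately have KD: "K \<le> D * ln (\<bar>t\<bar> + 3)" "K * 10 \<le> D * ln (\<bar>t\<bar> + 3)" by simp_all
    show ?thesis
    proof (intro exI[of _ \<Gamma>] exI[of _ "n \<circ> g"] exI[of _ E2] conjI ballI allI impI)
      show "real (\<Sum>\<gamma>\<in>\<Gamma>. (n \<circ> g) \<gamma>) \<le> D * ln (\<bar>t\<bar> + 3)" using r4 KD(1) by linarith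
      show "norm (E2 w) \<le> D * ln (\<bar>t\<bar> + 3)" if "norm (w - 3/2 - \<i> * of_real t) \<le> 16/10" for w
        using r5[OF that] KD(1) by linarith
      show "norm (E2 w - E2 w') \<le> D * ln (\<bar>t\<bar> + 3) * norm (w - w')"
        if "norm (w - 3/2 - \<i> * of_real t) \<le> 16/10 \<and> norm (w' - 3/2 - \<i> * of_real t) \<le> 16/10" for w w'
        using r6[of w w'] that mult_right_mono[OF KD(2), of "norm (w - w')"] by simp
    qed (use r1 r2 r3 r7 in blast)+
  qed
  with D(1) show ?thesis by (intro exI[of _ D] conjI allI)
qed

end


section \<open>Size and pole structure of the Laplace transform\<close>

definition lam :: "real \<Rightarrow> real" where "lam t = ln (\<bar>t\<bar> + 3) / (\<bar>t\<bar> + 1)"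

lemma lam_pos: "lam t > 0"
  by (auto simp: lam_def)

lemma ln_eq_lam: "ln (\<bar>t\<bar> + 3) = lam t * (\<bar>t\<bar> + 1)"
  by (simp add: lam_def)

lemma inverse_le_lam: "1 / (\<bar>t\<bar> + 1) \<le> lam t"
proof -
  have "exp 1 < \<bar>t\<bar> + 3" using e_less_272 by linarith
  hence "1 \<le> ln (\<bar>t\<bar> + 3)" by (subst ln_ge_iff) auto
  thus ?thesis by (auto simp: lam_def intro!: divide_right_mono)
qed

context grh_char
begin

abbreviation m where "m \<equiv> m_chi \<psi>"

text \<open>This will be the Laplace transform of \<open>ff\<close> (see \<open>laplace_ff\<close>).
  The division by w comes from summation, and m/w removes the zero at 1/2, whose double pole at w =
  0 would make \<open>ff\<close> drift linearly.\<close>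

definition FF :: "complex \<Rightarrow> complex" where
  "FF w = - (deriv (Lfun \<psi>) (1/2 + w) / Lfun \<psi> (1/2 + w) - of_nat m / w) / w"

lemma m_eq_0: "Lfun \<psi> (1/2) \<noteq> 0 \<Longrightarrow> m = 0"
  unfolding m_chi_def using Lfun_holo[of UNIV]
  by (subst zorder_eq_0I) (auto simp: analytic_on_holomorphic)

text \<open>Divide the local formula for L'/L by w and split 1/(w(w - i\<gamma>)) = (1/(i\<gamma>))
  (1/(w - i\<gamma>) - 1/w): only simple poles on the imaginary axis remain, and their coefficients
  have total size O(log(|t|+3)/(|t|+1)). Keeping the poles explicit, instead of bounding
  \<open>FF\<close> by its absolute value, is what lets Re w tend to 0 later.\<close>

lemma FF_decomposition:
  "\<exists>C>0. \<forall>t. \<exists>J c E. finite J \<and> (\<Sum>\<gamma>\<in>J. norm (c \<gamma>)) \<le> C * lam t \<and>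
     (\<forall>w. 0 < Re w \<and> Re w \<le> 1 \<and> \<bar>Im w - t\<bar> \<le> 1/4 \<longrightarrow>
        FF w = (\<Sum>\<gamma>\<in>J. c \<gamma> / (w - \<i> * of_real \<gamma>)) + E w \<and> norm (E w) \<le> C * lam t)"
proof -
  obtain C0 where C0: "C0 > 0" and ex: "\<forall>t. \<exists>\<Gamma> n E. finite \<Gamma> \<and> (\<forall>\<gamma>\<in>\<Gamma>. Lfun \<psi> (crit \<gamma>) = 0 \<and> \<bar>\<gamma> - t\<bar> \<le> 2 \<and> int (n \<gamma>) = zorder (Lfun \<psi>) (crit \<gamma>)) \<and>
     (\<forall>\<gamma>. Lfun \<psi> (crit \<gamma>) = 0 \<and> \<bar>\<gamma> - t\<bar> < 1/2 \<longrightarrow> \<gamma> \<in> \<Gamma>) \<and>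
     real (\<Sum>\<gamma>\<in>\<Gamma>. n \<gamma>) \<le> C0 * ln (\<bar>t\<bar> + 3) \<and>
     (\<forall>w. norm (w - 3/2 - \<i> * of_real t) \<le> 16/10 \<longrightarrow> norm (E w) \<le> C0 * ln (\<bar>t\<bar> + 3)) \<and>
     (\<forall>w w'. norm (w - 3/2 - \<i> * of_real t) \<le> 16/10 \<and> norm (w' - 3/2 - \<i> * of_real t) \<le> 16/10 \<longrightarrow>
        norm (E w - E w') \<le> C0 * ln (\<bar>t\<bar> + 3) * norm (w - w')) \<and>
     (\<forall>w. norm (w - 3/2 - \<i> * of_real t) \<le> 16/10 \<and> Re w > 0 \<longrightarrow>
        deriv (Lfun \<psi>) (1/2 + w) / Lfun \<psi> (1/2 + w) = (\<Sum>\<gamma>\<in>\<Gamma>. of_nat (n \<gamma>) / (w - \<i> * of_real \<gamma>)) + E w)"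
    using local_logderiv by (elim exE conjE)
  obtain \<gamma>0 where g0: "\<gamma>0 > 0" "\<forall>\<gamma>. Lfun \<psi> (crit \<gamma>) = 0 \<and> \<gamma> \<noteq> 0 \<longrightarrow> \<gamma>0 \<le> \<bar>\<gamma>\<bar>"
    using crit_zeros_away by (elim exE conjE)
  define K where "K = 1 + 3 / \<gamma>0"
  have K: "K \<ge> 1" using g0 by (simp add: K_def)
  define C where "C = 2 * C0 * K + 2 * C0 + 6 * C0 + 36 * real m"
  have Cb: "C > 0" "2 * C0 * K + 2 * C0 \<le> C" "6 * C0 + 36 * real m \<le> C" "2 * C0 \<le> C" 
    using C0 K by (auto simp: C_def intro!: add_pos_nonneg mult_pos_pos)
  have "\<exists>J c E. finite J \<and> (\<Sum>\<gamma>\<in>J. norm (c \<gamma>)) \<le> C * lam t \<and>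
     (\<forall>w. 0 < Re w \<and> Re w \<le> 1 \<and> \<bar>Im w - t\<bar> \<le> 1/4 \<longrightarrow>
        FF w = (\<Sum>\<gamma>\<in>J. c \<gamma> / (w - \<i> * of_real \<gamma>)) + E w \<and> norm (E w) \<le> C * lam t)" for t
  proof -
    obtain \<Gamma> n E where fin: "finite \<Gamma>" 
     and G: "\<forall>\<gamma>\<in>\<Gamma>. Lfun \<psi> (crit \<gamma>) = 0 \<and> \<bar>\<gamma> - t\<bar> \<le> 2 \<and> int (n \<gamma>) = zorder (Lfun \<psi>) (crit \<gamma>)"
     and G0: "\<forall>\<gamma>. Lfun \<psi> (crit \<gamma>) = 0 \<and> \<bar>\<gamma> - t\<bar> < 1/2 \<longrightarrow> \<gamma> \<in> \<Gamma>"
     and N: "real (\<Sum>\<gamma>\<in>\<Gamma>. n \<gamma>) \<le> C0 * ln (\<bar>t\<bar> + 3)"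
     and E1: "\<forall>w. norm (w - 3/2 - \<i> * of_real t) \<le> 16/10 \<longrightarrow> norm (E w) \<le> C0 * ln (\<bar>t\<bar> + 3)"
     and E2: "\<forall>w w'. norm (w - 3/2 - \<i> * of_real t) \<le> 16/10 \<and> norm (w' - 3/2 - \<i> * of_real t) \<le> 16/10 \<longrightarrow>
        norm (E w - E w') \<le> C0 * ln (\<bar>t\<bar> + 3) * norm (w - w')"
     and LD: "\<forall>w. norm (w - 3/2 - \<i> * of_real t) \<le> 16/10 \<and> Re w > 0 \<longrightarrow>
        deriv (Lfun \<psi>) (1/2 + w) / Lfun \<psi> (1/2 + w) = (\<Sum>\<gamma>\<in>\<Gamma>. of_nat (n \<gamma>) / (w - \<i> * of_real \<gamma>)) + E w"
      using ex[rule_format, of t] by (elim exE conjE)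
    define \<Gamma>' where "\<Gamma>' = \<Gamma> - {0}"
    define S0 where "S0 = (\<Sum>\<gamma>\<in>\<Gamma>'. of_nat (n \<gamma>) / (\<i> * of_real \<gamma>))"
    \<comment> \<open>Near height 0 the factor 1/w is not small and E(w)/w has a pole, which is
      separated as E(0)/w. Away from 0 one simply uses |w| \<ge> (|t| + 1)/6.\<close>
    define low where "low \<longleftrightarrow> \<bar>t\<bar> < 1/2"
    \<comment> \<open>The part of m/w that is not cancelled by the local zeros. It is 0 when the
      central point is among them, and for small t also otherwise, since then L(1/2) is not 0 and m
      = 0.\<close>
    define mm where "mm = (if 0 \<in> \<Gamma> then 0 else of_nat m :: complex)"
    \<comment> \<open>The pole at 0 collects the terms -1/w from all partial fractions and, at low
      height, -E(0).\<close>
    define c where "c = (\<lambda>\<gamma>. if \<gamma> = 0 then S0 - (if low then E 0 else 0) else - (of_nat (n \<gamma>) / (\<i> * of_real \<gamma>)))"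
    define E' where "E' = (\<lambda>w. if low then - ((E w - E 0) / w) else mm / w\<^sup>2 - E w / w)"
    have fin': "finite \<Gamma>'" "0 \<notin> \<Gamma>'" using fin by (auto simp: \<Gamma>'_def)
    have c0: "crit 0 = 1/2" by (simp add: crit_def)
    have n0: "of_nat (n 0) = (of_nat m :: complex)" if "0 \<in> \<Gamma>"
      using G that by (auto simp: c0 m_chi_def)
    have mm0: "mm = 0" if low
      using G0[rule_format, of 0] that m_eq_0 by (auto simp: mm_def low_def c0)
    have t0: "norm (0 - 3/2 - \<i> * of_real t) \<le> 16/10" if low
    proof -
      have "\<bar>t\<bar>\<^sup>2 \<le> (1/2)\<^sup>2" using that unfolding low_def by (intro power_mono) auto
      thus ?thesis unfolding cmod_def by (intro real_le_lsqrt) (auto simp: power2_eq_square)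
    qed
    define W where "W = {w. 0 < Re w \<and> Re w \<le> 1 \<and> \<bar>Im w - t\<bar> \<le> 1/4}"
    \<comment> \<open>The box fits into the disc of radius 16/10 since (3/2)^2 + (1/4)^2 <
      (16/10)^2.\<close>
    have wb: "norm (w - 3/2 - \<i> * of_real t) \<le> 16/10" if "w \<in> W" for w
    proof -
      have "\<bar>Re w - 3/2\<bar>\<^sup>2 \<le> (3/2)\<^sup>2" "\<bar>Im w - t\<bar>\<^sup>2 \<le> (1/4)\<^sup>2"
        using that unfolding W_def by (intro power_mono; simp)+
      thus ?thesis unfolding cmod_def by (intro real_le_lsqrt) (auto simp: power2_eq_square)
    qed
    have wlow: "(\<bar>t\<bar> + 1) / 6 \<le> norm w" if "w \<in> W" "\<not> low" for w
    proof -
      have "(\<bar>t\<bar> + 1) / 6 \<le> \<bar>Im w\<bar>" using that unfolding W_def low_def by (auto simp: abs_if split: if_splits)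
      thus ?thesis using abs_Im_le_cmod[of w] by linarith
    qed
    have lam1: "C0 * ln (\<bar>t\<bar> + 3) = C0 * lam t * (\<bar>t\<bar> + 1)" by (simp add: ln_eq_lam)
    have lamlow: "C0 * ln (\<bar>t\<bar> + 3) \<le> 2 * C0 * lam t" if low
    proof -
      have "C0 * lam t * (\<bar>t\<bar> + 1) \<le> C0 * lam t * 2"
        using that C0 lam_pos[of t] unfolding low_def by (intro mult_left_mono) auto
      thus ?thesis unfolding lam1 by simp
    qed
    have formula: "FF w = (\<Sum>\<gamma>\<in>insert 0 \<Gamma>'. c \<gamma> / (w - \<i> * of_real \<gamma>)) + E' w" if w: "w \<in> W" for w
    proof -
      have w0: "w \<noteq> 0" "Re w > 0" using w by (auto simp: W_def)
      have wg: "w - \<i> * of_real \<gamma> \<noteq> 0" for \<gamma> using w0 by (auto simp: complex_eq_iff)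
      have "(\<Sum>\<gamma>\<in>\<Gamma>. of_nat (n \<gamma>) / (w - \<i> * of_real \<gamma>)) = (\<Sum>\<gamma>\<in>\<Gamma>'. of_nat (n \<gamma>) / (w - \<i> * of_real \<gamma>)) + (of_nat m - mm) / w"
      proof (cases "0 \<in> \<Gamma>")
        case True
        thus ?thesis using fin n0 unfolding \<Gamma>'_def mm_def by (subst sum.remove[of _ 0]) auto
      qed (auto simp: \<Gamma>'_def mm_def)
      hence "deriv (Lfun \<psi>) (1/2 + w) / Lfun \<psi> (1/2 + w) - of_nat m / w = 
          (\<Sum>\<gamma>\<in>\<Gamma>'. of_nat (n \<gamma>) / (w - \<i> * of_real \<gamma>)) - mm / w + E w"
        using LD wb[OF w] w0 by (simp add: diff_divide_distrib)
      hence "FF w = - ((\<Sum>\<gamma>\<in>\<Gamma>'. of_nat (n \<gamma>) / (w - \<i> * of_real \<gamma>)) - mm / w + E w) / w"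
        unfolding FF_def by (rule arg_cong)
      also have "\<dots> = - ((\<Sum>\<gamma>\<in>\<Gamma>'. of_nat (n \<gamma>) / (w - \<i> * of_real \<gamma>)) / w) + mm / w\<^sup>2 - E w / w"
        by (simp only: power2_eq_square diff_divide_distrib add_divide_distrib minus_divide_left minus_add_distrib minus_diff_eq divide_divide_eq_left) simp
      also have "(\<Sum>\<gamma>\<in>\<Gamma>'. of_nat (n \<gamma>) / (w - \<i> * of_real \<gamma>)) / w = (\<Sum>\<gamma>\<in>\<Gamma>'. of_nat (n \<gamma>) / (w - \<i> * of_real \<gamma>) / w)"
        by (rule sum_divide_distrib)
      also have "(\<Sum>\<gamma>\<in>\<Gamma>'. of_nat (n \<gamma>) / (w - \<i> * of_real \<gamma>) / w) = 
          (\<Sum>\<gamma>\<in>\<Gamma>'. (of_nat (n \<gamma>) / (\<i> * of_real \<gamma>)) / (w - \<i> * of_real \<gamma>) - (of_nat (n \<gamma>) / (\<i> * of_real \<gamma>)) / w)"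
      proof (rule sum.cong)
        fix \<gamma> assume "\<gamma> \<in> \<Gamma>'"
        hence "\<i> * complex_of_real \<gamma> \<noteq> 0" by (auto simp: \<Gamma>'_def)
        thus "of_nat (n \<gamma>) / (w - \<i> * of_real \<gamma>) / w = (of_nat (n \<gamma>) / (\<i> * of_real \<gamma>)) / (w - \<i> * of_real \<gamma>) - (of_nat (n \<gamma>) / (\<i> * of_real \<gamma>)) / w"
          using w0 wg[of \<gamma>] by (simp add: divide_simps) (simp add: algebra_simps)
      qed simp
      also have "- \<dots> + mm / w\<^sup>2 - E w / w = (\<Sum>\<gamma>\<in>\<Gamma>'. c \<gamma> / (w - \<i> * of_real \<gamma>)) + S0 / w + mm / w\<^sup>2 - E w / w"
      proof -
        have "(\<Sum>\<gamma>\<in>\<Gamma>'. c \<gamma> / (w - \<i> * of_real \<gamma>)) = - (\<Sum>\<gamma>\<in>\<Gamma>'. (of_nat (n \<gamma>) / (\<i> * of_real \<gamma>)) / (w - \<i> * of_real \<gamma>))"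
          unfolding sum_negf[symmetric] by (rule sum.cong) (use fin'(2) in \<open>auto simp: c_def\<close>)
        thus ?thesis by (simp only: sum_subtractf S0_def sum_divide_distrib) simp
      qed
      also have "\<dots> = (\<Sum>\<gamma>\<in>insert 0 \<Gamma>'. c \<gamma> / (w - \<i> * of_real \<gamma>)) + E' w"
      proof -
        have "c 0 = S0 - (if low then E 0 else 0)" by (simp add: c_def)
        thus ?thesis using fin' mm0 by (cases low) (simp_all add: E'_def diff_divide_distrib)
      qed
      finally show ?thesis .
    qed
    have bound: "norm (E' w) \<le> C * lam t" if w: "w \<in> W" for w
    proof (cases low)
      case True
      have w0: "norm w > 0" using w by (auto simp: W_def)
      have "norm (E w - E 0) \<le> C0 * ln (\<bar>t\<bar> + 3) * norm (w - 0)"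
        using E2 wb[OF w] t0[OF True] by blast
      hence "norm (E' w) \<le> C0 * ln (\<bar>t\<bar> + 3)"
        using w0 True by (simp add: E'_def norm_divide pos_divide_le_eq)
      also have "\<dots> \<le> 2 * C0 * lam t" by (rule lamlow[OF True])
      also have "\<dots> \<le> C * lam t" using Cb(4) lam_pos[of t] by (intro mult_right_mono) auto
      finally show ?thesis .
    next
      case False
      note wl = wlow[OF w False]
      have "norm (E w / w) \<le> (C0 * lam t * (\<bar>t\<bar> + 1)) / ((\<bar>t\<bar> + 1) / 6)"
        unfolding norm_divide using E1 wb[OF w] wl lam1 C0 by (intro frac_le) (auto intro!: mult_nonneg_nonneg less_imp_le[OF lam_pos])
      also have "\<dots> = 6 * C0 * lam t" by (simp add: field_simps)
      finally have b1: "norm (E w / w) \<le> 6 * C0 * lam t" .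
      have "norm (mm / w\<^sup>2) \<le> real m / ((\<bar>t\<bar> + 1) / 6)\<^sup>2"
        unfolding norm_divide norm_power using wl by (intro frac_le power_mono zero_less_power) (auto simp: mm_def)
      also have "\<dots> = 36 * real m * (1 / (\<bar>t\<bar> + 1)) * (1 / (\<bar>t\<bar> + 1))" by (simp add: power2_eq_square divide_simps)
      also have "\<dots> \<le> 36 * real m * lam t * 1" by (intro mult_mono inverse_le_lam mult_nonneg_nonneg) (auto intro: less_imp_le[OF lam_pos])
      finally have b2: "norm (mm / w\<^sup>2) \<le> 36 * real m * lam t" by simp
      have "norm (E' w) \<le> (6 * C0 + 36 * real m) * lam t"
        using b1 b2 False norm_triangle_ineq4[of "mm / w\<^sup>2" "E w / w"] by (simp add: E'_def algebra_simps)
      also have "\<dots> \<le> C * lam t" using Cb(3) lam_pos[of t] by (intro mult_right_mono) auto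
      finally show ?thesis .
    qed
    have csum: "(\<Sum>\<gamma>\<in>\<Gamma>'. norm (of_nat (n \<gamma>) / (\<i> * of_real \<gamma>) :: complex)) \<le> C0 * K * lam t"
    proof -
      have "norm (of_nat (n \<gamma>) / (\<i> * of_real \<gamma>) :: complex) \<le> real (n \<gamma>) * (K / (\<bar>t\<bar> + 1))" if g: "\<gamma> \<in> \<Gamma>'" for \<gamma>
      proof -
        have g1: "\<gamma>0 \<le> \<bar>\<gamma>\<bar>" "\<gamma> \<noteq> 0" "\<bar>\<gamma> - t\<bar> \<le> 2" using G g0(2) g by (auto simp: \<Gamma>'_def)
        have "3 \<le> 3 / \<gamma>0 * \<bar>\<gamma>\<bar>" using g1 g0(1) by (simp add: field_simps)
        moreover have "\<bar>t\<bar> + 1 \<le> \<bar>\<gamma>\<bar> + 3" using g1 by linarith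
        ultimately have "\<bar>t\<bar> + 1 \<le> K * \<bar>\<gamma>\<bar>" by (simp add: K_def algebra_simps)
        moreover have p: "0 < \<bar>\<gamma>\<bar>" "0 < \<bar>t\<bar> + 1" using g1 by auto
        ultimately have "1 / \<bar>\<gamma>\<bar> \<le> K / (\<bar>t\<bar> + 1)"
          by (simp only: pos_le_divide_eq[OF p(2)]) (simp add: pos_divide_le_eq[OF p(1)])
        from mult_left_mono[OF this, of "real (n \<gamma>)"] show ?thesis by (simp add: norm_divide norm_mult)
      qed
      hence "(\<Sum>\<gamma>\<in>\<Gamma>'. norm (of_nat (n \<gamma>) / (\<i> * of_real \<gamma>) :: complex)) \<le> (\<Sum>\<gamma>\<in>\<Gamma>'. real (n \<gamma>) * (K / (\<bar>t\<bar> + 1)))"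
        by (rule sum_mono)
      also have "\<dots> = (\<Sum>\<gamma>\<in>\<Gamma>'. real (n \<gamma>)) * (K / (\<bar>t\<bar> + 1))" by (rule sum_distrib_right[symmetric])
      also have "\<dots> \<le> (C0 * ln (\<bar>t\<bar> + 3)) * (K / (\<bar>t\<bar> + 1))"
      proof (rule mult_right_mono)
        have "(\<Sum>\<gamma>\<in>\<Gamma>'. real (n \<gamma>)) \<le> (\<Sum>\<gamma>\<in>\<Gamma>. real (n \<gamma>))"
          using fin by (intro sum_mono2) (auto simp: \<Gamma>'_def)
        thus "(\<Sum>\<gamma>\<in>\<Gamma>'. real (n \<gamma>)) \<le> C0 * ln (\<bar>t\<bar> + 3)" using N by simp
      qed (use K in auto)
      also have "\<dots> = C0 * K * lam t" by (simp add: lam_def)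
      finally show ?thesis .
    qed
    have "(\<Sum>\<gamma>\<in>insert 0 \<Gamma>'. norm (c \<gamma>)) = norm (c 0) + (\<Sum>\<gamma>\<in>\<Gamma>'. norm (of_nat (n \<gamma>) / (\<i> * of_real \<gamma>) :: complex))"
    proof -
      have "(\<Sum>\<gamma>\<in>\<Gamma>'. norm (c \<gamma>)) = (\<Sum>\<gamma>\<in>\<Gamma>'. norm (of_nat (n \<gamma>) / (\<i> * of_real \<gamma>) :: complex))"
        using fin'(2) by (intro sum.cong) (auto simp: c_def)
      thus ?thesis using fin' by simp
    qed
    also have "norm (c 0) \<le> C0 * K * lam t + 2 * C0 * lam t"
    proof -
      have "norm S0 \<le> C0 * K * lam t" unfolding S0_def by (rule order_trans[OF norm_sum csum])
      moreover have "norm (if low then E 0 else 0) \<le> 2 * C0 * lam t"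
      proof (cases low)
        case True
        thus ?thesis using E1[rule_format, OF t0[OF True]] lamlow by simp
      qed (use C0 lam_pos[of t] in auto)
      ultimately show ?thesis using norm_triangle_ineq4[of S0 "if low then E 0 else 0"] by (simp add: c_def)
    qed
    also note csum
    also have "C0 * K * lam t + 2 * C0 * lam t + C0 * K * lam t = (2 * C0 * K + 2 * C0) * lam t" by (simp add: algebra_simps)
    also have "\<dots> \<le> C * lam t" using Cb(2) lam_pos[of t] by (intro mult_right_mono) auto
    finally have csum': "(\<Sum>\<gamma>\<in>insert 0 \<Gamma>'. norm (c \<gamma>)) \<le> C * lam t" by simp
    show ?thesis
      using fin' csum' formula bound unfolding W_def
      by (intro exI[of _ "insert 0 \<Gamma>'"] exI[of _ c] exI[of _ E'] conjI allI impI) simp_all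
  qed
  with Cb(1) show ?thesis by (intro exI[of _ C] conjI allI)
qed

text \<open>All poles in \<open>FF_decomposition\<close> lie on the imaginary axis, hence at
  distance at least Re w.\<close>

lemma FF_bound:
  "\<exists>C>0. \<forall>w. 0 < Re w \<and> Re w \<le> 1 \<longrightarrow> norm (FF w) \<le> C * lam (Im w) / Re w"
proof -
  obtain C where C: "C > 0" and ex: "\<forall>t. \<exists>J c E. finite J \<and> (\<Sum>\<gamma>\<in>J. norm (c \<gamma>)) \<le> C * lam t \<and>
     (\<forall>w. 0 < Re w \<and> Re w \<le> 1 \<and> \<bar>Im w - t\<bar> \<le> 1/4 \<longrightarrow>
        FF w = (\<Sum>\<gamma>\<in>J. c \<gamma> / (w - \<i> * of_real \<gamma>)) + E w \<and> norm (E w) \<le> C * lam t)"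
    using FF_decomposition by (elim exE conjE)
  have "norm (FF w) \<le> (2 * C) * lam (Im w) / Re w" if w: "0 < Re w" "Re w \<le> 1" for w
  proof -
    obtain J c E where J: "finite J" "(\<Sum>\<gamma>\<in>J. norm (c \<gamma>)) \<le> C * lam (Im w)" 
      "\<forall>w'. 0 < Re w' \<and> Re w' \<le> 1 \<and> \<bar>Im w' - Im w\<bar> \<le> 1/4 \<longrightarrow>
        FF w' = (\<Sum>\<gamma>\<in>J. c \<gamma> / (w' - \<i> * of_real \<gamma>)) + E w' \<and> norm (E w') \<le> C * lam (Im w)"
      using ex[rule_format, of "Im w"] by (elim exE conjE)
    have F: "FF w = (\<Sum>\<gamma>\<in>J. c \<gamma> / (w - \<i> * of_real \<gamma>)) + E w" "norm (E w) \<le> C * lam (Im w)"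
      using J(3)[rule_format, of w] w by simp_all
    have "norm (\<Sum>\<gamma>\<in>J. c \<gamma> / (w - \<i> * of_real \<gamma>)) \<le> (\<Sum>\<gamma>\<in>J. norm (c \<gamma>) / Re w)"
    proof (rule sum_norm_le)
      fix \<gamma>
      have "Re w \<le> norm (w - \<i> * of_real \<gamma>)" using abs_Re_le_cmod[of "w - \<i> * of_real \<gamma>"] by simp
      thus "norm (c \<gamma> / (w - \<i> * of_real \<gamma>)) \<le> norm (c \<gamma>) / Re w"
        unfolding norm_divide using w by (intro divide_left_mono mult_pos_pos) auto
    qed
    also have "\<dots> = (\<Sum>\<gamma>\<in>J. norm (c \<gamma>)) / Re w" by (simp add: sum_divide_distrib)
    also have "\<dots> \<le> C * lam (Im w) / Re w" using J w by (intro divide_right_mono) auto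
    finally have "norm (FF w) \<le> C * lam (Im w) / Re w + C * lam (Im w)"
      unfolding F(1) using F(2) by (intro norm_triangle_le) linarith
    moreover have "C * lam (Im w) \<le> C * lam (Im w) / Re w"
      using w C lam_pos[of "Im w"] by (simp add: pos_le_divide_eq mult_left_le)
    ultimately have "norm (FF w) \<le> C * lam (Im w) / Re w + C * lam (Im w) / Re w" by linarith
    thus ?thesis by (simp add: add_divide_distrib[symmetric])
  qed
  thus ?thesis using C by (intro exI[of _ "2 * C"]) simp
qed

end


subsection \<open>Fourier integrals\<close>

definition ft :: "(real \<Rightarrow> complex) \<Rightarrow> real \<Rightarrow> complex" where
  "ft k t = (LINT y|lborel. k y * cis (t * y))"

lemma lebesgue_norm_bound:
  fixes f :: "'a \<Rightarrow> 'b :: {banach, second_countable_topology}"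
  assumes "integrable M g" "\<And>x. norm (f x) \<le> g x"
  shows "norm (LINT x|M. f x) \<le> (LINT x|M. g x)"
  using integral_norm_bound[of M f] integral_mono'[OF assms(1), of "\<lambda>x. norm (f x)"] assms(2)
  by (meson norm_ge_zero order_trans)

lemma cis_measurable [measurable]: "cis \<in> borel_measurable borel"
  by (intro borel_measurable_continuous_onI continuous_intros)

lemma integrable_mult_cis:
  assumes "integrable lborel k"
  shows "integrable lborel (\<lambda>y. k y * cis (t * y))"
  using assms by (rule Bochner_Integration.integrable_bound) (use assms in \<open>auto simp: norm_mult\<close>)

lemma ft_measurable [measurable]:
  assumes [measurable]: "k \<in> borel_measurable lborel"
  shows "ft k \<in> borel_measurable borel"
  unfolding ft_def by measurable

lemma norm_ft_le:
  assumes "integrable lborel k"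
  shows "norm (ft k t) \<le> (LINT y|lborel. norm (k y))"
  using integral_norm_bound[of lborel "\<lambda>y. k y * cis (t * y)"] by (simp add: ft_def norm_mult)

lemma integrable_pair_mult:
  fixes k e :: "real \<Rightarrow> complex"
  assumes k: "integrable lborel k" and e: "integrable lborel e"
  shows "integrable (lborel \<Otimes>\<^sub>M lborel) (\<lambda>(y, t). k y * e t * cis (s * (y * t)))"
proof (rule lborel_pair.Fubini_integrable)
  have [measurable]: "k \<in> borel_measurable lborel" "e \<in> borel_measurable lborel" using k e by auto
  show "(\<lambda>(y, t). k y * e t * cis (s * (y * t))) \<in> borel_measurable (lborel \<Otimes>\<^sub>M lborel)" by measurable
  show "integrable lborel (\<lambda>x. LINT y|lborel. norm (case (x, y) of (y, t) \<Rightarrow> k y * e t * cis (s * (y * t))))"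
    using k by (simp add: norm_mult)
  show "AE x in lborel. integrable lborel (\<lambda>y. case (x, y) of (y, t) \<Rightarrow> k y * e t * cis (s * (y * t)))"
  proof (rule AE_I2)
    fix y
    have "integrable lborel (\<lambda>t. k y * (e t * cis ((s * y) * t)))"
      by (intro integrable_mult_right integrable_mult_cis e)
    thus "integrable lborel (\<lambda>t. case (y, t) of (y, t) \<Rightarrow> k y * e t * cis (s * (y * t)))"
      by (simp add: mult_ac)
  qed
qed

text \<open>The multiplication formula, which is Fubini. It takes the place of Fourier inversion in
  what follows; the scale s is used with the values 1 and -1.\<close>

lemma ft_swap:
  assumes k: "integrable lborel k" and e: "integrable lborel e"
  shows "(LINT y|lborel. k y * ft e (s * y)) = (LINT t|lborel. e t * ft k (s * t))"
proof -
  have "(LINT t|lborel. LINT y|lborel. k y * e t * cis (s * (y * t))) = (LINT y|lborel. LINT t|lborel. k y * e t * cis (s * (y * t)))"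
    using lborel_pair.Fubini_integral[OF integrable_pair_mult[OF k e, of s]] by simp
  moreover have "(LINT y|lborel. k y * e t * cis (s * (y * t))) = e t * ft k (s * t)" for t
    unfolding ft_def by (subst integral_mult_right_zero[symmetric]) (simp add: mult_ac)
  moreover have "(LINT t|lborel. k y * e t * cis (s * (y * t))) = k y * ft e (s * y)" for y
    unfolding ft_def by (subst integral_mult_right_zero[symmetric]) (simp add: mult_ac)
  ultimately show ?thesis by simp
qed

lemma std_normal_density_measurable [measurable]: "std_normal_density \<in> borel_measurable borel"
  unfolding normal_density_def by measurable

lemma std_normal_density_complex_measurable [measurable]:
  "(\<lambda>x. complex_of_real (std_normal_density x)) \<in> borel_measurable borel"
  unfolding normal_density_def by measurable

lemma cnj_measurable [measurable]: "cnj \<in> borel_measurable borel"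
  by (intro borel_measurable_continuous_onI continuous_intros)

lemma integrable_indicator_Icc: "integrable lborel (indicator {a..b::real} :: real \<Rightarrow> real)"
  by (cases "a \<le> b") (auto simp: integrable_indicator_iff emeasure_lborel_Icc)

lemma lint_indicator_Icc: "a \<le> b \<Longrightarrow> (LINT u|lborel. indicator {a..b::real} u :: real) = b - a"
  by (simp add: measure_def)

lemma integrable_std_normal_density: "integrable lborel std_normal_density"
  using integrable_normal_density[of 1 0] by simp

lemma ft_std_normal: "ft (\<lambda>x. of_real (std_normal_density x)) t = of_real (exp (- (t\<^sup>2) / 2))"
proof -
  have "char std_normal_distribution t = (LINT x|density lborel std_normal_density. iexp (t * x))"
    by (simp add: char_def)
  also have "\<dots> = (LINT x|lborel. std_normal_density x *\<^sub>R iexp (t * x))"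
    by (subst integral_density) (auto simp: normal_density_nonneg)
  also have "\<dots> = ft (\<lambda>x. of_real (std_normal_density x)) t"
    by (simp add: ft_def scaleR_conv_of_real cis_conv_exp)
  finally show ?thesis by (simp add: char_std_normal_distribution)
qed

definition gauss :: "real \<Rightarrow> real \<Rightarrow> real" where "gauss h v = std_normal_density (v / h) / h"

lemma integrable_scaled_normal:
  "h > 0 \<Longrightarrow> integrable lborel (\<lambda>t. std_normal_density (h * t))"
  using lborel_integrable_real_affine[OF integrable_std_normal_density, of h 0] by simp

lemma ft_gauss_inv:
  assumes h: "h > 0"
  shows "ft (\<lambda>t. of_real (std_normal_density (h * t))) v = of_real (exp (- ((v / h)\<^sup>2) / 2) / h)"
proof -
  have "ft (\<lambda>x. of_real (std_normal_density x)) (v / h) = 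
     (LINT x|lborel. of_real (std_normal_density x) * cis (v / h * x))"
    by (simp add: ft_def)
  also have "\<dots> = \<bar>h\<bar> *\<^sub>R (LINT t|lborel. of_real (std_normal_density (0 + h * t)) * cis (v / h * (0 + h * t)))"
    by (rule lborel_integral_real_affine) (use h in auto)
  also have "\<dots> = of_real h * ft (\<lambda>t. of_real (std_normal_density (h * t))) v" (is "_ = _ * ?X")
    using h by (simp add: ft_def scaleR_conv_of_real)
  finally have eq: "of_real (exp (- ((v / h)\<^sup>2) / 2)) = of_real h * ?X" unfolding ft_std_normal .
  have gen: "X = a / of_real h" if "a = of_real h * X" for a X :: complex
    using that h by simp
  show ?thesis unfolding of_real_divide by (rule gen[OF eq])
qed

lemma std_normal_density_eq: "std_normal_density x = exp (- (x\<^sup>2) / 2) / sqrt (2 * pi)"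
  by (simp add: normal_density_def)

text \<open>A Gaussian of width h is itself a Fourier transform, namely of a Gaussian of width 1/h,
  so smoothing integrals can be fed into \<open>ft_swap\<close>.\<close>

lemma ft_gauss:
  assumes h: "h > 0"
  shows "of_real (gauss h v) = ft (\<lambda>t. of_real (std_normal_density (h * t))) v / of_real (sqrt (2 * pi))"
  unfolding ft_gauss_inv[OF h] unfolding gauss_def std_normal_density_eq using h by (simp add: field_simps)

lemma integrable_gauss: "h > 0 \<Longrightarrow> integrable lborel (gauss h)"
  using lborel_integrable_real_affine[OF integrable_std_normal_density, of "1 / h" 0]
  unfolding gauss_def by (simp add: mult.commute)

lemma gauss_convolution:
  fixes g :: "real \<Rightarrow> complex"
  assumes h: "h > 0" and [measurable]: "g \<in> borel_measurable lborel"
  shows "(LINT u|lborel. g u * of_real (gauss h (u - y))) = (LINT z|lborel. g (y + h * z) * of_real (std_normal_density z))"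
proof -
  have "(LINT u|lborel. g u * of_real (gauss h (u - y))) = \<bar>h\<bar> *\<^sub>R (LINT z|lborel. g (y + h * z) * of_real (gauss h (y + h * z - y)))"
    by (rule lborel_integral_real_affine) (use h in simp)
  also have "\<dots> = (LINT z|lborel. of_real h * (g (y + h * z) * of_real (gauss h (y + h * z - y))))"
    using h by (simp add: scaleR_conv_of_real)
  also have "\<dots> = (LINT z|lborel. g (y + h * z) * of_real (std_normal_density z))"
    using h by (intro Bochner_Integration.integral_cong) (auto simp: gauss_def)
  finally show ?thesis .
qed

text \<open>The inequality half of Plancherel's theorem, by Gaussian regularisation.\<close>

lemma plancherel_le:
  fixes g :: "real \<Rightarrow> complex"
  assumes g: "integrable lborel g" and B: "\<And>y. norm (g y) \<le> B"
    and D: "countable D" "\<And>y. y \<notin> D \<Longrightarrow> isCont g y"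
    and H: "integrable lborel H" "\<And>t. (norm (ft g t))\<^sup>2 \<le> H t"
  shows "(LINT y|lborel. (norm (g y))\<^sup>2) \<le> (LINT t|lborel. H t) / (2 * pi)"
proof -
  have gm [measurable]: "g \<in> borel_measurable borel" using borel_measurable_integrable[OF g] by simp
  \<comment> \<open>The Gaussian average of the conjugate of g at scale h. It is bounded by B and
    tends to the conjugate of g at every continuity point, hence almost everywhere.\<close>
  define I where "I = (\<lambda>h y. LINT z|lborel. cnj (g (y + h * z)) * of_real (std_normal_density z))"
  have I_le: "norm (I h y) \<le> B" for h y
  proof -
    have int1: "integrable lborel (\<lambda>z. B * std_normal_density z)"
      by (intro integrable_mult_right integrable_std_normal_density)
    have b: "norm (cnj (g (y + h * z)) * of_real (std_normal_density z)) \<le> B * std_normal_density z" for z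
      unfolding norm_mult norm_of_real complex_mod_cnj using normal_density_nonneg[of 1 0 z] B[of "y + h * z"]
      by (simp add: mult_right_mono)
    have "norm (I h y) \<le> (LINT z|lborel. B * std_normal_density z)"
      unfolding I_def by (rule lebesgue_norm_bound[OF int1 b])
    also have "\<dots> = B" using integral_normal_density[of 1 0] by simp
    finally show ?thesis .
  qed
  have Im: "I h \<in> borel_measurable lborel" for h unfolding I_def by measurable
  have Ilim: "(\<lambda>n. I (1 / real (Suc n)) y) \<longlonglongrightarrow> cnj (g y)" if y: "y \<notin> D" for y
  proof -
    have "(\<lambda>n. I (1 / real (Suc n)) y) \<longlonglongrightarrow> (LINT z|lborel. cnj (g y) * of_real (std_normal_density z))"
      unfolding I_def
    proof (rule integral_dominated_convergence[where w = "\<lambda>z. B * std_normal_density z"])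
      show "AE z in lborel. (\<lambda>n. cnj (g (y + 1 / real (Suc n) * z)) * of_real (std_normal_density z)) \<longlonglongrightarrow> cnj (g y) * of_real (std_normal_density z)"
      proof (rule AE_I2)
        fix z
        have "(\<lambda>n. y + 1 / real (Suc n) * z) \<longlonglongrightarrow> y" by real_asymp
        hence "(\<lambda>n. g (y + 1 / real (Suc n) * z)) \<longlonglongrightarrow> g y" using D(2)[OF y] isCont_tendsto_compose by blast
        thus "(\<lambda>n. cnj (g (y + 1 / real (Suc n) * z)) * of_real (std_normal_density z)) \<longlonglongrightarrow> cnj (g y) * of_real (std_normal_density z)"
          by (intro tendsto_intros)
      qed
    qed (use B in \<open>auto intro!: integrable_std_normal_density mult_right_mono simp: norm_mult\<close>)
    also have "(LINT z|lborel. cnj (g y) * of_real (std_normal_density z)) = cnj (g y) * of_real (LINT z|lborel. std_normal_density z)"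
      by (simp del: integral_complex_of_real add: integral_complex_of_real[symmetric])
    also have "\<dots> = cnj (g y)" using integral_normal_density[of 1 0] by simp
    finally show ?thesis .
  qed
  have "(\<lambda>n. LINT y|lborel. g y * I (1 / real (Suc n)) y) \<longlonglongrightarrow> (LINT y|lborel. g y * cnj (g y))"
  proof (rule integral_dominated_convergence[where w = "\<lambda>y. B * norm (g y)"])
    have "AE y in lborel. y \<notin> D" using D(1) by (rule countable_imp_null_set_lborel[THEN AE_not_in])
    thus "AE y in lborel. (\<lambda>n. g y * I (1 / real (Suc n)) y) \<longlonglongrightarrow> g y * cnj (g y)"
      by eventually_elim (intro tendsto_intros Ilim)
    show "AE y in lborel. norm (g y * I (1 / real (Suc n)) y) \<le> B * norm (g y)" for n
      using mult_left_mono[OF I_le norm_ge_zero, of "g _"] by (intro AE_I2) (simp add: norm_mult mult.commute)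
    show "integrable lborel (\<lambda>y. B * norm (g y))" using g by simp
    show "(\<lambda>y. g y * I (1 / real (Suc n)) y) \<in> borel_measurable lborel" for n using Im[of "1 / real (Suc n)"] by measurable
  qed measurable
  hence lim: "(\<lambda>n. norm (LINT y|lborel. g y * I (1 / real (Suc n)) y)) \<longlonglongrightarrow> norm (LINT y|lborel. g y * cnj (g y))"
    by (rule tendsto_norm)
  \<comment> \<open>For fixed h, two applications of \<open>ft_swap\<close> turn this integral into
    that of |ft g(-t)|^2 against a Gaussian whose values are at most 1/sqrt(2 pi), divided by
    another sqrt(2 pi).\<close>
  have "norm (LINT y|lborel. g y * I h y) \<le> (LINT t|lborel. H t) / (2 * pi)" if h: "h > 0" for h
  proof -
    define e where "e = (\<lambda>t. complex_of_real (std_normal_density (h * t)))"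
    have e: "integrable lborel e" unfolding e_def by (intro integrable_of_real integrable_scaled_normal h)
    have cg: "integrable lborel (\<lambda>u. cnj (g u))" using g by simp
    have ftcnj: "ft (\<lambda>u. cnj (g u)) t = cnj (ft g (- t))" for t
    proof -
      have "(LINT y|lborel. cnj (g y * cis (- t * y))) = cnj (LINT y|lborel. g y * cis (- t * y))"
        by (rule Bochner_Integration.integral_cnj)
      thus ?thesis by (simp add: ft_def cis_cnj)
    qed
    have I_eq: "I h y = ft (\<lambda>t. e t * cnj (ft g (- t))) (- y) / sqrt (2 * pi)" for y
    proof -
      have "I h y = (LINT u|lborel. cnj (g u) * of_real (gauss h (u - y)))"
        unfolding I_def by (rule gauss_convolution[OF h, symmetric]) measurable
      also have "\<dots> = (LINT u|lborel. cnj (g u) * ft e (u - y)) / sqrt (2 * pi)"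
        unfolding e_def ft_gauss[OF h] by simp
      also have "(\<lambda>u. ft e (u - y)) = ft (\<lambda>t. e t * cis (- y * t))"
        unfolding ft_def by (simp add: fun_eq_iff cis_mult algebra_simps)
      also have "(LINT u|lborel. cnj (g u) * ft (\<lambda>t. e t * cis (- y * t)) u) = (LINT t|lborel. (e t * cis (- y * t)) * ft (\<lambda>u. cnj (g u)) t)"
        using ft_swap[OF cg integrable_mult_cis[OF e, of "- y"], of 1] by simp
      also have "\<dots> = ft (\<lambda>t. e t * cnj (ft g (- t))) (- y)"
        unfolding ftcnj by (simp add: ft_def mult_ac)
      finally show ?thesis .
    qed
    have ftm: "ft g \<in> borel_measurable borel" by (rule ft_measurable) (use gm in simp)
    have e2: "integrable lborel (\<lambda>t. e t * cnj (ft g (- t)))"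
    proof (rule Bochner_Integration.integrable_bound)
      show "integrable lborel (\<lambda>t. (LINT y|lborel. norm (g y)) * norm (e t))" using e by simp
      show "(\<lambda>t. e t * cnj (ft g (- t))) \<in> borel_measurable lborel" using ftm e by measurable
      show "AE t in lborel. norm (e t * cnj (ft g (- t))) \<le> norm ((LINT y|lborel. norm (g y)) * norm (e t))"
        by (intro AE_I2) (use norm_ft_le[OF g] in \<open>auto simp: norm_mult mult.commute intro!: mult_left_mono\<close>)
    qed
    have "(LINT y|lborel. g y * I h y) = (LINT y|lborel. g y * ft (\<lambda>t. e t * cnj (ft g (- t))) ((-1) * y)) / sqrt (2 * pi)"
      unfolding I_eq by simp
    also have "\<dots> = (LINT t|lborel. e t * cnj (ft g (- t)) * ft g ((-1) * t)) / sqrt (2 * pi)"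
      by (subst ft_swap[OF g e2]) simp
    finally have "norm (LINT y|lborel. g y * I h y) = norm (LINT t|lborel. e t * cnj (ft g (- t)) * ft g (- t)) / sqrt (2 * pi)"
      by (simp add: norm_divide)
    also have "norm (LINT t|lborel. e t * cnj (ft g (- t)) * ft g (- t)) \<le> (LINT t|lborel. H (- t) / sqrt (2 * pi))"
    proof (rule lebesgue_norm_bound)
      show "integrable lborel (\<lambda>t. H (- t) / sqrt (2 * pi))"
        using lborel_integrable_real_affine[OF H(1), of "-1" 0] by simp
      fix t
      have "std_normal_density (h * t) \<le> 1 / sqrt (2 * pi)"
        unfolding std_normal_density_eq by (intro divide_right_mono) auto
      hence "norm (e t) * (norm (ft g (- t)))\<^sup>2 \<le> 1 / sqrt (2 * pi) * H (- t)"
        by (intro mult_mono H(2)) (auto simp: e_def)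
      thus "norm (e t * cnj (ft g (- t)) * ft g (- t)) \<le> H (- t) / sqrt (2 * pi)"
        by (simp add: norm_mult power2_eq_square mult_ac)
    qed
    also have "(LINT t|lborel. H (- t) / sqrt (2 * pi)) = (LINT t|lborel. H t) / sqrt (2 * pi)"
      using lborel_integral_real_affine[of "-1" H 0] by simp
    also have "\<dots> / sqrt (2 * pi) = (LINT t|lborel. H t) / (2 * pi)" by simp
    finally show ?thesis by (simp add: divide_right_mono)
  qed
  hence "norm (LINT y|lborel. g y * cnj (g y)) \<le> (LINT t|lborel. H t) / (2 * pi)"
    by (intro LIMSEQ_le_const2[OF lim]) auto
  also have "(LINT y|lborel. g y * cnj (g y)) = of_real (LINT y|lborel. (norm (g y))\<^sup>2)"
    by (simp add: complex_norm_square[symmetric] flip: integral_complex_of_real of_real_power)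
  finally show ?thesis by simp
qed

subsection \<open>The Fej\'er weight\<close>

text \<open>The support [-1/4, 1/4] is the vertical window on which \<open>FF_decomposition\<close>
  holds.\<close>

definition tri :: "real \<Rightarrow> complex" where "tri u = of_real (max 0 (1 - 4 * \<bar>u\<bar>))"

text \<open>Defined through the transform so that the value at 0 is the right one: the closed form
  8(1 - cos(v/4))/v^2 reads 0/0 there.\<close>

definition fejer :: "real \<Rightarrow> real" where "fejer v = Re (ft tri v)"

lemma tri_measurable [measurable]: "tri \<in> borel_measurable borel"
  unfolding tri_def by measurable

lemma tri_integrable: "integrable lborel tri"
proof (rule Bochner_Integration.integrable_bound)
  show "integrable lborel (indicator {-1/4..1/4} :: real \<Rightarrow> real)" by (rule integrable_indicator_Icc)
  show "AE u in lborel. norm (tri u) \<le> norm (indicator {-1/4..1/4::real} u :: real)"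
    by (intro AE_I2) (auto simp: tri_def indicator_def max_def abs_if norm_of_real split: if_splits)
qed auto

lemma ft_tri:
  assumes v: "v \<noteq> 0"
  shows "ft tri v = of_real (8 * (1 - cos (v / 4)) / v\<^sup>2)"
proof -
  define G where "G = (\<lambda>c z. (1 - c * z) * exp (\<i> * v * z) / (\<i> * v) - c * exp (\<i> * v * z) / of_real (v\<^sup>2))"
  define F1 where "F1 = (\<lambda>u. G 4 (complex_of_real u))"
  define F2 where "F2 = (\<lambda>u. G (-4) (complex_of_real u))"
  have Gd: "(G c has_field_derivative (1 - c * z) * exp (\<i> * v * z)) (at z)" for c z
    unfolding G_def using v by (auto intro!: derivative_eq_intros simp: power2_eq_square divide_simps) (simp add: algebra_simps)
  have cis: "exp (\<i> * v * complex_of_real u) = cis (v * u)" for u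
    by (simp add: cis_conv_exp mult.assoc)
  have 1: "has_bochner_integral lborel (\<lambda>u. indicator {0..1/4} u *\<^sub>R ((1 - 4 * of_real u) * cis (v * u))) (F1 (1/4) - F1 0)"
  proof (rule has_bochner_integral_FTC_Icc)
    fix u show "(F1 has_vector_derivative (1 - 4 * of_real u) * cis (v * u)) (at u within {0..1/4})"
      unfolding F1_def using has_vector_derivative_real_field[OF Gd, of 4 u] by (simp add: cis)
  qed (auto intro!: continuous_intros)
  have 2: "has_bochner_integral lborel (\<lambda>u. indicator {-1/4..0} u *\<^sub>R ((1 + 4 * of_real u) * cis (v * u))) (F2 0 - F2 (-1/4))"
  proof (rule has_bochner_integral_FTC_Icc)
    fix u show "(F2 has_vector_derivative (1 + 4 * of_real u) * cis (v * u)) (at u within {-1/4..0})"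
      unfolding F2_def using has_vector_derivative_real_field[OF Gd, of "-4" u] by (simp add: cis)
  qed (auto intro!: continuous_intros)
  have "ft tri v = (F1 (1/4) - F1 0) + (F2 0 - F2 (-1/4))"
    unfolding ft_def
  proof (rule has_bochner_integral_integral_eq)
    have "AE u in lborel. u \<noteq> (0::real)" by (rule AE_lborel_singleton)
    hence "AE u in lborel. indicator {0..1/4} u *\<^sub>R ((1 - 4 * of_real u) * cis (v * u)) + indicator {-1/4..0} u *\<^sub>R ((1 + 4 * of_real u) * cis (v * u)) = tri u * cis (v * u)"
      by eventually_elim (auto simp: tri_def indicator_def max_def abs_if)
    thus "has_bochner_integral lborel (\<lambda>u. tri u * cis (v * u)) ((F1 (1/4) - F1 0) + (F2 0 - F2 (-1/4)))"
      by (intro has_bochner_integralI_AE[OF has_bochner_integral_add[OF 1 2]]) auto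
  qed
  also have "\<dots> = of_real (8 * (1 - cos (v / 4)) / v\<^sup>2)"
    unfolding F1_def F2_def G_def cis using v
    by (simp add: complex_eq_iff Re_divide Im_divide power2_eq_square) (simp add: field_simps)
  finally show ?thesis .
qed

lemma ft_tri_0: "ft tri 0 \<in> \<real>" "norm (ft tri 0) \<le> 1" "Re (ft tri 0) \<ge> 0"
proof -
  have e: "ft tri 0 = of_real (LINT u|lborel. max 0 (1 - 4 * \<bar>u\<bar>))"
    by (simp add: ft_def tri_def flip: integral_complex_of_real)
  thus "ft tri 0 \<in> \<real>" by simp
  show "Re (ft tri 0) \<ge> 0" unfolding e by (simp add: integral_nonneg_AE)
  have "norm (ft tri 0) \<le> (LINT u|lborel. indicator {-1/4..1/4::real} u :: real)"
    unfolding ft_def by (rule lebesgue_norm_bound[OF integrable_indicator_Icc])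
      (auto simp: tri_def indicator_def max_def abs_if norm_of_real split: if_splits)
  also have "\<dots> \<le> 1" by (simp add: lint_indicator_Icc)
  finally show "norm (ft tri 0) \<le> 1" .
qed

lemma ft_tri_fejer: "ft tri v = of_real (fejer v)"
proof (cases "v = 0")
  case True
  show ?thesis unfolding True fejer_def using ft_tri_0(1) by simp
qed (simp add: fejer_def ft_tri)

lemma fejer_nonneg: "fejer v \<ge> 0"
  using ft_tri_0(3) by (cases "v = 0") (auto simp: fejer_def ft_tri)

lemma fejer_le: "fejer v \<le> 32 * inverse (1 + v\<^sup>2)"
proof (cases "\<bar>v\<bar> \<le> 1")
  case True
  have v2: "v\<^sup>2 \<le> 1" using True by (simp add: abs_square_le_1)
  have "fejer v \<le> 1"
  proof (cases "v = 0")
    case False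
    have "1 - cos (v / 4) = 2 * (sin (v / 8))\<^sup>2" using cos_double_sin[of "v / 8"] by simp
    also have "\<dots> \<le> 2 * (v / 8)\<^sup>2" using abs_sin_x_le_abs_x[of "v / 8"] unfolding abs_le_square_iff by (rule mult_left_mono) simp
    also have "\<dots> = v\<^sup>2 / 32" by (simp add: power2_eq_square)
    finally have "1 - cos (v / 4) \<le> v\<^sup>2 / 32" .
    hence "8 * (1 - cos (v / 4)) \<le> 8 * (v\<^sup>2 / 32)" by (rule mult_left_mono) simp
    also have "\<dots> \<le> 1 * v\<^sup>2" by simp
    finally have "8 * (1 - cos (v / 4)) \<le> 1 * v\<^sup>2" .
    hence "8 * (1 - cos (v / 4)) / v\<^sup>2 \<le> 1" using False by (subst pos_divide_le_eq) auto
    thus ?thesis using False by (simp add: fejer_def ft_tri)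
  qed (use ft_tri_0(2) abs_Re_le_cmod[of "ft tri 0"] in \<open>simp add: fejer_def\<close>)
  also have "1 \<le> 32 * inverse (1 + v\<^sup>2)" using v2 by (simp add: field_simps add_pos_nonneg)
  finally show ?thesis .
next
  case False
  hence v: "v \<noteq> 0" "v\<^sup>2 \<ge> 1" using abs_square_le_1[of v] by (auto simp: not_le abs_square_less_1[symmetric])
  have "1 - c \<le> 2" if "-1 \<le> c" for c :: real using that by simp
  from mult_left_mono[OF this[OF cos_ge_minus_one], of 8 "v / 4"]
  have "8 * (1 - cos (v / 4)) \<le> 8 * 2" by simp
  hence "fejer v \<le> 16 / v\<^sup>2" using v by (simp add: fejer_def ft_tri divide_right_mono)
  also have "\<dots> \<le> 32 * inverse (1 + v\<^sup>2)" using v by (simp add: field_simps add_pos_nonneg)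
  finally show ?thesis .
qed

text \<open>For |v| \<le> 1 the phase stays within 1/4 on the support, so the cosine is at least
  1/2; the triangle is at least 1/2 on [-1/8, 1/8]. This gives 1/4 on a set of length 1/4, and the
  rest of the integrand is non-negative.\<close>

lemma fejer_ge:
  assumes "\<bar>v\<bar> \<le> 1"
  shows "fejer v \<ge> 1/16"
proof -
  have "fejer v = (LINT u|lborel. Re (tri u * cis (v * u)))"
    unfolding fejer_def ft_def by (rule integral_Re[symmetric], rule integrable_mult_cis[OF tri_integrable])
  also have "\<dots> \<ge> (LINT u|lborel. (1/4) * indicator {-1/8..1/8::real} u)"
  proof (rule Bochner_Integration.integral_mono)
    show "integrable lborel (\<lambda>u. (1/4) * indicator {-1/8..1/8::real} u :: real)"
      by (intro integrable_mult_right integrable_indicator_Icc)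
    show "integrable lborel (\<lambda>u. Re (tri u * cis (v * u)))" by (intro integrable_Re integrable_mult_cis tri_integrable)
    fix u :: real
    show "(1/4) * indicator {-1/8..1/8::real} u \<le> Re (tri u * cis (v * u))"
    proof (cases "\<bar>u\<bar> \<le> 1/4")
      case True
      have "\<bar>v * u\<bar> \<le> 1 * (1/4)" unfolding abs_mult using assms True by (intro mult_mono) auto
      hence a: "(v * u / 2)\<^sup>2 \<le> (1/8)\<^sup>2" by (intro power2_le_iff_abs_le[THEN iffD2]) auto
      have b: "(sin (v * u / 2))\<^sup>2 \<le> (v * u / 2)\<^sup>2"
        using abs_sin_x_le_abs_x[of "v * u / 2"] unfolding abs_le_square_iff .
      have "1/2 \<le> 1 - 2 * x" if "x \<le> (1/8)\<^sup>2" for x :: real using that by (simp add: power2_eq_square)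
      from this[OF order_trans[OF b a]] have c: "cos (v * u) \<ge> 1/2"
        using cos_double_sin[of "v * u / 2"] by simp
      have "(1/4) * indicator {-1/8..1/8::real} u \<le> max 0 (1 - 4 * \<bar>u\<bar>) * (1/2)"
        by (auto simp: indicator_def abs_if)
      also have "\<dots> \<le> max 0 (1 - 4 * \<bar>u\<bar>) * cos (v * u)" using c by (intro mult_left_mono) auto
      finally show ?thesis by (simp add: tri_def)
    qed (auto simp: tri_def indicator_def)
  qed
  also have "(LINT u|lborel. (1/4) * indicator {-1/8..1/8::real} u :: real) = 1/16" by (simp add: lint_indicator_Icc)
  finally show ?thesis .
qed


section \<open>Laplace integrals, decay of the majorant, and contour shift\<close>

lemma integrable_exp_half_line:
  assumes "c > 0"
  shows "integrable lborel (\<lambda>y. indicator {0..} y * exp (- c * y) :: real)"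
proof -
  have "set_integrable lborel {0<..} (\<lambda>u. exp (- (u * c)))" by (rule integrable_I0i_exp_mscale[OF assms])
  hence i: "integrable lborel (\<lambda>y. indicator {0<..} y * exp (- (y * c)))" by (simp add: set_integrable_def)
  have "AE y in lborel. y \<noteq> (0::real)" by (rule AE_lborel_singleton)
  hence "AE y in lborel. indicator {0<..} y * exp (- (y * c)) = (indicator {0..} y * exp (- c * y) :: real)"
    by eventually_elim (auto simp: indicator_def mult.commute)
  from integrable_cong_AE_imp[OF i _ this] show ?thesis by simp
qed

lemma half_line_integral:
  fixes F h :: "real \<Rightarrow> complex"
  assumes F: "\<And>y. (F has_vector_derivative h y) (at y)" and h: "continuous_on UNIV h"
    and a: "a \<ge> 0" and K: "\<And>y. y \<ge> 0 \<Longrightarrow> norm (h y) \<le> K * exp (- c * y)" and c: "c > 0" and lim: "(F \<longlongrightarrow> 0) at_top"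
  shows "integrable lborel (\<lambda>y. indicator {a..} y *\<^sub>R h y)" "(LINT y|lborel. indicator {a..} y *\<^sub>R h y) = - F a"
proof -
  have hm [measurable]: "h \<in> borel_measurable borel" using h by (rule borel_measurable_continuous_onI)
  show int: "integrable lborel (\<lambda>y. indicator {a..} y *\<^sub>R h y)"
  proof (rule Bochner_Integration.integrable_bound)
    show "integrable lborel (\<lambda>y. K * (indicator {0..} y * exp (- c * y)) :: real)"
      by (intro integrable_mult_right integrable_exp_half_line c)
    show "AE y in lborel. norm (indicator {a..} y *\<^sub>R h y) \<le> norm (K * (indicator {0..} y * exp (- c * y)))"
      by (intro AE_I2) (use a K in \<open>auto simp: indicator_def intro: order_trans[OF K]\<close>)
  qed measurable
  have "((\<lambda>N. LINT y|lborel. indicator {..N} y *\<^sub>R (indicator {a..} y *\<^sub>R h y)) \<longlongrightarrow> (LINT y|lborel. indicator {a..} y *\<^sub>R h y)) at_top"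
    by (rule tendsto_integral_at_top) (use int in auto)
  moreover have "\<forall>\<^sub>F N in at_top. (LINT y|lborel. indicator {..N} y *\<^sub>R (indicator {a..} y *\<^sub>R h y)) = F N - F a"
    using eventually_ge_at_top[of a]
  proof eventually_elim
    case (elim N)
    have "has_bochner_integral lborel (\<lambda>y. indicator {a..N} y *\<^sub>R h y) (F N - F a)"
      by (rule has_bochner_integral_FTC_Icc)
         (use elim h in \<open>auto intro: has_vector_derivative_at_within F continuous_on_subset\<close>)
    moreover have eq: "(\<lambda>y. indicator {..N} y *\<^sub>R (indicator {a..} y *\<^sub>R h y)) = (\<lambda>y. indicator {a..N} y *\<^sub>R h y)"
      by (auto simp: indicator_def fun_eq_iff)
    ultimately show ?case by (simp only: eq has_bochner_integral_integral_eq)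
  qed
  ultimately have "((\<lambda>N. F N - F a) \<longlongrightarrow> (LINT y|lborel. indicator {a..} y *\<^sub>R h y)) at_top"
    by (rule Lim_transform_eventually)
  moreover have "((\<lambda>N. F N - F a) \<longlongrightarrow> 0 - F a) at_top" by (intro tendsto_intros lim)
  ultimately show "(LINT y|lborel. indicator {a..} y *\<^sub>R h y) = - F a"
    using tendsto_unique[OF trivial_limit_at_top_linorder] by simp
qed

lemma norm_exp_neg: "norm (exp (- (w * of_real y))) = exp (- Re w * y)"
  by (simp add: norm_exp_eq_Re)

lemma laplace_exp:
  assumes w: "Re w > 0" and a: "a \<ge> 0"
  shows "integrable lborel (\<lambda>y. indicator {a..} y *\<^sub>R exp (- (w * of_real y)))"
    "(LINT y|lborel. indicator {a..} y *\<^sub>R exp (- (w * of_real y))) = exp (- (w * of_real a)) / w"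
proof -
  have w0: "w \<noteq> 0" using w by auto
  define F where "F = (\<lambda>y. - (exp (- (w * complex_of_real y)) / w))"
  have F: "(F has_vector_derivative exp (- (w * of_real y))) (at y)" for y
    unfolding F_def by (rule has_vector_derivative_real_field) (use w0 in \<open>auto intro!: derivative_eq_intros\<close>)
  have lim: "(F \<longlongrightarrow> 0) at_top"
  proof (rule Lim_null_comparison)
    show "\<forall>\<^sub>F y in at_top. norm (F y) \<le> exp (- Re w * y) / norm w"
      by (intro always_eventually allI) (simp add: F_def norm_divide norm_exp_neg del: exp_minus)
    show "((\<lambda>y. exp (- Re w * y) / norm w) \<longlongrightarrow> 0) at_top"
      using w zero_less_norm_iff[THEN iffD2, OF w0] by real_asymp
  qed
  have cont: "continuous_on UNIV (\<lambda>y. exp (- (w * complex_of_real y)))" by (intro continuous_intros)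
  have K: "norm (exp (- (w * of_real y))) \<le> 1 * exp (- Re w * y)" for y unfolding norm_exp_neg by simp
  show "integrable lborel (\<lambda>y. indicator {a..} y *\<^sub>R exp (- (w * of_real y)))"
    by (rule half_line_integral(1)[OF F cont a K w lim])
  show "(LINT y|lborel. indicator {a..} y *\<^sub>R exp (- (w * of_real y))) = exp (- (w * of_real a)) / w"
    using half_line_integral(2)[OF F cont a K w lim] by (simp add: F_def)
qed

lemma laplace_linear:
  assumes w: "Re w > 0"
  shows "integrable lborel (\<lambda>y. indicator {0..} y *\<^sub>R (of_real y * exp (- (w * of_real y))))"
    "(LINT y|lborel. indicator {0..} y *\<^sub>R (of_real y * exp (- (w * of_real y)))) = 1 / w\<^sup>2"
proof -
  have w0: "w \<noteq> 0" using w by auto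
  define F where "F = (\<lambda>y. - ((complex_of_real y / w + 1 / w\<^sup>2) * exp (- (w * complex_of_real y))))"
  have F: "(F has_vector_derivative of_real y * exp (- (w * of_real y))) (at y)" for y
    unfolding F_def by (rule has_vector_derivative_real_field) 
      (use w0 in \<open>auto intro!: derivative_eq_intros simp: field_simps power2_eq_square\<close>)
  have lim: "(F \<longlongrightarrow> 0) at_top"
  proof (rule Lim_null_comparison)
    show "\<forall>\<^sub>F y in at_top. norm (F y) \<le> (y / norm w + 1 / norm w ^ 2) * exp (- Re w * y)"
      using eventually_ge_at_top[of 0]
    proof eventually_elim
      case (elim y)
      have "norm (complex_of_real y / w + 1 / w\<^sup>2) \<le> y / norm w + 1 / norm w ^ 2"
        using norm_triangle_ineq[of "complex_of_real y / w" "1 / w\<^sup>2"] elim by (simp add: norm_divide norm_power)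
      thus ?case unfolding F_def norm_minus_cancel norm_mult norm_exp_neg by (rule mult_right_mono) simp
    qed
    have "norm w > 0" using w0 by simp
    thus "((\<lambda>y. (y / norm w + 1 / norm w ^ 2) * exp (- Re w * y)) \<longlongrightarrow> 0) at_top" using w by real_asymp
  qed
  have cont: "continuous_on UNIV (\<lambda>y. of_real y * exp (- (w * complex_of_real y)))" by (intro continuous_intros)
  have K: "norm (of_real y * exp (- (w * of_real y))) \<le> 2 / Re w * exp (- (Re w / 2) * y)" if "y \<ge> 0" for y
  proof -
    have "Re w / 2 * y \<le> exp (Re w / 2 * y)" using exp_ge_add_one_self[of "Re w / 2 * y"] by linarith
    hence "y \<le> 2 / Re w * exp (Re w / 2 * y)" using w by (simp add: field_simps)
    hence "y * exp (- Re w * y) \<le> 2 / Re w * exp (Re w / 2 * y) * exp (- Re w * y)" by (rule mult_right_mono) simp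
    also have "\<dots> = 2 / Re w * exp (Re w / 2 * y + (- Re w * y))" unfolding exp_add by simp
    also have "Re w / 2 * y + (- Re w * y) = - (Re w / 2) * y" by (simp add: field_simps)
    finally show ?thesis unfolding norm_mult norm_exp_neg using that by simp
  qed
  have w2: "Re w / 2 > 0" using w by simp
  show "integrable lborel (\<lambda>y. indicator {0..} y *\<^sub>R (of_real y * exp (- (w * of_real y))))"
    by (rule half_line_integral(1)[OF F cont order_refl K w2 lim])
  show "(LINT y|lborel. indicator {0..} y *\<^sub>R (of_real y * exp (- (w * of_real y)))) = 1 / w\<^sup>2"
    using half_line_integral(2)[OF F cont order_refl K w2 lim] by (simp add: F_def)
qed

lemma integrable_powr_decay:
  assumes e: "e > (0 :: real)"
  shows "integrable lborel (\<lambda>t::real. (1 + \<bar>t\<bar>) powr (- 1 - e))"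
proof -
  define p where "p = (\<lambda>t::real. (1 + \<bar>t\<bar>) powr (- 1 - e))"
  have pm [measurable]: "p \<in> borel_measurable borel" unfolding p_def by measurable
  have "(\<integral>\<^sup>+ x. ennreal ((1 + x) powr (- 1 - e)) * indicator {0..} x \<partial>lborel) = ennreal (0 - (- ((1 + 0) powr (- e) / e)))"
  proof (rule nn_integral_FTC_atLeast)
    show "((\<lambda>x. - ((1 + x) powr (- e) / e)) \<longlongrightarrow> 0) at_top" using e by real_asymp
    fix x :: real assume "0 \<le> x"
    hence "(1 + x) powr (- 1 - e) = (1 + x) powr (- e) / (1 + x)" using powr_diff[of "1 + x" "-e" 1] minus_diff_commute[of e 1] by simp
    thus "((\<lambda>x. - ((1 + x) powr (- e) / e)) has_real_derivative (1 + x) powr (- 1 - e)) (at x)"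
      using e \<open>0 \<le> x\<close> by (auto intro!: derivative_eq_intros simp: minus_diff_commute[of e 1])
  qed auto
  also have "(\<integral>\<^sup>+ x. ennreal ((1 + x) powr (- 1 - e)) * indicator {0..} x \<partial>lborel) = (\<integral>\<^sup>+ x. ennreal (indicator {0..} x * p x) \<partial>lborel)"
    by (intro nn_integral_cong) (auto simp: p_def indicator_def)
  finally have "(\<integral>\<^sup>+ x. ennreal (indicator {0..} x * p x) \<partial>lborel) < \<infinity>" by simp
  hence i: "integrable lborel (\<lambda>x. indicator {0..} x * p x)"
    by (intro integrableI_nonneg) (auto simp: p_def)
  have "integrable lborel (\<lambda>x. indicator {0..} (0 + (-1) * x) * p (0 + (-1) * x))"
    by (rule lborel_integrable_real_affine[OF i]) simp
  from Bochner_Integration.integrable_add[OF i this]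
  have "integrable lborel (\<lambda>x. indicator {0..} x * p x + indicator {0..} (- x) * p (- x))" by simp
  hence "integrable lborel p"
    by (rule Bochner_Integration.integrable_bound) (auto simp: p_def indicator_def intro!: AE_I2)
  thus ?thesis by (simp add: p_def)
qed

lemma ln_le_powr:
  assumes "x > 0" "e > 0" shows "ln x \<le> x powr e / (e::real)"
proof -
  have "e * ln x = ln (x powr e)" using assms by (simp add: ln_powr)
  also have "\<dots> \<le> x powr e" using ln_le_minus_one[of "x powr e"] assms by simp
  finally show ?thesis using assms by (simp add: pos_le_divide_eq mult.commute)
qed

lemma lam_le_powr:
  assumes e: "0 < e" "e \<le> 1"
  shows "lam t \<le> 3 / e * (1 + \<bar>t\<bar>) powr (e - 1)"
proof -
  have "ln (\<bar>t\<bar> + 3) \<le> (\<bar>t\<bar> + 3) powr e / e" by (rule ln_le_powr) (use e in auto)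
  also have "(\<bar>t\<bar> + 3) powr e \<le> (3 * (1 + \<bar>t\<bar>)) powr e" using e by (intro powr_mono2) auto
  also have "\<dots> = 3 powr e * (1 + \<bar>t\<bar>) powr e" by (rule powr_mult)
  also have "3 powr e \<le> 3 powr 1" using e by (intro powr_mono) auto
  finally have "ln (\<bar>t\<bar> + 3) \<le> 3 * (1 + \<bar>t\<bar>) powr e / e" using e by (simp add: divide_right_mono mult_right_mono)
  hence "lam t \<le> 3 * (1 + \<bar>t\<bar>) powr e / e / (1 + \<bar>t\<bar>)"
    unfolding lam_def add.commute[of "\<bar>t\<bar>" 1] by (rule divide_right_mono) simp
  also have "\<dots> = 3 / e * (1 + \<bar>t\<bar>) powr (e - 1)" by (simp add: powr_diff)
  finally show ?thesis .
qed

lemma lam_measurable [measurable]: "lam \<in> borel_measurable borel"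
  unfolding lam_def by measurable

lemma lam_le_3: "lam t \<le> 3"
  using lam_le_powr[of 1 t] by (auto split: if_splits)

lemma integrable_lam_sq: "integrable lborel (\<lambda>t. (lam t)\<^sup>2)"
proof (rule Bochner_Integration.integrable_bound)
  show "integrable lborel (\<lambda>t::real. 144 * (1 + \<bar>t\<bar>) powr (- 1 - 1/2))" by (rule integrable_mult_right, rule integrable_powr_decay) simp
  show "AE t in lborel. norm ((lam t)\<^sup>2) \<le> norm (144 * (1 + \<bar>t\<bar>) powr (- 1 - 1/2))"
  proof (rule AE_I2)
    fix t
    have "(lam t)\<^sup>2 \<le> (3 / (1/4) * (1 + \<bar>t\<bar>) powr (1/4 - 1))\<^sup>2"
      by (intro power_mono lam_le_powr) (auto intro: less_imp_le[OF lam_pos])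
    also have "\<dots> = 144 * ((1 + \<bar>t\<bar>) powr (1/4 - 1) * (1 + \<bar>t\<bar>) powr (1/4 - 1))" by (simp add: power2_eq_square)
    also have "(1 + \<bar>t\<bar>) powr (1/4 - 1) * (1 + \<bar>t\<bar>) powr (1/4 - 1) = (1 + \<bar>t\<bar>) powr (- 1 - 1/2)"
      by (subst powr_add[symmetric]) simp
    finally show "norm ((lam t)\<^sup>2) \<le> norm (144 * (1 + \<bar>t\<bar>) powr (- 1 - 1/2))" by simp
  qed
qed measurable

text \<open>Two power bounds are balanced: \<open>lam t\<close> is at most a multiple of (1 +
  |t|)^(e - 1), and the Gaussian is at most 2 h^(-2e) (1 + |t|)^(-2e). Their product decays like (1
  + |t|)^(-1 - e), which is integrable, and only h^(-2e) is lost.\<close>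

lemma gauss_lam_integral:
  assumes e: "0 < e" "e \<le> (1/2 :: real)"
  shows "\<exists>C>0. \<forall>h. 0 < h \<and> h \<le> 1 \<longrightarrow> integrable lborel (\<lambda>t. lam t * exp (- (h * t)\<^sup>2 / 2)) \<and>
     (LINT t|lborel. lam t * exp (- (h * t)\<^sup>2 / 2)) \<le> C * h powr (- 2 * e)"
proof -
  define p where "p = (\<lambda>t::real. (1 + \<bar>t\<bar>) powr (- 1 - e))"
  have p: "integrable lborel p" unfolding p_def by (rule integrable_powr_decay) (use e in simp)
  have key: "lam t * exp (- (h * t)\<^sup>2 / 2) \<le> 6 / e * h powr (- 2 * e) * p t" if h: "0 < h" "h \<le> 1" for h t :: real
  proof -
    define x :: real where "x = h * \<bar>t\<bar>"
    have x: "x \<ge> 0" using h by (simp add: x_def)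
    have "exp (- x\<^sup>2 / 2) \<le> (2 / (1 + x)) powr (2 * e)"
    proof (cases "x \<le> 1")
      case True
      hence "1 \<le> 2 / (1 + x)" using x by simp
      hence "1 powr (2 * e) \<le> (2 / (1 + x)) powr (2 * e)" using e by (intro powr_mono2) auto
      hence "1 \<le> (2 / (1 + x)) powr (2 * e)" by simp
      moreover have "exp (- x\<^sup>2 / 2) \<le> 1" by simp
      ultimately show ?thesis by linarith
    next
      case False
      have "1 + x \<le> 2 * exp (x\<^sup>2 / 2)"
      proof -
        have "(x - 1)\<^sup>2 \<ge> 0" by simp
        hence "x \<le> 1 + x\<^sup>2 / 2 + x\<^sup>2 / 2" using False by (simp add: power2_eq_square algebra_simps)
        thus ?thesis using exp_ge_add_one_self[of "x\<^sup>2 / 2"] by linarith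
      qed
      hence "exp (- (x\<^sup>2 / 2)) \<le> 2 / (1 + x)" using x by (simp add: exp_minus field_simps)
      also have "2 / (1 + x) = (2 / (1 + x)) powr 1" using x by simp
      also have "\<dots> \<le> (2 / (1 + x)) powr (2 * e)" using False e by (intro powr_mono') auto
      finally show ?thesis by simp
    qed
    also have "\<dots> \<le> (2 / (h * (1 + \<bar>t\<bar>))) powr (2 * e)"
      using h e x by (intro powr_mono2 divide_left_mono) (auto simp: x_def algebra_simps intro!: mult_pos_pos add_pos_nonneg)
    also have "\<dots> = 2 powr (2 * e) * (h powr (- 2 * e) * (1 + \<bar>t\<bar>) powr (- 2 * e))"
      using h by (simp add: powr_divide powr_mult powr_minus_divide)
    also have "\<dots> \<le> 2 powr 1 * (h powr (- 2 * e) * (1 + \<bar>t\<bar>) powr (- 2 * e))"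
      using e by (intro mult_right_mono powr_mono) auto
    finally have E: "exp (- (h * t)\<^sup>2 / 2) \<le> 2 * (h powr (- 2 * e) * (1 + \<bar>t\<bar>) powr (- 2 * e))"
      by (simp add: x_def power_mult_distrib)
    have "lam t * exp (- (h * t)\<^sup>2 / 2) \<le> (3 / e * (1 + \<bar>t\<bar>) powr (e - 1)) * (2 * (h powr (- 2 * e) * (1 + \<bar>t\<bar>) powr (- 2 * e)))"
      by (intro mult_mono lam_le_powr E) (use e in auto)
    also have "\<dots> = 6 / e * h powr (- 2 * e) * ((1 + \<bar>t\<bar>) powr (e - 1) * (1 + \<bar>t\<bar>) powr (- 2 * e))" by (simp add: mult_ac)
    also have "(1 + \<bar>t\<bar>) powr (e - 1) * (1 + \<bar>t\<bar>) powr (- 2 * e) = p t" unfolding p_def by (subst powr_add[symmetric]) (simp add: minus_diff_commute[of e 1])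
    finally show ?thesis .
  qed
  show ?thesis
  proof (intro exI[of _ "6 / e * (LINT t|lborel. p t) + 1"] conjI allI impI)
    have p0: "(LINT t|lborel. p t) \<ge> 0" by (intro integral_nonneg_AE AE_I2) (simp add: p_def)
    thus "6 / e * (LINT t|lborel. p t) + 1 > 0" using e by (intro add_nonneg_pos mult_nonneg_nonneg) auto
    fix h :: real assume "0 < h \<and> h \<le> 1"
    hence h: "0 < h" "h \<le> 1" by auto
    have i: "integrable lborel (\<lambda>t. 6 / e * h powr (- 2 * e) * p t)" using p by simp
    show i2: "integrable lborel (\<lambda>t. lam t * exp (- (h * t)\<^sup>2 / 2))"
    proof (rule Bochner_Integration.integrable_bound[OF i])
      show "AE t in lborel. norm (lam t * exp (- (h * t)\<^sup>2 / 2)) \<le> norm (6 / e * h powr (- 2 * e) * p t)"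
      proof (intro AE_I2)
        fix t
        have "norm (lam t * exp (- (h * t)\<^sup>2 / 2)) = lam t * exp (- (h * t)\<^sup>2 / 2)" using lam_pos[of t] by simp
        also note key[OF h, of t]
        also have "6 / e * h powr (- 2 * e) * p t \<le> norm (6 / e * h powr (- 2 * e) * p t)" by (simp only: real_norm_def abs_ge_self)
        finally show "norm (lam t * exp (- (h * t)\<^sup>2 / 2)) \<le> norm (6 / e * h powr (- 2 * e) * p t)" .
      qed
    qed measurable
    have "(LINT t|lborel. lam t * exp (- (h * t)\<^sup>2 / 2)) \<le> (LINT t|lborel. 6 / e * h powr (- 2 * e) * p t)"
      by (rule Bochner_Integration.integral_mono[OF i2 i]) (rule key[OF h])
    also have "\<dots> = (6 / e * (LINT t|lborel. p t)) * h powr (- 2 * e)" by simp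
    also have "\<dots> \<le> (6 / e * (LINT t|lborel. p t) + 1) * h powr (- 2 * e)" by (intro mult_right_mono) auto
    finally show "(LINT t|lborel. lam t * exp (- (h * t)\<^sup>2 / 2)) \<le> (6 / e * (LINT t|lborel. p t) + 1) * h powr (- 2 * e)" .
  qed
qed

lemma norm_exp_minus_1_le: "norm (exp z - 1) \<le> norm z * exp (norm (z :: complex))"
proof -
  have "norm (exp z - exp 0) \<le> exp (norm z) * norm (z - 0)"
  proof (rule field_differentiable_bound[where S = "cball 0 (norm z)" and f' = exp])
    fix x :: complex assume "x \<in> cball 0 (norm z)"
    thus "norm (exp x) \<le> exp (norm z)" using norm_exp[of x] by (simp add: order_trans)
  qed (auto intro!: derivative_eq_intros)
  thus ?thesis by (simp add: mult.commute)
qed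

text \<open>Differentiation under the integral sign by dominated convergence of the difference
  quotients; it gives holomorphy of the Laplace transform to the right of the growth
  exponent.\<close>

lemma laplace_has_field_derivative:
  fixes k :: "real \<Rightarrow> complex"
  assumes [measurable]: "k \<in> borel_measurable borel" and k0: "\<And>y. y < 0 \<Longrightarrow> k y = 0"
    and K: "\<And>y. y \<ge> 0 \<Longrightarrow> norm (k y) \<le> C * exp (c * y)" and w: "Re w > c"
  shows "((\<lambda>w. LINT y|lborel. k y * exp (- (w * of_real y))) has_field_derivative
            (LINT y|lborel. - of_real y * (k y * exp (- (w * of_real y))))) (at w)"
proof -
  \<comment> \<open>The integrand at w decays like e^(-3dy). The difference quotient for |h| \<le>
    d/2 costs at most (2/d) e^(dy), which leaves the dominating function e^(-2dy).\<close>
  define d where "d = (Re w - c) / 3"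
  have d: "d > 0" using w by (simp add: d_def)
  have d3: "Re w = c + 3 * d" by (simp add: d_def field_simps)
  have C: "C \<ge> 0" using order_trans[OF norm_ge_zero K[of 0]] by simp
  define W where "W = (\<lambda>y. C * (indicator {0..} y * exp (- (2 * d) * y)) * (2 / d) :: real)"
  have kb: "norm (k y * exp (- (w * of_real y))) \<le> C * (indicator {0..} y * exp (- (3 * d) * y))" for y :: real
  proof (cases "y < 0")
    case False
    have "norm (k y * exp (- (w * of_real y))) \<le> (C * exp (c * y)) * exp (- Re w * y)"
      unfolding norm_mult norm_exp_neg using False by (intro mult_right_mono K) auto
    also have "\<dots> = C * exp (c * y + - Re w * y)" unfolding exp_add by simp
    also have "c * y + - Re w * y = - (3 * d) * y" unfolding d3 by (simp add: algebra_simps)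
    finally show ?thesis using False by simp
  qed (use k0 in auto)
  have i0: "integrable lborel (\<lambda>y. k y * exp (- (z * of_real y)))" if z: "norm (z - w) \<le> d" for z
  proof (rule Bochner_Integration.integrable_bound)
    show "integrable lborel (\<lambda>y. C * (indicator {0..} y * exp (- (2 * d) * y)) :: real)"
      by (intro integrable_mult_right integrable_exp_half_line) (use d in simp)
    show "AE y in lborel. norm (k y * exp (- (z * of_real y))) \<le> norm (C * (indicator {0..} y * exp (- (2 * d) * y)))"
    proof (intro AE_I2)
      fix y
      show "norm (k y * exp (- (z * of_real y))) \<le> norm (C * (indicator {0..} y * exp (- (2 * d) * y)))"
      proof (cases "y < 0")
        case False
        have "Re w - d \<le> Re z" using z abs_Re_le_cmod[of "z - w"] by simp
        hence "(Re w - d) * y \<le> Re z * y" using False by (intro mult_right_mono) auto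
        hence "exp (- Re z * y) \<le> exp (- (Re w - d) * y)" by (simp only: exp_le_cancel_iff minus_mult_left[symmetric] neg_le_iff_le)
        hence "norm (k y * exp (- (z * of_real y))) \<le> (C * exp (c * y)) * exp (- (Re w - d) * y)"
          unfolding norm_mult norm_exp_neg using False C by (intro mult_mono K) auto
        also have "\<dots> = C * exp (c * y + - (Re w - d) * y)" unfolding exp_add by simp
        also have "c * y + - (Re w - d) * y = - (2 * d) * y" unfolding d3 by (simp add: algebra_simps)
        finally show ?thesis using False C by simp
      qed (use k0 in auto)
    qed
  qed measurable
  define Q where "Q = (\<lambda>h y. k y * exp (- (w * of_real y)) * ((exp (- (h * of_real y)) - 1) / h))"
  have Qb: "norm (Q h y) \<le> W y" if h: "h \<noteq> 0" "norm h \<le> d / 2" for h y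
  proof (cases "y < 0")
    case False
    have "norm ((exp (- (h * of_real y)) - 1) / h) \<le> y * exp (d / 2 * y)"
    proof -
      have "norm (exp (- (h * of_real y)) - 1) \<le> norm h * y * exp (norm h * y)"
        using norm_exp_minus_1_le[of "- (h * of_real y)"] False by (simp add: norm_mult)
      also have "\<dots> \<le> norm h * y * exp (d / 2 * y)" 
      proof (intro mult_left_mono)
        have "norm h * y \<le> d / 2 * y" using h False by (intro mult_right_mono) auto
        thus "exp (norm h * y) \<le> exp (d / 2 * y)" by (simp only: exp_le_cancel_iff)
      qed (use False in auto)
      finally show ?thesis using h by (simp add: norm_divide divide_le_eq mult_ac)
    qed
    also have "\<dots> \<le> 2 / d * exp (d * y)"
    proof -
      have "d / 2 * y \<le> exp (d / 2 * y)" using exp_ge_add_one_self[of "d / 2 * y"] by linarith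
      hence "y \<le> 2 / d * exp (d / 2 * y)" using d by (simp add: field_simps)
      hence "y * exp (d / 2 * y) \<le> 2 / d * exp (d / 2 * y) * exp (d / 2 * y)" by (rule mult_right_mono) simp
      also have "\<dots> = 2 / d * exp (d / 2 * y + d / 2 * y)" unfolding exp_add by simp
      finally show ?thesis by simp
    qed
    finally have "norm (Q h y) \<le> C * (indicator {0..} y * exp (- (3 * d) * y)) * (2 / d * exp (d * y))"
      unfolding Q_def by (subst norm_mult, intro mult_mono kb) (use C False in auto)
    also have "\<dots> = C * (2 / d) * exp (- (3 * d) * y + d * y)" unfolding exp_add using False by simp
    also have "- (3 * d) * y + d * y = - (2 * d) * y" by simp
    finally show ?thesis using False by (simp add: W_def mult_ac)
  qed (use k0 in \<open>simp add: Q_def W_def\<close>)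
  have W: "integrable lborel W" unfolding W_def
    by (intro integrable_mult_left integrable_mult_right integrable_exp_half_line) (use d in simp)
  have "((\<lambda>h. LINT y|lborel. Q h y) \<longlongrightarrow> (LINT y|lborel. - of_real y * (k y * exp (- (w * of_real y))))) (at 0 within ball 0 (d / 2))"
    unfolding tendsto_at_iff_sequentially comp_def
  proof (intro allI impI)
    fix X :: "nat \<Rightarrow> complex" assume X: "\<forall>i. X i \<in> ball 0 (d / 2) - {0}" "X \<longlonglongrightarrow> 0"
    show "(\<lambda>i. LINT y|lborel. Q (X i) y) \<longlonglongrightarrow> (LINT y|lborel. - of_real y * (k y * exp (- (w * of_real y))))"
    proof (rule integral_dominated_convergence[OF _ _ W])
      show "AE y in lborel. (\<lambda>i. Q (X i) y) \<longlonglongrightarrow> - of_real y * (k y * exp (- (w * of_real y)))"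
      proof (rule AE_I2)
        fix y
        have "((\<lambda>h. exp (- (h * complex_of_real y))) has_field_derivative - of_real y) (at 0)"
          by (auto intro!: derivative_eq_intros)
        hence "((\<lambda>h. (exp (- (h * complex_of_real y)) - 1) / h) \<longlongrightarrow> - of_real y) (at 0)"
          by (simp add: DERIV_def)
        moreover have "filterlim X (at 0) sequentially" using X by (auto simp: filterlim_at)
        ultimately have "(\<lambda>i. (exp (- (X i * complex_of_real y)) - 1) / X i) \<longlonglongrightarrow> - of_real y"
          by (rule filterlim_compose)
        from tendsto_mult[OF tendsto_const[of "k y * exp (- (w * of_real y))"] this]
        show "(\<lambda>i. Q (X i) y) \<longlonglongrightarrow> - of_real y * (k y * exp (- (w * of_real y)))"
          unfolding Q_def by (simp only: mult.commute)
      qed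
      show "AE y in lborel. norm (Q (X i) y) \<le> W y" for i
        by (rule AE_I2, rule Qb) (use X(1)[rule_format, of i] in \<open>simp_all add: dist_norm\<close>)
      show "(\<lambda>y. Q (X i) y) \<in> borel_measurable lborel" for i unfolding Q_def by measurable
      show "(\<lambda>y. - of_real y * (k y * exp (- (w * of_real y)))) \<in> borel_measurable lborel" by measurable
    qed
  qed
  moreover have at0: "at 0 within ball 0 (d / 2) = (at 0 :: complex filter)" by (rule at_within_open) (use d in auto)
  ultimately have "((\<lambda>h. LINT y|lborel. Q h y) \<longlongrightarrow> (LINT y|lborel. - of_real y * (k y * exp (- (w * of_real y))))) (at 0)"
    by (simp only:)
  moreover have "\<forall>\<^sub>F h in at 0. (LINT y|lborel. Q h y) =
      ((LINT y|lborel. k y * exp (- ((w + h) * of_real y))) - (LINT y|lborel. k y * exp (- (w * of_real y)))) / h"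
  proof -
    have "\<forall>\<^sub>F h in at (0::complex). norm h < d \<and> h \<noteq> 0"
      unfolding eventually_at by (intro exI[of _ d]) (use d in auto)
    thus ?thesis
    proof eventually_elim
      case (elim h)
      have "(LINT y|lborel. Q h y) = (LINT y|lborel. (k y * exp (- ((w + h) * of_real y)) - k y * exp (- (w * of_real y))) / h)"
        by (rule Bochner_Integration.integral_cong) (auto simp: Q_def ring_distribs exp_add[symmetric] diff_divide_distrib mult.assoc)
      also have "\<dots> = (LINT y|lborel. k y * exp (- ((w + h) * of_real y)) - k y * exp (- (w * of_real y))) / h" by simp
      also have "(LINT y|lborel. k y * exp (- ((w + h) * of_real y)) - k y * exp (- (w * of_real y))) =
           (LINT y|lborel. k y * exp (- ((w + h) * of_real y))) - (LINT y|lborel. k y * exp (- (w * of_real y)))"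
        by (rule Bochner_Integration.integral_diff; rule i0) (use elim d in auto)
      finally show ?case .
    qed
  qed
  ultimately show ?thesis unfolding DERIV_def by (rule Lim_transform_eventually)
qed

text \<open>A primitive F of P exists on the half-plane, so the integrals over the segments |t|
  \<le> N are differences of values of F, and the two lines differ by two horizontal increments of
  F, each at most G(N)(b - a). These vanish as N grows.\<close>

lemma vertical_line_shift:
  assumes P: "P holomorphic_on {w. Re w > 0}" and a: "0 < a" "a \<le> b"
    and G: "integrable lborel G" "(G \<longlongrightarrow> 0) at_top" "\<And>t. G (- t) = G t"
    and PG: "\<And>w. a \<le> Re w \<Longrightarrow> Re w \<le> b \<Longrightarrow> norm (P w) \<le> G (Im w)"
  shows "(LINT t|lborel. P (Complex a t)) = (LINT t|lborel. P (Complex b t))"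
proof -
  have cv: "convex {w. Re w > 0}" by (rule convex_halfspace_Re_gt)
  have op: "open {w. Re w > 0}" by (rule open_halfspace_Re_gt)
  obtain F where F0: "\<And>w. w \<in> {w. Re w > 0} \<Longrightarrow> (F has_field_derivative P w) (at w within {w. Re w > 0})"
    by (rule holomorphic_convex_primitive'[OF cv op P]) (rule that)
  have F: "(F has_field_derivative P w) (at w)" if "Re w > 0" for w
  proof -
    have "at w within {w. Re w > 0} = at w" by (rule at_within_open) (use that op in auto)
    thus ?thesis using F0[of w] that by simp
  qed
  have Pc: "isCont P w" if "Re w > 0" for w
    using continuous_on_eq_continuous_at[OF op, THEN iffD1, OF holomorphic_on_imp_continuous_on[OF P]] that by simp
  have cc: "isCont (\<lambda>t. P (Complex x t)) t" if "x > 0" for x t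
  proof -
    have "isCont (\<lambda>t. Complex x t) t" unfolding Complex_eq by (intro continuous_intros)
    from isCont_o2[OF this, of P] show ?thesis using Pc[of "Complex x t"] that by simp
  qed
  have m: "(\<lambda>t. P (Complex x t)) \<in> borel_measurable borel" if "x > 0" for x
    using cc[OF that] by (intro borel_measurable_continuous_onI continuous_at_imp_continuous_on) auto
  have lim: "((\<lambda>N. LINT t|lborel. indicator {-N..N} t *\<^sub>R P (Complex x t)) \<longlongrightarrow> (LINT t|lborel. P (Complex x t))) at_top"
    if x: "a \<le> x" "x \<le> b" for x
  proof (rule integral_dominated_convergence_at_top[OF _ _ G(1)])
    have [measurable]: "(\<lambda>t. P (Complex x t)) \<in> borel_measurable borel" using m x a by simp
    show "(\<lambda>t. P (Complex x t)) \<in> borel_measurable lborel" by measurable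
    show "(\<lambda>t. indicator {-N..N} t *\<^sub>R P (Complex x t)) \<in> borel_measurable lborel" for N by measurable
    show "\<forall>\<^sub>F N in at_top. AE t in lborel. norm (indicator {-N..N} t *\<^sub>R P (Complex x t)) \<le> G t"
    proof (intro always_eventually allI AE_I2)
      fix N t :: real
      have "norm (P (Complex x t)) \<le> G t" using PG[of "Complex x t"] x by simp
      moreover from this have "0 \<le> G t" using norm_ge_zero order_trans by blast
      ultimately show "norm (indicator {-N..N} t *\<^sub>R P (Complex x t)) \<le> G t" by (simp add: indicator_def)
    qed
    show "AE t in lborel. ((\<lambda>N. indicator {-N..N} t *\<^sub>R P (Complex x t)) \<longlongrightarrow> P (Complex x t)) at_top"
    proof (rule AE_I2)
      fix t :: real
      have "\<forall>\<^sub>F N in at_top. indicator {-N..N} t *\<^sub>R P (Complex x t) = P (Complex x t)"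
        using eventually_ge_at_top[of "\<bar>t\<bar>"] by eventually_elim (auto simp: indicator_def)
      thus "((\<lambda>N. indicator {-N..N} t *\<^sub>R P (Complex x t)) \<longlongrightarrow> P (Complex x t)) at_top" by (rule tendsto_eventually)
    qed
  qed
  have ftc: "(LINT t|lborel. indicator {-N..N} t *\<^sub>R P (Complex x t)) = (F (Complex x N) - F (Complex x (-N))) / \<i>"
    if "x > 0" "N \<ge> 0" for x N
  proof -
    have "has_bochner_integral lborel (\<lambda>t. indicator {-N..N} t *\<^sub>R P (Complex x t)) (F (Complex x N) / \<i> - F (Complex x (-N)) / \<i>)"
    proof (rule has_bochner_integral_FTC_Icc)
      fix t
      have "((\<lambda>t. F (of_real x + \<i> * t) / \<i>) has_field_derivative P (Complex x t)) (at (of_real t))"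
      proof -
        have "((\<lambda>t. of_real x + \<i> * t) has_field_derivative \<i>) (at (of_real t))" by (auto intro!: derivative_eq_intros)
        moreover have "(F has_field_derivative P (Complex x t)) (at (of_real x + \<i> * of_real t))"
          using F[of "Complex x t"] that unfolding Complex_eq by simp
        ultimately have D: "((\<lambda>t. F (of_real x + \<i> * t)) has_field_derivative P (Complex x t) * \<i>) (at (of_real t))"
          by (rule DERIV_chain2[rotated])
        show ?thesis by (rule DERIV_cong[OF DERIV_cdivide[OF D, of \<i>]]) (rule nonzero_mult_div_cancel_right, simp)
      qed
      hence "((\<lambda>t. F (of_real x + \<i> * of_real t) / \<i>) has_vector_derivative P (Complex x t)) (at t)"
        by (rule has_vector_derivative_real_field)
      thus "((\<lambda>t. F (Complex x t) / \<i>) has_vector_derivative P (Complex x t)) (at t within {-N..N})"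
        unfolding Complex_eq by (rule has_vector_derivative_at_within)
    qed (use that cc in \<open>auto intro!: continuous_at_imp_continuous_on\<close>)
    thus ?thesis by (simp only: has_bochner_integral_integral_eq diff_divide_distrib)
  qed
  have hor: "norm (F (Complex a N) - F (Complex b N)) \<le> G N * (b - a)" for N
  proof -
    have "norm (F (Complex a N) - F (Complex b N)) \<le> G N * norm (Complex a N - Complex b N)"
    proof (rule field_differentiable_bound[where S = "{w. a \<le> Re w \<and> Re w \<le> b \<and> Im w = N}" and f' = P])
      have "{w. a \<le> Re w \<and> Re w \<le> b \<and> Im w = N} = {w. Re w \<ge> a} \<inter> {w. Re w \<le> b} \<inter> {w. Im w \<ge> N} \<inter> {w. Im w \<le> N}" by auto
      thus "convex {w. a \<le> Re w \<and> Re w \<le> b \<and> Im w = N}"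
        by (simp add: convex_Int convex_halfspace_Re_ge convex_halfspace_Re_le convex_halfspace_Im_ge convex_halfspace_Im_le)
      fix z assume z: "z \<in> {w. a \<le> Re w \<and> Re w \<le> b \<and> Im w = N}"
      show "(F has_field_derivative P z) (at z within {w. a \<le> Re w \<and> Re w \<le> b \<and> Im w = N})"
        by (rule has_field_derivative_at_within, rule F) (use z a in auto)
      show "norm (P z) \<le> G N" using PG[of z] z by simp
    qed (use a in auto)
    also have "Complex a N - Complex b N = of_real (a - b)" by (simp add: complex_eq_iff)
    also have "norm \<dots> = b - a" unfolding norm_of_real using a by simp
    finally show ?thesis .
  qed
  have "((\<lambda>N. (LINT t|lborel. indicator {-N..N} t *\<^sub>R P (Complex a t)) - (LINT t|lborel. indicator {-N..N} t *\<^sub>R P (Complex b t))) \<longlongrightarrow> 0) at_top"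
  proof (rule Lim_null_comparison)
    show "\<forall>\<^sub>F N in at_top. norm ((LINT t|lborel. indicator {-N..N} t *\<^sub>R P (Complex a t)) - (LINT t|lborel. indicator {-N..N} t *\<^sub>R P (Complex b t))) \<le> 2 * (G N * (b - a))"
      using eventually_ge_at_top[of 0]
    proof eventually_elim
      case (elim N)
      have "(LINT t|lborel. indicator {-N..N} t *\<^sub>R P (Complex a t)) - (LINT t|lborel. indicator {-N..N} t *\<^sub>R P (Complex b t)) =
        ((F (Complex a N) - F (Complex b N)) - (F (Complex a (-N)) - F (Complex b (-N)))) / \<i>"
        using elim a by (simp add: ftc algebra_simps)
      hence "norm ((LINT t|lborel. indicator {-N..N} t *\<^sub>R P (Complex a t)) - (LINT t|lborel. indicator {-N..N} t *\<^sub>R P (Complex b t))) \<le>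
         norm (F (Complex a N) - F (Complex b N)) + norm (F (Complex a (-N)) - F (Complex b (-N)))"
        by (simp only: norm_divide norm_ii div_by_1 norm_triangle_ineq4)
      with hor[of N] hor[of "-N"] G(3)[of N] show ?case by simp
    qed
    have "((\<lambda>N. 2 * (G N * (b - a))) \<longlongrightarrow> 2 * (0 * (b - a))) at_top" by (intro tendsto_intros G)
    thus "((\<lambda>N. 2 * (G N * (b - a))) \<longlongrightarrow> 0) at_top" by simp
  qed
  moreover have "((\<lambda>N. (LINT t|lborel. indicator {-N..N} t *\<^sub>R P (Complex a t)) - (LINT t|lborel. indicator {-N..N} t *\<^sub>R P (Complex b t)))
      \<longlongrightarrow> (LINT t|lborel. P (Complex a t)) - (LINT t|lborel. P (Complex b t))) at_top"
    by (intro tendsto_diff lim) (use a in auto)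
  ultimately have "0 = (LINT t|lborel. P (Complex a t)) - (LINT t|lborel. P (Complex b t))"
    by (rule tendsto_unique[OF trivial_limit_at_top_linorder])
  thus ?thesis by simp
qed


lemma laplace_exp_real:
  assumes c: "c > 0" and a: "a \<ge> 0"
  shows "(LINT y|lborel. indicator {a..} y * exp (- c * y)) = exp (- c * a) / (c :: real)"
proof -
  have "complex_of_real (LINT y|lborel. indicator {a..} y * exp (- c * y)) =
      (LINT y|lborel. complex_of_real (indicator {a..} y * exp (- c * y)))"
    by (rule integral_complex_of_real[symmetric])
  also have "\<dots> = (LINT y|lborel. indicator {a..} y *\<^sub>R exp (- (of_real c * complex_of_real y)))"
    by (rule Bochner_Integration.integral_cong) (auto simp: scaleR_conv_of_real exp_of_real[symmetric] indicator_def)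
  also have "\<dots> = exp (- (of_real c * of_real a)) / of_real c"
    by (rule laplace_exp(2)) (use c a in auto)
  also have "\<dots> = complex_of_real (exp (- c * a) / c)" by (simp add: exp_of_real[symmetric])
  finally show ?thesis by (simp only: of_real_eq_iff)
qed

lemma abs_exp_minus_1_le: "\<bar>exp x - 1\<bar> \<le> \<bar>x\<bar> * exp \<bar>x :: real\<bar>"
proof -
  have "norm (exp (complex_of_real x) - 1) = norm (complex_of_real (exp x - 1))" by (simp add: exp_of_real)
  also have "\<dots> = \<bar>exp x - 1\<bar>" by (simp only: norm_of_real)
  finally show ?thesis using norm_exp_minus_1_le[of "complex_of_real x"] by simp
qed

lemma integrable_exp_abs_normal: "integrable lborel (\<lambda>z. exp (2 * \<bar>z\<bar>) * std_normal_density z)"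
proof (rule Bochner_Integration.integrable_bound)
  have "integrable lborel (\<lambda>z. std_normal_density (0 + 1 / sqrt 2 * z))"
    by (rule lborel_integrable_real_affine[OF integrable_std_normal_density]) simp
  thus "integrable lborel (\<lambda>z. exp 4 * std_normal_density (1 / sqrt 2 * z))"
    by (intro integrable_mult_right) simp
  show "AE z in lborel. norm (exp (2 * \<bar>z\<bar>) * std_normal_density z) \<le> norm (exp 4 * std_normal_density (1 / sqrt 2 * z))"
  proof (rule AE_I2)
    fix z :: real
    \<comment> \<open>The inequality is (u/2 - 2)^2 \<ge> 0: half of the Gaussian exponent pays for
      e^(2|z|) up to the factor e^4.\<close>
    have g: "2 * u + - (u\<^sup>2) / 2 \<le> 4 + - (u\<^sup>2 / 2) / 2" for u :: real
      using zero_le_power2[of "u / 2 - 2"] by (simp add: power2_eq_square algebra_simps)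
    have "2 * \<bar>z\<bar> + - (z\<^sup>2) / 2 \<le> 4 + - (1 / sqrt 2 * z)\<^sup>2 / 2"
      using g[of "\<bar>z\<bar>"] by (simp add: power_mult_distrib power_divide)
    hence "exp (2 * \<bar>z\<bar>) * exp (- (z\<^sup>2) / 2) \<le> exp 4 * exp (- (1 / sqrt 2 * z)\<^sup>2 / 2)"
      by (simp only: exp_add[symmetric] exp_le_cancel_iff)
    hence "exp (2 * \<bar>z\<bar>) * exp (- (z\<^sup>2) / 2) / sqrt (2 * pi) \<le> exp 4 * exp (- (1 / sqrt 2 * z)\<^sup>2 / 2) / sqrt (2 * pi)"
      by (rule divide_right_mono) simp
    thus "norm (exp (2 * \<bar>z\<bar>) * std_normal_density z) \<le> norm (exp 4 * std_normal_density (1 / sqrt 2 * z))"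
      unfolding std_normal_density_eq by simp
  qed
qed measurable

section \<open>The weighted prime power sum and its Laplace transform for large Re w\<close>

context grh_char
begin

definition aa :: "nat \<Rightarrow> complex" where
  "aa n = mangoldt n * \<psi> n * of_real (real n powr (- (1/2)))"

text \<open>The term m y compensates the drift -m y caused by a zero of order m at the central
  point. Cutting it off with \<open>max 0 y\<close> makes the function vanish on the negative axis,
  so that its Laplace transform is an integral over the whole line.\<close>

definition ff :: "real \<Rightarrow> complex" where
  "ff y = (\<Sum>n\<in>{1..nat \<lfloor>exp y\<rfloor>}. aa n) + of_real (real m * max 0 y)"

lemma unitmult_psi: "unitmult \<psi>" using char by (rule unitmult_dcharacter)

lemma aa_0 [simp]: "aa 0 = 0" by (simp add: aa_def)

lemma norm_aa: "norm (aa n) \<le> 3"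
proof (cases "n = 0")
  case False
  hence n: "real n \<ge> 1" by simp
  have "ln (real n) + 1 \<le> 3 * real n powr (1/2)"
    using ln_le_powr[of "real n" "1/2"] ge_one_powr_ge_zero[of "real n" "1/2"] n by simp
  moreover have "norm (mangoldt n * \<psi> n) \<le> ln (real n) + 1"
    using unitmult_bounds(2)[OF unitmult_psi, of n] False by simp
  ultimately have "norm (mangoldt n * \<psi> n) \<le> 3 * real n powr (1/2)" by linarith
  hence "norm (aa n) \<le> 3 * real n powr (1/2) * real n powr (- (1/2))"
    unfolding aa_def norm_mult[of _ "of_real _"] norm_of_real by (intro mult_mono) auto
  also have "\<dots> = 3" using n by (simp flip: powr_add)
  finally show ?thesis .
qed simp

lemma ff_neg: "y < 0 \<Longrightarrow> ff y = 0"
proof -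
  assume "y < 0"
  hence "\<lfloor>exp y\<rfloor> = 0" by (simp add: floor_eq_iff)
  thus ?thesis using \<open>y < 0\<close> by (simp add: ff_def)
qed

text \<open>A crude modulus of continuity: each term is at most 3 in modulus and there are at most
  |e^u - e^y| + 1 integers to count. It controls the smoothing error in
  \<open>ff_apriori\<close>.\<close>

lemma ff_diff: "norm (ff u - ff y) \<le> 3 * (\<bar>exp u - exp y\<bar> + 1) + real m * \<bar>u - y\<bar>"
proof -
  have *: "norm (ff u - ff y) \<le> 3 * (\<bar>exp u - exp y\<bar> + 1) + real m * \<bar>u - y\<bar>" if "y \<le> u" for y u :: real
  proof -
    define M N where "M = nat \<lfloor>exp y\<rfloor>" and "N = nat \<lfloor>exp u\<rfloor>"
    have MN: "M \<le> N" using that by (auto simp: M_def N_def intro!: nat_mono floor_mono)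
    have "{1..N} = {1..M} \<union> {M<..N}" using MN by auto
    hence "(\<Sum>n\<in>{1..N}. aa n) = (\<Sum>n\<in>{1..M}. aa n) + (\<Sum>n\<in>{M<..N}. aa n)"
      by (simp only:) (rule sum.union_disjoint, auto)
    hence "ff u - ff y = (\<Sum>n\<in>{M<..N}. aa n) + of_real (real m * (max 0 u - max 0 y))"
      by (simp add: ff_def M_def N_def algebra_simps)
    hence "norm (ff u - ff y) \<le> norm (\<Sum>n\<in>{M<..N}. aa n) + norm (complex_of_real (real m * (max 0 u - max 0 y)))"
      by (simp only: norm_triangle_ineq)
    also have "norm (\<Sum>n\<in>{M<..N}. aa n) \<le> (\<Sum>n\<in>{M<..N}. 3)" by (intro sum_norm_le norm_aa)
    also have "\<dots> = 3 * (real N - real M)" using MN by simp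
    also have "real N - real M \<le> \<bar>exp u - exp y\<bar> + 1"
    proof -
      have "real N \<le> exp u" by (simp add: N_def)
      moreover have "exp y < real M + 1" by (simp add: M_def)
      ultimately show ?thesis by linarith
    qed
    also have "norm (complex_of_real (real m * (max 0 u - max 0 y))) = real m * \<bar>max 0 u - max 0 y\<bar>"
      by (simp only: norm_of_real abs_mult abs_of_nat)
    also have "\<dots> \<le> real m * \<bar>u - y\<bar>" by (intro mult_left_mono) auto
    finally show ?thesis by simp
  qed
  show ?thesis
  proof (cases "y \<le> u")
    case False
    thus ?thesis using *[of u y] by (simp add: norm_minus_commute abs_minus_commute)
  qed (rule *)
qed

lemma norm_ff: "y \<ge> 0 \<Longrightarrow> norm (ff y) \<le> (6 + real m) * exp y"
proof -
  assume y: "y \<ge> 0"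
  have f0: "ff (-1) = 0" by (rule ff_neg) simp
  define F :: real where "F = exp (-1)"
  have F: "F > 0" "F \<le> 1" by (auto simp: F_def)
  have e: "exp y \<ge> 1 + y" by simp
  have c: "y + 1 \<le> exp y" using e by linarith
  have "norm (ff y) \<le> 3 * (\<bar>exp y - F\<bar> + 1) + real m * \<bar>y + 1\<bar>" using ff_diff[of y "-1"] f0 by (simp add: F_def)
  also have "\<dots> \<le> 3 * (2 * exp y) + real m * exp y"
  proof (intro add_mono mult_left_mono)
    show "\<bar>exp y - F\<bar> + 1 \<le> 2 * exp y" using F e y by linarith
    show "\<bar>y + 1\<bar> \<le> exp y" using y c by simp
  qed auto
  also have "\<dots> = (6 + real m) * exp y" by (simp add: algebra_simps)
  finally show ?thesis .
qed

lemma ff_measurable [measurable]: "ff \<in> borel_measurable borel"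
proof -
  have "(\<lambda>y. nat \<lfloor>exp y\<rfloor>) \<in> measurable (borel :: real measure) (count_space UNIV)" by measurable
  hence "(\<lambda>y. (\<lambda>N. \<Sum>n\<in>{1..N}. aa n) (nat \<lfloor>exp y\<rfloor>)) \<in> borel_measurable (borel :: real measure)"
    by (rule measurable_compose) simp
  hence [measurable]: "(\<lambda>y. \<Sum>n\<in>{1..nat \<lfloor>exp y\<rfloor>}. aa n) \<in> borel_measurable (borel :: real measure)" .
  show ?thesis unfolding ff_def by measurable
qed

lemma FF_eq:
  assumes w: "Re w > 1/2"
  shows "FF w = (dirs (\<lambda>n. mangoldt n * \<psi> n) (1/2 + w) + of_nat m / w) / w"
proof -
  let ?s = "1/2 + w"
  have s: "Re ?s > 1" using w by simp
  have "(dirs \<psi> has_field_derivative - (dirs \<psi> ?s * dirs (\<lambda>n. mangoldt n * \<psi> n) ?s)) (at ?s)"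
    by (rule dirs_logderiv[OF unitmult_psi s])
  hence "(Lfun \<psi> has_field_derivative - (dirs \<psi> ?s * dirs (\<lambda>n. mangoldt n * \<psi> n) ?s)) (at ?s)"
    by (rule has_field_derivative_transform_within_open[where S = "{s. Re s > 0}"])
       (use s in \<open>auto simp: open_halfspace_Re_gt Lfun_eq_dirs[OF NP]\<close>)
  hence "deriv (Lfun \<psi>) ?s = - (Lfun \<psi> ?s * dirs (\<lambda>n. mangoldt n * \<psi> n) ?s)"
    using s by (simp add: DERIV_imp_deriv Lfun_eq_dirs[OF NP])
  moreover have "Lfun \<psi> ?s \<noteq> 0" using Lfun_zero_Re[of ?s] w by auto
  ultimately have "deriv (Lfun \<psi>) ?s / Lfun \<psi> ?s = - dirs (\<lambda>n. mangoldt n * \<psi> n) ?s" by simp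
  thus ?thesis by (simp add: FF_def)
qed

text \<open>For Re w > 1 the Dirichlet series in \<open>FF_eq\<close> is bounded and the division by
  w supplies the decay 1/(|Im w| + 1), which \<open>lam\<close> dominates.\<close>

lemma FF_bound_all: "\<exists>C>0. \<forall>w. Re w > 0 \<longrightarrow> norm (FF w) \<le> C * lam (Im w) * (1 + 1 / Re w)"
proof -
  obtain C where C: "C > 0" "\<forall>w. 0 < Re w \<and> Re w \<le> 1 \<longrightarrow> norm (FF w) \<le> C * lam (Im w) / Re w"
    using FF_bound by (elim exE conjE)
  define g where "g = (\<lambda>n. (ln (real n) + 1) * real n powr (- (3/2)))"
  have g: "summable g" unfolding g_def by (rule summable_ln_powr) simp
  define K where "K = suminf g"
  have D: "norm (dirs (\<lambda>n. mangoldt n * \<psi> n) s) \<le> K" if s: "Re s \<ge> 3/2" for s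
    unfolding dirs_def K_def
  proof (rule norm_suminf_le[OF _ g])
    fix n :: nat
    show "norm (mangoldt n * \<psi> n * of_nat n powr (- s)) \<le> g n"
    proof (cases "n = 0")
      case False
      have "norm (mangoldt n * \<psi> n) \<le> ln (real n) + 1"
        using unitmult_bounds(2)[OF unitmult_psi, of n] False by simp
      moreover have "norm (of_nat n powr (- s)) \<le> real n powr (- (3/2))"
        using False s norm_of_nat_powr[of n "-s"] by (simp add: powr_mono)
      ultimately show ?thesis unfolding norm_mult[of _ "_ powr _"] g_def
        using False by (intro mult_mono) auto
    qed (simp add: g_def)
  qed
  have K0: "K \<ge> 0" using order_trans[OF norm_ge_zero D[of 2]] by simp
  define C' where "C' = C + 2 * (K + real m)"
  show ?thesis
  proof (intro exI[of _ C'] conjI allI impI)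
    show "C' > 0" using C K0 by (simp add: C'_def)
    fix w assume w: "Re w > 0"
    have l0: "lam (Im w) \<ge> 0" using lam_pos less_imp_le by blast
    show "norm (FF w) \<le> C' * lam (Im w) * (1 + 1 / Re w)"
    proof (cases "Re w \<le> 1")
      case True
      have "norm (FF w) \<le> C * lam (Im w) * (1 / Re w)" using C(2) w True by simp
      also have "\<dots> \<le> C' * lam (Im w) * (1 + 1 / Re w)"
        using C K0 l0 w by (intro mult_mono) (auto simp: C'_def)
      finally show ?thesis .
    next
      case False
      have nw: "norm w \<ge> 1" "norm w \<ge> \<bar>Im w\<bar>" using False abs_Re_le_cmod[of w] abs_Im_le_cmod[of w] by auto
      have "norm (dirs (\<lambda>n. mangoldt n * \<psi> n) (1/2 + w) + of_nat m / w) \<le> K + real m / norm w"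
        using D[of "1/2 + w"] False norm_triangle_ineq[of "dirs (\<lambda>n. mangoldt n * \<psi> n) (1/2 + w)" "of_nat m / w"]
        by (simp add: norm_divide)
      also have "real m / norm w \<le> real m / 1" using nw by (intro divide_left_mono) auto
      finally have "norm (dirs (\<lambda>n. mangoldt n * \<psi> n) (1/2 + w) + of_nat m / w) \<le> K + real m" by simp
      hence "norm (FF w) \<le> (K + real m) / norm w"
        using FF_eq[of w] False by (simp add: norm_divide divide_right_mono)
      also have "\<dots> \<le> (K + real m) / ((\<bar>Im w\<bar> + 1) / 2)" using nw K0 by (intro divide_left_mono mult_pos_pos) auto
      also have "\<dots> = 2 * (K + real m) * (1 / (\<bar>Im w\<bar> + 1))" by (simp add: field_simps)
      also have "\<dots> \<le> 2 * (K + real m) * lam (Im w)" using inverse_le_lam[of "Im w"] K0 by (intro mult_left_mono) auto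
      also have "\<dots> \<le> C' * lam (Im w) * 1" using C l0 by (simp add: C'_def mult_right_mono)
      also have "\<dots> \<le> C' * lam (Im w) * (1 + 1 / Re w)" using C K0 l0 w by (intro mult_left_mono) (auto simp: C'_def)
      finally show ?thesis .
    qed
  qed
qed

lemma FF_holomorphic: "(\<lambda>w. FF w) holomorphic_on {w. Re w > 0}"
proof -
  have c: "(\<lambda>w. g (1/2 + w)) holomorphic_on {w. Re w > 0}" if "g holomorphic_on UNIV" for g :: "complex \<Rightarrow> complex"
  proof -
    have "(g \<circ> (\<lambda>w. 1/2 + w)) holomorphic_on {w. Re w > 0}"
      by (rule holomorphic_on_compose_gen[OF _ that]) (auto intro!: holomorphic_intros)
    thus ?thesis by (simp only: comp_def)
  qed
  have L: "(\<lambda>w. Lfun \<psi> (1/2 + w)) holomorphic_on {w. Re w > 0}" by (rule c, rule Lfun_holo)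
  have L': "(\<lambda>w. deriv (Lfun \<psi>) (1/2 + w)) holomorphic_on {w. Re w > 0}"
    by (rule c, rule holomorphic_deriv[OF Lfun_holo open_UNIV])
  have "Lfun \<psi> (1/2 + w) \<noteq> 0" if "Re w > 0" for w using Lfun_zero_Re[of "1/2 + w"] that by auto
  thus ?thesis unfolding FF_def by (intro holomorphic_on_mult holomorphic_on_divide holomorphic_on_minus holomorphic_on_diff L L' holomorphic_on_const holomorphic_on_ident) auto
qed

lemma laplace_ff_integrable:
  assumes K: "\<And>y. y \<ge> 0 \<Longrightarrow> norm (ff y) \<le> K * exp (c * y)" and w: "Re w > c"
  shows "integrable lborel (\<lambda>y. ff y * exp (- (w * of_real y)))"
proof (rule Bochner_Integration.integrable_bound)
  show "integrable lborel (\<lambda>y. K * (indicator {0..} y * exp (- (Re w - c) * y)) :: real)"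
    by (intro integrable_mult_right integrable_exp_half_line) (use w in simp)
  show "AE y in lborel. norm (ff y * exp (- (w * of_real y))) \<le> norm (K * (indicator {0..} y * exp (- (Re w - c) * y)))"
  proof (rule AE_I2)
    fix y
    show "norm (ff y * exp (- (w * of_real y))) \<le> norm (K * (indicator {0..} y * exp (- (Re w - c) * y)))"
    proof (cases "y < 0")
      case False
      have "norm (ff y * exp (- (w * of_real y))) \<le> K * exp (c * y) * exp (- Re w * y)"
        unfolding norm_mult norm_exp_neg using False by (intro mult_right_mono K) auto
      also have "\<dots> = K * exp (c * y + - Re w * y)" unfolding exp_add by simp
      also have "c * y + - Re w * y = - (Re w - c) * y" by (simp add: algebra_simps)
      also have "K * exp \<dots> \<le> \<bar>K * exp (- (Re w - c) * y)\<bar>" by simp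
      finally show ?thesis using False by simp
    qed (simp add: ff_neg)
  qed
qed measurable

text \<open>Each n contributes the exponential e^(-wy) on the half-line from ln n, with integral
  n^(-w)/w. For Re w > 1 sum and integral may be exchanged by absolute convergence, and m y
  contributes m/w^2.\<close>

lemma laplace_ff_far:
  assumes w: "Re w > 1"
  shows "(LINT y|lborel. ff y * exp (- (w * of_real y))) = FF w"
proof -
  have w0: "w \<noteq> 0" using w by auto
  define F where "F = (\<lambda>n y. (indicator {ln (real n)..} y *\<^sub>R exp (- (w * complex_of_real y))) * aa n)"
  have l: "ln (real n) \<ge> 0" for n by (cases "n = 0") auto
  have wr: "Re w > 0" using w by simp
  have Fi: "integrable lborel (F n)" for n
    unfolding F_def by (intro integrable_mult_left laplace_exp(1) l wr)
  have pe: "exp (- (w * of_real (ln (real n)))) * aa n = (mangoldt n * \<psi> n) * of_nat n powr (- (1/2 + w))" for n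
  proof (cases "n = 0")
    case False
    have "- (1/2 + w) = - w + of_real (- (1/2))" by simp
    hence "of_nat n powr (- (1/2 + w)) = of_nat n powr (- w) * of_nat n powr (of_real (- (1/2)))"
      by (simp only: powr_add)
    also have "of_nat n powr (of_real (- (1/2))) = complex_of_real (real n powr (- (1/2)))"
      using powr_of_real[of "real n" "- (1/2)"] by simp
    also have "of_nat n powr (- w) = exp (- (w * of_real (ln (real n))))"
      using False by (simp add: powr_def Ln_of_nat)
    finally show ?thesis by (simp add: aa_def mult_ac)
  qed simp
  have Fv: "(LINT y|lborel. F n y) = ((mangoldt n * \<psi> n) * of_nat n powr (- (1/2 + w))) / w" for n
    unfolding F_def integral_mult_left_zero laplace_exp(2)[OF wr l[of n]] pe[symmetric] by simp
  have Fn: "(LINT y|lborel. norm (F n y)) = norm ((mangoldt n * \<psi> n) * of_nat n powr (- (1/2 + w))) / Re w" for n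
  proof -
    have "(LINT y|lborel. norm (F n y)) = (LINT y|lborel. (indicator {ln (real n)..} y * exp (- Re w * y)) * norm (aa n))"
      unfolding F_def by (rule Bochner_Integration.integral_cong) (auto simp: norm_mult norm_exp_eq_Re)
    also have "\<dots> = exp (- Re w * ln (real n)) / Re w * norm (aa n)"
      using laplace_exp_real[OF wr l[of n]] by simp
    also have "\<dots> = norm (exp (- (w * of_real (ln (real n)))) * aa n) / Re w" by (simp add: norm_mult norm_exp_eq_Re)
    finally show ?thesis unfolding pe .
  qed
  have ps: "(\<lambda>n. F n y) sums ((\<Sum>n\<in>{1..nat \<lfloor>exp y\<rfloor>}. aa n) * exp (- (w * of_real y)))"
    and pn: "summable (\<lambda>n. norm (F n y))" for y
  proof -
    have z: "F n y = 0" if "n \<notin> {1..nat \<lfloor>exp y\<rfloor>}" for n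
    proof (cases "n = 0")
      case False
      hence "\<not> int n \<le> \<lfloor>exp y\<rfloor>" using that by auto
      hence "real n > exp y" by (simp add: le_floor_iff)
      hence "exp y < exp (ln (real n))" using False by simp
      hence "ln (real n) > y" by (simp only: exp_less_cancel_iff)
      thus ?thesis by (simp add: F_def)
    qed (simp add: F_def)
    have v: "F n y = aa n * exp (- (w * of_real y))" if n: "n \<in> {1..nat \<lfloor>exp y\<rfloor>}" for n
    proof -
      have "int n \<le> \<lfloor>exp y\<rfloor>" "n \<ge> 1" using n by auto
      hence "real n \<le> exp y" by (simp add: le_floor_iff)
      hence "ln (real n) \<le> ln (exp y)" using \<open>n \<ge> 1\<close> by (subst ln_le_cancel_iff) auto
      thus ?thesis by (simp add: F_def)
    qed
    have "(\<lambda>n. F n y) sums (\<Sum>n\<in>{1..nat \<lfloor>exp y\<rfloor>}. F n y)" by (rule sums_finite) (use z in auto)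
    also have "(\<Sum>n\<in>{1..nat \<lfloor>exp y\<rfloor>}. F n y) = (\<Sum>n\<in>{1..nat \<lfloor>exp y\<rfloor>}. aa n) * exp (- (w * of_real y))"
      by (simp add: v sum_distrib_right)
    finally show "(\<lambda>n. F n y) sums ((\<Sum>n\<in>{1..nat \<lfloor>exp y\<rfloor>}. aa n) * exp (- (w * of_real y)))" .
    show "summable (\<lambda>n. norm (F n y))" by (rule summable_finite[of "{1..nat \<lfloor>exp y\<rfloor>}"]) (use z in auto)
  qed
  have D: "(\<lambda>n. (mangoldt n * \<psi> n) * of_nat n powr (- (1/2 + w))) sums dirs (\<lambda>n. mangoldt n * \<psi> n) (1/2 + w)"
    by (rule dirs_sums[OF unitmult_bounds(2)[OF unitmult_psi]]) (use w in auto)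
  have Ds: "summable (\<lambda>n. norm ((mangoldt n * \<psi> n) * of_nat n powr (- (1/2 + w))))"
    by (rule dirs_summable_norm[OF unitmult_bounds(2)[OF unitmult_psi]]) (use w in auto)
  have sn: "summable (\<lambda>n. LINT y|lborel. norm (F n y))" unfolding Fn by (rule summable_divide[OF Ds])
  have iS: "integrable lborel (\<lambda>y. \<Sum>n. F n y)"
    by (rule integrable_suminf[OF Fi _ sn]) (use pn in auto)
  have "(LINT y|lborel. (\<Sum>n. F n y)) = (\<Sum>n. LINT y|lborel. F n y)"
    by (rule integral_suminf[OF Fi _ sn]) (use pn in auto)
  also have "\<dots> = dirs (\<lambda>n. mangoldt n * \<psi> n) (1/2 + w) / w"
    unfolding Fv using sums_divide[OF D, of w] by (simp add: sums_iff)
  finally have A: "(LINT y|lborel. (\<Sum>n. F n y)) = dirs (\<lambda>n. mangoldt n * \<psi> n) (1/2 + w) / w" .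
  have e: "ff y * exp (- (w * of_real y)) = (\<Sum>n. F n y) + of_nat m * (indicator {0..} y *\<^sub>R (of_real y * exp (- (w * of_real y))))" for y
    using sums_unique[OF ps[of y]] by (auto simp: ff_def ring_distribs indicator_def max_def)
  have iL: "integrable lborel (\<lambda>y. of_nat m * (indicator {0..} y *\<^sub>R (of_real y * exp (- (w * complex_of_real y)))))"
    by (rule integrable_mult_right[OF laplace_linear(1)[OF wr]])
  have "(LINT y|lborel. ff y * exp (- (w * of_real y))) = dirs (\<lambda>n. mangoldt n * \<psi> n) (1/2 + w) / w + of_nat m * (1 / w\<^sup>2)"
    unfolding e Bochner_Integration.integral_add[OF iS iL] integral_mult_right_zero A laplace_linear(2)[OF wr] ..
  also have "\<dots> = FF w" using FF_eq[of w] w w0 by (simp add: field_simps power2_eq_square)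
  finally show ?thesis .
qed

end


section \<open>Subexponential growth and the Laplace identity on Re w > 0\<close>

lemma lam_tendsto_bound:
  assumes h: "h > 0"
  shows "((\<lambda>t. lam t * exp (- (h * t)\<^sup>2 / 2)) \<longlongrightarrow> 0) at_top"
proof (rule Lim_null_comparison)
  show "\<forall>\<^sub>F t in at_top. norm (lam t * exp (- (h * t)\<^sup>2 / 2)) \<le> 3 * exp (- (h * t)\<^sup>2 / 2)"
    by (intro always_eventually allI) (use lam_le_3 lam_pos in \<open>auto simp: abs_mult less_imp_le\<close>)
  show "((\<lambda>t. 3 * exp (- (h * t)\<^sup>2 / 2)) \<longlongrightarrow> 0) at_top" using h by real_asymp
qed

context grh_char
begin

lemma FF_gauss_bound:
  assumes C: "\<forall>w. Re w > 0 \<longrightarrow> norm (FF w) \<le> C * lam (Im w) * (1 + 1 / Re w)" "C > 0"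
    and w: "0 < a" "a \<le> Re w" "Re w \<le> b" and y: "y \<ge> 0" and h: "0 < h" "h \<le> 1"
  shows "norm (FF w * exp (w * of_real y + of_real (h\<^sup>2) * w\<^sup>2 / 2)) \<le>
     C * (1 + 1 / a) * exp (b * y + b\<^sup>2) * (lam (Im w) * exp (- (h * Im w)\<^sup>2 / 2))"
proof -
  have "Re (w * of_real y + of_real (h\<^sup>2) * w\<^sup>2 / 2) = Re w * y + h\<^sup>2 * (Re w)\<^sup>2 / 2 - (h * Im w)\<^sup>2 / 2"
    by (simp add: power2_eq_square algebra_simps diff_divide_distrib)
  also have "\<dots> \<le> (b * y + b\<^sup>2) + - (h * Im w)\<^sup>2 / 2"
  proof -
    have "Re w * y \<le> b * y" using w y by (intro mult_right_mono) auto
    moreover have "h\<^sup>2 * (Re w)\<^sup>2 \<le> 1 * b\<^sup>2" using w h by (intro mult_mono power_mono power_le_one) auto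
    moreover have "h\<^sup>2 * (Re w)\<^sup>2 \<ge> 0" by simp
    ultimately show ?thesis by linarith
  qed
  finally have "norm (exp (w * of_real y + of_real (h\<^sup>2) * w\<^sup>2 / 2)) \<le> exp (b * y + b\<^sup>2) * exp (- (h * Im w)\<^sup>2 / 2)"
    unfolding norm_exp_eq_Re by (simp only: exp_add[symmetric] exp_le_cancel_iff)
  moreover have "norm (FF w) \<le> C * lam (Im w) * (1 + 1 / a)"
  proof -
    have "norm (FF w) \<le> C * lam (Im w) * (1 + 1 / Re w)" using C w by simp
    also have "\<dots> \<le> C * lam (Im w) * (1 + 1 / a)"
      using w C lam_pos[of "Im w"] by (intro mult_left_mono add_left_mono divide_left_mono) auto
    finally show ?thesis .
  qed
  ultimately have "norm (FF w * exp (w * of_real y + of_real (h\<^sup>2) * w\<^sup>2 / 2)) \<le>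
     C * lam (Im w) * (1 + 1 / a) * (exp (b * y + b\<^sup>2) * exp (- (h * Im w)\<^sup>2 / 2))"
    unfolding norm_mult[of "FF w"] using C w lam_pos[of "Im w"] by (intro mult_mono) auto
  thus ?thesis by (simp only: mult_ac)
qed

text \<open>An inversion formula on the line Re w = 2 for the Gaussian average of \<open>ff\<close>.
  The smoothing makes everything absolutely convergent, so it is an instance of
  \<open>ft_swap\<close>.\<close>

lemma ff_smooth:
  assumes h: "h > 0"
  shows "(LINT z|lborel. ff (y + h * z) * of_real (std_normal_density z)) =
     (LINT t|lborel. FF (Complex 2 t) * exp (Complex 2 t * of_real y + of_real (h\<^sup>2) * (Complex 2 t)\<^sup>2 / 2)) / of_real (2 * pi)"
proof -
  \<comment> \<open>Completing the square: the real part 2 of w moves the centre of the Gaussian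
    from y to y + 2h^2 and leaves the factor e^(2y + 2h^2).\<close>
  define y' where "y' = y + 2 * h\<^sup>2"
  define g where "g = (\<lambda>u. ff u * exp (- (2 * complex_of_real u)))"
  have gi: "integrable lborel g" unfolding g_def
    by (rule laplace_ff_integrable[of "6 + real m" 1]) (use norm_ff in auto)
  define e where "e = (\<lambda>t. complex_of_real (std_normal_density (h * t)) * cis (y' * t))"
  have ei: "integrable lborel e" unfolding e_def
    by (intro integrable_mult_cis integrable_of_real integrable_scaled_normal) (use h in auto)
  have e1: "ft (\<lambda>t. of_real (std_normal_density (h * t))) (y' - u) = ft e (-1 * u)" for u
    unfolding ft_def e_def by (rule Bochner_Integration.integral_cong) (simp_all add: cis_mult algebra_simps)
  have ga: "gauss h (u - y) = exp (2 * y + 2 * h\<^sup>2) * (exp (- 2 * u) * gauss h (y' - u))" for u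
  proof -
    have "- (((u - y) / h)\<^sup>2) / 2 = (2 * y + 2 * h\<^sup>2) + (- 2 * u + - (((y' - u) / h)\<^sup>2) / 2)"
      using h by (simp add: y'_def power2_eq_square field_simps)
    hence "exp (- (((u - y) / h)\<^sup>2) / 2) = exp (2 * y + 2 * h\<^sup>2) * (exp (- 2 * u) * exp (- (((y' - u) / h)\<^sup>2) / 2))"
      by (simp only: exp_add[symmetric])
    thus ?thesis unfolding gauss_def std_normal_density_eq by simp
  qed
  have fg: "ft g (-1 * t) = FF (Complex 2 t)" for t
  proof -
    have "ft g (-1 * t) = (LINT u|lborel. ff u * exp (- (Complex 2 t * of_real u)))"
      unfolding ft_def g_def
      by (rule Bochner_Integration.integral_cong)
         (simp_all add: cis_conv_exp mult.assoc exp_add[symmetric] Complex_eq algebra_simps)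
    also have "\<dots> = FF (Complex 2 t)" by (rule laplace_ff_far) simp
    finally show ?thesis .
  qed
  have "(LINT z|lborel. ff (y + h * z) * of_real (std_normal_density z)) = (LINT u|lborel. ff u * of_real (gauss h (u - y)))"
    by (rule gauss_convolution[symmetric]) (use h in auto)
  also have "\<dots> = (LINT u|lborel. of_real (exp (2 * y + 2 * h\<^sup>2) / sqrt (2 * pi)) * (g u * ft e (-1 * u)))"
  proof (rule Bochner_Integration.integral_cong[OF refl])
    fix u
    have "complex_of_real (exp (- 2 * u)) = exp (- (2 * of_real u))" by (simp add: exp_of_real[symmetric])
    moreover have "complex_of_real (gauss h (y' - u)) = ft e (-1 * u) / of_real (sqrt (2 * pi))"
      using ft_gauss[OF h, of "y' - u"] e1 by simp
    ultimately have "complex_of_real (gauss h (u - y)) = of_real (exp (2 * y + 2 * h\<^sup>2)) * (exp (- (2 * of_real u)) * (ft e (-1 * u) / of_real (sqrt (2 * pi))))"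
      unfolding ga by (simp only: of_real_mult)
    thus "ff u * of_real (gauss h (u - y)) = of_real (exp (2 * y + 2 * h\<^sup>2) / sqrt (2 * pi)) * (g u * ft e (-1 * u))"
      by (simp add: g_def)
  qed
  also have "\<dots> = of_real (exp (2 * y + 2 * h\<^sup>2) / sqrt (2 * pi)) * (LINT u|lborel. g u * ft e (-1 * u))" by simp
  also have "(LINT u|lborel. g u * ft e (-1 * u)) = (LINT t|lborel. e t * FF (Complex 2 t))"
    unfolding ft_swap[OF gi ei] fg ..
  also have "of_real (exp (2 * y + 2 * h\<^sup>2) / sqrt (2 * pi)) * \<dots> =
      (LINT t|lborel. of_real (exp (2 * y + 2 * h\<^sup>2) / sqrt (2 * pi)) * (e t * FF (Complex 2 t)))" by simp
  also have "\<dots> = (LINT t|lborel. (FF (Complex 2 t) * exp (Complex 2 t * of_real y + of_real (h\<^sup>2) * (Complex 2 t)\<^sup>2 / 2)) / of_real (2 * pi))"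
  proof (rule Bochner_Integration.integral_cong[OF refl])
    fix t
    have "Complex 2 t * of_real y + of_real (h\<^sup>2) * (Complex 2 t)\<^sup>2 / 2 =
        of_real (2 * y + 2 * h\<^sup>2) + (of_real (- (h * t)\<^sup>2 / 2) + \<i> * of_real (y' * t))"
      by (simp add: complex_eq_iff y'_def power2_eq_square algebra_simps diff_divide_distrib)
    hence "exp (Complex 2 t * of_real y + of_real (h\<^sup>2) * (Complex 2 t)\<^sup>2 / 2) =
        of_real (exp (2 * y + 2 * h\<^sup>2)) * (of_real (exp (- (h * t)\<^sup>2 / 2)) * cis (y' * t))"
      by (simp only: exp_add cis_conv_exp exp_of_real)
    moreover have "e t = of_real (exp (- (h * t)\<^sup>2 / 2)) * cis (y' * t) / of_real (sqrt (2 * pi))"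
      unfolding e_def std_normal_density_eq by simp
    moreover have "complex_of_real (2 * pi) = of_real (sqrt (2 * pi)) * of_real (sqrt (2 * pi))"
      by (simp only: of_real_mult[symmetric]) simp
    ultimately show "of_real (exp (2 * y + 2 * h\<^sup>2) / sqrt (2 * pi)) * (e t * FF (Complex 2 t)) =
        (FF (Complex 2 t) * exp (Complex 2 t * of_real y + of_real (h\<^sup>2) * (Complex 2 t)\<^sup>2 / 2)) / of_real (2 * pi)"
      by (simp only:) (simp del: of_real_mult)
  qed
  finally show ?thesis by simp
qed

text \<open>The Gaussian average is moved from Re w = 2 to Re w = e, which is allowed because
  \<open>FF\<close> is holomorphic on Re w > 0 under GRH. The line Re w = e gives e^(ey) times a
  loss h^(-2e).\<close>

lemma ff_apriori:
  assumes e: "0 < e" "e \<le> 1/2"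
  shows "\<exists>C>0. \<forall>y\<ge>0. norm (ff y) \<le> C * exp (3 * e * y)"
proof -
  obtain C where C: "C > 0" "\<forall>w. Re w > 0 \<longrightarrow> norm (FF w) \<le> C * lam (Im w) * (1 + 1 / Re w)"
    using FF_bound_all by (elim exE conjE)
  obtain C2 where C2: "C2 > 0" "\<forall>h. 0 < h \<and> h \<le> 1 \<longrightarrow> integrable lborel (\<lambda>t. lam t * exp (- (h * t)\<^sup>2 / 2)) \<and>
     (LINT t|lborel. lam t * exp (- (h * t)\<^sup>2 / 2)) \<le> C2 * h powr (- 2 * e)"
    using gauss_lam_integral[OF e] by (elim exE conjE)
  define D where "D = (LINT z|lborel. (6 + real m) * (exp (2 * \<bar>z\<bar>) * std_normal_density z))"
  define B where "B = C * (1 + 1 / e) * exp (e\<^sup>2)"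
  have "1 + 1 / e > 0" using e by (simp add: add_pos_pos)
  hence B: "B > 0" using C e by (simp add: B_def)
  have D0: "D \<ge> 0" unfolding D_def by (intro integral_nonneg_AE AE_I2) simp
  have main: "norm (ff y) \<le> (D + B * C2) * exp (3 * e * y)" if y: "y \<ge> 0" for y :: real
  proof -
    \<comment> \<open>At this scale e^(y + hz) differs from e^y only by a bounded amount when z is
      bounded, so smoothing changes \<open>ff\<close> by O(1), while h^(-2e) = e^(2ey) remains
      affordable.\<close>
    define h where "h = exp (- y)"
    have h: "0 < h" "h \<le> 1" using y by (auto simp: h_def)
    define P where "P = (\<lambda>w. FF w * exp (w * of_real y + of_real (h\<^sup>2) * w\<^sup>2 / 2))"
    define S where "S = (LINT z|lborel. ff (y + h * z) * of_real (std_normal_density z))"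
    have li: "integrable lborel (\<lambda>t. lam t * exp (- (h * t)\<^sup>2 / 2))"
      and lv: "(LINT t|lborel. lam t * exp (- (h * t)\<^sup>2 / 2)) \<le> C2 * h powr (- 2 * e)" using C2 h by blast+
    have hol: "P holomorphic_on {w. Re w > 0}" unfolding P_def
      by (intro holomorphic_on_mult FF_holomorphic holomorphic_intros) auto
    have shift: "(LINT t|lborel. P (Complex e t)) = (LINT t|lborel. P (Complex 2 t))"
    proof (rule vertical_line_shift[OF hol])
      show "integrable lborel (\<lambda>t. C * (1 + 1 / e) * exp (2 * y + 2\<^sup>2) * (lam t * exp (- (h * t)\<^sup>2 / 2)))"
        by (intro integrable_mult_right li)
      show "((\<lambda>t. C * (1 + 1 / e) * exp (2 * y + 2\<^sup>2) * (lam t * exp (- (h * t)\<^sup>2 / 2))) \<longlongrightarrow> 0) at_top"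
        by (rule tendsto_mult_right_zero[OF lam_tendsto_bound[OF h(1)]])
      show "norm (P w) \<le> C * (1 + 1 / e) * exp (2 * y + 2\<^sup>2) * (lam (Im w) * exp (- (h * Im w)\<^sup>2 / 2))"
        if "e \<le> Re w" "Re w \<le> 2" for w
        unfolding P_def by (rule FF_gauss_bound[OF C(2,1)]) (use that e h y in auto)
    qed (use e in \<open>auto simp: lam_def\<close>)
    have "norm (LINT t|lborel. P (Complex e t)) \<le> (LINT t|lborel. C * (1 + 1 / e) * exp (e * y + e\<^sup>2) * (lam t * exp (- (h * t)\<^sup>2 / 2)))"
    proof (rule lebesgue_norm_bound)
      show "integrable lborel (\<lambda>t. C * (1 + 1 / e) * exp (e * y + e\<^sup>2) * (lam t * exp (- (h * t)\<^sup>2 / 2)))"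
        by (intro integrable_mult_right li)
      show "norm (P (Complex e t)) \<le> C * (1 + 1 / e) * exp (e * y + e\<^sup>2) * (lam t * exp (- (h * t)\<^sup>2 / 2))" for t
        using FF_gauss_bound[OF C(2,1), of e "Complex e t" e y h] e h y unfolding P_def by simp
    qed
    also have "\<dots> = B * exp (e * y) * (LINT t|lborel. lam t * exp (- (h * t)\<^sup>2 / 2))"
      by (simp add: B_def exp_add)
    also have "\<dots> \<le> B * exp (e * y) * (C2 * h powr (- 2 * e))" using B lv by (intro mult_left_mono) auto
    also have "h powr (- 2 * e) = exp (2 * e * y)" by (simp add: h_def powr_def)
    also have "B * exp (e * y) * (C2 * exp (2 * e * y)) = B * C2 * (exp (e * y + 2 * e * y))" unfolding exp_add by simp
    also have "e * y + 2 * e * y = 3 * e * y" by simp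
    finally have IP: "norm (LINT t|lborel. P (Complex e t)) \<le> B * C2 * exp (3 * e * y)" .
    have "S = (LINT t|lborel. P (Complex 2 t)) / of_real (2 * pi)" unfolding S_def P_def by (rule ff_smooth[OF h(1)])
    hence "norm S = norm (LINT t|lborel. P (Complex e t)) / (2 * pi)" by (simp add: shift norm_divide)
    also have "\<dots> \<le> norm (LINT t|lborel. P (Complex e t)) / 1"
      by (intro divide_left_mono) (use pi_gt3 in auto)
    finally have Sb: "norm S \<le> B * C2 * exp (3 * e * y)" using IP by simp
    \<comment> \<open>The pointwise smoothing error is dominated, independently of y, by e^(2|z|)
      times the normal density, which is integrable.\<close>
    have db: "norm ((ff (y + h * z) - ff y) * of_real (std_normal_density z)) \<le> (6 + real m) * (exp (2 * \<bar>z\<bar>) * std_normal_density z)" for z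
    proof -
      define E where "E = exp (2 * \<bar>z\<bar>)"
      have E1: "1 \<le> E" by (simp add: E_def)
      have z1: "\<bar>z\<bar> \<le> exp \<bar>z\<bar>" using exp_ge_add_one_self[of "\<bar>z\<bar>"] by linarith
      have "\<bar>z\<bar> * exp \<bar>z\<bar> \<le> exp \<bar>z\<bar> * exp \<bar>z\<bar>" using z1 by (intro mult_right_mono) auto
      also have "\<dots> = E" unfolding E_def exp_add[symmetric] by simp
      finally have E2: "\<bar>z\<bar> * exp \<bar>z\<bar> \<le> E" .
      have hz: "\<bar>h * z\<bar> \<le> \<bar>z\<bar>" using h by (simp add: abs_mult mult_left_le_one_le)
      have E3: "\<bar>h * z\<bar> \<le> E"
      proof -
        have "\<bar>z\<bar> * 1 \<le> \<bar>z\<bar> * exp \<bar>z\<bar>" by (intro mult_left_mono) auto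
        thus ?thesis using hz E2 by linarith
      qed
      have "exp (y + h * z) - exp y = exp y * (exp (h * z) - 1)" by (simp add: exp_add algebra_simps)
      hence "\<bar>exp (y + h * z) - exp y\<bar> = exp y * \<bar>exp (h * z) - 1\<bar>" by (simp add: abs_mult)
      also have "\<dots> \<le> exp y * (\<bar>h * z\<bar> * exp \<bar>h * z\<bar>)" by (intro mult_left_mono abs_exp_minus_1_le) auto
      also have "\<dots> = \<bar>z\<bar> * exp \<bar>h * z\<bar>" using h by (simp add: h_def abs_mult exp_minus)
      also have "\<dots> \<le> \<bar>z\<bar> * exp \<bar>z\<bar>" using hz by (intro mult_left_mono) auto
      finally have E4: "\<bar>exp (y + h * z) - exp y\<bar> \<le> E" using E2 by linarith
      have "norm (ff (y + h * z) - ff y) \<le> 3 * (\<bar>exp (y + h * z) - exp y\<bar> + 1) + real m * \<bar>h * z\<bar>"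
        using ff_diff[of "y + h * z" y] by simp
      also have "\<dots> \<le> 3 * (E + E) + real m * E" using E1 E3 E4 by (intro add_mono mult_left_mono) auto
      also have "\<dots> = (6 + real m) * E" by (simp add: algebra_simps)
      finally have "norm (ff (y + h * z) - ff y) * std_normal_density z \<le> (6 + real m) * E * std_normal_density z"
        by (rule mult_right_mono) simp
      thus ?thesis by (simp add: norm_mult E_def mult.assoc)
    qed
    have Di: "integrable lborel (\<lambda>z. (6 + real m) * (exp (2 * \<bar>z\<bar>) * std_normal_density z))"
      by (intro integrable_mult_right integrable_exp_abs_normal)
    have di: "integrable lborel (\<lambda>z. (ff (y + h * z) - ff y) * of_real (std_normal_density z))"
    proof (rule Bochner_Integration.integrable_bound[OF Di])
      show "AE z in lborel. norm ((ff (y + h * z) - ff y) * of_real (std_normal_density z)) \<le> norm ((6 + real m) * (exp (2 * \<bar>z\<bar>) * std_normal_density z))"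
        by (intro AE_I2 order_trans[OF db]) simp
    qed measurable
    have ci: "integrable lborel (\<lambda>z. ff y * of_real (std_normal_density z))"
      by (intro integrable_mult_right integrable_of_real integrable_std_normal_density)
    have "S = (LINT z|lborel. ff y * of_real (std_normal_density z) + (ff (y + h * z) - ff y) * of_real (std_normal_density z))"
      unfolding S_def by (rule Bochner_Integration.integral_cong) (auto simp: algebra_simps)
    also have "\<dots> = ff y * (LINT z|lborel. of_real (std_normal_density z)) + (LINT z|lborel. (ff (y + h * z) - ff y) * of_real (std_normal_density z))"
      using Bochner_Integration.integral_add[OF ci di] by simp
    also have "(LINT z|lborel. complex_of_real (std_normal_density z)) = 1"
      using ft_std_normal[of 0] by (simp add: ft_def cis_zero)
    finally have fy: "ff y = S - (LINT z|lborel. (ff (y + h * z) - ff y) * of_real (std_normal_density z))" by simp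
    have "norm (ff y) \<le> norm S + norm (LINT z|lborel. (ff (y + h * z) - ff y) * of_real (std_normal_density z))"
      by (subst fy) (rule norm_triangle_ineq4)
    also have "norm (LINT z|lborel. (ff (y + h * z) - ff y) * of_real (std_normal_density z)) \<le> D"
      unfolding D_def by (rule lebesgue_norm_bound[OF Di db])
    also have "D \<le> D * exp (3 * e * y)" using D0 e y by (simp add: mult_le_cancel_left1)
    finally show ?thesis using Sb by (simp add: algebra_simps)
  qed
  show ?thesis
    by (intro exI[of _ "D + B * C2"] conjI allI impI main) (use D0 B C2 in \<open>auto intro!: add_nonneg_pos mult_pos_pos\<close>)
qed

lemma ff_subexp:
  assumes "e > 0"
  shows "\<exists>C>0. \<forall>y\<ge>0. norm (ff y) \<le> C * exp (e * y)"
proof -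
  define e' where "e' = min (e / 3) (1/2)"
  have e': "0 < e'" "e' \<le> 1/2" "3 * e' \<le> e" using assms by (auto simp: e'_def)
  obtain C where C: "C > 0" "\<forall>y\<ge>0. norm (ff y) \<le> C * exp (3 * e' * y)" using ff_apriori[OF e'(1,2)] by (elim exE conjE)
  have "norm (ff y) \<le> C * exp (e * y)" if y: "y \<ge> 0" for y :: real
  proof -
    have "norm (ff y) \<le> C * exp (3 * e' * y)" using C y by simp
    also have "\<dots> \<le> C * exp (e * y)" using C e' y by (auto intro!: mult_right_mono)
    finally show ?thesis .
  qed
  thus ?thesis using C(1) by blast
qed

text \<open>By \<open>ff_subexp\<close> the integral is holomorphic on Re w > e for every e > 0, so
  the identity from Re w > 1 extends to the full right half-plane.\<close>

lemma laplace_ff: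
  assumes w: "Re w > 0"
  shows "integrable lborel (\<lambda>y. ff y * exp (- (w * of_real y)))"
    "(LINT y|lborel. ff y * exp (- (w * of_real y))) = FF w"
proof -
  define e where "e = Re w / 2"
  have e: "e > 0" "Re w > e" using w by (auto simp: e_def)
  obtain C where "C > 0" and C: "\<forall>y\<ge>0. norm (ff y) \<le> C * exp (e * y)" using ff_subexp[OF e(1)] by (elim exE conjE)
  show "integrable lborel (\<lambda>y. ff y * exp (- (w * of_real y)))"
    by (rule laplace_ff_integrable[of C e]) (use C e in auto)
  show "(LINT y|lborel. ff y * exp (- (w * of_real y))) = FF w"
  proof (rule half_plane_identity[where c = e and d = 1 and f = "\<lambda>w. LINT y|lborel. ff y * exp (- (w * of_real y))" and g = "\<lambda>w. FF w"])
    show "(\<lambda>w. LINT y|lborel. ff y * exp (- (w * of_real y))) holomorphic_on {s. Re s > e}"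
    proof (rule holomorphic_onI)
      fix s assume "s \<in> {s. Re s > e}"
      hence "((\<lambda>w. LINT y|lborel. ff y * exp (- (w * of_real y))) has_field_derivative
          (LINT y|lborel. - of_real y * (ff y * exp (- (s * of_real y))))) (at s)"
        by (intro laplace_has_field_derivative[where c = e and C = C]) (use C ff_neg in auto)
      thus "(\<lambda>w. LINT y|lborel. ff y * exp (- (w * of_real y))) field_differentiable at s within {s. Re s > e}"
        unfolding field_differentiable_def by (intro exI) (rule has_field_derivative_at_within)
    qed
    show "(\<lambda>w. FF w) holomorphic_on {s. Re s > e}" by (rule holomorphic_on_subset[OF FF_holomorphic]) (use e in auto)
    show "(LINT y|lborel. ff y * exp (- (s * of_real y))) = FF s" if "1 < Re s" for s by (rule laplace_ff_far[OF that])
  qed (rule e(2))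
qed

lemma ff_isCont:
  assumes "y \<notin> insert 0 (range (\<lambda>n. ln (real n)))"
  shows "isCont ff y"
proof -
  have "exp y \<notin> \<int>"
  proof
    assume "exp y \<in> \<int>"
    then obtain k where k: "exp y = of_int k" by (auto elim: Ints_cases)
    hence "k > 0" using exp_gt_zero[of y] by simp
    hence "exp y = real (nat k)" using k by simp
    hence "y = ln (real (nat k))" by (metis ln_exp)
    thus False using assms by auto
  qed
  moreover have "isCont exp y" by simp
  ultimately have "\<forall>\<^sub>F u in at y. \<lfloor>exp u\<rfloor> = \<lfloor>exp y\<rfloor>"
    unfolding isCont_def by (intro eventually_floor_eq) auto
  hence "\<forall>\<^sub>F u in at y. (\<Sum>n\<in>{1..nat \<lfloor>exp y\<rfloor>}. aa n) + of_real (real m * max 0 u) = ff u"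
    by eventually_elim (simp add: ff_def)
  moreover have "((\<lambda>u. (\<Sum>n\<in>{1..nat \<lfloor>exp y\<rfloor>}. aa n) + of_real (real m * max 0 u)) \<longlongrightarrow>
     (\<Sum>n\<in>{1..nat \<lfloor>exp y\<rfloor>}. aa n) + of_real (real m * max 0 y)) (at y)"
    by (intro tendsto_intros)
  ultimately have "(ff \<longlongrightarrow> (\<Sum>n\<in>{1..nat \<lfloor>exp y\<rfloor>}. aa n) + of_real (real m * max 0 y)) (at y)"
    by (rule Lim_transform_eventually[rotated])
  thus ?thesis by (simp add: isCont_def ff_def)
qed

end


section \<open>The mean-square bound on short windows\<close>

lemma fejer_measurable [measurable]: "fejer \<in> borel_measurable borel"
proof -
  have [measurable]: "ft tri \<in> borel_measurable borel" by (rule ft_measurable) simp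
  show ?thesis unfolding fejer_def by measurable
qed

lemma fejer_integrable: "integrable lborel fejer"
proof (rule Bochner_Integration.integrable_bound)
  show "integrable lborel (\<lambda>v::real. 64 * (1 + \<bar>v\<bar>) powr (- 1 - 1))"
    by (rule integrable_mult_right, rule integrable_powr_decay) simp
  show "AE v in lborel. norm (fejer v) \<le> norm (64 * (1 + \<bar>v\<bar>) powr (- 1 - 1))"
  proof (rule AE_I2)
    fix v :: real
    have "(1 + \<bar>v\<bar>)\<^sup>2 \<le> 2 * (1 + v\<^sup>2)"
      using zero_le_power2[of "\<bar>v\<bar> - 1"] by (simp add: power2_sum power2_diff)
    hence "inverse (1 + v\<^sup>2) \<le> 2 * inverse ((1 + \<bar>v\<bar>)\<^sup>2)"
      by (simp add: field_simps add_pos_nonneg)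
    also have "inverse ((1 + \<bar>v\<bar>)\<^sup>2) = (1 + \<bar>v\<bar>) powr (- 1 - 1)"
      by (simp add: powr_minus powr_numeral)
    finally show "norm (fejer v) \<le> norm (64 * (1 + \<bar>v\<bar>) powr (- 1 - 1))"
      using fejer_le[of v] fejer_nonneg[of v] by simp
  qed
qed measurable

lemma fejer_shift:
  "integrable lborel (\<lambda>y. fejer (y - Y))" "(LINT y|lborel. fejer (y - Y)) = (LINT v|lborel. fejer v)"
proof -
  show "integrable lborel (\<lambda>y. fejer (y - Y))"
    using lborel_integrable_real_affine[OF fejer_integrable, of 1 "- Y"] by simp
  show "(LINT y|lborel. fejer (y - Y)) = (LINT v|lborel. fejer v)"
    using lborel_integral_real_affine[of 1 fejer "- Y"] by simp
qed

lemma fejer_bound: "fejer v \<le> 32"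
proof -
  have "inverse (1 + v\<^sup>2) \<le> inverse 1" by (rule le_imp_inverse_le) auto
  thus ?thesis using fejer_le[of v] by simp
qed

lemma fejer_isCont:
  assumes "v \<noteq> 0" shows "isCont fejer v"
proof -
  have "isCont (\<lambda>v::real. 8 * (1 - cos (v / 4)) / v\<^sup>2) v" using assms by (intro continuous_intros) auto
  moreover have "\<forall>\<^sub>F u in nhds v. fejer u = 8 * (1 - cos (u / 4)) / u\<^sup>2"
  proof -
    have "\<forall>\<^sub>F u in nhds v. u \<in> - {0}" by (rule eventually_nhds_in_open) (use assms in auto)
    thus ?thesis by eventually_elim (simp add: fejer_def ft_tri)
  qed
  ultimately show ?thesis by (simp add: isCont_cong)
qed

lemma integrable_mult_ft:
  assumes e: "integrable lborel e" and k: "integrable lborel k"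
  shows "integrable lborel (\<lambda>u. e u * ft k u)"
proof (rule Bochner_Integration.integrable_bound)
  have [measurable]: "e \<in> borel_measurable borel" "k \<in> borel_measurable borel" using e k by auto
  show "integrable lborel (\<lambda>u. (LINT y|lborel. norm (k y)) * norm (e u))" using e by simp
  show "AE u in lborel. norm (e u * ft k u) \<le> norm ((LINT y|lborel. norm (k y)) * norm (e u))"
  proof (rule AE_I2)
    fix u
    have "norm (ft k u) * norm (e u) \<le> (LINT y|lborel. norm (k y)) * norm (e u)"
      by (intro mult_right_mono norm_ft_le k) simp
    also have "\<dots> \<le> norm ((LINT y|lborel. norm (k y)) * norm (e u))" by simp
    finally show "norm (e u * ft k u) \<le> norm ((LINT y|lborel. norm (k y)) * norm (e u))"
      unfolding norm_mult by (simp add: mult.commute)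
  qed
  have [measurable]: "ft k \<in> borel_measurable borel" by (rule ft_measurable) simp
  show "(\<lambda>u. e u * ft k u) \<in> borel_measurable lborel" by measurable
qed

lemma norm_tri_le: "norm (tri u) \<le> indicator {-1/4..1/4} u"
  by (auto simp: tri_def indicator_def)

context grh_char
begin

text \<open>Plancherel for g(y) = f(y) e^(-\<delta>y) times the Fejer weight centred at Y. All
  constants in the bound for the transform of g are independent of \<delta> and Y, although
  |\<open>FF\<close>| itself may be of size 1/\<delta> near a zero.\<close>

lemma ff_stepanov: "\<exists>C>0. \<forall>Y\<ge>1. (LINT y|lborel. indicator {Y-1..Y+1} y * (norm (ff y))\<^sup>2) \<le> C"
proof -
  obtain C where C: "C > 0" and dec: "\<forall>t. \<exists>J c E. finite J \<and> (\<Sum>\<gamma>\<in>J. norm (c \<gamma>)) \<le> C * lam t \<and>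
     (\<forall>w. 0 < Re w \<and> Re w \<le> 1 \<and> \<bar>Im w - t\<bar> \<le> 1/4 \<longrightarrow>
        FF w = (\<Sum>\<gamma>\<in>J. c \<gamma> / (w - \<i> * of_real \<gamma>)) + E w \<and> norm (E w) \<le> C * lam t)"
    using FF_decomposition by (elim exE conjE)
  define F0 where "F0 = (LINT v|lborel. fejer v)"
  have F0: "F0 \<ge> 0" unfolding F0_def by (intro integral_nonneg_AE AE_I2 fejer_nonneg)
  define K where "K = C * (F0 + 1)"
  have K: "K > 0" using C F0 by (simp add: K_def)
  define L where "L = (LINT t|lborel. (K * lam t)\<^sup>2) / (2 * pi)"
  have Hi: "integrable lborel (\<lambda>t. (K * lam t)\<^sup>2)" using integrable_lam_sq by (simp add: power_mult_distrib)
  have L0: "L \<ge> 0" unfolding L_def by (intro divide_nonneg_nonneg integral_nonneg_AE AE_I2) auto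
  have main: "(LINT y|lborel. indicator {Y-1..Y+1} y * (norm (ff y))\<^sup>2) \<le> (16 * exp 2)\<^sup>2 * L" if Y: "Y \<ge> 1" for Y :: real
  proof -
    \<comment> \<open>With this choice e^(-\<delta>y) is at least e^(-2) on the window
      [Y - 1, Y + 1], so the damping costs only a constant.\<close>
    define \<delta> where "\<delta> = 1 / Y"
    have \<delta>: "\<delta> > 0" "\<delta> \<le> 1" using Y by (auto simp: \<delta>_def)
    define e where "e = (\<lambda>u. tri u * cis (- Y * u))"
    have ei: "integrable lborel e" unfolding e_def by (rule integrable_mult_cis[OF tri_integrable])
    have fe: "ft e y = of_real (fejer (y - Y))" for y
    proof -
      have "ft e y = ft tri (y - Y)" unfolding ft_def e_def
        by (rule Bochner_Integration.integral_cong) (simp_all add: mult.assoc cis_mult algebra_simps)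
      thus ?thesis by (simp add: ft_tri_fejer)
    qed
    have ne: "norm (e u) \<le> indicator {-1/4..1/4} u" for u using norm_tri_le[of u] by (simp add: e_def norm_mult)
    define g where "g = (\<lambda>y. ff y * of_real (exp (- \<delta> * y) * fejer (y - Y)))"
    have gm [measurable]: "g \<in> borel_measurable borel" unfolding g_def by measurable
    \<comment> \<open>This constant depends on \<delta>. It serves for integrability and boundedness
      of g and does not enter the final estimate.\<close>
    obtain B where B: "B > 0" "\<forall>y\<ge>0. norm (ff y) \<le> B * exp (\<delta> * y)" using ff_subexp[OF \<delta>(1)] by (elim exE conjE)
    have gb: "norm (g y) \<le> B * fejer (y - Y)" for y
    proof (cases "y < 0")
      case False
      have "norm (g y) = norm (ff y) * (exp (- \<delta> * y) * fejer (y - Y))"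
        unfolding g_def norm_mult norm_of_real using fejer_nonneg by simp
      also have "\<dots> \<le> (B * exp (\<delta> * y)) * (exp (- \<delta> * y) * fejer (y - Y))"
        using B False fejer_nonneg by (intro mult_right_mono) auto
      also have "\<dots> = B * fejer (y - Y)" by (simp add: exp_minus)
      finally show ?thesis .
    qed (use B fejer_nonneg in \<open>simp add: g_def ff_neg\<close>)
    have gi: "integrable lborel g"
    proof (rule Bochner_Integration.integrable_bound)
      show "integrable lborel (\<lambda>y. B * fejer (y - Y))" by (intro integrable_mult_right fejer_shift)
      show "AE y in lborel. norm (g y) \<le> norm (B * fejer (y - Y))" by (intro AE_I2 order_trans[OF gb]) simp
    qed measurable
    have gB: "norm (g y) \<le> B * 32" for y
      using order_trans[OF gb mult_left_mono[OF fejer_bound]] B by simp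
    \<comment> \<open>The transform at -t is the integral of \<open>FF\<close> at \<delta> + i(t -
      u) against the triangle with a phase. It is split into the pole part S and the remainder,
      following \<open>FF_decomposition\<close> at height t.\<close>
    have ftg: "norm (ft g (- t)) \<le> K * lam t" for t
    proof -
      define k where "k = (\<lambda>y. ff y * exp (- (Complex \<delta> t * of_real y)))"
      have ki: "integrable lborel k" unfolding k_def by (rule laplace_ff) (use \<delta> in simp)
      have fk: "ft k u = FF (Complex \<delta> (t - u))" for u
      proof -
        have "ft k u = (LINT y|lborel. ff y * exp (- (Complex \<delta> (t - u) * of_real y)))"
          unfolding ft_def k_def
          by (rule Bochner_Integration.integral_cong)
             (simp_all add: cis_conv_exp mult.assoc exp_add[symmetric] Complex_eq algebra_simps)
        also have "\<dots> = FF (Complex \<delta> (t - u))" by (rule laplace_ff) (use \<delta> in simp)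
        finally show ?thesis .
      qed
      have "ft g (- t) = (LINT y|lborel. k y * ft e (1 * y))"
        unfolding ft_def[of g]
      proof (rule Bochner_Integration.integral_cong[OF refl])
        fix y
        have "exp (- (Complex \<delta> t * of_real y)) = of_real (exp (- \<delta> * y)) * cis (- t * y)"
          by (simp add: cis_conv_exp exp_of_real[symmetric] exp_add[symmetric] Complex_eq algebra_simps)
        thus "g y * cis (- t * y) = k y * ft e (1 * y)" by (simp add: g_def k_def fe)
      qed
      also have "\<dots> = (LINT u|lborel. e u * ft k u)" unfolding ft_swap[OF ki ei] by simp
      finally have G: "ft g (- t) = (LINT u|lborel. e u * ft k u)" .
      obtain J c E where J: "finite J" "(\<Sum>\<gamma>\<in>J. norm (c \<gamma>)) \<le> C * lam t"
        and JE: "\<forall>w. 0 < Re w \<and> Re w \<le> 1 \<and> \<bar>Im w - t\<bar> \<le> 1/4 \<longrightarrow>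
          FF w = (\<Sum>\<gamma>\<in>J. c \<gamma> / (w - \<i> * of_real \<gamma>)) + E w \<and> norm (E w) \<le> C * lam t"
        using dec[rule_format, of t] by (elim exE conjE)
      \<comment> \<open>On the line Re w = \<delta> a single pole 1/(w - i\<gamma>) is the transform
        of a half-line exponential of modulus at most 1. Swapping transforms therefore bounds its
        smoothed value by the integral of the Fejer weight, uniformly in \<delta> and
        \<gamma>.\<close>
      define kk where "kk = (\<lambda>\<gamma> y. indicator {0..} y *\<^sub>R exp (- (Complex \<delta> (t - \<gamma>) * complex_of_real y)))"
      have kki: "integrable lborel (kk \<gamma>)" for \<gamma> unfolding kk_def by (rule laplace_exp) (use \<delta> in auto)
      have fkk: "ft (kk \<gamma>) u = 1 / (Complex \<delta> (t - u) - \<i> * of_real \<gamma>)" for \<gamma> u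
      proof -
        have "ft (kk \<gamma>) u = (LINT y|lborel. indicator {0..} y *\<^sub>R exp (- (Complex \<delta> (t - \<gamma> - u) * of_real y)))"
          unfolding ft_def kk_def
          by (rule Bochner_Integration.integral_cong)
             (simp_all add: cis_conv_exp exp_add[symmetric] Complex_eq algebra_simps)
        also have "\<dots> = exp (- (Complex \<delta> (t - \<gamma> - u) * of_real 0)) / Complex \<delta> (t - \<gamma> - u)"
          by (rule laplace_exp) (use \<delta> in auto)
        also have "Complex \<delta> (t - \<gamma> - u) = Complex \<delta> (t - u) - \<i> * of_real \<gamma>" by (simp add: complex_eq_iff)
        finally show ?thesis by simp
      qed
      have pole: "norm (LINT u|lborel. e u * ft (kk \<gamma>) u) \<le> F0" for \<gamma>
      proof -
        have "(LINT u|lborel. e u * ft (kk \<gamma>) u) = (LINT y|lborel. kk \<gamma> y * ft e y)"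
          using ft_swap[OF ei kki[of \<gamma>], of 1] by simp
        also have "norm \<dots> \<le> (LINT y|lborel. fejer (y - Y))"
        proof (rule lebesgue_norm_bound[OF fejer_shift(1)])
          fix y
          have "norm (kk \<gamma> y) \<le> 1" using \<delta> by (auto simp: kk_def indicator_def norm_exp_eq_Re)
          hence "norm (kk \<gamma> y) * fejer (y - Y) \<le> 1 * fejer (y - Y)" by (intro mult_right_mono fejer_nonneg)
          thus "norm (kk \<gamma> y * ft e y) \<le> fejer (y - Y)" using fejer_nonneg by (simp add: norm_mult fe)
        qed
        finally show ?thesis by (simp add: fejer_shift F0_def)
      qed
      define S where "S = (\<lambda>u. \<Sum>\<gamma>\<in>J. c \<gamma> * (e u * ft (kk \<gamma>) u))"
      have Si: "integrable lborel S" unfolding S_def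
        by (intro Bochner_Integration.integrable_sum integrable_mult_right integrable_mult_ft ei kki)
      have Sv: "(LINT u|lborel. S u) = (\<Sum>\<gamma>\<in>J. c \<gamma> * (LINT u|lborel. e u * ft (kk \<gamma>) u))"
        unfolding S_def by (subst Bochner_Integration.integral_sum)
          (auto intro!: integrable_mult_right integrable_mult_ft ei kki)
      have "norm (LINT u|lborel. S u) \<le> (\<Sum>\<gamma>\<in>J. norm (c \<gamma>) * F0)"
        unfolding Sv by (intro sum_norm_le) (auto simp: norm_mult intro!: mult_left_mono pole)
      also have "\<dots> \<le> C * lam t * F0" unfolding sum_distrib_right[symmetric] using J F0 by (intro mult_right_mono) auto
      finally have Sb: "norm (LINT u|lborel. S u) \<le> C * lam t * F0" .
      \<comment> \<open>Outside the support of the triangle everything vanishes; inside it the pole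
        sum cancels and only the remainder E is left.\<close>
      have Rb: "norm (LINT u|lborel. e u * ft k u - S u) \<le> (LINT u|lborel. C * lam t * indicator {-1/4..1/4::real} u)"
      proof (rule lebesgue_norm_bound)
        show "integrable lborel (\<lambda>u. C * lam t * indicator {-1/4..1/4::real} u)"
          by (intro integrable_mult_right integrable_indicator_Icc)
        fix u :: real
        have l: "C * lam t \<ge> 0" using C lam_pos[of t] by simp
        show "norm (e u * ft k u - S u) \<le> C * lam t * indicator {-1/4..1/4::real} u"
        proof (cases "u \<in> {-1/4..1/4}")
          case False
          hence "norm (e u) \<le> 0" using ne[of u] by simp
          thus ?thesis using False by (simp add: S_def)
        next
          case True
          let ?w = "Complex \<delta> (t - u)"
          have FFw: "FF ?w = (\<Sum>\<gamma>\<in>J. c \<gamma> / (?w - \<i> * of_real \<gamma>)) + E ?w" "norm (E ?w) \<le> C * lam t"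
            using JE[rule_format, of ?w] True \<delta> by auto
          have "S u = e u * (\<Sum>\<gamma>\<in>J. c \<gamma> / (?w - \<i> * of_real \<gamma>))"
            unfolding S_def fkk sum_distrib_left by (intro sum.cong) auto
          hence "e u * ft k u - S u = e u * E ?w" unfolding fk FFw(1) by (simp add: algebra_simps)
          also have "norm \<dots> \<le> indicator {-1/4..1/4} u * (C * lam t)"
            unfolding norm_mult using ne[of u] FFw(2) by (intro mult_mono) auto
          finally show ?thesis by (simp add: mult.commute)
        qed
      qed
      have "(LINT u|lborel. e u * ft k u) = (LINT u|lborel. (e u * ft k u - S u) + S u)" by simp
      also have "\<dots> = (LINT u|lborel. e u * ft k u - S u) + (LINT u|lborel. S u)"
        by (rule Bochner_Integration.integral_add[OF Bochner_Integration.integrable_diff[OF integrable_mult_ft[OF ei ki] Si] Si])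
      finally have "norm (ft g (- t)) \<le> norm (LINT u|lborel. e u * ft k u - S u) + norm (LINT u|lborel. S u)"
        unfolding G by (simp only: norm_triangle_ineq)
      also have "\<dots> \<le> C * lam t * (1/2) + C * lam t * F0"
        using Rb Sb lint_indicator_Icc[of "-1/4" "1/4"] by simp
      also have "\<dots> \<le> K * lam t" using C lam_pos[of t] by (simp add: K_def algebra_simps)
      finally show ?thesis .
    qed
    \<comment> \<open>The jumps of \<open>ff\<close> are at logarithms of integers; Y is added
      because continuity of \<open>fejer\<close> is established away from 0.\<close>
    define D where "D = insert Y (insert 0 (range (\<lambda>n. ln (real n))))"
    have gc: "isCont g y" if "y \<notin> D" for y
      unfolding g_def
      by (intro continuous_intros ff_isCont isCont_o2[where g = fejer and f = "\<lambda>y. y - Y"] fejer_isCont)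
         (use that in \<open>auto simp: D_def\<close>)
    have "(LINT y|lborel. (norm (g y))\<^sup>2) \<le> L"
      unfolding L_def
    proof (rule plancherel_le[OF gi gB _ gc Hi])
      show "countable D" by (simp add: D_def)
      fix t
      have "norm (ft g t) \<le> K * lam t" using ftg[of "- t"] by (simp add: lam_def)
      thus "(norm (ft g t))\<^sup>2 \<le> (K * lam t)\<^sup>2" by (rule power_mono) simp
    qed
    moreover have "(LINT y|lborel. indicator {Y-1..Y+1} y * (norm (ff y))\<^sup>2) \<le> (LINT y|lborel. (16 * exp 2)\<^sup>2 * (norm (g y))\<^sup>2)"
    proof (rule integral_mono')
      have "integrable lborel (\<lambda>y. (norm (g y))\<^sup>2)"
      proof (rule Bochner_Integration.integrable_bound)
        show "integrable lborel (\<lambda>y. B * 32 * norm (g y))" using gi by simp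
        show "AE y in lborel. norm ((norm (g y))\<^sup>2) \<le> norm (B * 32 * norm (g y))"
          using gB B by (intro AE_I2) (simp add: power2_eq_square abs_mult mult_right_mono)
      qed measurable
      thus "integrable lborel (\<lambda>y. (16 * exp 2)\<^sup>2 * (norm (g y))\<^sup>2)" by (rule integrable_mult_right)
      fix y
      show "indicator {Y-1..Y+1} y * (norm (ff y))\<^sup>2 \<le> (16 * exp 2)\<^sup>2 * (norm (g y))\<^sup>2"
      proof (cases "y \<in> {Y-1..Y+1}")
        case True
        \<comment> \<open>From here \<delta>y \<le> 1 + \<delta> \<le> 2 on the window; together
          with the lower bound 1/16 for the Fejer weight this produces the factor 16 e^2.\<close>
        have "\<delta> * y \<le> \<delta> * (Y + 1)" using True \<delta> by (intro mult_left_mono) auto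
        also have "\<dots> = 1 + \<delta>" using Y by (simp add: \<delta>_def field_simps)
        finally have "exp (- 2) \<le> exp (- \<delta> * y)" using \<delta> by simp
        moreover have "1/16 \<le> fejer (y - Y)" by (rule fejer_ge) (use True in auto)
        ultimately have "exp (- 2) * (1/16) \<le> exp (- \<delta> * y) * fejer (y - Y)" by (intro mult_mono) auto
        hence "norm (ff y) * (exp (- 2) * (1/16)) \<le> norm (ff y) * (exp (- \<delta> * y) * fejer (y - Y))"
          by (rule mult_left_mono) simp
        also have "\<dots> = norm (g y)" unfolding g_def norm_mult norm_of_real using fejer_nonneg by simp
        finally have "norm (ff y) \<le> (16 * exp 2) * norm (g y)" by (simp add: exp_minus field_simps)
        hence "(norm (ff y))\<^sup>2 \<le> ((16 * exp 2) * norm (g y))\<^sup>2" by (rule power_mono) simp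
        thus ?thesis using True by (simp add: power_mult_distrib)
      qed simp
    qed simp
    ultimately show ?thesis
      by (simp add: order_trans[OF _ mult_left_mono])
  qed
  show ?thesis
  proof (intro exI[of _ "(16 * exp 2)\<^sup>2 * L + 1"] conjI allI impI)
    show "(16 * exp 2)\<^sup>2 * L + 1 > 0" using L0 by (intro add_nonneg_pos mult_nonneg_nonneg) auto
    fix Y :: real assume "Y \<ge> 1"
    from main[OF this] show "(LINT y|lborel. indicator {Y-1..Y+1} y * (norm (ff y))\<^sup>2) \<le> (16 * exp 2)\<^sup>2 * L + 1" by linarith
  qed
qed

end


section \<open>Summation by parts with the weight 1/ln n\<close>

lemma lborel_FTC_Icc:
  fixes F :: "real \<Rightarrow> real"
  assumes "a \<le> b" "\<And>v. a \<le> v \<Longrightarrow> v \<le> b \<Longrightarrow> (F has_real_derivative f v) (at v)" "\<And>v. a \<le> v \<Longrightarrow> v \<le> b \<Longrightarrow> isCont f v"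
  shows "integrable lborel (\<lambda>v. indicator {a..b} v * f v)" "(LINT v|lborel. indicator {a..b} v * f v) = F b - F a"
proof -
  have "has_bochner_integral lborel (\<lambda>v. indicator {a..b} v *\<^sub>R f v) (F b - F a)"
  proof (rule has_bochner_integral_FTC_Icc[OF assms(1)])
    show "(F has_vector_derivative f v) (at v within {a..b})" if "a \<le> v" "v \<le> b" for v
      using assms(2)[OF that] unfolding has_real_derivative_iff_has_vector_derivative by (rule has_vector_derivative_at_within)
    show "continuous_on {a..b} f" by (rule continuous_at_imp_continuous_on) (use assms(3) in auto)
  qed
  thus "integrable lborel (\<lambda>v. indicator {a..b} v * f v)" "(LINT v|lborel. indicator {a..b} v * f v) = F b - F a"
    by (auto simp: has_bochner_integral_iff)
qed

lemma integral_inverse_square: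
  assumes "0 < a" "a \<le> (b :: real)"
  shows "integrable lborel (\<lambda>v. indicator {a..b} v * (1 / v\<^sup>2))" "(LINT v|lborel. indicator {a..b} v * (1 / v\<^sup>2)) = 1 / a - 1 / b"
proof -
  have d: "((\<lambda>v. - (1 / v)) has_real_derivative 1 / v\<^sup>2) (at v)" if "a \<le> v" for v
    using that assms by (auto intro!: derivative_eq_intros simp: power2_eq_square)
  have c: "isCont (\<lambda>v. 1 / v\<^sup>2) v" if "a \<le> v" for v using that assms by (intro continuous_intros) auto
  show "integrable lborel (\<lambda>v. indicator {a..b} v * (1 / v\<^sup>2))" by (rule lborel_FTC_Icc(1)[OF assms(2) d c])
  show "(LINT v|lborel. indicator {a..b} v * (1 / v\<^sup>2)) = 1 / a - 1 / b"
    using lborel_FTC_Icc(2)[OF assms(2) d c] by simp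
qed

lemma integral_inverse:
  assumes "0 < a" "a \<le> (b :: real)"
  shows "integrable lborel (\<lambda>v. indicator {a..b} v * (1 / v))" "(LINT v|lborel. indicator {a..b} v * (1 / v)) = ln b - ln a"
proof -
  have d: "(ln has_real_derivative 1 / v) (at v)" if "a \<le> v" for v
    using that assms by (auto intro!: derivative_eq_intros)
  have c: "isCont (\<lambda>v. 1 / v) v" if "a \<le> v" for v using that assms by (intro continuous_intros) auto
  show "integrable lborel (\<lambda>v. indicator {a..b} v * (1 / v))" by (rule lborel_FTC_Icc(1)[OF assms(2) d c])
  show "(LINT v|lborel. indicator {a..b} v * (1 / v)) = ln b - ln a" by (rule lborel_FTC_Icc(2)[OF assms(2) d c])
qed

text \<open>Increments of size K/y^2 over unit steps are telescoped through K/y^2 \<le> 2K/y - 2K/(y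
  + 1), valid for y \<ge> 1.\<close>

lemma unit_steps_bound:
  fixes W :: "real \<Rightarrow> complex"
  assumes K: "K \<ge> 0" and step: "\<And>y y'. 1 \<le> y \<Longrightarrow> y \<le> y' \<Longrightarrow> y' \<le> y + 1 \<Longrightarrow> norm (W y' - W y) \<le> K / y\<^sup>2"
    and y: "1 \<le> y" "y \<le> y'"
  shows "norm (W y' - W y) \<le> 2 * K / y"
proof -
  have s2: "K / y\<^sup>2 \<le> 2 * K / y - 2 * K / (y + 1)" if "y \<ge> 1" for y :: real
  proof -
    have "1 / y\<^sup>2 \<le> 2 * (1 / y - 1 / (y + 1))"
    proof -
      have "y * (y + 1) \<le> y * (2 * y)" using that by (intro mult_left_mono) auto
      hence "2 / (2 * y\<^sup>2) \<le> 2 / (y * (y + 1))" using that by (intro divide_left_mono mult_pos_pos) (auto simp: power2_eq_square)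
      also have "2 / (y * (y + 1)) = 2 * (1 / y - 1 / (y + 1))" using that by (simp add: field_simps)
      finally show ?thesis by simp
    qed
    from mult_left_mono[OF this K] show ?thesis by (simp add: algebra_simps)
  qed
  have gen: "norm (W y' - W y) \<le> 2 * K / y - 2 * K / (y + real n + 1)"
    if "1 \<le> y" "y \<le> y'" "y' \<le> y + real n + 1" for n y y'
    using that
  proof (induction n arbitrary: y)
    case 0
    thus ?case using step[of y y'] s2[of y] by simp
  next
    case (Suc n)
    show ?case
    proof (cases "y' \<le> y + 1")
      case True
      have "2 * K / (y + real (Suc n) + 1) \<le> 2 * K / (y + 1)" using Suc.prems K by (intro divide_left_mono mult_pos_pos) auto
      thus ?thesis using step[of y y'] s2[of y] True Suc.prems by simp
    next
      case False
      have "norm (W y' - W (y + 1)) \<le> 2 * K / (y + 1) - 2 * K / (y + 1 + real n + 1)"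
        by (rule Suc.IH) (use Suc.prems False in auto)
      moreover have "norm (W (y + 1) - W y) \<le> K / y\<^sup>2" using step[of y "y + 1"] Suc.prems by simp
      moreover have "norm (W y' - W y) \<le> norm (W y' - W (y + 1)) + norm (W (y + 1) - W y)"
        using norm_triangle_ineq[of "W y' - W (y + 1)" "W (y + 1) - W y"] by simp
      moreover have "y + 1 + real n + 1 = y + real (Suc n) + 1" by simp
      ultimately show ?thesis using s2[OF Suc.prems(1)] by (simp only:)
    qed
  qed
  have "y' \<le> y + real (nat \<lceil>y' - y\<rceil>) + 1" using real_nat_ceiling_ge[of "y' - y"] by linarith
  with y have "norm (W y' - W y) \<le> 2 * K / y - 2 * K / (y + real (nat \<lceil>y' - y\<rceil>) + 1)" by (intro gen)
  also have "\<dots> \<le> 2 * K / y" using K y by (auto intro!: divide_nonneg_nonneg)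
  finally show ?thesis .
qed

lemma limit_with_rate:
  fixes W :: "real \<Rightarrow> complex"
  assumes K: "K \<ge> 0" and W: "\<And>y y'. 1 \<le> y \<Longrightarrow> y \<le> y' \<Longrightarrow> norm (W y' - W y) \<le> K / y"
  shows "\<exists>L. \<forall>y\<ge>1. norm (W y - L) \<le> K / y"
proof -
  have "Cauchy (\<lambda>n. W (real (Suc n)))"
  proof (rule CauchyI')
    fix e :: real assume e: "e > 0"
    obtain M where M: "real M > K / e" using reals_Archimedean2 by blast
    show "\<exists>M. \<forall>m\<ge>M. \<forall>n>m. dist (W (real (Suc m))) (W (real (Suc n))) < e"
    proof (intro exI[of _ M] allI impI)
      fix m n :: nat assume mn: "M \<le> m" "m < n"
      have "norm (W (real (Suc n)) - W (real (Suc m))) \<le> K / real (Suc m)" by (rule W) (use mn in auto)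
      also have "\<dots> < e"
      proof -
        have "K < e * real M" using M e by (simp add: field_simps)
        also have "\<dots> \<le> e * real (Suc m)" using mn e by (intro mult_left_mono) auto
        finally show ?thesis by (simp add: field_simps)
      qed
      finally show "dist (W (real (Suc m))) (W (real (Suc n))) < e" by (simp add: dist_norm norm_minus_commute)
    qed
  qed
  hence "convergent (\<lambda>n. W (real (Suc n)))" by (rule Cauchy_convergent)
  then obtain L where L: "(\<lambda>n. W (real (Suc n))) \<longlonglongrightarrow> L" unfolding convergent_def by (elim exE)
  show ?thesis
  proof (intro exI[of _ L] allI impI)
    fix y :: real assume y: "y \<ge> 1"
    have "(\<lambda>n. norm (W (real (Suc n)) - W y)) \<longlonglongrightarrow> norm (L - W y)" by (intro tendsto_intros L)
    moreover have "\<forall>\<^sub>F n in sequentially. norm (W (real (Suc n)) - W y) \<le> K / y"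
      using eventually_ge_at_top[of "nat \<lceil>y\<rceil>"]
    proof eventually_elim
      case (elim n)
      hence "y \<le> real (Suc n)" by linarith
      thus ?case by (intro W y)
    qed
    ultimately have "norm (L - W y) \<le> K / y" by (intro tendsto_upperbound) auto
    thus "norm (W y - L) \<le> K / y" by (simp add: norm_minus_commute)
  qed
qed

lemma le_nat_floor_exp: "n \<ge> 1 \<Longrightarrow> n \<le> nat \<lfloor>exp y\<rfloor> \<longleftrightarrow> ln (real n) \<le> y"
proof -
  assume n: "n \<ge> 1"
  hence "n \<le> nat \<lfloor>exp y\<rfloor> \<longleftrightarrow> real n \<le> exp y" by (simp add: le_nat_iff le_floor_iff)
  also have "\<dots> \<longleftrightarrow> ln (real n) \<le> y" using n by (subst ln_le_cancel_iff[symmetric]) auto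
  finally show ?thesis .
qed

text \<open>Stated for general coefficients so that it covers \<open>ff\<close> (coefficients
  \<open>aa\<close>, drift m) as well as the sums over 1/n used for Mertens' theorem (drift -1 or
  0).\<close>

definition psum :: "(nat \<Rightarrow> complex) \<Rightarrow> real \<Rightarrow> real \<Rightarrow> complex" where
  "psum a \<mu> y = (\<Sum>n\<in>{1..nat \<lfloor>exp y\<rfloor>}. a n) + of_real (\<mu> * max 0 y)"

definition lsum :: "(nat \<Rightarrow> complex) \<Rightarrow> real \<Rightarrow> complex" where
  "lsum a y = (\<Sum>n\<in>{2..nat \<lfloor>exp y\<rfloor>}. a n / of_real (ln (real n)))"

lemma psum_measurable [measurable]: "psum a \<mu> \<in> borel_measurable borel"
proof -
  have "(\<lambda>y. nat \<lfloor>exp y\<rfloor>) \<in> measurable (borel :: real measure) (count_space UNIV)" by measurable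
  hence "(\<lambda>y. (\<lambda>N. \<Sum>n\<in>{1..N}. a n) (nat \<lfloor>exp y\<rfloor>)) \<in> borel_measurable (borel :: real measure)"
    by (rule measurable_compose) simp
  hence [measurable]: "(\<lambda>y. \<Sum>n\<in>{1..nat \<lfloor>exp y\<rfloor>}. a n) \<in> borel_measurable (borel :: real measure)" .
  show ?thesis unfolding psum_def by measurable
qed

text \<open>The coefficient at n = 1 is required to vanish because 1/ln n is singular there and
  \<open>lsum\<close> starts at 2.\<close>

locale psum_stepanov =
  fixes a :: "nat \<Rightarrow> complex" and \<mu> C :: real
  assumes a1: "a (Suc 0) = 0"
    and stepanov: "\<forall>Y\<ge>1. (LINT y|lborel. indicator {Y-1..Y+1} y * (norm (psum a \<mu> y))\<^sup>2) \<le> C"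
begin

definition A0 :: "real \<Rightarrow> complex" where
  "A0 y = (\<Sum>n\<in>{1..nat \<lfloor>exp y\<rfloor>}. a n)"

lemma A0_eq: "A0 y = (\<Sum>n\<in>{2..nat \<lfloor>exp y\<rfloor>}. a n)"
  unfolding A0_def
proof (rule sum.mono_neutral_right)
  show "\<forall>n\<in>{1..nat \<lfloor>exp y\<rfloor>} - {2..nat \<lfloor>exp y\<rfloor>}. a n = 0"
  proof
    fix n assume "n \<in> {1..nat \<lfloor>exp y\<rfloor>} - {2..nat \<lfloor>exp y\<rfloor>}"
    hence "n = Suc 0" by auto
    thus "a n = 0" using a1 by simp
  qed
qed auto

lemma psum_eq_A0: "y \<ge> 0 \<Longrightarrow> psum a \<mu> y = A0 y + of_real (\<mu> * y)"
  by (simp add: psum_def A0_def)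

lemma psum_square_integrable: "integrable lborel (\<lambda>v. indicator {s..b} v * (norm (psum a \<mu> v))\<^sup>2)"
proof (rule Bochner_Integration.integrable_bound)
  define B where "B = (\<Sum>n\<in>{1..nat \<lfloor>exp b\<rfloor>}. norm (a n)) + \<bar>\<mu>\<bar> * max 0 b"
  show "integrable lborel (\<lambda>v. B\<^sup>2 * indicator {s..b} v)" by (intro integrable_mult_right integrable_indicator_Icc)
  show "AE v in lborel. norm (indicator {s..b} v * (norm (psum a \<mu> v))\<^sup>2) \<le> norm (B\<^sup>2 * indicator {s..b} v)"
  proof (rule AE_I2)
    fix v
    have "norm (psum a \<mu> v) \<le> B" if v: "v \<le> b"
    proof -
      have "norm (\<Sum>n\<in>{1..nat \<lfloor>exp v\<rfloor>}. a n) \<le> (\<Sum>n\<in>{1..nat \<lfloor>exp v\<rfloor>}. norm (a n))" by (rule norm_sum)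
      also have "\<dots> \<le> (\<Sum>n\<in>{1..nat \<lfloor>exp b\<rfloor>}. norm (a n))"
      proof (rule sum_mono2)
        have "nat \<lfloor>exp v\<rfloor> \<le> nat \<lfloor>exp b\<rfloor>" using v by (intro nat_mono floor_mono) simp
        thus "{1..nat \<lfloor>exp v\<rfloor>} \<subseteq> {1..nat \<lfloor>exp b\<rfloor>}" by auto
      qed auto
      finally have 1: "norm (\<Sum>n\<in>{1..nat \<lfloor>exp v\<rfloor>}. a n) \<le> (\<Sum>n\<in>{1..nat \<lfloor>exp b\<rfloor>}. norm (a n))" .
      have "norm (complex_of_real (\<mu> * max 0 v)) = \<bar>\<mu>\<bar> * max 0 v" unfolding norm_of_real abs_mult by simp
      also have "\<dots> \<le> \<bar>\<mu>\<bar> * max 0 b" using v by (intro mult_left_mono) auto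
      finally show ?thesis unfolding psum_def B_def using 1 by (intro norm_triangle_le add_mono)
    qed
    thus "norm (indicator {s..b} v * (norm (psum a \<mu> v))\<^sup>2) \<le> norm (B\<^sup>2 * indicator {s..b} v)"
      by (auto simp: indicator_def intro!: power_mono)
  qed
qed measurable

definition WW :: "real \<Rightarrow> complex" where
  "WW y = (LINT v|lborel. indicator {ln 2..y} v *\<^sub>R (psum a \<mu> v / of_real (v\<^sup>2)))"

lemma WW_integrable: 
  assumes s: "s > 0"
  shows "integrable lborel (\<lambda>v. indicator {s..y} v *\<^sub>R (psum a \<mu> v / of_real (v\<^sup>2)))"
proof (rule Bochner_Integration.integrable_bound)
  show "integrable lborel (\<lambda>v. (indicator {s..y} v + indicator {s..y} v * (norm (psum a \<mu> v))\<^sup>2) / s\<^sup>2)"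
    by (intro integrable_divide_zero Bochner_Integration.integrable_add integrable_indicator_Icc psum_square_integrable)
  show "AE v in lborel. norm (indicator {s..y} v *\<^sub>R (psum a \<mu> v / of_real (v\<^sup>2))) \<le>
      norm ((indicator {s..y} v + indicator {s..y} v * (norm (psum a \<mu> v))\<^sup>2) / s\<^sup>2)"
  proof (rule AE_I2)
    fix v
    have "norm (psum a \<mu> v / of_real (v\<^sup>2)) \<le> (1 + (norm (psum a \<mu> v))\<^sup>2) / s\<^sup>2" if v: "s \<le> v"
    proof -
      have "norm (psum a \<mu> v) \<le> 1 + (norm (psum a \<mu> v))\<^sup>2" using zero_le_power2[of "norm (psum a \<mu> v) - 1/2"] by (simp add: power2_eq_square algebra_simps)
      moreover have "s\<^sup>2 \<le> v\<^sup>2" using v assms by (intro power_mono) auto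
      ultimately have "norm (psum a \<mu> v) / v\<^sup>2 \<le> (1 + (norm (psum a \<mu> v))\<^sup>2) / s\<^sup>2" using assms by (intro frac_le) auto
      thus ?thesis by (simp add: norm_divide norm_power)
    qed
    thus "norm (indicator {s..y} v *\<^sub>R (psum a \<mu> v / of_real (v\<^sup>2))) \<le>
      norm ((indicator {s..y} v + indicator {s..y} v * (norm (psum a \<mu> v))\<^sup>2) / s\<^sup>2)"
      by (auto simp: indicator_def)
  qed
qed measurable

text \<open>The linear integral is controlled by the quadratic one through |z| \<le> 1 + |z|^2, and
  v^(-2) \<le> y^(-2) on the step.\<close>

lemma WW_step:
  assumes y: "1 \<le> y" "y \<le> y'" "y' \<le> y + 1"
  shows "norm (WW y' - WW y) \<le> (1 + C) / y\<^sup>2"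
proof -
  have l: "ln 2 \<le> (1::real)" "0 < ln (2::real)" using ln_2_less_1 by auto
  have "WW y' - WW y = (LINT v|lborel. indicator {ln 2..y'} v *\<^sub>R (psum a \<mu> v / of_real (v\<^sup>2)) - indicator {ln 2..y} v *\<^sub>R (psum a \<mu> v / of_real (v\<^sup>2)))"
    unfolding WW_def by (rule Bochner_Integration.integral_diff[symmetric]) (intro WW_integrable l)+
  hence "norm (WW y' - WW y) = norm (LINT v|lborel. indicator {ln 2..y'} v *\<^sub>R (psum a \<mu> v / of_real (v\<^sup>2)) - indicator {ln 2..y} v *\<^sub>R (psum a \<mu> v / of_real (v\<^sup>2)))"
    by (rule arg_cong)
  also have "\<dots> \<le> (LINT v|lborel. (indicator {y..y+1} v + indicator {y-1..y+1} v * (norm (psum a \<mu> v))\<^sup>2) / y\<^sup>2)"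
  proof (rule lebesgue_norm_bound)
    show "integrable lborel (\<lambda>v. (indicator {y..y+1} v + indicator {y-1..y+1} v * (norm (psum a \<mu> v))\<^sup>2) / y\<^sup>2)"
      by (intro integrable_divide_zero Bochner_Integration.integrable_add integrable_indicator_Icc psum_square_integrable)
    fix v
    show "norm (indicator {ln 2..y'} v *\<^sub>R (psum a \<mu> v / of_real (v\<^sup>2)) - indicator {ln 2..y} v *\<^sub>R (psum a \<mu> v / of_real (v\<^sup>2))) \<le>
      (indicator {y..y+1} v + indicator {y-1..y+1} v * (norm (psum a \<mu> v))\<^sup>2) / y\<^sup>2"
    proof (cases "y < v \<and> v \<le> y'")
      case True
      have "norm (psum a \<mu> v) \<le> 1 + (norm (psum a \<mu> v))\<^sup>2" using zero_le_power2[of "norm (psum a \<mu> v) - 1/2"] by (simp add: power2_eq_square algebra_simps)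
      moreover have "y\<^sup>2 \<le> v\<^sup>2" using True y by (intro power_mono) auto
      ultimately have "norm (psum a \<mu> v) / v\<^sup>2 \<le> (1 + (norm (psum a \<mu> v))\<^sup>2) / y\<^sup>2" using y by (intro frac_le) auto
      thus ?thesis using True y l by (simp add: norm_divide norm_power)
    next
      case False
      hence "indicator {ln 2..y'} v = (indicator {ln 2..y} v :: real)" using y by (auto simp: indicator_def)
      thus ?thesis by simp
    qed
  qed
  also have "\<dots> = ((LINT v|lborel. indicator {y..y+1} v) + (LINT v|lborel. indicator {y-1..y+1} v * (norm (psum a \<mu> v))\<^sup>2)) / y\<^sup>2"
    unfolding integral_divide_zero
    by (rule arg_cong[where f = "\<lambda>x. x / y\<^sup>2", OF Bochner_Integration.integral_add[OF integrable_indicator_Icc psum_square_integrable]])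
  also have "\<dots> \<le> (1 + C) / y\<^sup>2"
    using stepanov y lint_indicator_Icc[of y "y + 1"] by (intro divide_right_mono add_mono) auto
  finally show ?thesis .
qed

text \<open>Abel summation in the variable v = ln x: 1/ln n is 1/y plus the integral of v^(-2) from
  ln n to y. Replacing the bare partial sum A0(v) by \<open>psum\<close> minus \<mu>v produces the
  term -\<mu> ln y.\<close>

lemma lsum_eq:
  assumes y: "y \<ge> 1"
  shows "lsum a y = psum a \<mu> y / of_real y + WW y - of_real \<mu> - of_real \<mu> * of_real (ln y - ln (ln 2))"
proof -
  have l: "ln 2 \<le> (1::real)" "0 < ln (2::real)" using ln_2_less_1 by auto
  define N where "N = nat \<lfloor>exp y\<rfloor>"
  have le: "ln 2 \<le> ln (real n) \<and> ln (real n) \<le> y" if "n \<in> {2..N}" for n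
    using that le_nat_floor_exp[of n y] by (auto simp: N_def)
  \<comment> \<open>The integral of g n over v is the contribution of n to the integral term; for
    fixed v, summing over n gives A0(v)/v^2.\<close>
  define g where "g = (\<lambda>n v. a n * of_real (indicator {ln (real n)..y} v * (1 / v\<^sup>2)))"
  have gi: "integrable lborel (g n)" and gv: "(LINT v|lborel. g n v) = a n * of_real (1 / ln (real n) - 1 / y)"
    if "n \<in> {2..N}" for n
  proof -
    have n: "0 < ln (real n)" "ln (real n) \<le> y" using le[OF that] less_le_trans[OF l(2), of "ln (real n)"] by blast+
    show "integrable lborel (g n)"
      unfolding g_def by (intro integrable_mult_right integrable_of_real integral_inverse_square n)
    show "(LINT v|lborel. g n v) = a n * of_real (1 / ln (real n) - 1 / y)"
      unfolding g_def integral_mult_right_zero integral_complex_of_real integral_inverse_square(2)[OF n] ..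
  qed
  have gs: "(\<Sum>n\<in>{2..N}. g n v) = indicator {ln 2..y} v *\<^sub>R (psum a \<mu> v / of_real (v\<^sup>2)) - of_real (\<mu> * (indicator {ln 2..y} v * (1 / v)))" for v
  proof (cases "v \<in> {ln 2..y}")
    case False
    hence "g n v = 0" if "n \<in> {2..N}" for n using le[OF that] by (auto simp: g_def indicator_def)
    thus ?thesis using False by simp
  next
    case True
    have v: "v > 0" by (rule less_le_trans[OF l(2)]) (use True in simp)
    have "{n \<in> {2..N}. ln (real n) \<le> v} = {2..nat \<lfloor>exp v\<rfloor>}"
    proof -
      have "n \<le> nat \<lfloor>exp v\<rfloor> \<longleftrightarrow> n \<le> N \<and> ln (real n) \<le> v" if "n \<ge> 2" for n
        using le_nat_floor_exp[of n v] le_nat_floor_exp[of n y] True that by (auto simp: N_def)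
      thus ?thesis by auto
    qed
    moreover have "(\<Sum>n\<in>{2..N}. g n v) = (\<Sum>n\<in>{n \<in> {2..N}. ln (real n) \<le> v}. a n / of_real (v\<^sup>2))"
      by (rule sum.mono_neutral_cong_right) (use True in \<open>auto simp: g_def indicator_def\<close>)
    ultimately have "(\<Sum>n\<in>{2..N}. g n v) = A0 v / of_real (v\<^sup>2)" by (simp add: A0_eq sum_divide_distrib)
    also have "A0 v = psum a \<mu> v - of_real (\<mu> * v)" using psum_eq_A0[of v] v by simp
    finally show ?thesis using True v by (simp add: diff_divide_distrib power2_eq_square)
  qed
  have mi: "integrable lborel (\<lambda>v. complex_of_real (\<mu> * (indicator {ln 2..y} v * (1 / v))))"
    by (intro integrable_of_real integrable_mult_right integral_inverse) (use l y in auto)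
  have mv: "(LINT v|lborel. complex_of_real (\<mu> * (indicator {ln 2..y} v * (1 / v)))) = of_real (\<mu> * (ln y - ln (ln 2)))"
    unfolding integral_complex_of_real integral_mult_right_zero by (subst integral_inverse) (use l y in auto)
  have "lsum a y = (\<Sum>n\<in>{2..N}. a n * of_real (1 / ln (real n) - 1 / y) + a n / of_real y)"
    unfolding lsum_def N_def by (intro sum.cong) (auto simp: field_simps)
  also have "\<dots> = (\<Sum>n\<in>{2..N}. a n * of_real (1 / ln (real n) - 1 / y)) + A0 y / of_real y"
    by (simp only: sum.distrib A0_eq N_def[symmetric] sum_divide_distrib)
  also have "(\<Sum>n\<in>{2..N}. a n * of_real (1 / ln (real n) - 1 / y)) = (\<Sum>n\<in>{2..N}. LINT v|lborel. g n v)"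
    by (rule sum.cong[OF refl]) (rule gv[symmetric])
  also have "(\<Sum>n\<in>{2..N}. LINT v|lborel. g n v) = (LINT v|lborel. (\<Sum>n\<in>{2..N}. g n v))"
    by (rule Bochner_Integration.integral_sum[symmetric]) (rule gi)
  also have "\<dots> = WW y - of_real (\<mu> * (ln y - ln (ln 2)))"
    unfolding gs WW_def by (subst Bochner_Integration.integral_diff[OF WW_integrable[OF l(2)] mi]) (simp only: mv)
  also have "A0 y = psum a \<mu> y - of_real (\<mu> * y)" using psum_eq_A0[of y] y by simp
  finally show ?thesis using y by (simp add: diff_divide_distrib)
qed

text \<open>The mean-square bound makes \<open>WW\<close> converge with error O(1/y), so the only
  term that is not controlled pointwise is |psum(y)|/y.\<close>

lemma lsum_asymp:
  "\<exists>C0 K. K \<ge> 0 \<and> (\<forall>y\<ge>1. norm (lsum a y + of_real (\<mu> * ln y) - C0) \<le> (norm (psum a \<mu> y) + K) / y)"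
proof -
  have "0 \<le> (LINT y|lborel. indicator {1-1..1+1} y * (norm (psum a \<mu> y))\<^sup>2)" by (intro integral_nonneg_AE AE_I2) simp
  from order_trans[OF this stepanov[rule_format, OF order_refl]] have C: "C \<ge> 0" .
  hence C1: "1 + C \<ge> 0" by simp
  have "norm (WW y' - WW y) \<le> 2 * (1 + C) / y" if "1 \<le> y" "y \<le> y'" for y y'
    by (rule unit_steps_bound[OF C1 WW_step that])
  hence "\<exists>L. \<forall>y\<ge>1. norm (WW y - L) \<le> 2 * (1 + C) / y" using C1 by (intro limit_with_rate) auto
  then obtain L where L: "\<forall>y\<ge>1. norm (WW y - L) \<le> 2 * (1 + C) / y" by (elim exE)
  show ?thesis
  proof (intro exI[of _ "L - of_real \<mu> + of_real \<mu> * of_real (ln (ln 2))"] exI[of _ "2 * (1 + C)"] conjI allI impI)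
    fix y :: real assume y: "y \<ge> 1"
    have "lsum a y + of_real (\<mu> * ln y) - (L - of_real \<mu> + of_real \<mu> * of_real (ln (ln 2))) = psum a \<mu> y / of_real y + (WW y - L)"
      unfolding lsum_eq[OF y] by (simp add: algebra_simps)
    also have "norm \<dots> \<le> norm (psum a \<mu> y) / y + 2 * (1 + C) / y"
      using L[rule_format, OF y] y by (intro norm_triangle_le add_mono) (auto simp: norm_divide)
    finally show "norm (lsum a y + of_real (\<mu> * ln y) - (L - of_real \<mu> + of_real \<mu> * of_real (ln (ln 2)))) \<le> (norm (psum a \<mu> y) + 2 * (1 + C)) / y"
      by (simp add: add_divide_distrib)
  qed (use C in simp)
qed

end


section \<open>Chebyshev and Mertens estimates\<close>

lemma sum_divisors_swap:
  fixes f :: "nat \<Rightarrow> real"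
  shows "(\<Sum>n\<in>{1..N}. \<Sum>d | d dvd n. f d) = (\<Sum>d\<in>{1..N}. real (N div d) * f d)"
proof (induction N)
  case (Suc N)
  have dv: "{d. d dvd Suc N} = {d \<in> {1..Suc N}. d dvd Suc N}"
    using dvd_imp_le[of _ "Suc N"] by (auto intro: Suc_leI dvd_pos_nat)
  have "real (Suc N div d) = real (N div d) + (if d dvd Suc N then 1 else 0)" for d
    by (simp add: div_Suc dvd_eq_mod_eq_0)
  hence "(\<Sum>d\<in>{1..Suc N}. real (Suc N div d) * f d) =
      (\<Sum>d\<in>{1..Suc N}. real (N div d) * f d + (if d dvd Suc N then f d else 0))"
    by (intro sum.cong) (auto simp: ring_distribs)
  also have "\<dots> = (\<Sum>d\<in>{1..Suc N}. real (N div d) * f d) + (\<Sum>d\<in>{1..Suc N}. if d dvd Suc N then f d else 0)"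
    by (rule sum.distrib)
  also have "(\<Sum>d\<in>{1..Suc N}. if d dvd Suc N then f d else 0) = (\<Sum>d | d dvd Suc N. f d)"
    unfolding dv by (rule sum.inter_filter[symmetric]) simp
  also have "(\<Sum>d\<in>{1..Suc N}. real (N div d) * f d) = (\<Sum>d\<in>{1..N}. real (N div d) * f d)" by simp
  finally show ?case using Suc by simp
qed simp

lemma ln_fact_mangoldt: "ln (fact N) = (\<Sum>d\<in>{1..N}. real (N div d) * mangoldt d)"
proof -
  have "ln (fact N) = (\<Sum>n\<in>{1..N}. ln (real n))"
  proof (induction N)
    case (Suc N)
    have "ln (fact (Suc N)) = ln (real (Suc N)) + ln (fact N)" by (simp add: ln_mult)
    thus ?case using Suc by simp
  qed simp
  also have "\<dots> = (\<Sum>n\<in>{1..N}. \<Sum>d | d dvd n. mangoldt d)"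
    by (intro sum.cong) (auto simp: mangoldt_sum)
  finally show ?thesis by (simp only: sum_divisors_swap)
qed

text \<open>In the logarithm of the central binomial coefficient, \<Lambda>(d) has coefficient
  floor(2M/d) - 2 floor(M/d): never negative, and 1 for M < d \<le> 2M. The binomial coefficient is
  at most 4^M.\<close>

lemma mangoldt_sum_double: "(\<Sum>n\<in>{M<..2*M}. mangoldt n) \<le> 2 * real M"
proof -
  have "ln (fact (2 * M)) - 2 * ln (fact M :: real) =
      (\<Sum>d\<in>{1..2*M}. real (2 * M div d) * mangoldt d) - 2 * (\<Sum>d\<in>{1..2*M}. real (M div d) * mangoldt d)"
  proof -
    have "(\<Sum>d\<in>{1..M}. real (M div d) * mangoldt d) = (\<Sum>d\<in>{1..2*M}. real (M div d) * mangoldt d)"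
      by (rule sum.mono_neutral_left) auto
    thus ?thesis by (simp add: ln_fact_mangoldt)
  qed
  also have "\<dots> = (\<Sum>d\<in>{1..2*M}. (real (2 * M div d) - 2 * real (M div d)) * mangoldt d)"
    by (simp add: sum_subtractf sum_distrib_left ring_distribs mult.assoc)
  also have "\<dots> \<ge> (\<Sum>d\<in>{1..2*M}. if M < d then mangoldt d else 0)"
  proof (rule sum_mono)
    fix d assume d: "d \<in> {1..2*M}"
    have m: "(mangoldt d :: real) \<ge> 0" by (rule mangoldt_nonneg)
    show "(if M < d then mangoldt d else 0) \<le> (real (2 * M div d) - 2 * real (M div d)) * mangoldt d"
    proof (cases "M < d")
      case True
      hence "2 * M div d = 1" using d by (intro div_nat_eqI) auto
      thus ?thesis using True by simp
    next
      case False
      have "2 * (M div d) * d \<le> 2 * M" using div_times_less_eq_dividend[of M d] by simp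
      hence "2 * (M div d) \<le> 2 * M div d" using d by (simp add: less_eq_div_iff_mult_less_eq)
      hence "real (2 * M div d) - 2 * real (M div d) \<ge> 0" by linarith
      thus ?thesis using False m by simp
    qed
  qed
  also have "(\<Sum>d\<in>{1..2*M}. if M < d then mangoldt d else 0 :: real) = (\<Sum>d\<in>{d\<in>{1..2*M}. M < d}. mangoldt d)"
    by (rule sum.inter_filter[symmetric]) simp
  also have "{d\<in>{1..2*M}. M < d} = {M<..2*M}" by auto
  finally have "(\<Sum>d\<in>{M<..2*M}. mangoldt d) \<le> ln (fact (2 * M)) - 2 * ln (fact M :: real)" .
  also have "\<dots> = ln (real ((2 * M) choose M))"
  proof -
    have "real ((2 * M) choose M) = fact (2 * M) / (fact M * fact M)" by (simp add: binomial_fact)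
    thus ?thesis by (simp add: ln_div ln_mult)
  qed
  also have "\<dots> \<le> ln (2 ^ (2 * M))"
  proof (subst ln_le_cancel_iff)
    show "0 < real ((2 * M) choose M)" by simp
    show "real ((2 * M) choose M) \<le> 2 ^ (2 * M)"
      using of_nat_mono[OF binomial_le_pow2[of "2 * M" M], where 'a = real] by simp
  qed simp
  also have "\<dots> = 2 * real M * ln 2" by (simp add: ln_realpow)
  also have "\<dots> \<le> 2 * real M * 1" using ln_2_less_1 by (intro mult_left_mono) auto
  finally show ?thesis by simp
qed

lemma chebyshev_bound: "(\<Sum>n\<in>{1..N}. mangoldt n) \<le> 8 * real N"
proof (induction N rule: less_induct)
  case (less N)
  consider "N = 0" | "N = 1" | "N \<ge> 2" by linarith
  thus ?case
  proof cases
    case 3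
    \<comment> \<open>Half of N rounded up, so that N \<le> 2M but M < N; the induction closes
      because 8M + 2M \<le> 5N + 5 \<le> 8N for N \<ge> 2.\<close>
    define M where "M = (N + 1) div 2"
    have M: "M < N" "N \<le> 2 * M" "2 * M \<le> N + 1" using 3 by (auto simp: M_def)
    have "(\<Sum>n\<in>{1..N}. mangoldt n :: real) \<le> (\<Sum>n\<in>{1..2*M}. mangoldt n)"
      using M by (intro sum_mono2) (auto intro: mangoldt_nonneg)
    also have "{1..2*M} = {1..M} \<union> {M<..2*M}" by auto
    also have "(\<Sum>n\<in>{1..M} \<union> {M<..2*M}. mangoldt n :: real) = (\<Sum>n\<in>{1..M}. mangoldt n) + (\<Sum>n\<in>{M<..2*M}. mangoldt n)"
      by (rule sum.union_disjoint) auto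
    also have "\<dots> \<le> 8 * real M + 2 * real M" by (intro add_mono less M mangoldt_sum_double)
    also have "\<dots> \<le> 8 * real N" using M 3 by linarith
    finally show ?thesis .
  qed auto
qed

lemma ln_fact_bounds:
  assumes "N \<ge> 1"
  shows "ln (fact N) \<le> real N * ln (real N)" "ln (fact N) \<ge> real N * ln (real N) - real N"
proof -
  have "ln (fact N) \<le> real N * ln (real N) \<and> ln (fact N) \<ge> real N * ln (real N) - real N"
    using assms
  proof (induction N rule: dec_induct)
    case (step N)
    have e: "ln (fact (Suc N)) = ln (real (Suc N)) + ln (fact N)" by (simp add: ln_mult)
    have N: "real N > 0" using step by simp
    have "ln (real N) \<le> ln (real (Suc N))" using N by simp
    hence 1: "real N * ln (real N) \<le> real N * ln (real (Suc N))" using N by (intro mult_left_mono) auto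
    have "ln (real (Suc N)) - ln (real N) = ln (real (Suc N) / real N)" using N by (simp add: ln_div del: of_nat_Suc)
    also have "real (Suc N) / real N = 1 + 1 / real N" using N by (simp add: field_simps)
    also have "ln (1 + 1 / real N) \<le> 1 / real N" using N by (intro ln_add_one_self_le_self) auto
    finally have "real N * (ln (real (Suc N)) - ln (real N)) \<le> real N * (1 / real N)" using N by (intro mult_left_mono) auto
    hence 2: "real N * ln (real (Suc N)) - real N * ln (real N) \<le> 1" using N by (simp add: algebra_simps)
    have 3: "real (Suc N) * ln (real (Suc N)) = real N * ln (real (Suc N)) + ln (real (Suc N))" by (simp add: algebra_simps)
    have "ln (fact N) \<le> real N * ln (real N)" "ln (fact N) \<ge> real N * ln (real N) - real N" using step by auto
    moreover have "real (Suc N) = real N + 1" by simp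
    ultimately show ?case unfolding e 3 using 1 2 by (intro conjI) linarith+
  qed simp
  thus "ln (fact N) \<le> real N * ln (real N)" "ln (fact N) \<ge> real N * ln (real N) - real N" by auto
qed

text \<open>In ln N! = sum of floor(N/d) \<Lambda>(d), dropping the floor costs at most the
  Chebyshev sum, which is at most 8N; divide by N and compare with N ln N.\<close>

lemma mertens_first:
  assumes N: "N \<ge> 1"
  shows "\<bar>(\<Sum>n\<in>{1..N}. mangoldt n / real n) - ln (real N)\<bar> \<le> 8"
proof -
  define S where "S = (\<Sum>n\<in>{1..N}. mangoldt n / real n)"
  have N0: "real N > 0" using N by simp
  have "real N * S - ln (fact N) = (\<Sum>d\<in>{1..N}. (real N / real d - real (N div d)) * mangoldt d)"
    by (simp add: S_def ln_fact_mangoldt sum_distrib_left sum_subtractf[symmetric] ring_distribs)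
  moreover have "0 \<le> (real N / real d - real (N div d)) * mangoldt d \<and> (real N / real d - real (N div d)) * mangoldt d \<le> mangoldt d" for d
  proof -
    have "real (N div d) = of_int \<lfloor>real N / real d\<rfloor>" by (simp add: floor_divide_of_nat_eq)
    hence "real (N div d) \<le> real N / real d" "real N / real d - real (N div d) \<le> 1" by linarith+
    moreover have "(mangoldt d :: real) \<ge> 0" by (rule mangoldt_nonneg)
    ultimately show ?thesis by (auto intro!: mult_nonneg_nonneg mult_left_le_one_le)
  qed
  ultimately have "0 \<le> real N * S - ln (fact N)" "real N * S - ln (fact N) \<le> (\<Sum>d\<in>{1..N}. mangoldt d)"
    by (auto intro!: sum_nonneg sum_mono)
  hence "real N * S \<le> real N * (ln (real N) + 8)" "real N * (ln (real N) - 1) \<le> real N * S"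
    using ln_fact_bounds[OF N] chebyshev_bound[of N] by (auto simp: algebra_simps)
  hence "S \<le> ln (real N) + 8" "ln (real N) - 1 \<le> S" using N0 by auto
  thus ?thesis unfolding S_def[symmetric] by linarith
qed

definition high_powers :: "nat \<Rightarrow> nat set" where
  "high_powers k0 = {n. \<exists>p k. prime p \<and> k \<ge> k0 \<and> n = p ^ k}"

lemma primepow_sum_le:
  fixes g :: "nat \<Rightarrow> real"
  assumes "finite P" "A \<subseteq> (\<lambda>(p, j). p ^ (k0 + j)) ` (P \<times> {..<N})" "\<And>n. g n \<ge> 0"
  shows "sum g A \<le> (\<Sum>p\<in>P. \<Sum>j<N. g (p ^ (k0 + j)))"
proof -
  have "sum g A \<le> sum g ((\<lambda>(p, j). p ^ (k0 + j)) ` (P \<times> {..<N}))"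
    by (rule sum_mono2) (use assms in auto)
  also have "\<dots> \<le> sum (g \<circ> (\<lambda>(p, j). p ^ (k0 + j))) (P \<times> {..<N})"
    by (rule sum_image_le) (use assms in auto)
  also have "\<dots> = (\<Sum>(p, j)\<in>P \<times> {..<N}. g (p ^ (k0 + j)))" by (intro sum.cong) auto
  also have "\<dots> = (\<Sum>p\<in>P. \<Sum>j<N. g (p ^ (k0 + j)))" by (rule sum.cartesian_product[symmetric])
  finally show ?thesis .
qed

lemma geometric_sum_le:
  assumes "0 \<le> r" "r \<le> 3/4"
  shows "(\<Sum>j<N. r ^ j) \<le> (4 :: real)"
proof -
  have "(\<Sum>j<N. r ^ j) \<le> (\<Sum>j. r ^ j)" using assms by (intro sum_le_suminf summable_geometric) auto
  also have "\<dots> = 1 / (1 - r)" using assms by (intro suminf_geometric) auto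
  also have "\<dots> \<le> 1 / (1/4)" using assms by (intro divide_left_mono) auto
  finally show ?thesis by simp
qed

lemma mangoldt_prime_power: "prime p \<Longrightarrow> k > 0 \<Longrightarrow> (mangoldt (p ^ k) :: real) = ln (real p)"
  by (simp add: mangoldt_def aprimedivisor_prime_power)

lemma mangoldt_powr_inner:
  assumes p: "prime p" and k0: "k0 > 0" and s: "\<sigma> \<ge> 1/2"
  shows "(\<Sum>j<N. mangoldt (p ^ (k0 + j)) * real (p ^ (k0 + j)) powr (- \<sigma>)) \<le> 4 * (ln (real p) * real p powr (- (real k0 * \<sigma>)))"
proof -
  have p2: "real p \<ge> 2" using prime_ge_2_nat[OF p] by simp
  define r where "r = real p powr (- \<sigma>)"
  have "r \<le> 2 powr (- \<sigma>)" unfolding r_def using p2 s by (intro powr_mono2') auto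
  also have "\<dots> \<le> 2 powr (- (1/2))" using s by (intro powr_mono) auto
  also have "\<dots> \<le> 3/4"
  proof -
    have q: "4/3 \<le> sqrt (2 :: real)" by (rule real_le_rsqrt) (simp add: power2_eq_square)
    have "2 powr (- (1/2)) = inverse (sqrt 2)" by (simp add: powr_minus powr_half_sqrt)
    also have "\<dots> \<le> inverse (4/3)" by (rule le_imp_inverse_le[OF q]) simp
    finally show ?thesis by simp
  qed
  finally have r: "0 \<le> r" "r \<le> 3/4" by (auto simp: r_def)
  have rk: "real (p ^ k) powr (- \<sigma>) = r ^ k" for k
    using p2 by (simp add: r_def powr_realpow[symmetric] powr_powr mult.commute)
  have "(\<Sum>j<N. mangoldt (p ^ (k0 + j)) * real (p ^ (k0 + j)) powr (- \<sigma>)) = (\<Sum>j<N. ln (real p) * (r ^ k0 * r ^ j))"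
  proof (rule sum.cong[OF refl])
    fix j
    have m: "(mangoldt (p ^ (k0 + j)) :: real) = ln (real p)" by (rule mangoldt_prime_power[OF p]) (use k0 in simp)
    show "mangoldt (p ^ (k0 + j)) * real (p ^ (k0 + j)) powr (- \<sigma>) = ln (real p) * (r ^ k0 * r ^ j)"
      unfolding m rk by (simp add: power_add)
  qed
  also have "\<dots> = ln (real p) * r ^ k0 * (\<Sum>j<N. r ^ j)" by (simp add: sum_distrib_left mult.assoc)
  also have "\<dots> \<le> ln (real p) * r ^ k0 * 4" using r p2 by (intro mult_left_mono geometric_sum_le) auto
  also have "r ^ k0 = real p powr (- (real k0 * \<sigma>))"
    using p2 by (simp add: r_def powr_realpow[symmetric] powr_powr mult.commute)
  finally show ?thesis by simp
qed

text \<open>For each prime the powers from k0 on form a geometric series of ratio at most 2^(-1/2) <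
  3/4. The leading terms ln p p^(-k0 \<sigma>) are summable since k0 \<sigma> \<ge> 3/2.\<close>

lemma summable_high_powers:
  assumes k0: "k0 > 0" and s: "\<sigma> \<ge> 1/2" "real k0 * \<sigma> \<ge> 3/2"
  shows "summable (\<lambda>n. indicator (high_powers k0) n * (mangoldt n * real n powr (- \<sigma>)) :: real)"
proof (rule summableI_nonneg_bounded)
  define h where "h = (\<lambda>n. (ln (real n) + 1) * real n powr (- (3/2)))"
  have h: "summable h" unfolding h_def by (rule summable_ln_powr) simp
  have h0: "h n \<ge> 0" for n unfolding h_def by (cases "n = 0") (auto intro!: mult_nonneg_nonneg add_nonneg_nonneg)
  fix N :: nat
  show "0 \<le> indicator (high_powers k0) N * (mangoldt N * real N powr (- \<sigma>) :: real)"
    by (intro mult_nonneg_nonneg mangoldt_nonneg) auto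
  have "(\<Sum>n<N. indicator (high_powers k0) n * (mangoldt n * real n powr (- \<sigma>)) :: real) =
      (\<Sum>n\<in>{..<N} \<inter> high_powers k0. mangoldt n * real n powr (- \<sigma>))"
    by (rule sum.mono_neutral_cong_right) auto
  also have "\<dots> \<le> (\<Sum>p\<in>{p\<in>{..<N}. prime p}. \<Sum>j<N. mangoldt (p ^ (k0 + j)) * real (p ^ (k0 + j)) powr (- \<sigma>))"
  proof (rule primepow_sum_le)
    show "{..<N} \<inter> high_powers k0 \<subseteq> (\<lambda>(p, j). p ^ (k0 + j)) ` ({p\<in>{..<N}. prime p} \<times> {..<N})"
    proof
      fix n assume "n \<in> {..<N} \<inter> high_powers k0"
      then obtain p k where pk: "prime p" "k \<ge> k0" "n = p ^ k" "n < N" by (auto simp: high_powers_def)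
      have "p ^ 1 \<le> p ^ k" using pk k0 prime_gt_0_nat[of p] by (intro power_increasing) auto
      moreover have "k < p ^ k" using prime_ge_2_nat[OF pk(1)] by (intro power_gt_expt) auto
      ultimately show "n \<in> (\<lambda>(p, j). p ^ (k0 + j)) ` ({p\<in>{..<N}. prime p} \<times> {..<N})"
        using pk by (intro image_eqI[of _ _ "(p, k - k0)"]) auto
    qed
  qed (auto intro!: mult_nonneg_nonneg mangoldt_nonneg)
  also have "\<dots> \<le> (\<Sum>p\<in>{p\<in>{..<N}. prime p}. 4 * h p)"
  proof (rule sum_mono)
    fix p assume "p \<in> {p\<in>{..<N}. prime p}"
    hence p: "prime p" "real p \<ge> 2" using prime_ge_2_nat[of p] by auto
    have "ln (real p) * real p powr (- (real k0 * \<sigma>)) \<le> h p"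
      unfolding h_def using p s by (intro mult_mono powr_mono) auto
    thus "(\<Sum>j<N. mangoldt (p ^ (k0 + j)) * real (p ^ (k0 + j)) powr (- \<sigma>)) \<le> 4 * h p"
      using mangoldt_powr_inner[OF p(1) k0 s(1), of N] by linarith
  qed
  also have "\<dots> \<le> (\<Sum>p<N. 4 * h p)" by (rule sum_mono2) (use h0 in auto)
  also have "\<dots> = 4 * (\<Sum>p<N. h p)" by (simp add: sum_distrib_left)
  also have "\<dots> \<le> 4 * suminf h" using sum_le_suminf[OF h, of "{..<N}"] h0 by simp
  finally show "(\<Sum>n<N. indicator (high_powers k0) n * (mangoldt n * real n powr (- \<sigma>)) :: real) \<le> 4 * suminf h" .
qed

lemma ln2_ge_half: "ln 2 \<ge> (1/2 :: real)"
proof -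
  have "exp (1/2) \<le> (2::real)"
  proof -
    have "exp (1/2) ^ 2 = exp (1::real)" by (simp flip: exp_of_nat_mult)
    also have "\<dots> \<le> 2 ^ 2" using e_less_272 by simp
    finally show ?thesis by (rule power2_le_imp_le) simp
  qed
  thus ?thesis by (subst ln_ge_iff) auto
qed

text \<open>Terms beyond e^y carry the extra factor 1/ln n \<le> 1/y, so the tail of the convergent
  series is O(1/y). It is used with k0 = 2, \<sigma> = 1 and with k0 = 3, \<sigma> = 1/2.\<close>

lemma high_powers_sum:
  fixes f :: "nat \<Rightarrow> complex"
  assumes f: "\<And>n. norm (f n) \<le> 1" and k0: "k0 > 0" and s: "\<sigma> \<ge> 1/2" "real k0 * \<sigma> \<ge> 3/2"
  shows "\<exists>c K. K \<ge> 0 \<and> (\<forall>y\<ge>1. norm ((\<Sum>n\<in>{2..nat \<lfloor>exp y\<rfloor>} \<inter> high_powers k0.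
      mangoldt n * f n * of_real (real n powr (- \<sigma>)) / of_real (ln (real n))) - c) \<le> K / y)"
proof -
  define g where "g = (\<lambda>n. indicator (high_powers k0) n * (mangoldt n * real n powr (- \<sigma>)) :: real)"
  have g: "summable g" unfolding g_def by (rule summable_high_powers[OF k0 s])
  have g0: "g n \<ge> 0" for n unfolding g_def by (intro mult_nonneg_nonneg mangoldt_nonneg) auto
  define b where "b = (\<lambda>n. indicator (high_powers k0) n * (mangoldt n * f n * of_real (real n powr (- \<sigma>)) / of_real (ln (real n))) :: complex)"
  have bg: "norm (b n) \<le> g n / t" if "t > 0" "ln (real n) \<ge> t" for n and t :: real
  proof -
    have "norm (b n) = g n * norm (f n) / ln (real n)"
      using that by (simp add: b_def g_def norm_mult norm_divide norm_mangoldt indicator_def mangoldt_nonneg)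
    also have "\<dots> \<le> g n * 1 / t" using that f[of n] g0[of n] by (intro frac_le mult_left_mono mult_nonneg_nonneg) auto
    finally show ?thesis by simp
  qed
  have hp2: "n \<ge> 2" if n: "n \<in> high_powers k0" for n
  proof -
    from n obtain p k where pk: "prime p" "k \<ge> k0" "n = p ^ k" by (auto simp: high_powers_def)
    have "p ^ 1 \<le> p ^ k" using pk k0 prime_gt_0_nat[of p] by (intro power_increasing) auto
    thus ?thesis using pk prime_ge_2_nat[of p] by simp
  qed
  have bn: "norm (b n) \<le> 2 * g n" for n
  proof (cases "n \<in> high_powers k0")
    case True
    have "ln 2 \<le> ln (real n)" using hp2[OF True] by (subst ln_le_cancel_iff) auto
    thus ?thesis using bg[of "1/2" n] ln2_ge_half by simp
  qed (simp add: b_def g_def)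
  have b: "summable (\<lambda>n. norm (b n))"
    by (rule summable_comparison_test[OF _ summable_mult[OF g, of 2]]) (use bn in auto)
  show ?thesis
  proof (intro exI[of _ "suminf b"] exI[of _ "suminf g"] conjI allI impI)
    show "suminf g \<ge> 0" by (rule suminf_nonneg[OF g g0])
    fix y :: real assume y: "y \<ge> 1"
    define N where "N = nat \<lfloor>exp y\<rfloor>"
    have "(\<Sum>n\<in>{2..N} \<inter> high_powers k0. mangoldt n * f n * of_real (real n powr (- \<sigma>)) / of_real (ln (real n))) = (\<Sum>n<Suc N. b n)"
      by (rule sum.mono_neutral_cong_left) (use hp2 in \<open>auto simp: b_def indicator_def split: if_split_asm\<close>)
    moreover have "suminf b = (\<Sum>n. b (n + Suc N)) + (\<Sum>n<Suc N. b n)"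
      by (rule suminf_split_initial_segment[OF summable_norm_cancel[OF b]])
    ultimately have "norm ((\<Sum>n\<in>{2..N} \<inter> high_powers k0. mangoldt n * f n * of_real (real n powr (- \<sigma>)) / of_real (ln (real n))) - suminf b)
        = norm (\<Sum>n. b (n + Suc N))" by (simp add: norm_minus_commute)
    also have "\<dots> \<le> (\<Sum>n. g (n + Suc N) / y)"
    proof (rule norm_suminf_le)
      show "summable (\<lambda>n. g (n + Suc N) / y)" by (intro summable_divide summable_ignore_initial_segment g)
      fix n
      have "\<not> n + Suc N \<le> nat \<lfloor>exp y\<rfloor>" by (simp add: N_def)
      hence "ln (real (n + Suc N)) \<ge> y" using le_nat_floor_exp[of "n + Suc N" y] by simp
      thus "norm (b (n + Suc N)) \<le> g (n + Suc N) / y" using y by (intro bg) auto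
    qed
    also have "\<dots> = (\<Sum>n. g (n + Suc N)) / y" by (rule suminf_divide[OF summable_ignore_initial_segment[OF g]])
    also have "\<dots> \<le> suminf g / y"
      using suminf_split_initial_segment[OF g, of "Suc N"] sum_nonneg[of "{..<Suc N}" g] g0 y
      by (intro divide_right_mono) auto
    finally show "norm ((\<Sum>n\<in>{2..nat \<lfloor>exp y\<rfloor>} \<inter> high_powers k0. mangoldt n * f n * of_real (real n powr (- \<sigma>)) / of_real (ln (real n))) - suminf b) \<le> suminf g / y"
      by (simp only: N_def)
  qed
qed


section \<open>From prime powers to primes\<close>

lemma norm_add_bound: "norm a \<le> x \<Longrightarrow> norm b \<le> y \<Longrightarrow> norm (a + b) \<le> x + y"
  using norm_triangle_ineq[of a b] by linarith

lemma norm_diff_bound: "norm a \<le> x \<Longrightarrow> norm b \<le> y \<Longrightarrow> norm (a - b) \<le> x + y"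
  using norm_triangle_ineq4[of a b] by linarith

definition prime_sum :: "(nat \<Rightarrow> complex) \<Rightarrow> real \<Rightarrow> real \<Rightarrow> complex" where
  "prime_sum f \<sigma> y = (\<Sum>p | prime p \<and> p \<le> nat \<lfloor>exp y\<rfloor>. f p * of_real (real p powr (- \<sigma>)))"

lemma mangoldt_nonzeroD:
  assumes "(mangoldt n :: 'a :: real_algebra_1) \<noteq> 0"
  obtains p k where "prime p" "k > 0" "n = p ^ k"
  using assms by (auto simp: mangoldt_def primepow_def split: if_splits)

text \<open>The weight \<Lambda>(n)/ln n equals 1/k at p^k: primes count fully, prime squares by one
  half, and everything else is left in the high powers.\<close>

lemma high_powers_split:
  fixes f :: "nat \<Rightarrow> complex" and \<sigma> :: real
  defines "t \<equiv> (\<lambda>n. mangoldt n * f n * of_real (real n powr (- \<sigma>)) / of_real (ln (real n)))"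
  shows "(\<Sum>n\<in>{2..N}. t n) = (\<Sum>p | prime p \<and> p \<le> N. f p * of_real (real p powr (- \<sigma>))) + (\<Sum>n\<in>{2..N} \<inter> high_powers 2. t n)"
    "(\<Sum>n\<in>{2..N} \<inter> high_powers 2. t n) =
      (\<Sum>p | prime p \<and> p\<^sup>2 \<le> N. f (p\<^sup>2) * of_real (real p powr (- (2 * \<sigma>)))) / 2 + (\<Sum>n\<in>{2..N} \<inter> high_powers 3. t n)"
proof -
  have ln0: "ln (real p) > 0" if "prime p" for p using prime_gt_1_nat[OF that] by simp
  have P: "{p. prime p \<and> p \<le> N} = {n\<in>{2..N}. prime n}" using prime_ge_2_nat by auto
  have "(\<Sum>n\<in>{2..N}. t n) = (\<Sum>n\<in>{n\<in>{2..N}. prime n} \<union> ({2..N} \<inter> high_powers 2). t n)"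
  proof (rule sum.mono_neutral_right)
    show "\<forall>n\<in>{2..N} - ({n\<in>{2..N}. prime n} \<union> ({2..N} \<inter> high_powers 2)). t n = 0"
    proof
      fix n assume n: "n \<in> {2..N} - ({n\<in>{2..N}. prime n} \<union> ({2..N} \<inter> high_powers 2))"
      have "(mangoldt n :: complex) = 0"
      proof (rule ccontr)
        assume "(mangoldt n :: complex) \<noteq> 0"
        then obtain p k where pk: "prime p" "k > 0" "n = p ^ k" by (rule mangoldt_nonzeroD)
        have n2: "n \<in> {2..N}" "n \<notin> {n\<in>{2..N}. prime n}" "n \<notin> {2..N} \<inter> high_powers 2" using n by blast+
        show False
        proof (cases "k = 1")
          case True
          hence "prime n" using pk by simp
          thus False using n2 by blast
        next
          case False
          hence "n \<in> high_powers 2" using pk unfolding high_powers_def by (intro CollectI exI[of _ p] exI[of _ k]) auto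
          thus False using n2 by blast
        qed
      qed
      thus "t n = 0" by (simp add: t_def)
    qed
  qed auto
  also have "\<dots> = (\<Sum>n\<in>{n\<in>{2..N}. prime n}. t n) + (\<Sum>n\<in>{2..N} \<inter> high_powers 2. t n)"
    by (rule sum.union_disjoint) (auto simp: high_powers_def prime_power_iff)
  also have "(\<Sum>n\<in>{n\<in>{2..N}. prime n}. t n) = (\<Sum>p | prime p \<and> p \<le> N. f p * of_real (real p powr (- \<sigma>)))"
    unfolding P
  proof (rule sum.cong[OF refl])
    fix p assume "p \<in> {n\<in>{2..N}. prime n}"
    hence p: "prime p" by simp
    have "(mangoldt p :: complex) = of_real (ln (real p))" using p by simp
    thus "t p = f p * of_real (real p powr (- \<sigma>))" using ln0[OF p] unfolding t_def by simp
  qed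
  finally show "(\<Sum>n\<in>{2..N}. t n) = (\<Sum>p | prime p \<and> p \<le> N. f p * of_real (real p powr (- \<sigma>))) + (\<Sum>n\<in>{2..N} \<inter> high_powers 2. t n)" .
  have set: "{2..N} \<inter> high_powers 2 = (\<lambda>p. p\<^sup>2) ` {p. prime p \<and> p\<^sup>2 \<le> N} \<union> ({2..N} \<inter> high_powers 3)"
  proof (rule equalityI; rule subsetI)
    fix n assume "n \<in> {2..N} \<inter> high_powers 2"
    then obtain p k where pk: "prime p" "k \<ge> 2" "n = p ^ k" "n \<in> {2..N}" by (auto simp: high_powers_def)
    show "n \<in> (\<lambda>p. p\<^sup>2) ` {p. prime p \<and> p\<^sup>2 \<le> N} \<union> ({2..N} \<inter> high_powers 3)"
    proof (cases "k = 2")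
      case True
      thus ?thesis using pk by auto
    next
      case False
      hence "n \<in> high_powers 3" using pk unfolding high_powers_def by (intro CollectI exI[of _ p] exI[of _ k]) auto
      thus ?thesis using pk by auto
    qed
  next
    fix n assume "n \<in> (\<lambda>p. p\<^sup>2) ` {p. prime p \<and> p\<^sup>2 \<le> N} \<union> ({2..N} \<inter> high_powers 3)"
    thus "n \<in> {2..N} \<inter> high_powers 2"
    proof
      assume "n \<in> (\<lambda>p. p\<^sup>2) ` {p. prime p \<and> p\<^sup>2 \<le> N}"
      then obtain p where p: "prime p" "n = p\<^sup>2" "p\<^sup>2 \<le> N" by auto
      have "p ^ 1 \<le> p\<^sup>2" using prime_gt_0_nat[OF p(1)] by (intro power_increasing) auto
      hence "n \<in> {2..N}" using p prime_ge_2_nat[OF p(1)] by simp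
      moreover have "n \<in> high_powers 2" using p unfolding high_powers_def by (intro CollectI exI[of _ p] exI[of _ 2]) auto
      ultimately show ?thesis by simp
    next
      assume n: "n \<in> {2..N} \<inter> high_powers 3"
      then obtain p k where pk: "prime p" "k \<ge> 3" "n = p ^ k" by (auto simp: high_powers_def)
      hence "n \<in> high_powers 2" unfolding high_powers_def by (intro CollectI exI[of _ p] exI[of _ k]) auto
      thus ?thesis using n by simp
    qed
  qed
  have disj: "(\<lambda>p. p\<^sup>2) ` {p. prime p \<and> p\<^sup>2 \<le> N} \<inter> ({2..N} \<inter> high_powers 3) = {}"
  proof (rule ccontr)
    assume "\<not> ?thesis"
    then obtain n where n: "n \<in> (\<lambda>p. p\<^sup>2) ` {p. prime p \<and> p\<^sup>2 \<le> N}" "n \<in> high_powers 3" by blast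
    obtain p where p: "prime p" "n = p\<^sup>2" using n(1) by auto
    obtain r k where rk: "prime r" "k \<ge> 3" "n = r ^ k" using n(2) unfolding high_powers_def by blast
    have "2 = k" by (rule prime_power_inj'(2)[OF p(1) rk(1)]) (use p rk in auto)
    thus False using rk by simp
  qed
  have fin: "finite {p. prime p \<and> p\<^sup>2 \<le> N}"
  proof (rule finite_subset)
    show "{p. prime p \<and> p\<^sup>2 \<le> N} \<subseteq> {..N}"
    proof
      fix p assume "p \<in> {p. prime p \<and> p\<^sup>2 \<le> N}"
      moreover from this have "p ^ 1 \<le> p\<^sup>2" using prime_gt_0_nat[of p] by (intro power_increasing) auto
      ultimately show "p \<in> {..N}" by simp
    qed
  qed simp
  have "(\<Sum>n\<in>{2..N} \<inter> high_powers 2. t n) = (\<Sum>n\<in>(\<lambda>p. p\<^sup>2) ` {p. prime p \<and> p\<^sup>2 \<le> N}. t n) + (\<Sum>n\<in>{2..N} \<inter> high_powers 3. t n)"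
    unfolding set by (rule sum.union_disjoint) (use disj fin in auto)
  also have "(\<Sum>n\<in>(\<lambda>p. p\<^sup>2) ` {p. prime p \<and> p\<^sup>2 \<le> N}. t n) = (\<Sum>p | prime p \<and> p\<^sup>2 \<le> N. t (p\<^sup>2))"
    by (subst sum.reindex) (auto simp: inj_on_def)
  also have "\<dots> = (\<Sum>p | prime p \<and> p\<^sup>2 \<le> N. f (p\<^sup>2) * of_real (real p powr (- (2 * \<sigma>))) / 2)"
  proof (rule sum.cong[OF refl])
    fix p assume "p \<in> {p. prime p \<and> p\<^sup>2 \<le> N}"
    hence p: "prime p" by simp
    have p0: "real p > 0" using prime_gt_0_nat[OF p] by simp
    have "(mangoldt (p\<^sup>2) :: complex) = of_real (ln (real p))" using p by (intro mangoldt_primepow') auto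
    moreover have "ln (real (p\<^sup>2)) = 2 * ln (real p)" using p0 by (simp add: ln_realpow)
    moreover have "real (p\<^sup>2) powr (- \<sigma>) = real p powr (- (2 * \<sigma>))"
      using p0 by (simp add: powr_powr flip: powr_numeral)
    ultimately show "t (p\<^sup>2) = f (p\<^sup>2) * of_real (real p powr (- (2 * \<sigma>))) / 2"
      using ln0[OF p] unfolding t_def by simp
  qed
  also have "\<dots> = (\<Sum>p | prime p \<and> p\<^sup>2 \<le> N. f (p\<^sup>2) * of_real (real p powr (- (2 * \<sigma>)))) / 2"
    by (rule sum_divide_distrib[symmetric])
  finally show "(\<Sum>n\<in>{2..N} \<inter> high_powers 2. t n) =
      (\<Sum>p | prime p \<and> p\<^sup>2 \<le> N. f (p\<^sup>2) * of_real (real p powr (- (2 * \<sigma>)))) / 2 + (\<Sum>n\<in>{2..N} \<inter> high_powers 3. t n)" .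
qed

text \<open>A bounded \<open>psum\<close> satisfies the mean-square hypothesis trivially, so the
  machinery built for \<open>ff\<close> also proves Mertens' second theorem and its analogue for
  characters.\<close>

lemma psum_stepanov_bounded:
  assumes a1: "a (Suc 0) = 0" and B: "\<And>y. y \<ge> 0 \<Longrightarrow> norm (psum a \<mu> y) \<le> B"
  shows "psum_stepanov a \<mu> (B\<^sup>2 * 2)"
proof
  have B': "norm (psum a \<mu> y) \<le> B" for y
  proof (cases "y \<ge> 0")
    case False
    hence "\<lfloor>exp y\<rfloor> = 0" by (simp add: floor_eq_iff)
    hence "psum a \<mu> y = 0" using False by (simp add: psum_def)
    thus ?thesis using order_trans[OF norm_ge_zero B[of 0]] by simp
  qed (rule B)
  show "\<forall>Y\<ge>1. (LINT y|lborel. indicator {Y-1..Y+1} y * (norm (psum a \<mu> y))\<^sup>2) \<le> B\<^sup>2 * 2"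
  proof (intro allI impI)
    fix Y :: real
    have "(LINT y|lborel. indicator {Y-1..Y+1} y * (norm (psum a \<mu> y))\<^sup>2) \<le> (LINT y|lborel. B\<^sup>2 * indicator {Y-1..Y+1} y)"
    proof (rule integral_mono')
      show "integrable lborel (\<lambda>y. B\<^sup>2 * indicator {Y-1..Y+1} y)" by (intro integrable_mult_right integrable_indicator_Icc)
      fix y
      have "(norm (psum a \<mu> y))\<^sup>2 \<le> B\<^sup>2" by (intro power_mono B') simp
      thus "indicator {Y-1..Y+1} y * (norm (psum a \<mu> y))\<^sup>2 \<le> B\<^sup>2 * indicator {Y-1..Y+1} y" by (simp add: indicator_def)
    qed simp
    also have "\<dots> = B\<^sup>2 * 2" unfolding integral_mult_right_zero using lint_indicator_Icc[of "Y-1" "Y+1"] by simp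
    finally show "(LINT y|lborel. indicator {Y-1..Y+1} y * (norm (psum a \<mu> y))\<^sup>2) \<le> B\<^sup>2 * 2" .
  qed
qed (rule a1)

lemma prime_sum_recip:
  fixes f :: "nat \<Rightarrow> complex"
  defines "a \<equiv> (\<lambda>n. mangoldt n * f n * of_real (real n powr (- 1)))"
  assumes f: "\<And>n. norm (f n) \<le> 1" and B: "\<And>y. y \<ge> 0 \<Longrightarrow> norm (psum a \<mu> y) \<le> B"
  shows "\<exists>c K. K \<ge> 0 \<and> (\<forall>y\<ge>1. norm (prime_sum f 1 y + of_real (\<mu> * ln y) - c) \<le> K / y)"
proof -
  have a1: "a (Suc 0) = 0" by (simp add: a_def)
  interpret psum_stepanov a \<mu> "B\<^sup>2 * 2" by (rule psum_stepanov_bounded[OF a1 B])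
  obtain c1 K1 where 1: "K1 \<ge> 0" "\<forall>y\<ge>1. norm (lsum a y + of_real (\<mu> * ln y) - c1) \<le> (norm (psum a \<mu> y) + K1) / y"
    using lsum_asymp by (elim exE conjE)
  have "\<exists>c K. K \<ge> 0 \<and> (\<forall>y\<ge>1. norm ((\<Sum>n\<in>{2..nat \<lfloor>exp y\<rfloor>} \<inter> high_powers 2.
      mangoldt n * f n * of_real (real n powr (- 1)) / of_real (ln (real n))) - c) \<le> K / y)"
    by (rule high_powers_sum[OF f]) auto
  then obtain c2 K2 where 2: "K2 \<ge> 0" "\<forall>y\<ge>1. norm ((\<Sum>n\<in>{2..nat \<lfloor>exp y\<rfloor>} \<inter> high_powers 2.
      mangoldt n * f n * of_real (real n powr (- 1)) / of_real (ln (real n))) - c2) \<le> K2 / y"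
    by (elim exE conjE)
  have B0: "B \<ge> 0" using order_trans[OF norm_ge_zero B[of 0]] by simp
  show ?thesis
  proof (intro exI[of _ "c1 - c2"] exI[of _ "B + K1 + K2"] conjI allI impI)
    fix y :: real assume y: "y \<ge> 1"
    define H where "H = (\<Sum>n\<in>{2..nat \<lfloor>exp y\<rfloor>} \<inter> high_powers 2. mangoldt n * f n * of_real (real n powr (- 1)) / of_real (ln (real n)))"
    have "lsum a y = prime_sum f 1 y + H"
      unfolding lsum_def prime_sum_def a_def H_def by (rule high_powers_split(1))
    hence "prime_sum f 1 y + of_real (\<mu> * ln y) - (c1 - c2) = (lsum a y + of_real (\<mu> * ln y) - c1) - (H - c2)" by simp
    also have "norm \<dots> \<le> (B + K1) / y + K2 / y"
    proof (rule norm_diff_bound)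
      have "(norm (psum a \<mu> y) + K1) / y \<le> (B + K1) / y" using B[of y] y by (intro divide_right_mono) auto
      thus "norm (lsum a y + of_real (\<mu> * ln y) - c1) \<le> (B + K1) / y" using 1(2)[rule_format, OF y] by linarith
      show "norm (H - c2) \<le> K2 / y" unfolding H_def using 2(2)[rule_format, OF y] .
    qed
    finally show "norm (prime_sum f 1 y + of_real (\<mu> * ln y) - (c1 - c2)) \<le> (B + K1 + K2) / y"
      by (simp add: add_divide_distrib)
  qed (use 1 2 B0 in auto)
qed

text \<open>Mertens' first theorem bounds the full sum of \<Lambda>(n)/n minus y, and the terms with
  n not coprime to q are powers of the finitely many primes dividing q. Hence \<open>psum\<close>
  with \<mu> = -1 is bounded.\<close>

lemma mertens_principal:
  assumes q: "q > 0"
  shows "\<exists>c K. K \<ge> 0 \<and> (\<forall>y\<ge>1. norm (prime_sum (principal_char q) 1 y + of_real ((- 1) * ln y) - c) \<le> K / y)"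
proof (rule prime_sum_recip)
  define b where "b = (\<lambda>n. mangoldt n * real n powr (- 1) :: real)"
  have b0: "b n \<ge> 0" for n unfolding b_def by (intro mult_nonneg_nonneg mangoldt_nonneg) auto
  \<comment> \<open>A bound, independent of y, for the contribution of all powers of primes dividing
    q.\<close>
  define D where "D = (\<Sum>p\<in>prime_factors q. 4 * (ln (real p) * real p powr (- (real 1 * 1))))"
  show "norm (principal_char q n) \<le> 1" for n by (simp add: principal_char_def)
  fix y :: real assume y: "y \<ge> 0"
  define N where "N = nat \<lfloor>exp y\<rfloor>"
  have e1: "exp y \<ge> 1" using y by simp
  have N1: "N \<ge> 1" using e1 by (simp add: N_def le_nat_iff le_floor_iff)
  have N2: "real N \<le> exp y" "exp y \<le> 2 * real N"
  proof -
    show "real N \<le> exp y" by (simp add: N_def)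
    have "exp y < real N + 1" by (simp add: N_def)
    thus "exp y \<le> 2 * real N" using N1 by simp
  qed
  have lnN: "ln (real N) \<le> y" "y \<le> ln (real N) + 1"
  proof -
    have "ln (real N) \<le> ln (exp y)" using N1 N2 by (subst ln_le_cancel_iff) auto
    thus "ln (real N) \<le> y" by simp
    have "ln (exp y) \<le> ln (2 * real N)" using N1 N2 by (subst ln_le_cancel_iff) auto
    also have "\<dots> = ln 2 + ln (real N)" using N1 by (simp add: ln_mult)
    finally show "y \<le> ln (real N) + 1" using ln_2_less_1 by simp
  qed
  define S where "S = (\<Sum>n\<in>{1..N}. b n)"
  define S1 where "S1 = (\<Sum>n\<in>{n\<in>{1..N}. coprime n q}. b n)"
  define S2 where "S2 = (\<Sum>n\<in>{n\<in>{1..N}. \<not> coprime n q}. b n)"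
  have S: "S = S1 + S2"
    unfolding S_def S1_def S2_def by (subst sum.union_disjoint[symmetric]) (auto intro!: sum.cong)
  have S20: "S2 \<ge> 0" unfolding S2_def by (intro sum_nonneg b0)
  have "S2 = (\<Sum>n\<in>{n\<in>{1..N}. \<not> coprime n q \<and> mangoldt n \<noteq> (0::real)}. b n)"
    unfolding S2_def by (rule sum.mono_neutral_right) (auto simp: b_def)
  also have "\<dots> \<le> (\<Sum>p\<in>prime_factors q. \<Sum>j<N. b (p ^ (1 + j)))"
  proof (rule primepow_sum_le)
    show "{n\<in>{1..N}. \<not> coprime n q \<and> mangoldt n \<noteq> (0::real)} \<subseteq> (\<lambda>(p, j). p ^ (1 + j)) ` (prime_factors q \<times> {..<N})"
    proof
      fix n assume "n \<in> {n\<in>{1..N}. \<not> coprime n q \<and> mangoldt n \<noteq> (0::real)}"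
      hence n: "n \<le> N" "\<not> coprime n q" "mangoldt n \<noteq> (0::real)" by auto
      obtain p k where pk: "prime p" "k > 0" "n = p ^ k" using n(3) by (rule mangoldt_nonzeroD)
      have "p dvd q" using n(2) pk prime_imp_coprime[of p q] by auto
      moreover have "k < p ^ k" using prime_gt_1_nat[OF pk(1)] by (intro power_gt_expt) auto
      moreover obtain j where "k = Suc j" using pk(2) by (cases k) auto
      ultimately show "n \<in> (\<lambda>(p, j). p ^ (1 + j)) ` (prime_factors q \<times> {..<N})"
        using pk n q by (intro image_eqI[of _ _ "(p, j)"]) (auto simp: in_prime_factors_iff)
    qed
  qed (use b0 in auto)
  also have "\<dots> \<le> D" unfolding D_def b_def
    by (intro sum_mono mangoldt_powr_inner) (auto simp: in_prime_factors_iff)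
  finally have S2: "S2 \<le> D" .
  have "S = (\<Sum>n\<in>{1..N}. mangoldt n / real n)"
    unfolding S_def b_def by (intro sum.cong) (auto simp: powr_minus field_simps)
  hence Sb: "\<bar>S - ln (real N)\<bar> \<le> 8" using mertens_first[OF N1] by simp
  have "(\<Sum>n\<in>{1..N}. mangoldt n * principal_char q n * of_real (real n powr (- 1))) = (\<Sum>n\<in>{1..N}. of_real (if coprime n q then b n else 0))"
    by (intro sum.cong) (auto simp: principal_char_def b_def)
  also have "\<dots> = complex_of_real (\<Sum>n\<in>{1..N}. if coprime n q then b n else 0)" by simp
  also have "(\<Sum>n\<in>{1..N}. if coprime n q then b n else 0) = S1" unfolding S1_def by (rule sum.inter_filter[symmetric]) simp
  finally have "psum (\<lambda>n. mangoldt n * principal_char q n * of_real (real n powr (- 1))) (- 1) y = of_real (S1 - y)"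
    using y by (simp add: psum_def N_def)
  hence "norm (psum (\<lambda>n. mangoldt n * principal_char q n * of_real (real n powr (- 1))) (- 1) y) = \<bar>S1 - y\<bar>"
    by (simp only: norm_of_real)
  also have "\<dots> \<le> 9 + D" using S S2 S20 Sb lnN by linarith
  finally show "norm (psum (\<lambda>n. mangoldt n * principal_char q n * of_real (real n powr (- 1))) (- 1) y) \<le> 9 + D" .
qed

lemma summation_by_parts:
  fixes a :: "nat \<Rightarrow> complex"
  shows "(\<Sum>n\<in>{1..N}. a n * of_real (g n)) = (\<Sum>n\<in>{1..N}. a n) * of_real (g (Suc N)) + (\<Sum>n\<in>{1..N}. (\<Sum>k\<in>{1..n}. a k) * of_real (g n - g (Suc n)))"
  by (induction N) (auto simp: algebra_simps)

context grh_char
begin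

lemma ff_eq_psum: "ff y = psum aa (real m) y"
  by (simp add: ff_def psum_def)

text \<open>For non-principal \<psi> the sums with weight 1/n stay bounded: \<open>ff_subexp\<close>
  bounds the partial sums of \<open>aa\<close> by K n^(1/4), and summation by parts against n^(-1/2)
  converges. In \<open>prime_sum_asymp\<close> this is applied to the square of the
  character.\<close>

lemma mertens_char:
  "\<exists>c K. K \<ge> 0 \<and> (\<forall>y\<ge>1. norm (prime_sum \<psi> 1 y + of_real (0 * ln y) - c) \<le> K / y)"
proof -
  have e4: "0 < (1/4 :: real)" by simp
  obtain C where C: "C > 0" "\<forall>y\<ge>0. norm (ff y) \<le> C * exp (1/4 * y)" using ff_subexp[OF e4] by (elim exE conjE)
  define K where "K = C + 4 * real m"
  have K0: "K \<ge> 0" using C by (simp add: K_def)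
  \<comment> \<open>With u = n^(1/4) the weight n^(-1/2) is 1/u^2, and u(n) times its decrement is
    at most 2(1/u(n) - 1/u(n+1)), which telescopes.\<close>
  define u where "u = (\<lambda>n. real n powr (1/4))"
  have u0: "u n > 0" if "n \<ge> 1" for n using that by (simp add: u_def)
  have um: "u n \<le> u (Suc n)" for n by (simp add: u_def powr_mono2)
  define g where "g = (\<lambda>n. real n powr (- (1/2)))"
  have gu: "g n = 1 / (u n)\<^sup>2" if "n \<ge> 1" for n
    using that by (simp add: g_def u_def powr_minus_divide power2_eq_square flip: powr_add)
  have A: "norm (\<Sum>k\<in>{1..n}. aa k) \<le> K * u n" if n: "n \<ge> 1" for n
  proof -
    define y where "y = ln (real n)"
    have y: "y \<ge> 0" "exp y = real n" using n by (auto simp: y_def)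
    have eu: "exp (1/4 * y) = u n" using n by (simp add: y_def u_def powr_def)
    have "(\<Sum>k\<in>{1..n}. aa k) = ff y - of_real (real m * y)" using y by (simp add: ff_def)
    also have "norm \<dots> \<le> norm (ff y) + norm (complex_of_real (real m * y))" by (rule norm_triangle_ineq4)
    also have "norm (complex_of_real (real m * y)) = real m * y" unfolding norm_of_real using y by simp
    also have "norm (ff y) + real m * y \<le> C * exp (1/4 * y) + real m * (4 * exp (1/4 * y))"
    proof (intro add_mono mult_left_mono)
      show "norm (ff y) \<le> C * exp (1/4 * y)" using C y by simp
      show "y \<le> 4 * exp (1/4 * y)" using exp_ge_add_one_self[of "1/4 * y"] by linarith
    qed auto
    finally show ?thesis unfolding eu by (simp add: K_def algebra_simps)
  qed
  have tel: "(\<Sum>n\<in>{1..N}. 2 * K * (1 / u n - 1 / u (Suc n))) = 2 * K * (1 / u 1 - 1 / u (Suc N))" for N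
    by (induction N) (auto simp: algebra_simps)
  have bd: "norm (\<Sum>n\<in>{1..N}. aa n * of_real (g n)) \<le> 3 * K" for N
  proof (cases "N = 0")
    case False
    hence N: "N \<ge> 1" by simp
    have "norm ((\<Sum>n\<in>{1..N}. aa n) * of_real (g (Suc N))) \<le> K * u N * (1 / (u N * u N))"
    proof -
      have "g (Suc N) = 1 / (u (Suc N) * u (Suc N))" using gu[of "Suc N"] by (simp add: power2_eq_square)
      also have "\<dots> \<le> 1 / (u N * u N)" using um[of N] u0[OF N] u0[of "Suc N"] by (intro divide_left_mono mult_mono mult_pos_pos) auto
      finally have "g (Suc N) \<le> 1 / (u N * u N)" .
      thus ?thesis unfolding norm_mult norm_of_real using A[OF N] K0 u0[OF N] by (intro mult_mono) (auto simp: g_def)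
    qed
    also have "\<dots> = K * (1 / u N)" using u0[OF N] by (simp add: field_simps)
    also have "\<dots> \<le> K * 1"
    proof (intro mult_left_mono)
      have "1 \<le> u N" unfolding u_def using N by (intro ge_one_powr_ge_zero) auto
      thus "1 / u N \<le> 1" by simp
    qed (rule K0)
    finally have 1: "norm ((\<Sum>n\<in>{1..N}. aa n) * of_real (g (Suc N))) \<le> K" by simp
    have "norm (\<Sum>n\<in>{1..N}. (\<Sum>k\<in>{1..n}. aa k) * of_real (g n - g (Suc n))) \<le> (\<Sum>n\<in>{1..N}. 2 * K * (1 / u n - 1 / u (Suc n)))"
    proof (rule sum_norm_le)
      fix n assume "n \<in> {1..N}"
      hence n: "n \<ge> 1" by simp
      define s t where "s = u n" and "t = u (Suc n)"
      have st: "0 < s" "s \<le> t" using u0[OF n] um[of n] by (auto simp: s_def t_def)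
      have d: "g n - g (Suc n) = 1 / s\<^sup>2 - 1 / t\<^sup>2" using gu[OF n] gu[of "Suc n"] by (simp add: s_def t_def)
      have "1 / s\<^sup>2 - 1 / t\<^sup>2 = (1 / s - 1 / t) * (1 / s + 1 / t)" by (simp add: power2_eq_square algebra_simps)
      also have "\<dots> \<le> (1 / s - 1 / t) * (1 / s + 1 / s)"
        using st by (intro mult_left_mono add_left_mono) (auto simp: frac_le)
      finally have "g n - g (Suc n) \<le> (1 / s - 1 / t) * (2 / s)" using d by simp
      moreover have "g n - g (Suc n) \<ge> 0"
      proof -
        have "s\<^sup>2 \<le> t\<^sup>2" using st by (intro power_mono) auto
        thus ?thesis unfolding d using st by (simp add: frac_le)
      qed
      ultimately have "norm ((\<Sum>k\<in>{1..n}. aa k) * of_real (g n - g (Suc n))) \<le> K * s * ((1 / s - 1 / t) * (2 / s))"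
        unfolding norm_mult norm_of_real using A[OF n] K0 st by (intro mult_mono) (auto simp: s_def)
      also have "\<dots> = 2 * K * (1 / s - 1 / t)" using st by (simp add: field_simps)
      finally show "norm ((\<Sum>k\<in>{1..n}. aa k) * of_real (g n - g (Suc n))) \<le> 2 * K * (1 / u n - 1 / u (Suc n))"
        by (simp only: s_def t_def)
    qed
    also have "\<dots> \<le> 2 * K * 1"
      unfolding tel using K0 u0[of "Suc N"] by (intro mult_left_mono) (auto simp: u_def)
    finally have 2: "norm (\<Sum>n\<in>{1..N}. (\<Sum>k\<in>{1..n}. aa k) * of_real (g n - g (Suc n))) \<le> 2 * K" by simp
    show ?thesis unfolding summation_by_parts[of aa g N]
      using 1 2 by (intro order_trans[OF norm_triangle_ineq]) linarith
  qed (use K0 in simp)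
  show ?thesis
  proof (rule prime_sum_recip)
    show "norm (\<psi> n) \<le> 1" for n by (rule norm_dcharacter_le[OF char])
    fix y :: real
    have "mangoldt n * \<psi> n * of_real (real n powr (- 1)) = aa n * of_real (g n)" for n
      by (simp add: aa_def g_def mult.assoc flip: of_real_mult powr_add)
    thus "norm (psum (\<lambda>n. mangoldt n * \<psi> n * of_real (real n powr (- 1))) 0 y) \<le> 3 * K"
      using bd[of "nat \<lfloor>exp y\<rfloor>"] by (simp add: psum_def)
  qed
qed

text \<open>From the sum over prime powers subtract half of the sum of \<psi>^2(p)/p over p \<le>
  e^(y/2), which is (e/2) ln y plus a constant, and a convergent rest. The bound for
  \<open>ff\<close> enters through \<open>lsum_asymp\<close>, which leaves |ff y|/y
  pointwise.\<close>

lemma prime_sum_asymp_aux: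
  assumes sq: "\<exists>c K. K \<ge> 0 \<and> (\<forall>y\<ge>1. norm (prime_sum (\<lambda>n. \<psi> (n\<^sup>2)) 1 y + of_real (- e * ln y) - c) \<le> K / y)"
  shows "\<exists>c K. K \<ge> 0 \<and> (\<forall>y\<ge>2. norm (prime_sum \<psi> (1/2) y + of_real ((real m + e / 2) * ln y) - c) \<le> (norm (ff y) + K) / y)"
proof -
  obtain C where "C > 0" and C: "\<forall>Y\<ge>1. (LINT y|lborel. indicator {Y-1..Y+1} y * (norm (ff y))\<^sup>2) \<le> C"
    using ff_stepanov by (elim exE conjE)
  interpret psum_stepanov aa "real m" C by unfold_locales (use C in \<open>simp_all add: ff_eq_psum aa_def\<close>)
  obtain c1 K1 where 1: "K1 \<ge> 0" "\<forall>y\<ge>1. norm (lsum aa y + of_real (real m * ln y) - c1) \<le> (norm (psum aa (real m) y) + K1) / y"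
    using lsum_asymp by (elim exE conjE)
  obtain c2 K2 where 2: "K2 \<ge> 0" "\<forall>y\<ge>1. norm (prime_sum (\<lambda>n. \<psi> (n\<^sup>2)) 1 y + of_real (- e * ln y) - c2) \<le> K2 / y"
    using sq by (elim exE conjE)
  have "\<exists>c K. K \<ge> 0 \<and> (\<forall>y\<ge>1. norm ((\<Sum>n\<in>{2..nat \<lfloor>exp y\<rfloor>} \<inter> high_powers 3.
      mangoldt n * \<psi> n * of_real (real n powr (- (1/2))) / of_real (ln (real n))) - c) \<le> K / y)"
    by (rule high_powers_sum[OF norm_dcharacter_le[OF char]]) auto
  then obtain c3 K3 where 3: "K3 \<ge> 0" "\<forall>y\<ge>1. norm ((\<Sum>n\<in>{2..nat \<lfloor>exp y\<rfloor>} \<inter> high_powers 3.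
      mangoldt n * \<psi> n * of_real (real n powr (- (1/2))) / of_real (ln (real n))) - c3) \<le> K3 / y"
    by (elim exE conjE)
  show ?thesis
  proof (intro exI[of _ "c1 - c2 / 2 - c3 + of_real (e / 2 * ln 2)"] exI[of _ "K1 + K2 + K3"] conjI allI impI)
    fix y :: real assume y2: "y \<ge> 2"
    hence y: "y \<ge> 1" "y / 2 \<ge> 1" by auto
    define H where "H = (\<Sum>n\<in>{2..nat \<lfloor>exp y\<rfloor>} \<inter> high_powers 3. mangoldt n * \<psi> n * of_real (real n powr (- (1/2))) / of_real (ln (real n)))"
    \<comment> \<open>Squares up to e^y come from primes up to e^(y/2). This is why the final range
      is y \<ge> 2 and why a constant (e/2) ln 2 appears.\<close>
    have sqset: "p\<^sup>2 \<le> nat \<lfloor>exp y\<rfloor> \<longleftrightarrow> p \<le> nat \<lfloor>exp (y / 2)\<rfloor>" if "prime p" for p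
    proof -
      have p: "p \<ge> 1" using prime_gt_0_nat[OF that] by simp
      have "p\<^sup>2 \<le> nat \<lfloor>exp y\<rfloor> \<longleftrightarrow> ln (real (p\<^sup>2)) \<le> y" using p by (intro le_nat_floor_exp) simp
      also have "ln (real (p\<^sup>2)) = 2 * ln (real p)" using p by (simp add: ln_realpow)
      also have "2 * ln (real p) \<le> y \<longleftrightarrow> ln (real p) \<le> y / 2" by linarith
      also have "\<dots> \<longleftrightarrow> p \<le> nat \<lfloor>exp (y / 2)\<rfloor>" using p by (intro le_nat_floor_exp[symmetric])
      finally show ?thesis .
    qed
    have "lsum aa y = prime_sum \<psi> (1/2) y + (\<Sum>n\<in>{2..nat \<lfloor>exp y\<rfloor>} \<inter> high_powers 2. mangoldt n * \<psi> n * of_real (real n powr (- (1/2))) / of_real (ln (real n)))"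
      unfolding lsum_def prime_sum_def aa_def by (rule high_powers_split(1))
    also have "(\<Sum>n\<in>{2..nat \<lfloor>exp y\<rfloor>} \<inter> high_powers 2. mangoldt n * \<psi> n * of_real (real n powr (- (1/2))) / of_real (ln (real n))) =
       (\<Sum>p | prime p \<and> p\<^sup>2 \<le> nat \<lfloor>exp y\<rfloor>. \<psi> (p\<^sup>2) * of_real (real p powr (- (2 * (1/2))))) / 2 + H"
      unfolding H_def by (rule high_powers_split(2))
    also have "(\<Sum>p | prime p \<and> p\<^sup>2 \<le> nat \<lfloor>exp y\<rfloor>. \<psi> (p\<^sup>2) * of_real (real p powr (- (2 * (1/2))))) = prime_sum (\<lambda>n. \<psi> (n\<^sup>2)) 1 (y / 2)"
      unfolding prime_sum_def by (rule sum.cong) (auto simp: sqset)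
    finally have l: "lsum aa y = prime_sum \<psi> (1/2) y + (prime_sum (\<lambda>n. \<psi> (n\<^sup>2)) 1 (y / 2) / 2 + H)" .
    have lny: "ln (y / 2) = ln y - ln 2" using y by (simp add: ln_div)
    have "prime_sum \<psi> (1/2) y + of_real ((real m + e / 2) * ln y) - (c1 - c2 / 2 - c3 + of_real (e / 2 * ln 2)) =
       (lsum aa y + of_real (real m * ln y) - c1) - ((prime_sum (\<lambda>n. \<psi> (n\<^sup>2)) 1 (y / 2) + of_real (- e * ln (y / 2)) - c2) / 2 + (H - c3))"
      unfolding l lny by (simp add: field_simps)
    also have "norm \<dots> \<le> (norm (ff y) + K1) / y + (K2 / y + K3 / y)"
    proof (rule norm_diff_bound[OF _ norm_add_bound])
      show "norm (lsum aa y + of_real (real m * ln y) - c1) \<le> (norm (ff y) + K1) / y"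
        using 1(2)[rule_format, OF y(1)] by (simp only: ff_eq_psum)
      show "norm (H - c3) \<le> K3 / y" unfolding H_def using 3(2)[rule_format, OF y(1)] .
      have "norm (prime_sum (\<lambda>n. \<psi> (n\<^sup>2)) 1 (y / 2) + of_real (- e * ln (y / 2)) - c2) \<le> K2 / (y / 2)"
        by (rule 2(2)[rule_format, OF y(2)])
      thus "norm ((prime_sum (\<lambda>n. \<psi> (n\<^sup>2)) 1 (y / 2) + of_real (- e * ln (y / 2)) - c2) / 2) \<le> K2 / y"
        by (simp add: norm_divide)
    qed
    finally show "norm (prime_sum \<psi> (1/2) y + of_real ((real m + e / 2) * ln y) - (c1 - c2 / 2 - c3 + of_real (e / 2 * ln 2))) \<le> (norm (ff y) + (K1 + K2 + K3)) / y"
      by (simp add: add_divide_distrib)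
  qed (use 1 2 3 in auto)
qed

end

lemma dcharacter_square:
  assumes "dcharacter q \<psi>"
  shows "dcharacter q (\<lambda>n. \<psi> (n\<^sup>2))"
  unfolding dcharacter_def
proof (intro conjI allI)
  show "q > 0" using assms by (rule dcharacterD)
  show "\<psi> (1\<^sup>2) = 1" using dcharacterD(2)[OF assms] by simp
  show "\<psi> ((k * n)\<^sup>2) = \<psi> (k\<^sup>2) * \<psi> (n\<^sup>2)" for k n by (simp only: power_mult_distrib dcharacterD(3)[OF assms])
  show "\<psi> ((n + q)\<^sup>2) = \<psi> (n\<^sup>2)" for n
    by (rule dcharacter_cong[OF assms], rule cong_pow) (simp add: cong_def)
  show "\<psi> (n\<^sup>2) = 0 \<longleftrightarrow> \<not> coprime (n) q" for n
    using dcharacterD(5)[OF assms, of "n\<^sup>2"] by simp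
qed

text \<open>The indicator \<open>e\<close> records whether \<psi>^2 is principal: if so Mertens'
  theorem supplies ln y, and otherwise \<psi>^2 is again non-principal, so GRH is invoked for it as
  well.\<close>

lemma prime_sum_asymp:
  assumes GRH: "\<forall>\<psi> \<in> nonprincipal_chars q. GRH_L \<psi>" and NP: "\<psi> \<in> nonprincipal_chars q"
  defines "e \<equiv> (if (\<lambda>n. \<psi> (n\<^sup>2)) = principal_char q then 1 else 0)"
  shows "\<exists>c K. K \<ge> 0 \<and> (\<forall>y\<ge>2. norm (prime_sum \<psi> (1/2) y + of_real ((real (m_chi \<psi>) + e / 2) * ln y) - c) \<le> (norm (grh_char.ff \<psi> y) + K) / y)"
proof -
  interpret grh_char q \<psi> by unfold_locales (use GRH NP in auto)
  show ?thesis
  proof (rule prime_sum_asymp_aux, cases "(\<lambda>n. \<psi> (n\<^sup>2)) = principal_char q")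
    case True
    thus "\<exists>c K. K \<ge> 0 \<and> (\<forall>y\<ge>1. norm (prime_sum (\<lambda>n. \<psi> (n\<^sup>2)) 1 y + of_real (- e * ln y) - c) \<le> K / y)"
      using mertens_principal[OF dcharacterD(1)[OF char]] by (simp add: e_def)
  next
    case False
    hence NP2: "(\<lambda>n. \<psi> (n\<^sup>2)) \<in> nonprincipal_chars q" using dcharacter_square[OF char] by (simp add: nonprincipal_chars_def)
    interpret sq: grh_char q "\<lambda>n. \<psi> (n\<^sup>2)" by (rule grh_char.intro[OF NP2 assms(1)[rule_format, OF NP2]])
    show "\<exists>c K. K \<ge> 0 \<and> (\<forall>y\<ge>1. norm (prime_sum (\<lambda>n. \<psi> (n\<^sup>2)) 1 y + of_real (- e * ln y) - c) \<le> K / y)"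
      using sq.mertens_char False by (simp add: e_def)
  qed
qed


section \<open>Orthogonality of Dirichlet characters and counting square roots\<close>

definition chars :: "nat \<Rightarrow> (nat \<Rightarrow> complex) set" where
  "chars q = {\<psi>. dcharacter q \<psi>}"

text \<open>A character is determined by its values on residues, and each value is 0 or a root of
  unity of order dividing the totient.\<close>

lemma finite_chars:
  assumes q: "q > 0"
  shows "finite (chars q)"
proof -
  define R where "R = insert 0 {z :: complex. z ^ totient q = 1}"
  have t: "totient q > 0" using q by simp
  have R: "finite R" using finite_roots_unity[of "totient q"] t by (simp add: R_def)
  have "inj_on (\<lambda>\<psi>. restrict \<psi> {..<q}) (chars q)"
  proof (rule inj_onI)
    fix \<psi> \<theta> assume c: "\<psi> \<in> chars q" "\<theta> \<in> chars q" and e: "restrict \<psi> {..<q} = restrict \<theta> {..<q}"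
    show "\<psi> = \<theta>"
    proof
      fix n
      have "\<psi> (n mod q) = \<theta> (n mod q)" using fun_cong[OF e, of "n mod q"] q by simp
      thus "\<psi> n = \<theta> n" using c dcharacterD(6)[of q \<psi> n] dcharacterD(6)[of q \<theta> n] by (simp add: chars_def)
    qed
  qed
  moreover have "(\<lambda>\<psi>. restrict \<psi> {..<q}) ` chars q \<subseteq> PiE {..<q} (\<lambda>_. R)"
  proof (rule image_subsetI)
    fix \<psi> assume "\<psi> \<in> chars q"
    hence c: "dcharacter q \<psi>" by (simp add: chars_def)
    have "\<psi> n \<in> R" for n
      using dcharacter_totient[OF c, of n] dcharacterD(5)[OF c, of n] by (cases "coprime n q") (auto simp: R_def)
    thus "restrict \<psi> {..<q} \<in> PiE {..<q} (\<lambda>_. R)" by auto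
  qed
  moreover have "finite (PiE {..<q} (\<lambda>_. R))" by (intro finite_PiE R) auto
  ultimately show ?thesis by (meson finite_imageD finite_subset)
qed

lemma dcharacter_principal: "q > 0 \<Longrightarrow> dcharacter q (principal_char q)"
  unfolding dcharacter_def principal_char_def
  by (auto simp: coprime_mult_left_iff) (metis coprime_add_one_left coprime_iff_gcd_eq_1 gcd_add1)+

lemma chars_eq: "q > 0 \<Longrightarrow> chars q = insert (principal_char q) (nonprincipal_chars q)"
  using dcharacter_principal[of q] by (auto simp: chars_def nonprincipal_chars_def)

lemma finite_nonprincipal_chars: "q > 0 \<Longrightarrow> finite (nonprincipal_chars q)"
  using finite_chars[of q] chars_eq[of q] by simp

lemma dcharacter_mult:
  assumes "dcharacter q \<psi>" "dcharacter q \<theta>"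
  shows "dcharacter q (\<lambda>n. \<psi> n * \<theta> n)"
  using assms unfolding dcharacter_def by auto

lemma dcharacter_cnj:
  assumes "dcharacter q \<psi>"
  shows "dcharacter q (\<lambda>n. cnj (\<psi> n))"
  using assms unfolding dcharacter_def by auto

lemma dcharacter_cnj_mult:
  assumes "dcharacter q \<psi>" "coprime n q"
  shows "cnj (\<psi> n) * \<psi> n = 1"
  using norm_dcharacter[OF assms(1), of n] assms(2) complex_norm_square[of "\<psi> n"] by (simp add: mult.commute)

lemma roots_of_unity_sum:
  assumes N: "N > 0" and j: "j < N"
  shows "(\<Sum>k<N. (exp (2 * of_real pi * \<i> * of_nat k / of_nat N)) ^ j) = (if j = 0 then of_nat N else (0 :: complex))"
proof (cases "j = 0")
  case False
  define w where "w = exp (2 * of_real pi * \<i> * of_nat j / of_nat N)"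
  have "w \<noteq> 1"
  proof
    assume "w = 1"
    hence "exp (2 * of_real pi * \<i> * of_nat j / of_nat N) = exp (2 * of_real pi * \<i> * of_nat 0 / of_nat N)" by (simp add: w_def)
    hence "j mod N = 0 mod N" using complex_root_unity_eq[of N j 0] N by simp
    thus False using j False by simp
  qed
  moreover have "w ^ N = 1" unfolding w_def using N by (intro complex_root_unity) simp
  moreover have "(\<Sum>k<N. (exp (2 * of_real pi * \<i> * of_nat k / of_nat N)) ^ j) = (\<Sum>k<N. w ^ k)"
    unfolding w_def by (intro sum.cong refl) (simp add: exp_of_nat_mult[symmetric] field_simps)
  ultimately show ?thesis using False by (simp add: geometric_sum)
qed simp

text \<open>If every character were trivial at \<open>n\<close>, then so would be every function on the unit group:
  averaging over the powers of a unit \<open>g\<close> decomposes a function into eigenfunctions of translation by \<open>g\<close>,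
  and a joint eigenfunction of all translations is a multiple of a character.\<close>

definition unit_fun :: "nat \<Rightarrow> (nat \<Rightarrow> complex) \<Rightarrow> bool" where
  "unit_fun q F \<longleftrightarrow> (\<forall>x y. [x = y] (mod q) \<longrightarrow> F x = F y) \<and> (\<forall>x. \<not> coprime x q \<longrightarrow> F x = 0)"

definition eigen :: "(nat \<Rightarrow> complex) \<Rightarrow> nat \<Rightarrow> bool" where
  "eigen F g \<longleftrightarrow> (\<exists>c. \<forall>x. F (g * x) = c * F x)"

lemma joint_eigenfunction:
  assumes q: "q > 0" and F: "unit_fun q F" and e: "\<And>g. g < q \<Longrightarrow> coprime g q \<Longrightarrow> eigen F g"
    and n: "\<And>\<psi>. dcharacter q \<psi> \<Longrightarrow> \<psi> n = 1"
  shows "F (n * x) = F x"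
proof -
  have cong: "F x = F y" if "[x = y] (mod q)" for x y using F that unfolding unit_fun_def by blast
  have supp: "F x = 0" if "\<not> coprime x q" for x using F that unfolding unit_fun_def by blast
  have mult: "F (k * x) * F 1 = F k * F x" for k x
  proof (cases "coprime k q")
    case True
    define g where "g = k mod q"
    have g: "g < q" "coprime g q" using q True by (auto simp: g_def coprime_mod_left_iff)
    obtain c where c: "\<forall>x. F (g * x) = c * F x" using e[OF g] unfolding eigen_def by blast
    have "F (k * x) = F (g * x)" by (rule cong) (simp add: g_def cong_def mod_mult_left_eq)
    moreover have "F k = F (g * 1)" by (rule cong) (simp add: g_def cong_def)
    ultimately have "F (k * x) = c * F x" "F k = c * F 1"
      using c[rule_format, of x] c[rule_format, of 1] by (simp_all only:)
    thus ?thesis by simp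
  next
    case False
    hence "\<not> coprime (k * x) q" by (simp add: coprime_mult_left_iff)
    thus ?thesis using supp[OF False] supp by simp
  qed
  show ?thesis
  proof (cases "F 1 = 0")
    case True
    have "F k = 0" for k
    proof (cases "coprime k q")
      case kc: True
      obtain l where l: "[k * l = 1] (mod q)" using cong_solve_coprime_nat[OF kc] by auto
      have "F k * F k = F (k * k) * F 1" by (rule mult[symmetric])
      thus ?thesis using True by simp
    qed (rule supp)
    thus ?thesis by simp
  next
    case False
    \<comment> \<open>By \<open>mult\<close>, F(kx) F(1) = F(k) F(x), so dividing by F(1) makes the
      eigenfunction completely multiplicative, hence a character.\<close>
    define \<psi> where "\<psi> = (\<lambda>k. F k / F 1)"
    have m: "\<psi> (k * x) = \<psi> k * \<psi> x" for k x using mult[of k x] False by (simp add: \<psi>_def field_simps)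
    have "dcharacter q \<psi>" unfolding dcharacter_def
    proof (intro conjI allI)
      show "\<psi> 1 = 1" using False by (simp add: \<psi>_def)
      show "\<psi> (n + q) = \<psi> n" for n unfolding \<psi>_def by (subst cong[of "n + q" n]) (auto simp: cong_def)
      show "\<psi> k = 0 \<longleftrightarrow> \<not> coprime k q" for k
      proof
        assume z: "\<psi> k = 0"
        show "\<not> coprime k q"
        proof
          assume "coprime k q"
          then obtain l where l: "[k * l = 1] (mod q)" using cong_solve_coprime_nat by auto
          have "\<psi> (k * l) = \<psi> 1" unfolding \<psi>_def by (subst cong[OF l]) simp
          thus False using m[of k l] z False by (simp add: \<psi>_def)
        qed
      qed (simp add: \<psi>_def supp)
    qed (use q m in auto)
    hence "\<psi> n = 1" by (rule n)
    hence "\<psi> (n * x) = \<psi> x" by (simp add: m)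
    thus ?thesis using False by (simp add: \<psi>_def)
  qed
qed

text \<open>E is a Fourier average over the powers of g, up to scaling a projection to the
  eigenspace of translation by g with eigenvalue 1/c. Translations commute, so eigenvectors of other
  translations are preserved.\<close>

lemma eigen_projection:
  assumes q: "q > 0" and F: "unit_fun q F" and g: "coprime g q" and k: "k < totient q"
  defines "c \<equiv> exp (2 * of_real pi * \<i> * of_nat k / of_nat (totient q)) :: complex"
  defines "E \<equiv> (\<lambda>x. \<Sum>j<totient q. c ^ j * F (g ^ j * x))"
  shows "unit_fun q E" "eigen E g" "eigen F h \<Longrightarrow> eigen E h"
proof -
  have cong: "F x = F y" if "[x = y] (mod q)" for x y using F that unfolding unit_fun_def by blast
  have supp: "F x = 0" if "\<not> coprime x q" for x using F that unfolding unit_fun_def by blast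
  show "unit_fun q E" unfolding unit_fun_def
  proof (intro conjI allI impI)
    fix x y assume "[x = y] (mod q)"
    hence "F (g ^ j * x) = F (g ^ j * y)" for j by (intro cong cong_mult cong_refl)
    thus "E x = E y" by (simp add: E_def)
  next
    fix x assume "\<not> coprime x q"
    hence "F (g ^ j * x) = 0" for j by (intro supp) (simp add: coprime_mult_left_iff)
    thus "E x = 0" by (simp add: E_def)
  qed
  show "eigen E h" if dh: "eigen F h"
  proof -
    obtain d where d: "\<forall>x. F (h * x) = d * F x" using dh unfolding eigen_def by blast
    have "E (h * x) = d * E x" for x
    proof -
      have "F (g ^ j * (h * x)) = d * F (g ^ j * x)" for j
        using d[rule_format, of "g ^ j * x"] by (simp add: mult_ac)
      thus ?thesis by (simp add: E_def sum_distrib_left mult_ac)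
    qed
    thus ?thesis unfolding eigen_def by blast
  qed
  have t: "totient q > 0" using q by simp
  have ct: "c ^ totient q = 1" unfolding c_def using t by (intro complex_root_unity) simp
  have gt: "F (g ^ totient q * x) = F x" for x
  proof (rule cong)
    have "[g ^ totient q * x = 1 * x] (mod q)" by (intro cong_mult cong_refl euler_theorem g)
    thus "[g ^ totient q * x = x] (mod q)" by simp
  qed
  have "c * E (g * x) = E x" for x
  proof -
    define t where "t = (\<lambda>j. c ^ j * F (g ^ j * x))"
    have "c * E (g * x) = (\<Sum>j<totient q. t (Suc j))"
      unfolding E_def t_def sum_distrib_left by (intro sum.cong) (auto simp: mult_ac)
    also have "\<dots> = (\<Sum>j<totient q. t j) + (t (totient q) - t 0)"
      using sum_lessThan_telescope[of t "totient q"] by (simp add: sum_subtractf algebra_simps)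
    also have "t (totient q) = t 0" by (simp add: t_def ct gt)
    finally show ?thesis by (simp add: E_def t_def)
  qed
  moreover have "c \<noteq> 0" by (simp add: c_def)
  ultimately have "\<forall>x. E (g * x) = (1 / c) * E x" by (simp add: field_simps)
  thus "eigen E g" unfolding eigen_def by blast
qed

text \<open>S holds the units for which F is not yet known to be an eigenfunction. Splitting F into
  its projections for one g in S removes g from S for every piece, and invariance of the pieces
  gives that of F.\<close>

lemma invariant_induct:
  assumes q: "q > 0" and n: "\<And>\<psi>. dcharacter q \<psi> \<Longrightarrow> \<psi> n = 1"
    and S: "finite S" "S \<subseteq> {g. g < q \<and> coprime g q}"
    and F: "unit_fun q F" "\<And>g. g < q \<Longrightarrow> coprime g q \<Longrightarrow> g \<notin> S \<Longrightarrow> eigen F g"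
  shows "F (n * x) = F x"
  using S F
proof (induction S arbitrary: F x rule: finite_induct)
  case empty
  show ?case by (rule joint_eigenfunction[OF q empty(2) _ n]) (use empty in auto)
next
  case (insert g S)
  have g: "g < q" "coprime g q" using insert.prems(1) by auto
  define N where "N = totient q"
  have N: "N > 0" using q by (simp add: N_def)
  define E where "E = (\<lambda>k x. \<Sum>j<N. exp (2 * of_real pi * \<i> * of_nat k / of_nat N) ^ j * F (g ^ j * x))"
  have inv: "E k (n * x) = E k x" if k: "k < N" for k x
  proof (rule insert.IH)
    note p = eigen_projection[OF q insert.prems(2) g(2) k[unfolded N_def], folded N_def]
    show "unit_fun q (E k)" unfolding E_def by (rule p(1))
    show "eigen (E k) h" if "h < q" "coprime h q" "h \<notin> S" for h
    proof (cases "h = g")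
      case True
      show ?thesis unfolding True E_def by (rule p(2))
    next
      case False
      have "eigen F h" by (rule insert.prems(3)) (use that False in auto)
      thus ?thesis unfolding E_def by (rule p(3))
    qed
  qed (use insert.prems in auto)
  \<comment> \<open>The projections add up to N times F because averaging over all N-th roots of
    unity keeps only the term j = 0.\<close>
  have sum: "(\<Sum>k<N. E k x) = of_nat N * F x" for x
  proof -
    have "(\<Sum>k<N. E k x) = (\<Sum>j<N. (\<Sum>k<N. exp (2 * of_real pi * \<i> * of_nat k / of_nat N) ^ j) * F (g ^ j * x))"
      unfolding E_def sum_distrib_right by (rule sum.swap)
    also have "\<dots> = (\<Sum>j<N. if j = 0 then of_nat N * F x else 0)"
      by (intro sum.cong) (auto simp: roots_of_unity_sum[OF N])
    also have "\<dots> = of_nat N * F x" using N by (simp add: sum.delta)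
    finally show ?thesis .
  qed
  have "of_nat N * F (n * x) = of_nat N * F x" unfolding sum[symmetric] by (intro sum.cong inv) auto
  thus ?case using N by simp
qed

text \<open>Otherwise \<open>invariant_induct\<close> would make the indicator of the class 1
  invariant under multiplication by n, and n would lie in that class.\<close>

lemma characters_separate:
  assumes q: "q > 0" and n: "coprime n q" "\<not> [n = 1] (mod q)"
  shows "\<exists>\<psi>. dcharacter q \<psi> \<and> \<psi> n \<noteq> 1"
proof (rule ccontr)
  assume "\<not> ?thesis"
  hence all: "\<And>\<psi>. dcharacter q \<psi> \<Longrightarrow> \<psi> n = 1" by blast
  define F where "F = (\<lambda>x. if [x = 1] (mod q) then 1 else 0 :: complex)"
  have uf: "unit_fun q F" unfolding unit_fun_def
  proof (intro conjI allI impI)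
    fix x y assume "[x = y] (mod q)"
    thus "F x = F y" by (simp add: F_def cong_def)
  next
    fix x assume "\<not> coprime x q"
    hence "\<not> [x = 1] (mod q)" using cong_imp_coprime[of 1 x q] cong_sym by auto
    thus "F x = 0" by (simp add: F_def)
  qed
  have "F (n * 1) = F 1"
  proof (rule invariant_induct[OF q all _ _ uf])
    show "finite {g. g < q \<and> coprime g q}" by simp
    show "{g. g < q \<and> coprime g q} \<subseteq> {g. g < q \<and> coprime g q}" by simp
  qed auto
  thus False using n by (simp add: F_def)
qed

lemma sum_principal_char:
  assumes q: "q > 1"
  shows "(\<Sum>k<q. principal_char q k) = of_nat (totient q)"
proof -
  have "(\<Sum>k<q. principal_char q k) = of_nat (card {k\<in>{..<q}. coprime k q})"
    by (simp add: principal_char_def sum.inter_filter[symmetric] flip: of_nat_sum)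
  also have "{k\<in>{..<q}. coprime k q} = totatives q"
  proof (rule equalityI; rule subsetI)
    fix k assume k: "k \<in> {k\<in>{..<q}. coprime k q}"
    hence "k \<noteq> 0" using q by (intro notI) simp
    thus "k \<in> totatives q" using k by (simp add: totatives_def)
  next
    fix k assume k: "k \<in> totatives q"
    hence "k \<noteq> q" using q by (intro notI) (simp add: totatives_def)
    thus "k \<in> {k\<in>{..<q}. coprime k q}" using k by (simp add: totatives_def)
  qed
  finally show ?thesis by (simp add: totient_def)
qed

text \<open>For n not congruent to 1, multiplying by a character \<theta> with \<theta>(n) different
  from 1 permutes the characters and rescales the sum by \<theta>(n), so the sum is 0. If n is not a
  unit, all terms vanish.\<close>

lemma sum_chars:
  assumes q: "q > 1"
  shows "(\<Sum>\<psi>\<in>chars q. \<psi> n) = (if [n = 1] (mod q) then of_nat (totient q) else 0)"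
proof -
  have q0: "q > 0" using q by simp
  have zero: "(\<Sum>\<psi>\<in>chars q. \<psi> n) = 0" if n: "\<not> [n = 1] (mod q)" for n
  proof (cases "coprime n q")
    case True
    obtain \<theta> where \<theta>: "dcharacter q \<theta>" "\<theta> n \<noteq> 1" using characters_separate[OF q0 True n] by blast
    have inv: "cnj (\<theta> k) * (\<theta> k * \<psi> k) = \<psi> k" if "dcharacter q \<psi>" for \<psi> k
      using dcharacter_cnj_mult[OF \<theta>(1), of k] dcharacterD(5)[OF that, of k]
      by (cases "coprime k q") (auto simp: mult.assoc[symmetric])
    have "(\<Sum>\<psi>\<in>chars q. \<psi> n) = (\<Sum>\<psi>\<in>chars q. \<theta> n * \<psi> n)"
    proof (rule sum.reindex_bij_witness[where i = "\<lambda>\<psi> k. \<theta> k * \<psi> k" and j = "\<lambda>\<psi> k. cnj (\<theta> k) * \<psi> k"])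
      fix \<psi> assume "\<psi> \<in> chars q"
      hence c: "dcharacter q \<psi>" by (simp add: chars_def)
      show "(\<lambda>k. cnj (\<theta> k) * \<psi> k) \<in> chars q" "(\<lambda>k. \<theta> k * \<psi> k) \<in> chars q"
        using dcharacter_mult[OF dcharacter_cnj[OF \<theta>(1)] c] dcharacter_mult[OF \<theta>(1) c] by (auto simp: chars_def)
      show "(\<lambda>k. cnj (\<theta> k) * (\<theta> k * \<psi> k)) = \<psi>" using inv[OF c] by auto
      thus "(\<lambda>k. \<theta> k * (cnj (\<theta> k) * \<psi> k)) = \<psi>" by (simp add: mult.left_commute)
      thus "\<theta> n * (cnj (\<theta> n) * \<psi> n) = \<psi> n" by (rule fun_cong)
    qed
    hence "\<theta> n * (\<Sum>\<psi>\<in>chars q. \<psi> n) = (\<Sum>\<psi>\<in>chars q. \<psi> n)" unfolding sum_distrib_left by (rule sym)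
    thus ?thesis using \<theta>(2) by simp
  next
    case False
    have z: "\<psi> n = 0" if "\<psi> \<in> chars q" for \<psi> using dcharacterD(5)[of q \<psi> n] that False by (simp add: chars_def)
    show ?thesis by (rule sum.neutral, rule ballI, rule z)
  qed
  \<comment> \<open>The number of characters is found by summing all values of all characters in two
    orders: only k = 1 survives one way, only the principal character the other way.\<close>
  have one: "(\<Sum>\<psi>\<in>chars q. \<psi> 1) = of_nat (totient q)"
  proof -
    have "(\<Sum>k<q. \<Sum>\<psi>\<in>chars q. \<psi> k) = (\<Sum>k<q. if k = 1 then (\<Sum>\<psi>\<in>chars q. \<psi> 1) else 0)"
    proof (intro sum.cong refl)
      fix k assume k: "k \<in> {..<q}"
      show "(\<Sum>\<psi>\<in>chars q. \<psi> k) = (if k = 1 then (\<Sum>\<psi>\<in>chars q. \<psi> 1) else 0)"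
      proof (cases "k = 1")
        case False
        hence "\<not> [k = 1] (mod q)" using k q by (simp add: cong_def)
        thus ?thesis using False zero by simp
      qed simp
    qed
    also have "\<dots> = (\<Sum>\<psi>\<in>chars q. \<psi> 1)" using q by (simp add: sum.delta)
    finally have "(\<Sum>\<psi>\<in>chars q. \<psi> 1) = (\<Sum>k<q. \<Sum>\<psi>\<in>chars q. \<psi> k)" by simp
    also have "\<dots> = (\<Sum>\<psi>\<in>chars q. \<Sum>k<q. \<psi> k)" by (rule sum.swap)
    also have "\<dots> = (\<Sum>k<q. principal_char q k) + (\<Sum>\<psi>\<in>nonprincipal_chars q. \<Sum>k<q. \<psi> k)"
      unfolding chars_eq[OF q0] by (rule sum.insert[OF finite_nonprincipal_chars[OF q0]]) (simp add: nonprincipal_chars_def)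
    also have "(\<Sum>\<psi>\<in>nonprincipal_chars q. \<Sum>k<q. \<psi> k) = 0" by (intro sum.neutral ballI sum_dcharacter_eq_0)
    finally show ?thesis by (simp add: sum_principal_char[OF q])
  qed
  show ?thesis
  proof (cases "[n = 1] (mod q)")
    case True
    have n1: "\<psi> n = \<psi> 1" if "\<psi> \<in> chars q" for \<psi> using that True by (auto simp: chars_def intro: dcharacter_cong)
    have "(\<Sum>\<psi>\<in>chars q. \<psi> n) = (\<Sum>\<psi>\<in>chars q. \<psi> 1)" by (rule sum.cong[OF refl n1])
    thus ?thesis using True one by simp
  qed (simp add: zero)
qed

lemma char_orthogonality:
  assumes q: "q > 1" and a: "coprime a q"
  shows "(\<Sum>\<psi>\<in>chars q. cnj (\<psi> a) * \<psi> n) = (if [n = a] (mod q) then of_nat (totient q) else 0)"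
proof -
  obtain b where b: "[a * b = 1] (mod q)" using cong_solve_coprime_nat[OF a] by auto
  have bq: "coprime b q" using cong_imp_coprime[OF cong_sym[OF b]] by (simp add: coprime_mult_left_iff)
  have "(\<Sum>\<psi>\<in>chars q. cnj (\<psi> a) * \<psi> n) = (\<Sum>\<psi>\<in>chars q. \<psi> (b * n))"
  proof (intro sum.cong refl)
    fix \<psi> assume "\<psi> \<in> chars q"
    hence c: "dcharacter q \<psi>" by (simp add: chars_def)
    have "\<psi> a * \<psi> b = 1" using dcharacter_cong[OF c b] dcharacterD(2,3)[OF c] by simp
    hence "cnj (\<psi> a) = cnj (\<psi> a) * (\<psi> a * \<psi> b)" by simp
    also have "\<dots> = \<psi> b" using dcharacter_cnj_mult[OF c a] by (simp add: mult.assoc[symmetric])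
    finally show "cnj (\<psi> a) * \<psi> n = \<psi> (b * n)" by (simp add: dcharacterD(3)[OF c])
  qed
  also have "\<dots> = (if [b * n = 1] (mod q) then of_nat (totient q) else 0)" by (rule sum_chars[OF q])
  also have "[b * n = 1] (mod q) \<longleftrightarrow> [n = a] (mod q)"
  proof -
    have "[b * n = 1] (mod q) \<longleftrightarrow> [b * n = b * a] (mod q)"
      using b by (simp add: cong_def mult.commute)
    also have "\<dots> \<longleftrightarrow> [n = a] (mod q)" by (rule cong_mult_lcancel_nat) (rule bq)
    finally show ?thesis .
  qed
  finally show ?thesis .
qed

text \<open>Detect x^2 congruent to a by orthogonality and sum over x first: the sum of \<psi>(x^2)
  is the totient if \<psi>^2 is principal and 0 otherwise.\<close>

lemma rsq_char_sum:
  assumes q: "q > 1" and a: "coprime a q"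
  shows "of_nat (rsq q a) = (\<Sum>\<psi>\<in>chars q. cnj (\<psi> a) * (if (\<lambda>n. \<psi> (n\<^sup>2)) = principal_char q then 1 else 0))"
proof -
  have q0: "q > 0" using q by simp
  have t: "totient q > 0" using q by simp
  note pc = sum_principal_char[OF q]
  have "of_nat (totient q) * complex_of_nat (rsq q a) = (\<Sum>x<q. if [x\<^sup>2 = a] (mod q) then of_nat (totient q) else 0)"
  proof -
    have "{x \<in> {0..<q}. coprime x q \<and> [x ^ 2 = a] (mod q)} = {x\<in>{..<q}. [x\<^sup>2 = a] (mod q)}"
    proof (rule equalityI; rule subsetI)
      fix x assume x: "x \<in> {x\<in>{..<q}. [x\<^sup>2 = a] (mod q)}"
      hence "coprime (x\<^sup>2) q" using cong_imp_coprime[OF cong_sym, of "x\<^sup>2" a q] a by simp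
      thus "x \<in> {x \<in> {0..<q}. coprime x q \<and> [x ^ 2 = a] (mod q)}" using x by simp
    qed auto
    thus ?thesis by (simp add: rsq_def sum.inter_filter[symmetric] mult.commute)
  qed
  also have "\<dots> = (\<Sum>x<q. \<Sum>\<psi>\<in>chars q. cnj (\<psi> a) * \<psi> (x\<^sup>2))" unfolding char_orthogonality[OF q a] ..
  also have "\<dots> = (\<Sum>\<psi>\<in>chars q. \<Sum>x<q. cnj (\<psi> a) * \<psi> (x\<^sup>2))" by (rule sum.swap)
  also have "\<dots> = (\<Sum>\<psi>\<in>chars q. of_nat (totient q) * (cnj (\<psi> a) * (if (\<lambda>n. \<psi> (n\<^sup>2)) = principal_char q then 1 else 0)))"
  proof (intro sum.cong refl)
    fix \<psi> assume "\<psi> \<in> chars q"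
    hence c: "dcharacter q \<psi>" by (simp add: chars_def)
    show "(\<Sum>x<q. cnj (\<psi> a) * \<psi> (x\<^sup>2)) = of_nat (totient q) * (cnj (\<psi> a) * (if (\<lambda>n. \<psi> (n\<^sup>2)) = principal_char q then 1 else 0))"
    proof (cases "(\<lambda>n. \<psi> (n\<^sup>2)) = principal_char q")
      case True
      hence "\<psi> (x\<^sup>2) = principal_char q x" for x by (rule fun_cong)
      thus ?thesis using True pc by (simp add: sum_distrib_left[symmetric] mult.commute)
    next
      case False
      hence "(\<lambda>n. \<psi> (n\<^sup>2)) \<in> nonprincipal_chars q" using dcharacter_square[OF c] by (simp add: nonprincipal_chars_def)
      from sum_dcharacter_eq_0[OF this] show ?thesis using False by (simp add: sum_distrib_left[symmetric])
    qed
  qed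
  also have "\<dots> = of_nat (totient q) * (\<Sum>\<psi>\<in>chars q. cnj (\<psi> a) * (if (\<lambda>n. \<psi> (n\<^sup>2)) = principal_char q then 1 else 0))"
    by (rule sum_distrib_left[symmetric])
  finally show ?thesis using t by simp
qed


section \<open>From the mean-square bound to densities\<close>

lemma exp1_ge_2: "exp 1 \<ge> (2 :: real)"
  using exp_ge_add_one_self[of 1] by simp

lemma integrable_indicator_inverse:
  assumes S: "S \<in> sets borel" "S \<subseteq> {1..X}"
  shows "integrable lborel (\<lambda>u. indicator S u * (1 / u) :: real)"
proof (rule Bochner_Integration.integrable_bound)
  have [measurable]: "S \<in> sets borel" by (rule S)
  show "integrable lborel (\<lambda>u. indicator {1..X} u :: real)" by (rule integrable_indicator_Icc)
  show "AE u in lborel. norm (indicator S u * (1 / u) :: real) \<le> norm (indicator {1..X} u :: real)"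
    by (intro AE_I2) (use S in \<open>auto simp: indicator_def\<close>)
  show "(\<lambda>u. indicator S u * (1 / u) :: real) \<in> borel_measurable lborel" by measurable
qed

lemma lmeasure_subset_interval:
  assumes "S \<in> sets borel" "S \<subseteq> {a..b::real}"
  shows "S \<in> fmeasurable lborel"
  by (rule fmeasurableI2[of "{a..b}"]) (use assms in \<open>auto simp: fmeasurable_def emeasure_lborel_Icc_eq\<close>)

text \<open>The complement of A is measured on the blocks (X/e, X], which are the unit windows in
  the variable ln x. Vanishing relative measure on these blocks gives both kinds of density.\<close>

context
  fixes A :: "real set"
  assumes A: "A \<in> sets borel" "A \<subseteq> {2..}"
    and thin: "\<forall>\<epsilon>>0. \<exists>X0. \<forall>X\<ge>X0. measure lborel ({X / exp 1<..X} - A) \<le> \<epsilon> * X"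
begin

lemma thin_X0:
  assumes "\<epsilon> > 0"
  obtains X0 where "X0 \<ge> 1" "\<And>X. X \<ge> X0 \<Longrightarrow> measure lborel ({X / exp 1<..X} - A) \<le> \<epsilon> * X"
proof -
  obtain X0 where "\<forall>X\<ge>X0. measure lborel ({X / exp 1<..X} - A) \<le> \<epsilon> * X" using thin assms by blast
  thus thesis by (intro that[of "max 1 X0"]) auto
qed

lemma scale_exhaust:
  fixes X0 X :: real
  assumes "X0 \<ge> 1" "X > 0"
  shows "X \<le> X0 * exp 1 ^ nat \<lceil>ln X\<rceil>"
proof -
  have "ln X \<le> real (nat \<lceil>ln X\<rceil>)" by (rule real_nat_ceiling_ge)
  hence "exp (ln X) \<le> exp (real (nat \<lceil>ln X\<rceil>))" by (simp only: exp_le_cancel_iff)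
  also have "\<dots> = 1 * exp 1 ^ nat \<lceil>ln X\<rceil>" by (simp flip: exp_of_nat_mult)
  also have "\<dots> \<le> X0 * exp 1 ^ nat \<lceil>ln X\<rceil>" using assms by (intro mult_right_mono) auto
  finally show ?thesis using assms by simp
qed

text \<open>The measure N of the complement satisfies N(X) \<le> N(X/e) + \<epsilon>X beyond some
  X0. Since e \<ge> 2, iterating gives N(X) \<le> X0 + 2\<epsilon>X.\<close>

lemma natural_density_thin: "has_natural_density A 1"
proof -
  define N where "N = (\<lambda>X. measure lborel ({0<..X} - A))"
  have fm: "{s<..X} - A \<in> fmeasurable lborel" for s X
    by (rule lmeasure_subset_interval[of _ s X]) (use A in auto)
  have rec: "N X \<le> N (X / exp 1) + measure lborel ({X / exp 1<..X} - A)" for X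
  proof -
    have "N X \<le> measure lborel (({0<..X / exp 1} - A) \<union> ({X / exp 1<..X} - A))"
      unfolding N_def by (rule measure_mono_fmeasurable) (use fm A in \<open>auto intro!: fmeasurable.Un\<close>)
    also have "\<dots> \<le> N (X / exp 1) + measure lborel ({X / exp 1<..X} - A)"
      unfolding N_def by (rule measure_Un_le) (use A in auto)
    finally show ?thesis .
  qed
  have triv: "N X \<le> X" if "X > 0" for X
  proof -
    have fX: "{0<..X} \<in> fmeasurable lborel" by (rule lmeasure_subset_interval[of _ 0 X]) auto
    have "N X \<le> measure lborel {0<..X}" unfolding N_def
      by (rule measure_mono_fmeasurable[OF _ _ fX]) (use A in auto)
    thus ?thesis using that by simp
  qed
  have bound: "\<exists>X0. \<forall>X>0. N X \<le> X0 + 2 * \<epsilon> * X" if e: "\<epsilon> > 0" for \<epsilon>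
  proof -
    obtain X0 where X0: "X0 \<ge> 1" "\<And>X. X \<ge> X0 \<Longrightarrow> measure lborel ({X / exp 1<..X} - A) \<le> \<epsilon> * X"
      using thin_X0[OF e] by blast
    have "N X \<le> X0 + 2 * \<epsilon> * X" if "0 < X" "X \<le> X0 * exp 1 ^ n" for n X
      using that
    proof (induction n arbitrary: X)
      case 0
      have "0 \<le> 2 * \<epsilon> * X" using e 0 by simp
      moreover have "X \<le> X0" using 0 by simp
      ultimately show ?case using triv[of X] 0(1) by linarith
    next
      case (Suc n)
      show ?case
      proof (cases "X \<le> X0")
        case True
        have "0 \<le> 2 * \<epsilon> * X" using e Suc.prems by simp
        thus ?thesis using triv[of X] True Suc.prems by linarith
      next
        case False
        have "X / exp 1 \<le> X0 * exp 1 ^ n" using Suc.prems by (simp add: divide_le_eq mult_ac)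
        hence "N (X / exp 1) \<le> X0 + 2 * \<epsilon> * (X / exp 1)" using Suc.prems by (intro Suc.IH) auto
        also have "2 * \<epsilon> * (X / exp 1) \<le> 2 * \<epsilon> * (X / 2)"
          using e Suc.prems exp1_ge_2 by (intro mult_left_mono divide_left_mono) auto
        finally show ?thesis using rec[of X] X0(2)[of X] False by simp
      qed
    qed
    thus ?thesis using scale_exhaust[OF X0(1)] by blast
  qed
  have N0: "((\<lambda>X. N X / X) \<longlongrightarrow> 0) at_top"
  proof (rule tendstoI)
    fix e :: real assume "e > 0"
    hence e: "e / 4 > 0" by simp
    obtain X0 where X0: "\<forall>X>0. N X \<le> X0 + 2 * (e / 4) * X" using bound[OF e] by blast
    show "\<forall>\<^sub>F X in at_top. dist (N X / X) 0 < e"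
      using eventually_gt_at_top[of "max 0 (4 * X0 / e)"]
    proof eventually_elim
      case (elim X)
      hence X: "X > 0" "4 * X0 / e < X" by auto
      have "N X \<ge> 0" by (simp add: N_def)
      moreover have "4 * X0 < e * X" using X(2) \<open>e > 0\<close> by (simp add: field_simps)
      hence "X0 + 2 * (e / 4) * X < e * X" using X \<open>e > 0\<close> mult_pos_pos[of e X] by linarith
      hence "N X < e * X" using X0 X(1) by (meson le_less_trans)
      ultimately show ?case using X(1) by (simp add: dist_norm divide_less_eq)
    qed
  qed
  have "((\<lambda>X. 1 - N X / X) \<longlongrightarrow> 1 - 0) at_top" by (intro tendsto_intros N0)
  moreover have "\<forall>\<^sub>F X in at_top. 1 - N X / X = measure lborel (A \<inter> {2..X}) / X"
    using eventually_ge_at_top[of 2]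
  proof eventually_elim
    case (elim X)
    have fA: "A \<inter> {2..X} \<in> fmeasurable lborel" by (rule lmeasure_subset_interval[of _ 2 X]) (use A in auto)
    have "{0<..X} = (A \<inter> {2..X}) \<union> ({0<..X} - A)" using A elim by auto
    hence "measure lborel {0<..X} = measure lborel ((A \<inter> {2..X}) \<union> ({0<..X} - A))" by (rule arg_cong)
    also have "\<dots> = measure lborel (A \<inter> {2..X}) + measure lborel (({0<..X} - A) - (A \<inter> {2..X}))"
      by (rule measure_Un2[OF fA fm])
    also have "({0<..X} - A) - (A \<inter> {2..X}) = {0<..X} - A" by auto
    finally have "measure lborel {0<..X} = measure lborel (A \<inter> {2..X}) + N X" by (simp only: N_def)
    hence "measure lborel (A \<inter> {2..X}) = X - N X" using elim by simp
    thus ?case using elim by (simp add: field_simps)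
  qed
  ultimately have "((\<lambda>X. measure lborel (A \<inter> {2..X}) / X) \<longlongrightarrow> 1) at_top"
    by (simp add: Lim_transform_eventually)
  thus ?thesis using A by (simp add: has_natural_density_def)
qed

text \<open>Each block contributes at most (e/X) \<epsilon>X \<le> 3\<epsilon> to the integral of
  1/u over the complement, and about ln X blocks are needed to reach X0.\<close>

lemma log_density_thin: "has_log_density A 1"
proof -
  have [measurable]: "A \<in> sets borel" by (rule A)
  define L where "L = (\<lambda>X. LINT u|lborel. indicator ({1..X} - A) u * (1 / u) :: real)"
  have Li: "integrable lborel (\<lambda>u. indicator ({1..X} - A) u * (1 / u) :: real)" for X
    by (rule integrable_indicator_inverse[of _ X]) auto
  have L0: "L X \<ge> 0" for X unfolding L_def by (intro integral_nonneg_AE AE_I2) (auto simp: indicator_def)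
  have fm: "{s<..X} - A \<in> fmeasurable lborel" for s X
    by (rule lmeasure_subset_interval[of _ s X]) auto
  have rec: "L X \<le> L (X / exp 1) + exp 1 / X * measure lborel ({X / exp 1<..X} - A)" if X: "X > 0" for X
  proof -
    have i2: "integrable lborel (\<lambda>u. exp 1 / X * indicator ({X / exp 1<..X} - A) u :: real)"
      using fm by (intro integrable_mult_right integrable_real_indicator) (auto simp: fmeasurable_def)
    have "L X \<le> (LINT u|lborel. indicator ({1..X / exp 1} - A) u * (1 / u) + exp 1 / X * indicator ({X / exp 1<..X} - A) u)"
      unfolding L_def
    proof (rule Bochner_Integration.integral_mono[OF Li Bochner_Integration.integrable_add[OF Li i2]])
      fix u
      have "1 / u \<le> exp 1 / X" if "X / exp 1 < u"
        using that X less_trans[OF divide_pos_pos[OF X exp_gt_zero[of 1]] that] by (simp add: field_simps)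
      thus "indicator ({1..X} - A) u * (1 / u) \<le> indicator ({1..X / exp 1} - A) u * (1 / u) + exp 1 / X * indicator ({X / exp 1<..X} - A) u"
        using X by (auto simp: indicator_def)
    qed
    also have "\<dots> = L (X / exp 1) + exp 1 / X * (LINT u|lborel. indicator ({X / exp 1<..X} - A) u)"
      unfolding L_def Bochner_Integration.integral_add[OF Li i2] integral_mult_right_zero ..
    finally show ?thesis by simp
  qed
  have total: "(LINT u|lborel. indicator {1..X} u * (1 / u)) = ln X" if "X \<ge> 1" for X :: real
    using integral_inverse(2)[of 1 X] that by simp
  have triv: "L X \<le> ln X0" if "X \<le> X0" "X0 \<ge> 1" for X X0
  proof -
    have "L X \<le> (LINT u|lborel. indicator {1..X0} u * (1 / u))" unfolding L_def
      by (rule Bochner_Integration.integral_mono[OF Li integral_inverse(1)]) (use that in \<open>auto simp: indicator_def\<close>)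
    thus ?thesis using total that by simp
  qed
  have bound: "\<exists>X0\<ge>1. \<forall>X\<ge>1. L X \<le> ln X0 + 3 * \<epsilon> * (ln X + 1)" if e: "\<epsilon> > 0" for \<epsilon>
  proof -
    obtain X0 where X0: "X0 \<ge> 1" "\<And>X. X \<ge> X0 \<Longrightarrow> measure lborel ({X / exp 1<..X} - A) \<le> \<epsilon> * X"
      using thin_X0[OF e] by blast
    have ind: "L X \<le> ln X0 + 3 * \<epsilon> * real n" if "0 < X" "X \<le> X0 * exp 1 ^ n" for n X
      using that
    proof (induction n arbitrary: X)
      case 0
      thus ?case using triv[of X X0] X0 by simp
    next
      case (Suc n)
      show ?case
      proof (cases "X \<le> X0")
        case True
        have "0 \<le> 3 * \<epsilon> * real (Suc n)" using e by simp
        thus ?thesis using triv[of X X0] X0 True by linarith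
      next
        case False
        have "X / exp 1 \<le> X0 * exp 1 ^ n" using Suc.prems by (simp add: divide_le_eq mult_ac)
        hence IH: "L (X / exp 1) \<le> ln X0 + 3 * \<epsilon> * real n" using Suc.prems by (intro Suc.IH) auto
        have "exp 1 / X * measure lborel ({X / exp 1<..X} - A) \<le> exp 1 / X * (\<epsilon> * X)"
          using X0(2)[of X] False Suc.prems by (intro mult_left_mono) auto
        also have "\<dots> = exp 1 * \<epsilon>" using Suc.prems by simp
        also have "\<dots> \<le> 3 * \<epsilon>" using e exp_le by (intro mult_right_mono) auto
        finally show ?thesis using rec[OF Suc.prems(1)] IH by (simp add: algebra_simps)
      qed
    qed
    have "L X \<le> ln X0 + 3 * \<epsilon> * (ln X + 1)" if X: "X \<ge> 1" for X
    proof -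
      have "L X \<le> ln X0 + 3 * \<epsilon> * real (nat \<lceil>ln X\<rceil>)"
        by (rule ind) (use X scale_exhaust[OF X0(1), of X] in auto)
      also have "real (nat \<lceil>ln X\<rceil>) \<le> ln X + 1" using X of_int_ceiling_le_add_one[of "ln X"] by simp
      finally show ?thesis using e by (simp add: mult_left_mono)
    qed
    thus ?thesis using X0(1) by blast
  qed
  have L_lim: "((\<lambda>X. L X / ln X) \<longlongrightarrow> 0) at_top"
  proof (rule tendstoI)
    fix e :: real assume e0: "e > 0"
    hence e: "e / 6 > 0" by simp
    obtain X0 where X0: "X0 \<ge> 1" "\<forall>X\<ge>1. L X \<le> ln X0 + 3 * (e / 6) * (ln X + 1)" using bound[OF e] by blast
    have "\<forall>\<^sub>F X in at_top. ln X > (ln X0 + e / 2) * 2 / e" by (rule filterlim_at_top_dense[THEN iffD1, OF ln_at_top, rule_format])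
    with eventually_gt_at_top[of 1] show "\<forall>\<^sub>F X in at_top. dist (L X / ln X) 0 < e"
    proof eventually_elim
      case (elim X)
      have lX: "ln X > 0" using elim(1) by simp
      have "(ln X0 + e / 2) * 2 < ln X * e" using elim(2) e0 by (simp add: divide_less_eq)
      moreover have "l + (t / 2 + e / 2) < t" if "(l + e / 2) * 2 < t" for l t :: real using that by (simp add: field_simps)
      ultimately have "ln X0 + (ln X * e / 2 + e / 2) < ln X * e" by blast
      moreover have "3 * (e / 6) * (ln X + 1) = ln X * e / 2 + e / 2" by (simp add: field_simps)
      ultimately have "ln X0 + 3 * (e / 6) * (ln X + 1) < e * ln X" by (simp only: mult.commute[of e "ln X"])
      hence "L X < e * ln X" using X0(2) elim(1) by (meson le_less_trans less_imp_le)
      thus ?case using lX L0[of X] by (simp add: dist_norm divide_less_eq)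
    qed
  qed
  have "((\<lambda>X. 1 - L X / ln X) \<longlongrightarrow> 1 - 0) at_top" by (intro tendsto_intros L_lim)
  moreover have "\<forall>\<^sub>F X in at_top. 1 - L X / ln X = (LBINT u : A \<inter> {2..X}. 1 / u) / ln X"
    using eventually_ge_at_top[of 2]
  proof eventually_elim
    case (elim X)
    have i: "integrable lborel (\<lambda>u. indicator (A \<inter> {2..X}) u * (1 / u) :: real)"
      by (rule integrable_indicator_inverse[of _ X]) auto
    have "ln X = (LINT u|lborel. indicator {1..X} u * (1 / u))" using total[of X] elim by simp
    also have "\<dots> = (LINT u|lborel. indicator (A \<inter> {2..X}) u * (1 / u) + indicator ({1..X} - A) u * (1 / u))"
      by (rule Bochner_Integration.integral_cong) (use A in \<open>auto simp: indicator_def\<close>)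
    also have "\<dots> = (LINT u|lborel. indicator (A \<inter> {2..X}) u * (1 / u)) + L X"
      unfolding L_def by (rule Bochner_Integration.integral_add[OF i Li])
    finally have "(LBINT u : A \<inter> {2..X}. 1 / u) = ln X - L X" by (simp add: set_lebesgue_integral_def)
    moreover have "ln X > 0" using elim by simp
    ultimately show ?case by (simp add: diff_divide_distrib)
  qed
  ultimately have "((\<lambda>X. (LBINT u : A \<inter> {2..X}. 1 / u) / ln X) \<longlongrightarrow> 1) at_top"
    by (simp add: Lim_transform_eventually)
  thus ?thesis using A by (simp add: has_log_density_def)
qed

end

text \<open>Chebyshev's inequality on one window: outside A the function G(ln u) is at least a
  multiple of (ln ln u)^2, which tends to infinity, while its window integral stays bounded.\<close>

lemma thin_from_mean_square:
  fixes G :: "real \<Rightarrow> real"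
  assumes [measurable]: "G \<in> borel_measurable borel" "A \<in> sets borel" and G0: "\<And>y. G y \<ge> 0"
    and Gi: "\<And>Y. Y \<ge> 1 \<Longrightarrow> integrable lborel (\<lambda>y. indicator {Y-1..Y+1} y * G y)"
    and C: "\<And>Y. Y \<ge> 1 \<Longrightarrow> (LINT y|lborel. indicator {Y-1..Y+1} y * G y) \<le> C"
    and large: "\<And>x. x \<ge> X1 \<Longrightarrow> x \<notin> A \<Longrightarrow> G (ln x) \<ge> c * (ln (ln x))\<^sup>2" and c: "c > 0"
  shows "\<forall>\<epsilon>>0. \<exists>X0. \<forall>X\<ge>X0. measure lborel ({X / exp 1<..X} - A) \<le> \<epsilon> * X"
proof (intro allI impI)
  fix \<epsilon> :: real assume e: "\<epsilon> > 0"
  have C0: "C \<ge> 0"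
  proof -
    have "0 \<le> (LINT y|lborel. indicator {1-1..1+1} y * G y)" by (intro integral_nonneg_AE AE_I2) (simp add: G0)
    from order_trans[OF this C[OF order_refl]] show ?thesis .
  qed
  have ev: "\<forall>\<^sub>F X in at_top. X / exp 1 \<ge> X1 \<and> X \<ge> exp 3 \<and> C / \<epsilon> + 1 \<le> c * (ln (ln X - 1))\<^sup>2"
  proof (intro eventually_conj)
    have "filterlim (\<lambda>X::real. X / exp 1) at_top at_top" by real_asymp
    thus "\<forall>\<^sub>F X in at_top. X1 \<le> X / exp 1" by (simp add: filterlim_at_top)
    show "\<forall>\<^sub>F X in at_top. exp 3 \<le> (X :: real)" by (rule eventually_ge_at_top)
    have "filterlim (\<lambda>X::real. c * (ln (ln X - 1))\<^sup>2) at_top at_top" using c by real_asymp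
    thus "\<forall>\<^sub>F X in at_top. C / \<epsilon> + 1 \<le> c * (ln (ln X - 1))\<^sup>2" by (simp add: filterlim_at_top)
  qed
  then obtain X0 where X0: "\<forall>X\<ge>X0. X / exp 1 \<ge> X1 \<and> X \<ge> exp 3 \<and> C / \<epsilon> + 1 \<le> c * (ln (ln X - 1))\<^sup>2"
    unfolding eventually_at_top_linorder by blast
  show "\<exists>X0. \<forall>X\<ge>X0. measure lborel ({X / exp 1<..X} - A) \<le> \<epsilon> * X"
  proof (intro exI[of _ X0] allI impI)
    fix X assume "X \<ge> X0"
    hence X: "X / exp 1 \<ge> X1" "X \<ge> exp 3" "C / \<epsilon> + 1 \<le> c * (ln (ln X - 1))\<^sup>2" using X0 by auto
    define Y where "Y = ln X"
    have Xp: "X > 0" by (rule less_le_trans[OF exp_gt_zero X(2)])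
    have XY: "X = exp Y" using Xp by (simp add: Y_def)
    have Y: "Y \<ge> 3" using X(2) unfolding XY by simp
    have XY1: "X / exp 1 = exp (Y - 1)" by (simp add: XY exp_diff)
    define T where "T = c * (ln (Y - 1))\<^sup>2"
    have "C / \<epsilon> \<ge> 0" using C0 e by simp
    hence T: "T > 0" "C / \<epsilon> \<le> T" using X(3) by (auto simp: T_def Y_def)
    \<comment> \<open>On the whole block ln u exceeds Y - 1, so one threshold T works; it exceeds
      C/\<epsilon> by the choice of X0.\<close>
    have bad: "T \<le> G (ln u)" if u: "u \<in> {X / exp 1<..X} - A" for u
    proof -
      have u0: "u > 0" using u Xp by (auto intro: less_trans[of _ "X / exp 1"])
      have "ln (exp (Y - 1)) < ln u" using u u0 unfolding XY1 by (subst ln_less_cancel_iff) auto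
      hence lu: "Y - 1 < ln u" by simp
      have "ln (Y - 1) \<le> ln (ln u)" using lu Y by (subst ln_le_cancel_iff) auto
      moreover have "0 \<le> ln (Y - 1)" using Y by simp
      ultimately have "T \<le> c * (ln (ln u))\<^sup>2" unfolding T_def using c by (intro mult_left_mono power_mono) auto
      also have "\<dots> \<le> G (ln u)" by (rule large) (use u X(1) in auto)
      finally show ?thesis .
    qed
    have "emeasure lborel ({X / exp 1<..X} - A) = (\<integral>\<^sup>+ u. indicator ({X / exp 1<..X} - A) u \<partial>lborel)" by simp
    also have "\<dots> \<le> (\<integral>\<^sup>+ u. ennreal (G (ln u) / T) * indicator {exp (Y - 1)..exp Y} u \<partial>lborel)"
    proof (rule nn_integral_mono)
      fix u
      have "1 \<le> ennreal (G (ln u) / T)" if "u \<in> {X / exp 1<..X} - A"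
        using bad[OF that] T by simp
      thus "indicator ({X / exp 1<..X} - A) u \<le> ennreal (G (ln u) / T) * indicator {exp (Y - 1)..exp Y} u"
        unfolding XY1 using XY by (auto simp: indicator_def)
    qed
    also have "\<dots> = (\<integral>\<^sup>+ u. ennreal (G (ln u) / T * indicator {exp (Y - 1)..exp Y} u) \<partial>lborel)"
      by (intro nn_integral_cong) (auto simp: indicator_def)
    \<comment> \<open>Substituting u = e^y costs the Jacobian e^y \<le> X, which is the factor X in
      the claim.\<close>
    also have "\<dots> = (\<integral>\<^sup>+ y. ennreal (G (ln (exp y)) / T * exp y * indicator {Y - 1..Y} y) \<partial>lborel)"
      by (rule nn_integral_substitution)
         (auto intro!: derivative_eq_intros continuous_intros simp: set_borel_measurable_def)
    also have "\<dots> \<le> (\<integral>\<^sup>+ y. ennreal (X / T * (indicator {Y-1..Y+1} y * G y)) \<partial>lborel)"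
    proof (intro nn_integral_mono ennreal_leI)
      fix y
      have "G y / T * exp y \<le> G y / T * X" if "y \<le> Y" using that T G0 unfolding XY by (intro mult_left_mono) auto
      thus "G (ln (exp y)) / T * exp y * indicator {Y - 1..Y} y \<le> X / T * (indicator {Y-1..Y+1} y * G y)"
        using T Xp G0 by (auto simp: indicator_def mult_ac)
    qed
    also have "\<dots> = ennreal (LINT y|lborel. X / T * (indicator {Y-1..Y+1} y * G y))"
      by (rule nn_integral_eq_integral) (use Gi[of Y] Y T Xp G0 in \<open>auto intro!: integrable_mult_right\<close>)
    also have "(LINT y|lborel. X / T * (indicator {Y-1..Y+1} y * G y)) = X / T * (LINT y|lborel. indicator {Y-1..Y+1} y * G y)"
      by (rule integral_mult_right_zero)
    also have "ennreal \<dots> \<le> ennreal (X / T * C)" using C[of Y] Y T Xp by (intro ennreal_leI mult_left_mono) auto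
    finally have "measure lborel ({X / exp 1<..X} - A) \<le> X / T * C"
      unfolding measure_def using T Xp C0 by (intro enn2real_leI) auto
    also have "\<dots> = X * (C / T)" by simp
    also have "C / T \<le> \<epsilon>" using T e by (simp add: field_simps)
    finally show "measure lborel ({X / exp 1<..X} - A) \<le> \<epsilon> * X" using Xp by (simp add: mult.commute mult_left_mono)
  qed
qed


section \<open>Assembling the prime race\<close>

lemma pi_half_char_sum:
  assumes q: "q > 1" and a: "coprime a q"
  shows "complex_of_real (pi_half (exp y) q a) * of_nat (totient q) = (\<Sum>\<psi>\<in>chars q. cnj (\<psi> a) * prime_sum \<psi> (1/2) y)"
proof -
  define P where "P = {p :: nat. prime p \<and> p \<le> nat \<lfloor>exp y\<rfloor>}"
  have fin: "finite P" by (rule finite_subset[of _ "{..nat \<lfloor>exp y\<rfloor>}"]) (auto simp: P_def)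
  have le: "real p \<le> exp y \<longleftrightarrow> p \<le> nat \<lfloor>exp y\<rfloor>" for p by (simp add: le_nat_iff le_floor_iff)
  have "{p. prime p \<and> real p \<le> exp y \<and> [p = a] (mod q)} = {p\<in>P. [p = a] (mod q)}" by (auto simp: P_def le)
  hence "complex_of_real (pi_half (exp y) q a) = (\<Sum>p\<in>{p\<in>P. [p = a] (mod q)}. of_real (real p powr (- (1/2))))"
    by (simp add: pi_half_def)
  also have "\<dots> = (\<Sum>p\<in>P. if [p = a] (mod q) then of_real (real p powr (- (1/2))) else 0)"
    by (rule sum.inter_filter[OF fin])
  finally have "complex_of_real (pi_half (exp y) q a) * of_nat (totient q) =
      (\<Sum>p\<in>P. (if [p = a] (mod q) then of_real (real p powr (- (1/2))) else 0) * of_nat (totient q))"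
    by (simp only: sum_distrib_right)
  also have "\<dots> = (\<Sum>p\<in>P. (\<Sum>\<psi>\<in>chars q. cnj (\<psi> a) * \<psi> p) * of_real (real p powr (- (1/2))))"
    by (intro sum.cong refl) (simp add: char_orthogonality[OF q a])
  also have "\<dots> = (\<Sum>p\<in>P. \<Sum>\<psi>\<in>chars q. cnj (\<psi> a) * (\<psi> p * of_real (real p powr (- (1/2)))))"
    by (simp only: sum_distrib_right mult.assoc)
  also have "\<dots> = (\<Sum>\<psi>\<in>chars q. \<Sum>p\<in>P. cnj (\<psi> a) * (\<psi> p * of_real (real p powr (- (1/2)))))"
    by (rule sum.swap)
  also have "\<dots> = (\<Sum>\<psi>\<in>chars q. cnj (\<psi> a) * prime_sum \<psi> (1/2) y)"
    by (simp only: prime_sum_def P_def sum_distrib_left)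
  finally show ?thesis .
qed

text \<open>The principal character has the value 1 at both units, so it cancels in the difference;
  this removes the one prime sum that is not covered by \<open>prime_sum_asymp\<close>.\<close>

lemma sum_chars_diff:
  assumes q: "q > 0" and "coprime a q" "coprime b q"
  shows "(\<Sum>\<psi>\<in>chars q. cnj (\<psi> a) * f \<psi>) - (\<Sum>\<psi>\<in>chars q. cnj (\<psi> b) * f \<psi>) =
     (\<Sum>\<psi>\<in>nonprincipal_chars q. (cnj (\<psi> a) - cnj (\<psi> b)) * f \<psi>)"
proof -
  have "(\<Sum>\<psi>\<in>chars q. cnj (\<psi> a) * f \<psi>) - (\<Sum>\<psi>\<in>chars q. cnj (\<psi> b) * f \<psi>) = (\<Sum>\<psi>\<in>chars q. (cnj (\<psi> a) - cnj (\<psi> b)) * f \<psi>)"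
    by (simp only: sum_subtractf[symmetric] left_diff_distrib)
  also have "\<dots> = (\<Sum>\<psi>\<in>nonprincipal_chars q. (cnj (\<psi> a) - cnj (\<psi> b)) * f \<psi>)"
  proof (rule sum.mono_neutral_right)
    show "finite (chars q)" by (rule finite_chars[OF q])
    show "nonprincipal_chars q \<subseteq> chars q" unfolding chars_eq[OF q] by blast
    have p: "principal_char q a = 1" "principal_char q b = 1" using assms by (auto simp: principal_char_def)
    show "\<forall>\<psi>\<in>chars q - nonprincipal_chars q. (cnj (\<psi> a) - cnj (\<psi> b)) * f \<psi> = 0"
    proof
      fix \<psi> assume "\<psi> \<in> chars q - nonprincipal_chars q"
      hence "\<psi> = principal_char q" unfolding chars_eq[OF q] by blast
      thus "(cnj (\<psi> a) - cnj (\<psi> b)) * f \<psi> = 0" using p by simp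
    qed
  qed
  finally show ?thesis .
qed

lemma pi_half_mono: "mono (\<lambda>x. pi_half x q a)"
proof (rule monoI)
  fix x y :: real assume xy: "x \<le> y"
  have "finite {p :: nat. prime p \<and> real p \<le> y \<and> [p = a] (mod q)}"
  proof (rule finite_subset)
    show "{p :: nat. prime p \<and> real p \<le> y \<and> [p = a] (mod q)} \<subseteq> {..nat \<lfloor>y\<rfloor>}"
      by (auto intro: le_nat_floor)
  qed simp
  thus "pi_half x q a \<le> pi_half y q a"
    unfolding pi_half_def by (rule sum_mono2) (use xy in auto)
qed

lemma pi_half_measurable [measurable]: "(\<lambda>x. pi_half x q a) \<in> borel_measurable borel"
  by (rule borel_measurable_mono[OF pi_half_mono])

text \<open>The coefficients m + e/2 of \<open>prime_sum_asymp\<close> reproduce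
  \<open>Mqab\<close>: r(a) - r(b) is the sum of the conjugate character differences against e by
  \<open>rsq_char_sum\<close>, and the factor 2 in front of the m-sum balances the outer
  1/2.\<close>

lemma Mqab_char_sum:
  assumes q: "q > 1" and ab: "coprime a q" "coprime b q"
  defines "e \<equiv> (\<lambda>\<psi>. if (\<lambda>n. \<psi> (n\<^sup>2)) = principal_char q then 1 else 0 :: real)"
  shows "Mqab q a b = Re ((\<Sum>\<psi>\<in>nonprincipal_chars q. (cnj (\<psi> a) - cnj (\<psi> b)) * of_real (real (m_chi \<psi>) + e \<psi> / 2)) / of_nat (totient q))"
proof -
  let ?NP = "nonprincipal_chars q"
  have q0: "q > 0" using q by simp
  have t: "real (totient q) > 0" using q by simp
  have r: "of_nat (rsq q a) - of_nat (rsq q b) = (\<Sum>\<psi>\<in>?NP. (cnj (\<psi> a) - cnj (\<psi> b)) * of_real (e \<psi>))"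
  proof -
    have "of_nat (rsq q c) = (\<Sum>\<psi>\<in>chars q. cnj (\<psi> c) * of_real (e \<psi>))" if "coprime c q" for c
      unfolding rsq_char_sum[OF q that] by (intro sum.cong refl) (simp add: e_def)
    thus ?thesis using sum_chars_diff[OF q0 ab, of "\<lambda>\<psi>. of_real (e \<psi>)"] ab by simp
  qed
  \<comment> \<open>Orthogonality produces conjugated values where \<open>Mqab\<close> has plain
    ones. As the weights m are real, both sums have the same real part.\<close>
  have re: "Re (\<Sum>\<psi>\<in>?NP. (\<psi> a - \<psi> b) * of_nat (m_chi \<psi>)) = Re (\<Sum>\<psi>\<in>?NP. (cnj (\<psi> a) - cnj (\<psi> b)) * of_nat (m_chi \<psi>))"
    unfolding Re_sum by (intro sum.cong refl) simp
  have "(\<Sum>\<psi>\<in>?NP. (cnj (\<psi> a) - cnj (\<psi> b)) * of_real (real (m_chi \<psi>) + e \<psi> / 2)) =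
      (\<Sum>\<psi>\<in>?NP. (cnj (\<psi> a) - cnj (\<psi> b)) * of_nat (m_chi \<psi>)) + (\<Sum>\<psi>\<in>?NP. (cnj (\<psi> a) - cnj (\<psi> b)) * of_real (e \<psi>)) / 2"
    unfolding sum_divide_distrib sum.distrib[symmetric] by (intro sum.cong refl) (simp add: algebra_simps)
  hence R: "Re (\<Sum>\<psi>\<in>?NP. (cnj (\<psi> a) - cnj (\<psi> b)) * of_real (real (m_chi \<psi>) + e \<psi> / 2)) =
     Re (\<Sum>\<psi>\<in>?NP. (cnj (\<psi> a) - cnj (\<psi> b)) * of_nat (m_chi \<psi>)) + Re (of_nat (rsq q a) - of_nat (rsq q b)) / 2"
    unfolding r by simp
  have d: "Re (z / of_nat n) = Re z / real n" for z n by (metis Re_divide_of_real of_real_of_nat_eq)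
  have "Mqab q a b = Re (of_nat (rsq q a) - of_nat (rsq q b) + 2 * (\<Sum>\<psi>\<in>?NP. (\<psi> a - \<psi> b) * of_nat (m_chi \<psi>))) / real (2 * totient q)"
  proof -
    have "2 * complex_of_nat (totient q) = of_nat (2 * totient q)" by simp
    thus ?thesis unfolding Mqab_def by (simp only: d)
  qed
  also have "\<dots> = (Re (of_nat (rsq q a) - of_nat (rsq q b)) + 2 * Re (\<Sum>\<psi>\<in>?NP. (\<psi> a - \<psi> b) * of_nat (m_chi \<psi>))) / (2 * real (totient q))"
    by simp
  also have "\<dots> = Re (\<Sum>\<psi>\<in>?NP. (cnj (\<psi> a) - cnj (\<psi> b)) * of_real (real (m_chi \<psi>) + e \<psi> / 2)) / real (totient q)"
    unfolding R re using t by (simp add: field_simps del: Re_sum)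
  finally show ?thesis by (simp only: d)
qed

text \<open>Sum \<open>prime_sum_asymp\<close> over the characters with weights of modulus at most 2
  and divide by the totient, which is at least 1; the real part of the combined constants is
  C.\<close>

lemma pi_half_difference:
  assumes q: "q > 1" and GRH: "\<forall>\<psi> \<in> nonprincipal_chars q. GRH_L \<psi>" and ab: "coprime a q" "coprime b q"
  shows "\<exists>C K. \<forall>y\<ge>2. \<bar>pi_half (exp y) q a - pi_half (exp y) q b + Mqab q a b * ln y - C\<bar> \<le>
     (2 * (\<Sum>\<psi>\<in>nonprincipal_chars q. norm (grh_char.ff \<psi> y)) + K) / y"
proof -
  let ?NP = "nonprincipal_chars q"
  have q0: "q > 0" using q by simp
  define e where "e = (\<lambda>\<psi>. if (\<lambda>n. \<psi> (n\<^sup>2)) = principal_char q then 1 else 0 :: real)"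
  have "\<forall>\<psi>\<in>?NP. \<exists>cK. \<forall>y\<ge>2. norm (prime_sum \<psi> (1/2) y + of_real ((real (m_chi \<psi>) + e \<psi> / 2) * ln y) - fst cK) \<le> (norm (grh_char.ff \<psi> y) + snd cK) / y"
  proof
    fix \<psi> assume "\<psi> \<in> ?NP"
    from prime_sum_asymp[OF GRH this, folded e_def] obtain c K where
      cK: "\<forall>y\<ge>2. norm (prime_sum \<psi> (1/2) y + of_real ((real (m_chi \<psi>) + e \<psi> / 2) * ln y) - c) \<le> (norm (grh_char.ff \<psi> y) + K) / y"
      by (auto simp: e_def)
    show "\<exists>cK. \<forall>y\<ge>2. norm (prime_sum \<psi> (1/2) y + of_real ((real (m_chi \<psi>) + e \<psi> / 2) * ln y) - fst cK) \<le> (norm (grh_char.ff \<psi> y) + snd cK) / y"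
      by (intro exI[of _ "(c, K)"]) (use cK in simp)
  qed
  from bchoice[OF this] obtain cK where cK: "\<forall>\<psi>\<in>?NP. \<forall>y\<ge>2.
      norm (prime_sum \<psi> (1/2) y + of_real ((real (m_chi \<psi>) + e \<psi> / 2) * ln y) - fst (cK \<psi>)) \<le> (norm (grh_char.ff \<psi> y) + snd (cK \<psi>)) / y"
    by (elim exE)
  define w where "w = (\<lambda>\<psi>. cnj (\<psi> a) - cnj (\<psi> b) :: complex)"
  have w2: "norm (w \<psi>) \<le> 2" if "\<psi> \<in> ?NP" for \<psi>
  proof -
    have c: "dcharacter q \<psi>" using that by (rule nonprincipal_charsD)
    have "norm (w \<psi>) \<le> norm (cnj (\<psi> a)) + norm (cnj (\<psi> b))" unfolding w_def by (rule norm_triangle_ineq4)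
    also have "\<dots> \<le> 1 + 1" unfolding complex_mod_cnj by (intro add_mono norm_dcharacter_le[OF c])
    finally show ?thesis by simp
  qed
  define \<phi> :: complex where "\<phi> = of_nat (totient q)"
  have \<phi>: "norm \<phi> \<ge> 1" "\<phi> \<noteq> 0" using q by (auto simp: \<phi>_def Suc_le_eq)
  define C where "C = Re ((\<Sum>\<psi>\<in>?NP. w \<psi> * fst (cK \<psi>)) / \<phi>)"
  define K where "K = (\<Sum>\<psi>\<in>?NP. 2 * snd (cK \<psi>))"
  show ?thesis
  proof (rule exI[of _ C], rule exI[of _ K], intro allI impI)
    fix y :: real assume y: "y \<ge> 2"
    have "complex_of_real (pi_half (exp y) q a - pi_half (exp y) q b) * \<phi> = of_real (pi_half (exp y) q a) * \<phi> - of_real (pi_half (exp y) q b) * \<phi>"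
      by (simp add: left_diff_distrib)
    also have "\<dots> = (\<Sum>\<psi>\<in>?NP. w \<psi> * prime_sum \<psi> (1/2) y)"
      unfolding \<phi>_def pi_half_char_sum[OF q ab(1)] pi_half_char_sum[OF q ab(2)] w_def by (rule sum_chars_diff[OF q0 ab])
    finally have E: "complex_of_real (pi_half (exp y) q a - pi_half (exp y) q b) = (\<Sum>\<psi>\<in>?NP. w \<psi> * prime_sum \<psi> (1/2) y) / \<phi>"
      using \<phi>(2) by (metis nonzero_mult_div_cancel_right)
    have D: "pi_half (exp y) q a - pi_half (exp y) q b = Re ((\<Sum>\<psi>\<in>?NP. w \<psi> * prime_sum \<psi> (1/2) y) / \<phi>)"
      unfolding E[symmetric] by (rule Re_complex_of_real[symmetric])
    have M: "Mqab q a b * ln y = Re ((\<Sum>\<psi>\<in>?NP. w \<psi> * of_real (real (m_chi \<psi>) + e \<psi> / 2)) / \<phi> * of_real (ln y))"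
      unfolding Mqab_char_sum[OF q ab, folded e_def] w_def \<phi>_def e_def by (simp del: Re_sum)
    define S1 S2 S3 S where "S1 = (\<Sum>\<psi>\<in>?NP. w \<psi> * prime_sum \<psi> (1/2) y)"
      and "S2 = (\<Sum>\<psi>\<in>?NP. w \<psi> * of_real (real (m_chi \<psi>) + e \<psi> / 2))"
      and "S3 = (\<Sum>\<psi>\<in>?NP. w \<psi> * fst (cK \<psi>))"
      and "S = (\<Sum>\<psi>\<in>?NP. w \<psi> * (prime_sum \<psi> (1/2) y + of_real ((real (m_chi \<psi>) + e \<psi> / 2) * ln y) - fst (cK \<psi>)))"
    have "S1 + S2 * of_real (ln y) - S3 = S"
      unfolding S1_def S2_def S3_def S_def sum_distrib_right sum.distrib[symmetric] sum_subtractf[symmetric]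
      by (intro sum.cong refl) (simp add: algebra_simps)
    hence E2: "S1 / \<phi> + S2 / \<phi> * of_real (ln y) - S3 / \<phi> = S / \<phi>" using \<phi>(2) by (simp add: field_simps)
    have "pi_half (exp y) q a - pi_half (exp y) q b + Mqab q a b * ln y - C = Re (S / \<phi>)"
      unfolding D M C_def S1_def[symmetric] S2_def[symmetric] S3_def[symmetric] E2[symmetric]
      by (simp only: plus_complex.sel minus_complex.sel)
    hence "\<bar>pi_half (exp y) q a - pi_half (exp y) q b + Mqab q a b * ln y - C\<bar> \<le> norm (S / \<phi>)"
      by (simp only: abs_Re_le_cmod)
    moreover have "norm (S / \<phi>) \<le> norm S / 1"
      unfolding norm_divide using \<phi> by (intro divide_left_mono) auto
    moreover have "norm S \<le> (\<Sum>\<psi>\<in>?NP. 2 * ((norm (grh_char.ff \<psi> y) + snd (cK \<psi>)) / y))"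
      unfolding S_def
    proof (rule sum_norm_le)
      fix \<psi> assume \<psi>: "\<psi> \<in> ?NP"
      show "norm (w \<psi> * (prime_sum \<psi> (1/2) y + of_real ((real (m_chi \<psi>) + e \<psi> / 2) * ln y) - fst (cK \<psi>))) \<le> 2 * ((norm (grh_char.ff \<psi> y) + snd (cK \<psi>)) / y)"
        unfolding norm_mult[of "w \<psi>"] by (rule mult_mono[OF w2[OF \<psi>] cK[rule_format, OF \<psi> y]]) auto
    qed
    moreover have "(\<Sum>\<psi>\<in>?NP. 2 * ((norm (grh_char.ff \<psi> y) + snd (cK \<psi>)) / y)) = (2 * (\<Sum>\<psi>\<in>?NP. norm (grh_char.ff \<psi> y)) + K) / y"
      unfolding K_def sum_distrib_left sum.distrib[symmetric] sum_divide_distrib by (intro sum.cong refl) (simp add: algebra_simps)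
    ultimately show "\<bar>pi_half (exp y) q a - pi_half (exp y) q b + Mqab q a b * ln y - C\<bar> \<le> (2 * (\<Sum>\<psi>\<in>?NP. norm (grh_char.ff \<psi> y)) + K) / y"
      by (simp only: div_by_1)
  qed
qed

text \<open>The constant C is fixed before the threshold \<theta>, so one C serves all \<epsilon> in
  the first claim of the theorem and the second claim too. Every Borel threshold that is eventually
  at least (ln ln x)/(ln x) gives density 1 in both senses.\<close>

lemma pi_half_thin:
  assumes q: "q > 1" and GRH: "\<forall>\<psi> \<in> nonprincipal_chars q. GRH_L \<psi>" and ab: "coprime a q" "coprime b q"
  shows "\<exists>C. \<forall>\<theta>. \<theta> \<in> borel_measurable borel \<longrightarrow> (\<forall>\<^sub>F x in at_top. ln (ln x) / ln x \<le> \<theta> x) \<longrightarrow>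
     (let A = {x. x \<ge> 2 \<and> \<bar>pi_half x q a - pi_half x q b + Mqab q a b * ln (ln x) - C\<bar> \<le> \<theta> x}
      in has_natural_density A 1 \<and> has_log_density A 1)"
proof -
  let ?NP = "nonprincipal_chars q"
  have q0: "q > 0" using q by simp
  have fin: "finite ?NP" by (rule finite_nonprincipal_chars[OF q0])
  obtain C K where CK: "\<forall>y\<ge>2. \<bar>pi_half (exp y) q a - pi_half (exp y) q b + Mqab q a b * ln y - C\<bar> \<le>
     (2 * (\<Sum>\<psi>\<in>?NP. norm (grh_char.ff \<psi> y)) + K) / y"
    using pi_half_difference[OF assms] by (elim exE)
  have gc: "grh_char q \<psi>" if "\<psi> \<in> ?NP" for \<psi> by (rule grh_char.intro[OF that GRH[rule_format, OF that]])
  \<comment> \<open>The factor \<open>card\<close> is the one in the Cauchy-Schwarz inequality, so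
    that G bounds the square of the sum of the |ff|.\<close>
  define G where "G = (\<lambda>y. real (card ?NP) * (\<Sum>\<psi>\<in>?NP. (norm (grh_char.ff \<psi> y))\<^sup>2))"
  have "\<forall>\<psi>\<in>?NP. \<exists>B. \<forall>Y\<ge>1. (LINT y|lborel. indicator {Y-1..Y+1} y * (norm (grh_char.ff \<psi> y))\<^sup>2) \<le> B"
    using grh_char.ff_stepanov[OF gc] by blast
  from bchoice[OF this] obtain B where B: "\<forall>\<psi>\<in>?NP. \<forall>Y\<ge>1. (LINT y|lborel. indicator {Y-1..Y+1} y * (norm (grh_char.ff \<psi> y))\<^sup>2) \<le> B \<psi>"
    by (elim exE)
  have int: "integrable lborel (\<lambda>y. indicator {s..t} y * (norm (grh_char.ff \<psi> y))\<^sup>2)" if \<psi>: "\<psi> \<in> ?NP" for \<psi> s t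
  proof -
    interpret grh_char q \<psi> by (rule gc[OF \<psi>])
    obtain C where "C > 0" and C: "\<forall>Y\<ge>1. (LINT y|lborel. indicator {Y-1..Y+1} y * (norm (ff y))\<^sup>2) \<le> C"
      using ff_stepanov by (elim exE conjE)
    interpret psum_stepanov aa "real m" C by unfold_locales (use C in \<open>simp_all add: ff_eq_psum aa_def\<close>)
    show ?thesis unfolding ff_eq_psum by (rule psum_square_integrable)
  qed
  have Geq: "indicator S y * G y = real (card ?NP) * (\<Sum>\<psi>\<in>?NP. indicator S y * (norm (grh_char.ff \<psi> y))\<^sup>2)" for S y
    by (simp only: G_def sum_distrib_left mult.left_commute)
  have Gm: "G \<in> borel_measurable borel"
  proof -
    have "(\<lambda>y. (norm (grh_char.ff \<psi> y))\<^sup>2) \<in> borel_measurable borel" if "\<psi> \<in> ?NP" for \<psi>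
    proof -
      have [measurable]: "grh_char.ff \<psi> \<in> borel_measurable borel" by (rule grh_char.ff_measurable[OF gc[OF that]])
      show ?thesis by measurable
    qed
    thus ?thesis unfolding G_def by (intro borel_measurable_times borel_measurable_const borel_measurable_sum)
  qed
  have Gi: "integrable lborel (\<lambda>y. indicator {Y-1..Y+1} y * G y)" for Y :: real
    unfolding Geq by (intro integrable_mult_right Bochner_Integration.integrable_sum int)
  have GC: "(LINT y|lborel. indicator {Y-1..Y+1} y * G y) \<le> real (card ?NP) * (\<Sum>\<psi>\<in>?NP. B \<psi>)" if Y: "Y \<ge> 1" for Y :: real
  proof -
    have "(LINT y|lborel. indicator {Y-1..Y+1} y * G y) = real (card ?NP) * (\<Sum>\<psi>\<in>?NP. LINT y|lborel. indicator {Y-1..Y+1} y * (norm (grh_char.ff \<psi> y))\<^sup>2)"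
      unfolding Geq integral_mult_right_zero by (subst Bochner_Integration.integral_sum) (auto intro: int)
    also have "\<dots> \<le> real (card ?NP) * (\<Sum>\<psi>\<in>?NP. B \<psi>)" using B Y by (intro mult_left_mono sum_mono) auto
    finally show ?thesis .
  qed
  have G0: "G y \<ge> 0" for y unfolding G_def by (intro mult_nonneg_nonneg sum_nonneg) auto
  show ?thesis
  proof (intro exI[of _ C] allI impI)
    fix \<theta> :: "real \<Rightarrow> real"
    assume \<theta> [measurable]: "\<theta> \<in> borel_measurable borel" and ev: "\<forall>\<^sub>F x in at_top. ln (ln x) / ln x \<le> \<theta> x"
    define A where "A = {x. x \<ge> 2 \<and> \<bar>pi_half x q a - pi_half x q b + Mqab q a b * ln (ln x) - C\<bar> \<le> \<theta> x}"
    have Am: "A \<in> sets borel" unfolding A_def by measurable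
    have A2: "A \<subseteq> {2..}" by (auto simp: A_def)
    have lnln: "filterlim (\<lambda>x::real. ln (ln x)) at_top at_top" by real_asymp
    have "\<forall>\<^sub>F x in at_top. ln (ln x) / ln x \<le> \<theta> x \<and> x \<ge> exp 2 \<and> 2 * K \<le> ln (ln x) \<and> 0 \<le> ln (ln x)"
      using lnln by (intro eventually_conj ev eventually_ge_at_top) (auto simp: filterlim_at_top)
    then obtain X1 where X1: "\<forall>x\<ge>X1. ln (ln x) / ln x \<le> \<theta> x \<and> x \<ge> exp 2 \<and> 2 * K \<le> ln (ln x) \<and> 0 \<le> ln (ln x)"
      unfolding eventually_at_top_linorder by (elim exE)
    \<comment> \<open>Outside A the error forces ln y < 2 S + K with S the sum of the |ff|. As 2K
      \<le> ln y for large x, this gives S \<ge> (ln y)/4, and squaring yields the constant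
      1/16.\<close>
    have large: "G (ln x) \<ge> 1/16 * (ln (ln x))\<^sup>2" if x: "x \<ge> X1" "x \<notin> A" for x
    proof -
      have X: "ln (ln x) / ln x \<le> \<theta> x" "x \<ge> exp 2" "2 * K \<le> ln (ln x)" "0 \<le> ln (ln x)" using X1 x(1) by auto
      define y where "y = ln x"
      have x0: "x > 0" by (rule less_le_trans[OF exp_gt_zero X(2)])
      have xy: "x = exp y" using x0 by (simp add: y_def)
      have y: "y \<ge> 2" using X(2) unfolding xy by simp
      have "exp (1::real) \<le> exp 2" by simp
      hence "x \<ge> 2" using X(2) exp1_ge_2 by linarith
      hence "\<theta> x < \<bar>pi_half x q a - pi_half x q b + Mqab q a b * ln (ln x) - C\<bar>" using x(2) by (simp add: A_def)
      hence "ln y / y < \<bar>pi_half (exp y) q a - pi_half (exp y) q b + Mqab q a b * ln y - C\<bar>"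
        using X(1) by (simp add: y_def[symmetric] xy[symmetric])
      also have "\<dots> \<le> (2 * (\<Sum>\<psi>\<in>?NP. norm (grh_char.ff \<psi> y)) + K) / y" using CK y by simp
      finally have "ln y < 2 * (\<Sum>\<psi>\<in>?NP. norm (grh_char.ff \<psi> y)) + K" using y by (simp add: divide_less_cancel)
      hence "ln y / 4 \<le> (\<Sum>\<psi>\<in>?NP. norm (grh_char.ff \<psi> y))" using X(3) unfolding y_def[symmetric] by linarith
      hence "(ln y / 4)\<^sup>2 \<le> (\<Sum>\<psi>\<in>?NP. norm (grh_char.ff \<psi> y))\<^sup>2" using X(4) unfolding y_def[symmetric] by (intro power_mono) auto
      also have "\<dots> \<le> (\<Sum>\<psi>\<in>?NP. (norm (grh_char.ff \<psi> y))\<^sup>2) * real (card ?NP)" by (rule sum_squared_le_sum_of_squares)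
      also have "\<dots> = G y" by (simp add: G_def mult.commute)
      finally show ?thesis by (simp add: y_def power_divide)
    qed
    have thin: "\<forall>\<epsilon>>0. \<exists>X0. \<forall>X\<ge>X0. measure lborel ({X / exp 1<..X} - A) \<le> \<epsilon> * X"
      by (rule thin_from_mean_square[OF Gm Am G0 Gi GC large]) auto
    show "let A = {x. x \<ge> 2 \<and> \<bar>pi_half x q a - pi_half x q b + Mqab q a b * ln (ln x) - C\<bar> \<le> \<theta> x}
      in has_natural_density A 1 \<and> has_log_density A 1"
      unfolding Let_def A_def[symmetric] using natural_density_thin[OF Am A2 thin] log_density_thin[OF Am A2 thin] by blast
  qed
qed

theorem theorem1p1:
  fixes q a b :: nat
  assumes "q \<ge> 3"
    and GRH: "\<forall>\<psi> \<in> nonprincipal_chars q. GRH_L \<psi>"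
    and "a < q" "b < q" "coprime a q" "coprime b q" "a \<noteq> b"
  shows "\<exists>C::real.
     (\<forall>\<epsilon>>0. has_natural_density
        {x. x \<ge> 2 \<and> \<bar>pi_half x q a - pi_half x q b + Mqab q a b * ln (ln x) - C\<bar>
                 \<le> ln (ln x) powr (3 + \<epsilon>) / ln x} 1)
   \<and> (\<exists>K>1. has_log_density
        {x. x \<ge> 2 \<and> \<bar>pi_half x q a - pi_half x q b + Mqab q a b * ln (ln x) - C\<bar>
                 \<le> K * ln (ln x) / ln x} 1)"
proof -
  have q: "q > 1" using assms(1) by simp
  obtain C where C: "\<forall>\<theta>. \<theta> \<in> borel_measurable borel \<longrightarrow> (\<forall>\<^sub>F x in at_top. ln (ln x) / ln x \<le> \<theta> x) \<longrightarrow>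
     (let A = {x. x \<ge> 2 \<and> \<bar>pi_half x q a - pi_half x q b + Mqab q a b * ln (ln x) - C\<bar> \<le> \<theta> x}
      in has_natural_density A 1 \<and> has_log_density A 1)"
    using pi_half_thin[OF q GRH assms(5,6)] by (elim exE)
  have big: "\<forall>\<^sub>F x::real in at_top. 1 \<le> ln (ln x) \<and> 0 < ln x"
  proof (intro eventually_conj)
    have "filterlim (\<lambda>x::real. ln (ln x)) at_top at_top" by real_asymp
    thus "\<forall>\<^sub>F x::real in at_top. 1 \<le> ln (ln x)" by (simp add: filterlim_at_top)
    show "\<forall>\<^sub>F x::real in at_top. 0 < ln x" by real_asymp
  qed
  show ?thesis
  \<comment> \<open>The witness 2 is a convenient K > 1: the threshold 2 (ln ln x)/(ln x) dominates
    (ln ln x)/(ln x) as soon as ln ln x is non-negative.\<close>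
  proof (rule exI[of _ C], intro conjI allI impI exI[of _ "2::real"])
    fix \<epsilon> :: real assume e: "\<epsilon> > 0"
    have "\<forall>\<^sub>F x::real in at_top. ln (ln x) / ln x \<le> ln (ln x) powr (3 + \<epsilon>) / ln x"
      using big
    proof eventually_elim
      case (elim x)
      \<comment> \<open>Once ln ln x \<ge> 1, raising it to the exponent 3 + \<epsilon> only
        enlarges it, so the first threshold is eventually above the one required by
        \<open>pi_half_thin\<close>.\<close>
      have "ln (ln x) powr 1 \<le> ln (ln x) powr (3 + \<epsilon>)" using elim e by (intro powr_mono) auto
      thus ?case using elim by (intro divide_right_mono) auto
    qed
    moreover have "(\<lambda>x::real. ln (ln x) powr (3 + \<epsilon>) / ln x) \<in> borel_measurable borel" by measurable
    ultimately show "has_natural_density {x. x \<ge> 2 \<and> \<bar>pi_half x q a - pi_half x q b + Mqab q a b * ln (ln x) - C\<bar>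
                 \<le> ln (ln x) powr (3 + \<epsilon>) / ln x} 1"
      using C unfolding Let_def by blast
  next
    have "\<forall>\<^sub>F x::real in at_top. ln (ln x) / ln x \<le> 2 * ln (ln x) / ln x"
      using big
    proof eventually_elim
      case (elim x)
      thus ?case by (intro divide_right_mono) linarith+
    qed
    moreover have "(\<lambda>x::real. 2 * ln (ln x) / ln x) \<in> borel_measurable borel" by measurable
    ultimately show "has_log_density {x. x \<ge> 2 \<and> \<bar>pi_half x q a - pi_half x q b + Mqab q a b * ln (ln x) - C\<bar>
                 \<le> 2 * ln (ln x) / ln x} 1"
      using C unfolding Let_def by blast
  qed simp
qed

end
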